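(* Let $\nu,b\in(0,\infty)$, $a\in(0,b)$ and $\gamma\in[0,\pi)$. Let $q$ be a real-valued function in $AC_{\mathrm{loc}}(0,b]$ such that the function $x\mapsto xq(x)$ belongs to $L^r(0,b)$ for some $r\in(2,\infty]$. Let $\lambda_1<\lambda_2<\cdots$ be the elements of $\sigma(S_{b,\gamma})$ in increasing order. Given $\epsilon=\{\epsilon_n\}_{n\in\mathbb N}\in\ell_\infty(\nu)$ and $F\in\mathcal B_a$, define $$F_\epsilon(z)=\sum_{n\in\mathbb N}\frac{J_{ab}(z,\lambda_n)}{K_b(\lambda_n,\lambda_n)}\bigl(F(\lambda_n)+\epsilon_n\bigr).$$ Then for every compact set $\mathbb K\subset\mathbb C$ there exists a constant $C>0$, depending only on $\mathbb K,\nu,q,\gamma,a,b$, such that for all $F\in\mathcal B_a$ and all $\epsilon\in\ell_\infty(\nu)$, $$|F(z)-F_\epsilon(z)|\le C\,\|\epsilon\|_{\ell_\infty(\nu)},\qquad z\in\mathbb K.$$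
   Context: Notation: $\xi_\nu(z,x)=z^{-\nu/2}\sqrt{\pi x/2}\,J_\nu(\sqrt z\,x)$ ($J_\nu$ the Bessel function), which is entire in $z$ and real for real $z$. Solution $\xi$: for each $z\in\mathbb C$, $\xi(z,\cdot)$ is the solution on $(0,b]$ of $-\varphi''+\left(\frac{\nu^2-1/4}{x^2}+q(x)\right)\varphi=z\varphi$ determined by the estimates, valid for all $z\in\mathbb C$, $x\in(0,b]$ with a constant $C=C(\nu,q,b)$, $$|\xi(z,x)-\xi_\nu(z,x)|\le C\Bigl(\tfrac{x}{1+|\sqrt z|x}\Bigr)^{\nu+\frac12}e^{|\mathrm{Im}\sqrt z|x}\int_0^x\frac{u|q(u)|}{1+|\sqrt z|u}du,$$ $$|\xi'(z,x)-\xi_\nu'(z,x)|\le C\Bigl(\tfrac{x}{1+|\sqrt z|x}\Bigr)^{\nu-\frac12}e^{|\mathrm{Im}\sqrt z|x}\int_0^x\frac{u|q(u)|}{1+|\sqrt z|u}du,$$ where $'$ is the derivative in $x$. The functions $\xi(\cdot,x)$ and $\xi'(\cdot,x)$ are entire and real on the real line. De Branges spaces: for $s\in(0,b]$, $\mathcal B_s=\{F(z)=\int_0^s\xi(z,x)\varphi(x)\,dx:\varphi\in L^2(0,s)\}$ with $\|F\|_{\mathcal B_s}^2=\int_0^s|\varphi(x)|^2dx$. Its reproducing kernel is $K_s(z,w)=\int_0^s\xi(z,x)\,\xi(\overline w,x)\,dx$. The space $\mathcal B_a$ is isometrically contained in $\mathcal B_b$ (extend $\varphi$ by zero). Operators and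 spectrum: $S_{s,\gamma}$ is the selfadjoint operator in $\mathcal B_s$ unitarily equivalent, via $\varphi\mapsto F$, to the selfadjoint operator $H_{s,\gamma}$ in $L^2(0,s)$ given by $-\frac{d^2}{dx^2}+\frac{\nu^2-1/4}{x^2}+q$ with boundary condition $\varphi(s)\cos\gamma+\varphi'(s)\sin\gamma=0$ and, if $\nu\in(0,1)$, also $\lim_{x\to0+}x^{\nu-1/2}\left((\nu+\tfrac12)\varphi(x)-x\varphi'(x)\right)=0$. Its spectrum is discrete, simple, bounded below, and equals $\sigma(S_{s,\gamma})=\sigma(H_{s,\gamma})=\{\lambda\in\mathbb R:\xi(\lambda,s)\cos\gamma+\xi'(\lambda,s)\sin\gamma=0\}$. Modified kernel: $R_{ab}(x)=1$ for $x\in(0,a]$ and $R_{ab}(x)=\frac{b-x}{b-a}$ for $x\in(a,b]$; $J_{ab}(z,w)=\int_0^bR_{ab}(x)\,\xi(z,x)\,\xi(\overline w,x)\,dx$. Sequence space: $\ell_\infty(\nu)=\{\{\beta_n\}_{n\in\mathbb N}\subset\mathbb C:\{\beta_nn^{\nu+1/2}\}\in\ell_\infty\}$, $\|\beta\|_{\ell_\infty(\nu)}=\sup_{n\ge1}|\beta_n|n^{\nu+1/2}$. *)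

theory Defs
  imports "HOL-Analysis.Analysis"
begin

definition bessel_J :: "real \<Rightarrow> complex \<Rightarrow> complex" where
  "bessel_J \<nu> w =
     (w / 2) powr of_real \<nu> *
     (\<Sum>k. (-1) ^ k / of_real (fact k * Gamma (\<nu> + real k + 1)) * (w / 2) ^ (2 * k))"

text \<open>
  The prefactor \<open>z powr (-\<nu>/2)\<close> is singular at \<open>z = 0\<close>; the value there is the one of the
  entire extension, see \<open>xi_free_series\<close> below.
\<close>

definition xi_free :: "real \<Rightarrow> complex \<Rightarrow> real \<Rightarrow> complex" where
  "xi_free \<nu> z x =
     (if z = 0 then of_real (sqrt (pi * x / 2) * (x / 2) powr \<nu> / Gamma (\<nu> + 1))
      else z powr of_real (- \<nu> / 2) * of_real (sqrt (pi * x / 2)) *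
             bessel_J \<nu> (csqrt z * of_real x))"

lemma xi_free_series:
  assumes "x > 0"
  shows "xi_free \<nu> z x =
    of_real (sqrt (pi * x / 2) * (x / 2) powr \<nu>) *
    (\<Sum>k. (-1) ^ k / of_real (fact k * Gamma (\<nu> + real k + 1)) * of_real ((x / 2) ^ (2 * k)) * z ^ k)"
proof (cases "z = 0")
  case True
  have "(\<Sum>k. (-1) ^ k / of_real (fact k * Gamma (\<nu> + real k + 1)) * of_real ((x / 2) ^ (2 * k)) * (0::complex) ^ k)
      = (\<Sum>k\<in>{0}. (-1) ^ k / of_real (fact k * Gamma (\<nu> + real k + 1)) * of_real ((x / 2) ^ (2 * k)) * (0::complex) ^ k)"
    by (rule suminf_finite) auto
  then show ?thesis using True by (simp add: xi_free_def)
next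
  case False
  have nz: "csqrt z \<noteq> 0" using False by simp
  have ln_csqrt: "Ln (csqrt z) = Ln z / 2"
  proof -
    have "csqrt z = exp (Ln z / 2)" using False by (rule csqrt_exp_Ln)
    moreover have "- pi < Im (Ln z / 2)" "Im (Ln z / 2) \<le> pi"
      using mpi_less_Im_Ln[OF False] Im_Ln_le_pi[OF False] pi_gt_zero by simp_all
    ultimately show ?thesis by (simp add: Ln_exp)
  qed
  have "Ln (of_real (x / 2) * csqrt z) = of_real (ln (x / 2)) + Ln (csqrt z)"
    using assms nz Ln_of_real[of "x / 2"] by (subst Ln_times_of_real) auto
  then have L: "Ln (csqrt z * of_real x / 2) = of_real (ln (x / 2)) + Ln z / 2"
    by (simp add: ln_csqrt mult.commute)
  have nz2: "csqrt z * of_real x / 2 \<noteq> 0" using nz assms by simp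
  have E: "complex_of_real ((x / 2) powr \<nu>) = exp (of_real \<nu> * of_real (ln (x / 2)))"
    using assms by (simp only: powr_def) (simp flip: exp_of_real)
  have "z powr of_real (- \<nu> / 2) * (csqrt z * of_real x / 2) powr of_real \<nu> =
      exp (of_real (- \<nu> / 2) * Ln z + of_real \<nu> * (of_real (ln (x / 2)) + Ln z / 2))"
    unfolding powr_def[of z] powr_def[of "csqrt z * of_real x / 2"] L
    using False nz2 by (simp only: if_False exp_add)
  also have "of_real (- \<nu> / 2) * Ln z + of_real \<nu> * (of_real (ln (x / 2)) + Ln z / 2) =
      of_real \<nu> * of_real (ln (x / 2))"
    by (simp add: algebra_simps)
  finally have P: "z powr of_real (- \<nu> / 2) * (csqrt z * of_real x / 2) powr of_real \<nu> =
      complex_of_real ((x / 2) powr \<nu>)"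
    by (simp only: E)
  have Q: "(csqrt z * of_real x / 2) ^ (2 * k) = of_real ((x / 2) ^ (2 * k)) * z ^ k" for k
    by (simp add: power_mult power_mult_distrib power_divide)
  let ?S = "\<Sum>k. (-1) ^ k / of_real (fact k * Gamma (\<nu> + real k + 1)) * (of_real ((x / 2) ^ (2 * k)) * z ^ k)"
  have "xi_free \<nu> z x = of_real (sqrt (pi * x / 2)) *
      (z powr of_real (- \<nu> / 2) * (csqrt z * of_real x / 2) powr of_real \<nu>) * ?S"
    unfolding xi_free_def bessel_J_def Q using False by (simp only: if_False mult_ac)
  then show ?thesis
    by (simp only: P of_real_mult mult.assoc)
qed

text \<open>
  Since \<open>q\<close> will be continuous on \<open>{0<..b}\<close>, solutions are classical; at \<open>b\<close> the derivative is
  one-sided. In the two estimates, the choice of the branch of the square root is immaterial.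
\<close>

definition regular_solution ::
  "real \<Rightarrow> (real \<Rightarrow> real) \<Rightarrow> real \<Rightarrow> (complex \<Rightarrow> real \<Rightarrow> complex) \<Rightarrow> bool" where
  "regular_solution \<nu> q b \<xi> \<longleftrightarrow>
     (\<exists>\<xi>'. 
       (\<forall>z. \<forall>x\<in>{0<..b}.
          (\<xi> z has_vector_derivative \<xi>' z x) (at x within {0<..b}) \<and>
          (\<exists>d. (\<xi>' z has_vector_derivative d) (at x within {0<..b}) \<and>
               - d + of_real ((\<nu>\<^sup>2 - 1/4) / x\<^sup>2 + q x) * \<xi> z x = z * \<xi> z x)) \<and>
       (\<exists>C. \<forall>z. \<forall>x\<in>{0<..b}.
          norm (\<xi> z x - xi_free \<nu> z x) \<le>
            C * (x / (1 + norm (csqrt z) * x)) powr (\<nu> + 1/2) * exp (\<bar>Im (csqrt z)\<bar> * x) *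
            (LINT u:{0<..<x}|lborel. u * \<bar>q u\<bar> / (1 + norm (csqrt z) * u)) \<and>
          norm (\<xi>' z x - vector_derivative (xi_free \<nu> z) (at x)) \<le>
            C * (x / (1 + norm (csqrt z) * x)) powr (\<nu> - 1/2) * exp (\<bar>Im (csqrt z)\<bar> * x) *
            (LINT u:{0<..<x}|lborel. u * \<bar>q u\<bar> / (1 + norm (csqrt z) * u))))"

definition AC_on :: "(real \<Rightarrow> 'a::real_normed_vector) \<Rightarrow> real \<Rightarrow> real \<Rightarrow> bool" where
  "AC_on f c d \<longleftrightarrow>
     (\<forall>\<epsilon>>0. \<exists>\<delta>>0. \<forall>D :: (real \<times> real) set.
        finite D \<and> (\<forall>(u, v)\<in>D. c \<le> u \<and> u \<le> v \<and> v \<le> d) \<and>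
        disjoint_family_on (\<lambda>(u, v). {u<..<v}) D \<and>
        (\<Sum>(u, v)\<in>D. v - u) < \<delta> \<longrightarrow>
        (\<Sum>(u, v)\<in>D. norm (f v - f u)) < \<epsilon>)"

definition AC_loc :: "(real \<Rightarrow> 'a::real_normed_vector) \<Rightarrow> real \<Rightarrow> bool" where
  "AC_loc f b \<longleftrightarrow> (\<forall>c. 0 < c \<and> c < b \<longrightarrow> AC_on f c b)"

definition in_Lr :: "ereal \<Rightarrow> real \<Rightarrow> (real \<Rightarrow> 'a::{real_normed_vector, second_countable_topology}) \<Rightarrow> bool" where
  "in_Lr r s f \<longleftrightarrow>
     set_borel_measurable lborel {0<..<s} f \<and>
     (if r = \<infinity> then \<exists>M. AE x in lborel. x \<in> {0<..<s} \<longrightarrow> norm (f x) \<le> M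
      else set_integrable lborel {0<..<s} (\<lambda>x. norm (f x) powr real_of_ereal r))"

abbreviation L2 :: "real \<Rightarrow> (real \<Rightarrow> complex) set" where
  "L2 s \<equiv> {\<phi>. in_Lr 2 s \<phi>}"

definition transf :: "(complex \<Rightarrow> real \<Rightarrow> complex) \<Rightarrow> real \<Rightarrow> (real \<Rightarrow> complex) \<Rightarrow> complex \<Rightarrow> complex" where
  "transf \<xi> s \<phi> z = (LINT x:{0<..<s}|lborel. \<xi> z x * \<phi> x)"

definition dB_space :: "(complex \<Rightarrow> real \<Rightarrow> complex) \<Rightarrow> real \<Rightarrow> (complex \<Rightarrow> complex) set" where
  "dB_space \<xi> s = transf \<xi> s ` L2 s"

definition dB_norm :: "(complex \<Rightarrow> real \<Rightarrow> complex) \<Rightarrow> real \<Rightarrow> (complex \<Rightarrow> complex) \<Rightarrow> real" where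
  "dB_norm \<xi> s F =
     (THE N. \<exists>\<phi>\<in>L2 s. F = transf \<xi> s \<phi> \<and> N = sqrt (LINT x:{0<..<s}|lborel. (norm (\<phi> x))\<^sup>2))"

definition kernel_K :: "(complex \<Rightarrow> real \<Rightarrow> complex) \<Rightarrow> real \<Rightarrow> complex \<Rightarrow> complex \<Rightarrow> complex" where
  "kernel_K \<xi> s z w = (LINT x:{0<..<s}|lborel. \<xi> z x * \<xi> (cnj w) x)"

definition R_mod :: "real \<Rightarrow> real \<Rightarrow> real \<Rightarrow> real" where
  "R_mod a b x = (if x \<le> a then 1 else (b - x) / (b - a))"

definition kernel_J ::
  "(complex \<Rightarrow> real \<Rightarrow> complex) \<Rightarrow> real \<Rightarrow> real \<Rightarrow> complex \<Rightarrow> complex \<Rightarrow> complex" where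
  "kernel_J \<xi> a b z w = (LINT x:{0<..<b}|lborel. of_real (R_mod a b x) * \<xi> z x * \<xi> (cnj w) x)"

text \<open>
  An unbounded operator is represented by its graph. A pair \<open>(\<phi>, \<psi>)\<close> below consists of the
  continuously differentiable representative \<open>\<phi>\<close> of an element of the domain and of any
  representative \<open>\<psi>\<close> of its image.
\<close>

definition H_graph ::
  "real \<Rightarrow> (real \<Rightarrow> real) \<Rightarrow> real \<Rightarrow> real \<Rightarrow> ((real \<Rightarrow> complex) \<times> (real \<Rightarrow> complex)) set" where
  "H_graph \<nu> q s \<gamma> =
     {(\<phi>, \<psi>). \<phi> \<in> L2 s \<and> \<psi> \<in> L2 s \<and>
        (\<exists>\<phi>'. (\<forall>x\<in>{0<..s}. (\<phi> has_vector_derivative \<phi>' x) (at x within {0<..s})) \<and>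
              AC_loc \<phi>' s \<and>
              (AE x in lborel. x \<in> {0<..<s} \<longrightarrow>
                 (\<exists>d. (\<phi>' has_vector_derivative d) (at x) \<and>
                      \<psi> x = - d + of_real ((\<nu>\<^sup>2 - 1/4) / x\<^sup>2 + q x) * \<phi> x)) \<and>
              \<phi> s * of_real (cos \<gamma>) + \<phi>' s * of_real (sin \<gamma>) = 0 \<and>
              (\<nu> < 1 \<longrightarrow>
                 ((\<lambda>x. of_real (x powr (\<nu> - 1/2)) *
                        (of_real (\<nu> + 1/2) * \<phi> x - of_real x * \<phi>' x)) \<longlongrightarrow> 0) (at_right 0)))}"

definition S_graph ::
  "(complex \<Rightarrow> real \<Rightarrow> complex) \<Rightarrow> real \<Rightarrow> (real \<Rightarrow> real) \<Rightarrow> real \<Rightarrow> real \<Rightarrow>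
     ((complex \<Rightarrow> complex) \<times> (complex \<Rightarrow> complex)) set" where
  "S_graph \<xi> \<nu> q s \<gamma> = map_prod (transf \<xi> s) (transf \<xi> s) ` H_graph \<nu> q s \<gamma>"

text \<open>
  For an operator with graph \<open>T\<close> in a space \<open>V\<close> of functions with norm \<open>N\<close>, the number \<open>\<mu>\<close> is in
  the resolvent set iff \<open>T - \<mu>\<close> is a bijection of the domain onto \<open>V\<close> with bounded inverse.
\<close>

definition resolvent_set ::
  "(complex \<Rightarrow> complex) set \<Rightarrow> ((complex \<Rightarrow> complex) \<Rightarrow> real) \<Rightarrow>
     ((complex \<Rightarrow> complex) \<times> (complex \<Rightarrow> complex)) set \<Rightarrow> complex set" where
  "resolvent_set V N T =
     {\<mu>. (\<forall>G\<in>V. \<exists>!F. (F, \<lambda>z. G z + \<mu> * F z) \<in> T) \<and>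
         (\<exists>C. \<forall>(F, H)\<in>T. N F \<le> C * N (\<lambda>z. H z - \<mu> * F z))}"

definition spectrum_S ::
  "(complex \<Rightarrow> real \<Rightarrow> complex) \<Rightarrow> real \<Rightarrow> (real \<Rightarrow> real) \<Rightarrow> real \<Rightarrow> real \<Rightarrow> complex set" where
  "spectrum_S \<xi> \<nu> q s \<gamma> =
     - resolvent_set (dB_space \<xi> s) (dB_norm \<xi> s) (S_graph \<xi> \<nu> q s \<gamma>)"

text \<open>Sequences are indexed from \<open>1\<close>; the value at \<open>0\<close> is irrelevant.\<close>

definition ell_inf :: "real \<Rightarrow> (nat \<Rightarrow> complex) set" where
  "ell_inf \<nu> = {\<beta>. bdd_above ((\<lambda>n. norm (\<beta> n) * real n powr (\<nu> + 1/2)) ` {1..})}"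

definition ell_inf_norm :: "real \<Rightarrow> (nat \<Rightarrow> complex) \<Rightarrow> real" where
  "ell_inf_norm \<nu> \<beta> = (SUP n\<in>{1..}. norm (\<beta> n) * real n powr (\<nu> + 1/2))"

definition sampling_term ::
  "(complex \<Rightarrow> real \<Rightarrow> complex) \<Rightarrow> real \<Rightarrow> real \<Rightarrow> (nat \<Rightarrow> real) \<Rightarrow>
     (complex \<Rightarrow> complex) \<Rightarrow> (nat \<Rightarrow> complex) \<Rightarrow> complex \<Rightarrow> nat \<Rightarrow> complex" where
  "sampling_term \<xi> a b lam F \<epsilon> z n =
     kernel_J \<xi> a b z (of_real (lam n)) / kernel_K \<xi> b (of_real (lam n)) (of_real (lam n)) *
     (F (of_real (lam n)) + \<epsilon> n)"

definition F_eps ::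
  "(complex \<Rightarrow> real \<Rightarrow> complex) \<Rightarrow> real \<Rightarrow> real \<Rightarrow> (nat \<Rightarrow> real) \<Rightarrow>
     (complex \<Rightarrow> complex) \<Rightarrow> (nat \<Rightarrow> complex) \<Rightarrow> complex \<Rightarrow> complex" where
  "F_eps \<xi> a b lam F \<epsilon> z = (\<Sum>n. sampling_term \<xi> a b lam F \<epsilon> z (Suc n))"

end

theory Submission
  imports Defs "HOL-Complex_Analysis.Great_Picard"
begin

text \<open>
  Since \<open>R\<^sub>a\<^sub>b = 1\<close> on \<open>(0,a)\<close>, every \<open>F\<close> in \<open>\<B>\<^sub>a\<close> is the integral of \<open>R\<^sub>a\<^sub>b \<xi>(z,\<cdot>)\<close> against a function
  supported in \<open>(0,a)\<close>. Expanding \<open>R\<^sub>a\<^sub>b \<xi>(z,\<cdot>)\<close> in the normalized eigenfunctions \<open>e\<^sub>n\<close> of \<open>H\<^sub>b\<^sub>,\<^sub>\<gamma>\<close> recovers \<open>F\<close>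
  exactly, so only the perturbation \<open>\<epsilon>\<close> contributes to \<open>F - F\<^sub>\<epsilon>\<close>. By the Lagrange identity the coefficients
  \<open>\<langle>R\<^sub>a\<^sub>b \<xi>(z,\<cdot>), e\<^sub>n\<rangle> = J\<^sub>a\<^sub>b(z,\<lambda>\<^sub>n) / \<surd>K\<^sub>b(\<lambda>\<^sub>n,\<lambda>\<^sub>n)\<close> are of order \<open>1/\<lambda>\<^sub>n\<close>, locally uniformly in \<open>z\<close>, and
  \<open>\<Sum> 1/\<lambda>\<^sub>n\<close> converges because the primitives of the \<open>e\<^sub>n\<close>, of \<open>L\<^sup>2\<close> norm of order \<open>\<lambda>\<^sub>n\<close> to the power
  \<open>-1/2\<close>, have square sum at most a constant by Bessel's inequality for indicator functions. Testing
  Parseval's identity on a bump of width \<open>1/n\<close> gives \<open>\<lambda>\<^sub>n = O(n\<^sup>2)\<close>, whence \<open>|\<epsilon>\<^sub>n| = O(\<parallel>\<epsilon>\<parallel> \<surd>K\<^sub>b(\<lambda>\<^sub>n,\<lambda>\<^sub>n))\<close>.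

  The Bessel asymptotics enter only through the energy \<open>f\<^sup>2 + f'\<^sup>2\<close> of the free solution. Completeness of
  the \<open>e\<^sub>n\<close> follows from compactness of the Green operator, applied to an extremal sequence in the
  orthogonal complement, and gives the injectivity of \<open>\<phi> \<mapsto> F\<close> that identifies the spectrum.
\<close>


text \<open>What makes the coefficients summable is that R vanishes at b, so the Lagrange identity
  leaves no boundary term there. The derivative of u exceeds u by the square root of the eigenvalue;
  a boundary term of that size would leave only the inverse square root of the eigenvalue. One
  integration by parts over [a,b] removes u' from the remaining term as well. The weight in
  \<open>ell_inf\<close> is explained by the norm of u at \<lambda>, comparable with \<lambda> to
  the power -(\<nu>+1/2)/2: an upper bound for the n-th eigenvalue of order n squared turns n to the
  power -(\<nu>+1/2) into a multiple of that norm. The obstacle is the singular endpoint 0, where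
  for \<nu> < 1 every solution is square integrable. All control there comes from the two estimates
  for \<xi>, read as a leading term with a relative error \<omega> that tends to 0 uniformly for
  bounded z. Wronskians with \<xi> can then be evaluated at 0. Since the spectrum is given by a
  resolvent set in the de Branges space, a Green operator is needed at every real point where the
  boundary form does not vanish, in addition to the single one that serves for completeness.\<close>

section \<open>Absolutely continuous functions and indefinite integrals\<close>

text \<open>A fine tagged division splits by its tags. Outside \<open>N\<close> the zero derivative
  bounds each increment by \<eta> times the length. Intervals tagged in \<open>N\<close> lie in an
  open set of measure below \<delta>, so absolute continuity bounds the sum of their
  increments.\<close>

lemma AC_on_zero_derivative:
 fixes h :: "real \<Rightarrow> 'a::real_normed_vector"
 assumes ac: "AC_on h c d" and cd: "c \<le> d" and N: "negligible N"
  and der: "\<And>x. x \<in> {c..d} - N \<Longrightarrow> (h has_vector_derivative 0) (at x within {c..d})"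
 shows "h d = h c"
proof -
 have "norm (h d - h c) \<le> e" if e: "e > 0" for e
 proof -
  obtain \<delta> where \<delta>: "\<delta> > 0" and ac\<delta>: "\<And>D :: (real \<times> real) set.
    finite D \<Longrightarrow> (\<forall>(u, v)\<in>D. c \<le> u \<and> u \<le> v \<and> v \<le> d) \<Longrightarrow>
    disjoint_family_on (\<lambda>(u, v). {u<..<v}) D \<Longrightarrow>
    (\<Sum>(u, v)\<in>D. v - u) < \<delta> \<Longrightarrow> (\<Sum>(u, v)\<in>D. norm (h v - h u)) < e / 2"
   using ac[unfolded AC_on_def, rule_format, OF half_gt_zero[OF e]] by blast
  obtain T where T: "open T" "N \<subseteq> T" "T - N \<in> lmeasurable" "emeasure lebesgue (T - N) < ennreal \<delta>"
   using sets_lebesgue_outer_open[of N \<delta>] N \<delta> by (metis negligible_imp_sets)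
  have Tm: "T \<in> lmeasurable" and "measure lebesgue T < \<delta>"
  proof -
   have nl: "N \<in> lmeasurable" "measure lebesgue N = 0"
    using N negligible_iff_measure by blast+
   have "T = (T - N) \<union> N" using T by auto
   then show "T \<in> lmeasurable" using T nl by (metis fmeasurable.Un)
   have "measure lebesgue (T - N) < \<delta>"
    using T \<delta> by (simp add: emeasure_eq_measure2 ennreal_less_iff)
   moreover have "measure lebesgue ((T - N) \<union> N) \<le> measure lebesgue (T - N) + measure lebesgue N"
    using T nl by (intro measure_Un_le) auto
   ultimately show "measure lebesgue T < \<delta>" using nl \<open>T = (T - N) \<union> N\<close> by simp
  qed
  \<comment> \<open>Makes the increments tagged outside \<open>N\<close> add up to at most e/2; the
    summand 1 avoids a division by zero when c = d.\<close>
  define \<eta> where "\<eta> = e / (2 * (d - c + 1))"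
  have \<eta>: "\<eta> > 0" "\<eta> * (d - c) \<le> e / 2" using e cd by (auto simp: \<eta>_def field_simps)
  have c1: "\<exists>r>0. ball x r \<subseteq> T" if "x \<in> N" for x
   using that T by (metis open_contains_ball subsetD)
  have c2: "\<exists>r>0. \<forall>y\<in>{c..d}. \<bar>y - x\<bar> < r \<longrightarrow> norm (h y - h x) \<le> \<eta> * \<bar>y - x\<bar>" if "x \<in> {c..d} - N" for x
  proof -
   have "\<forall>e>0. \<exists>d'>0. \<forall>y\<in>{c..d}. norm (y - x) < d' \<longrightarrow> norm (h y - h x - (y - x) *\<^sub>R 0) \<le> e * norm (y - x)"
    using der[OF that] unfolding has_vector_derivative_def has_derivative_within_alt by blast
   from this[rule_format, OF \<eta>(1)] show ?thesis by simp
  qed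
  have "\<exists>r>0. (x \<in> N \<longrightarrow> ball x r \<subseteq> T) \<and>
    (x \<in> {c..d} - N \<longrightarrow> (\<forall>y\<in>{c..d}. \<bar>y - x\<bar> < r \<longrightarrow> norm (h y - h x) \<le> \<eta> * \<bar>y - x\<bar>))" for x
  proof -
   consider "x \<in> N" | "x \<in> {c..d} - N" | "x \<notin> N" "x \<notin> {c..d}" by blast
   then show ?thesis
   proof cases
    case 3
    then show ?thesis using zero_less_one by blast
   qed (use c1 c2 in blast)+
  qed
  then obtain r where r: "\<And>x. r x > 0" "\<And>x. x \<in> N \<Longrightarrow> ball x (r x) \<subseteq> T"
    "\<And>x y. x \<in> {c..d} - N \<Longrightarrow> y \<in> {c..d} \<Longrightarrow> \<bar>y - x\<bar> < r x \<Longrightarrow> norm (h y - h x) \<le> \<eta> * \<bar>y - x\<bar>"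
   by metis
  have "gauge (\<lambda>x. ball x (r x))" using r by (auto simp: gauge_def)
  then obtain p where p: "p tagged_division_of (cbox c d)" "(\<lambda>x. ball x (r x)) fine p"
   using fine_division_exists[of "\<lambda>x. ball x (r x)" c d] by auto
  have p': "p tagged_division_of {c..d}" using p by simp
  have fin: "finite p" using p by auto
  have kint: "\<exists>u v. k = {u..v} \<and> u \<le> v \<and> c \<le> u \<and> v \<le> d \<and> u \<le> x \<and> x \<le> v \<and> {u..v} \<subseteq> ball x (r x)"
   if xk: "(x,k) \<in> p" for x k
  proof -
   obtain u v where k: "k = cbox u v" using tagged_division_ofD(4)[OF p(1) xk] by auto
   moreover have "x \<in> k" "k \<subseteq> cbox c d" using tagged_division_ofD(2,3)[OF p(1) xk] by auto
   moreover have "k \<subseteq> ball x (r x)" using p(2) xk by (auto simp: fine_def)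
   ultimately have "u \<le> x \<and> x \<le> v \<and> {u..v} \<subseteq> {c..d}" "{u..v} \<subseteq> ball x (r x)" by (auto simp: k)
   then show ?thesis using k by (intro exI[of _ u] exI[of _ v]) (auto)
  qed
  have eq: "(\<Sum>(x,k)\<in>p. h (Sup k) - h (Inf k)) = h d - h c"
   using additive_tagged_division_1[OF cd p', of h] by simp
  define p1 where "p1 = {(x,k)\<in>p. x \<in> N}"
  define p2 where "p2 = {(x,k)\<in>p. x \<notin> N}"
  have pp0: "p = p1 \<union> p2" "p1 \<inter> p2 = {}" by (auto simp: p1_def p2_def)
  then have pp: "p = p1 \<union> p2" "p1 \<inter> p2 = {}" "finite p1" "finite p2" using fin by auto
  have b2: "(\<Sum>(x,k)\<in>p2. norm (h (Sup k) - h (Inf k))) \<le> e / 2"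
  proof -
   have "(\<Sum>(x,k)\<in>p2. norm (h (Sup k) - h (Inf k))) \<le> (\<Sum>(x,k)\<in>p2. \<eta> * measure lborel k)"
   proof (rule sum_mono, clarify)
    fix x k assume xk2: "(x,k) \<in> p2"
    then have xk: "(x,k) \<in> p" "x \<notin> N" by (auto simp: p2_def)
    from kint[OF xk(1)] obtain u v where k: "k = {u..v}" "u \<le> v" "c \<le> u" "v \<le> d" "u \<le> x" "x \<le> v" "{u..v} \<subseteq> ball x (r x)"
     by auto
    have "u \<in> ball x (r x)" "v \<in> ball x (r x)" using k(2,7) by (meson atLeastAtMost_iff order_refl subsetD)+
    then have "norm (h v - h x) \<le> \<eta> * \<bar>v - x\<bar>" "norm (h u - h x) \<le> \<eta> * \<bar>u - x\<bar>"
     using r(3)[of x v] r(3)[of x u] k(2-6) xk(2) by (auto simp: dist_real_def abs_minus_commute)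
    then have "norm (h v - h u) \<le> \<eta> * (v - u)"
     using norm_triangle_ineq4[of "h v - h x" "h u - h x"] k by (simp add: algebra_simps)
    then show "norm (h (Sup k) - h (Inf k)) \<le> \<eta> * measure lborel k" using k by simp
   qed
   also have "\<dots> \<le> (\<Sum>(x,k)\<in>p. \<eta> * measure lborel k)"
    using \<eta> fin pp by (intro sum_mono2) (auto)
   also have "\<dots> = \<eta> * (d - c)"
    using additive_content_tagged_division[OF p(1)] cd
    by (simp add: sum_distrib_left[symmetric] split_def)
   finally show ?thesis using \<eta> by linarith
  qed
  define g where "g = (\<lambda>(x::real,k::real set). (Inf k, Sup k))"
  define D where "D = g ` p1"
  have ov: "interior k \<inter> interior k' = {}" if "(x,k) \<in> p" "(x',k') \<in> p" "(x,k) \<noteq> (x',k')" for x k x' k'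
   using tagged_division_ofD(5)[OF p(1) that(1,2)] that(3) by blast
  have nt: "Sup k = Inf k" if "(x,k) \<in> p" "(x',k') \<in> p" "(x,k) \<noteq> (x',k')" "g (x,k) = g (x',k')" for x k x' k'
  proof -
   from kint[OF that(1)] kint[OF that(2)] that(4) have "k = k'" by (auto simp: g_def)
   with ov[OF that(1-3)] have "interior k = {}" by simp
   with kint[OF that(1)] show ?thesis by (auto simp: interior_atLeastAtMost_real)
  qed
  \<comment> \<open>\<open>g\<close> forgets the tag and is not injective on \<open>p1\<close>. Two
    members with the same endpoints do not overlap, hence are degenerate, and degenerate intervals
    contribute \<open>F t t = 0\<close>.\<close>
  have reidx: "(\<Sum>(u,v)\<in>D. F u v) = (\<Sum>(x,k)\<in>p1. F (Inf k) (Sup k))" if "\<And>t. F t t = 0" for F :: "real \<Rightarrow> real \<Rightarrow> real"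
  proof -
   have "sum (\<lambda>(u,v). F u v) (g ` p1) = sum ((\<lambda>(u,v). F u v) \<circ> g) p1"
   proof (rule sum.reindex_nontrivial[OF pp(3)])
    fix s t assume "s \<in> p1" "t \<in> p1" "s \<noteq> t" "g s = g t"
    then show "(case g s of (u,v) \<Rightarrow> F u v) = 0"
     using nt[of "fst s" "snd s" "fst t" "snd t"] that pp(1) by (auto simp: g_def split_def)
   qed
   then show ?thesis by (simp add: D_def g_def split_def o_def)
  qed
  have Dprop: "\<forall>(u, v)\<in>D. c \<le> u \<and> u \<le> v \<and> v \<le> d \<and> {u<..<v} \<subseteq> T"
  proof (clarsimp simp: D_def g_def)
   fix x k assume "(x,k) \<in> p1"
   then have xk: "(x,k) \<in> p" "x \<in> N" by (auto simp: p1_def)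
   from kint[OF xk(1)] obtain u v where k: "k = {u..v}" "u \<le> v" "c \<le> u" "v \<le> d" "u \<le> x" "x \<le> v" "{u..v} \<subseteq> ball x (r x)" by auto
   have "{u<..<v} \<subseteq> {u..v}" by auto
   also note k(7)
   also note r(2)[OF xk(2)]
   finally show "c \<le> Inf k \<and> Inf k \<le> Sup k \<and> Sup k \<le> d \<and> {Inf k<..<Sup k} \<subseteq> T" using k by auto
  qed
  have Ddis: "disjoint_family_on (\<lambda>(u, v). {u<..<v}) D"
   unfolding disjoint_family_on_def
  proof (intro ballI impI)
   fix s t assume "s \<in> D" "t \<in> D" and ne: "s \<noteq> t"
   then obtain x k x' k' where st: "(x,k) \<in> p" "(x',k') \<in> p" "s = g (x,k)" "t = g (x',k')"
    using pp by (auto simp: D_def)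
   then have "(x,k) \<noteq> (x',k')" using ne by auto
   from ov[OF st(1,2) this] kint[OF st(1)] kint[OF st(2)] show "(case s of (u,v) \<Rightarrow> {u<..<v}) \<inter> (case t of (u,v) \<Rightarrow> {u<..<v}) = {}"
    by (auto simp: st g_def interior_atLeastAtMost_real split_def)
  qed
  have Dfin: "finite D" using pp by (simp add: D_def)
  have "(\<Sum>(u,v)\<in>D. v - u) = (\<Sum>s\<in>D. measure lebesgue (case s of (u,v) \<Rightarrow> {u<..<v}))"
   using Dprop by (intro sum.cong) (auto)
  also have "\<dots> = measure lebesgue (\<Union>s\<in>D. case s of (u,v) \<Rightarrow> {u<..<v})"
   using Dfin Ddis by (intro measure_finite_Union[symmetric]) (use Dprop in fastforce)+
  also have "\<dots> \<le> measure lebesgue T"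
   using Dprop Tm by (intro measure_mono_fmeasurable) (auto simp: split_def intro!: sets.finite_UN Dfin)
  finally have "(\<Sum>(u,v)\<in>D. v - u) < \<delta>" using \<open>measure lebesgue T < \<delta>\<close> by simp
  then have "(\<Sum>(u, v)\<in>D. norm (h v - h u)) < e / 2"
   using Dprop Dfin Ddis by (intro ac\<delta>) auto
  then have b1: "(\<Sum>(x,k)\<in>p1. norm (h (Sup k) - h (Inf k))) \<le> e / 2"
   by (subst (asm) reidx) auto
  have "norm (h d - h c) \<le> (\<Sum>(x,k)\<in>p. norm (h (Sup k) - h (Inf k)))"
   unfolding eq[symmetric] by (rule order_trans[OF norm_sum]) (simp add: split_def)
  also have "\<dots> = (\<Sum>(x,k)\<in>p1. norm (h (Sup k) - h (Inf k))) + (\<Sum>(x,k)\<in>p2. norm (h (Sup k) - h (Inf k)))"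
   using pp by (simp add: sum.union_disjoint)
  finally show ?thesis using b1 b2 by linarith
 qed
 then have "norm (h d - h c) \<le> 0" by (meson field_le_epsilon add_0 le_less_trans dense not_le order_refl)
 then show ?thesis by simp
qed

text \<open>Truncation: min (norm g) n differs from norm g by less than e/2 in the mean, and the
  truncated part contributes at most n times the total length of the intervals. Hence \<delta> = e /
  (2 (n+1)), where n + 1 allows n = 0.\<close>

lemma AC_on_indefinite_integral:
 fixes g :: "real \<Rightarrow> 'a::euclidean_space"
 assumes g: "g absolutely_integrable_on {c..d}"
 shows "AC_on (\<lambda>x. integral {c..x} g) c d"
 unfolding AC_on_def
proof (intro allI impI)
 fix e :: real assume e: "e > 0"
 define G where "G = (\<lambda>x. indicator {c..d} x * norm (g x))"
 have Gi: "integrable lebesgue G"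
  using g absolutely_integrable_norm[OF g] by (simp add: G_def set_integrable_def)
 then have Gm[measurable]: "G \<in> borel_measurable lebesgue" by auto
 have G0: "G x \<ge> 0" for x by (simp add: G_def)
 define H where "H n x = min (G x) (real n)" for n x
 have Hm[measurable]: "H n \<in> borel_measurable lebesgue" for n unfolding H_def by measurable
 have Hi: "integrable lebesgue (H n)" for n
  by (rule Bochner_Integration.integrable_bound[OF Gi]) (auto simp: H_def G0 min_def)
 have lim: "(\<lambda>n. \<integral>x. H n x \<partial>lebesgue) \<longlonglongrightarrow> (\<integral>x. G x \<partial>lebesgue)"
 proof (rule integral_dominated_convergence[where w=G])
  show "AE x in lebesgue. (\<lambda>n. H n x) \<longlonglongrightarrow> G x"
  proof (rule AE_I2)
   fix x
   obtain N where "G x \<le> real N" using real_arch_simple by blast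
   then have "\<forall>n\<ge>N. H n x = G x" by (auto simp: H_def min_def intro: order_trans)
   then show "(\<lambda>n. H n x) \<longlonglongrightarrow> G x"
    by (intro tendsto_eventually) (auto simp: eventually_sequentially)
  qed
 qed (auto simp: Gi H_def G0)
 then obtain n where n: "norm ((\<integral>x. H n x \<partial>lebesgue) - (\<integral>x. G x \<partial>lebesgue)) < e / 2"
  using e by (metis LIMSEQ_D half_gt_zero order_refl)
 show "\<exists>\<delta>>0. \<forall>D :: (real \<times> real) set. finite D \<and> (\<forall>(u, v)\<in>D. c \<le> u \<and> u \<le> v \<and> v \<le> d) \<and>
    disjoint_family_on (\<lambda>(u, v). {u<..<v}) D \<and>
    (\<Sum>(u, v)\<in>D. v - u) < \<delta> \<longrightarrow>
    (\<Sum>(u, v)\<in>D. norm (integral {c..v} g - integral {c..u} g)) < e"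
 proof (intro exI[of _ "e / (2 * (real n + 1))"] conjI allI impI; (elim conjE)?)
  show "e / (2 * (real n + 1)) > 0" using e by simp
  fix D :: "(real \<times> real) set"
  assume D: "finite D" "\<forall>(u, v)\<in>D. c \<le> u \<and> u \<le> v \<and> v \<le> d"
   "disjoint_family_on (\<lambda>(u, v). {u<..<v}) D" "(\<Sum>(u, v)\<in>D. v - u) < e / (2 * (real n + 1))"
  have bi: "integrable lebesgue (\<lambda>x. indicator {u<..<v} x * G x)" for u v :: real
  proof -
   have "{u<..<v} \<in> sets lebesgue" by simp
   from integrable_mult_indicator[OF this Gi] show ?thesis unfolding real_scaleR_def .
  qed
  have one: "norm (integral {c..v} g - integral {c..u} g) \<le> (\<integral>x. indicator {u<..<v} x * G x \<partial>lebesgue)"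
   if "(u,v) \<in> D" for u v
  proof -
   have uv: "c \<le> u" "u \<le> v" "v \<le> d" using D(2) that by auto
   have gi: "g absolutely_integrable_on {u..v}"
    by (rule set_integrable_subset[OF g]) (use uv in auto)
   have "g integrable_on {c..v}"
    by (rule integrable_on_subinterval[OF set_lebesgue_integral_eq_integral(1)[OF g]]) (use uv in auto)
   then have "integral {c..v} g - integral {c..u} g = integral {u..v} g"
    using Henstock_Kurzweil_Integration.integral_combine[of c u v g] uv by (simp add: algebra_simps)
   also have "norm \<dots> \<le> integral {u..v} (\<lambda>x. norm (g x))"
    using gi by (intro integral_norm_bound_integral) (auto simp: absolutely_integrable_on_def)
   also have "\<dots> = (LINT x:{u..v}|lebesgue. norm (g x))"
    using absolutely_integrable_norm[OF gi] by (simp add: set_lebesgue_integral_eq_integral o_def)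
   also have "\<dots> = (\<integral>x. indicator {u<..<v} x * G x \<partial>lebesgue)"
    unfolding set_lebesgue_integral_def
   proof (rule integral_cong_AE)
    have "AE x in lebesgue. x \<notin> {u,v}" by (intro AE_not_in) (simp add: null_sets_completionI)
    then show "AE x in lebesgue. indicat_real {u..v} x *\<^sub>R norm (g x) = indicat_real {u<..<v} x * G x"
     by eventually_elim (use uv in \<open>auto simp: G_def indicator_def\<close>)
    show "(\<lambda>x. indicat_real {u..v} x *\<^sub>R norm (g x)) \<in> borel_measurable lebesgue"
     using absolutely_integrable_norm[OF gi] unfolding set_integrable_def o_def
     by (rule borel_measurable_integrable)
    show "(\<lambda>x. indicat_real {u<..<v} x * G x) \<in> borel_measurable lebesgue"
     by (rule borel_measurable_integrable[OF bi])
   qed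
   finally show ?thesis .
  qed
  have bi2: "integrable lebesgue (\<lambda>x. real n * indicator {u<..<v} x)" for u v :: real
   by (intro integrable_mult_right) (auto intro!: integrable_real_indicator emeasure_bounded_finite[THEN order.strict_trans2] bounded_Ioo)
  define U where "U = (\<Union>s\<in>D. case s of (u,v) \<Rightarrow> {u<..<v})"
  have Uind: "(\<Sum>(u,v)\<in>D. indicator {u<..<v} x) = indicat_real U x" for x
   unfolding U_def by (subst indicator_UN_disjoint[OF D(1,3)]) (simp only: split_def)
  have "(\<Sum>(u, v)\<in>D. norm (integral {c..v} g - integral {c..u} g)) \<le> (\<Sum>(u,v)\<in>D. \<integral>x. indicator {u<..<v} x * G x \<partial>lebesgue)"
   by (rule sum_mono, clarify, rule one)
  also have "\<dots> = (\<integral>x. (\<Sum>(u,v)\<in>D. indicator {u<..<v} x * G x) \<partial>lebesgue)"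
   unfolding split_def by (rule Bochner_Integration.integral_sum[symmetric]) (rule bi)
  also have "\<dots> \<le> (\<integral>x. (G x - H n x) + (\<Sum>(u,v)\<in>D. real n * indicator {u<..<v} x) \<partial>lebesgue)"
  proof (rule integral_mono)
   show "integrable lebesgue (\<lambda>x. \<Sum>(u,v)\<in>D. indicator {u<..<v} x * G x)"
    unfolding split_def by (rule Bochner_Integration.integrable_sum) (rule bi)
   show "integrable lebesgue (\<lambda>x. (G x - H n x) + (\<Sum>(u,v)\<in>D. real n * indicator {u<..<v} x))"
    unfolding split_def by (intro Bochner_Integration.integrable_add Bochner_Integration.integrable_diff Bochner_Integration.integrable_sum bi2 Gi Hi)
   fix x
   have "(\<Sum>(u,v)\<in>D. indicator {u<..<v} x * G x) = indicator U x * G x"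
    unfolding Uind[symmetric] by (simp add: sum_distrib_right split_def)
   moreover have "(\<Sum>(u,v)\<in>D. real n * indicator {u<..<v} x) = real n * indicator U x"
    unfolding Uind[symmetric] by (simp add: sum_distrib_left split_def)
   ultimately show "(\<Sum>(u,v)\<in>D. indicator {u<..<v} x * G x) \<le> (G x - H n x) + (\<Sum>(u,v)\<in>D. real n * indicator {u<..<v} x)"
    by (auto simp: H_def indicator_def)
  qed
  also have "\<dots> = ((\<integral>x. G x \<partial>lebesgue) - (\<integral>x. H n x \<partial>lebesgue)) + (\<Sum>(u,v)\<in>D. \<integral>x. real n * indicator {u<..<v} x \<partial>lebesgue)"
   unfolding split_def by (subst Bochner_Integration.integral_add Bochner_Integration.integral_diff Bochner_Integration.integral_sum; (intro Bochner_Integration.integrable_diff Bochner_Integration.integrable_sum bi2 Gi Hi refl)?)+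
  also have "(\<Sum>(u,v)\<in>D. \<integral>x. real n * indicator {u<..<v} x \<partial>lebesgue) = real n * (\<Sum>(u,v)\<in>D. v - u)"
   unfolding sum_distrib_left using D(2) by (intro sum.cong) auto
  also have "real n * (\<Sum>(u,v)\<in>D. v - u) \<le> real n * (e / (2 * (real n + 1)))"
   using D(4) by (intro mult_left_mono) auto
  also have "\<dots> \<le> e / 2" using e by (simp add: field_simps)
  finally show "(\<Sum>(u, v)\<in>D. norm (integral {c..v} g - integral {c..u} g)) < e"
   using n unfolding real_norm_def by linarith
 qed
qed

text \<open>Lebesgue differentiation in the form of averages over intervals to the right of x; the
  exceptional set depends neither on the lower limit c nor on the interval.\<close>

lemma indefinite_integral_right_derivative:
 fixes g :: "real \<Rightarrow> 'a::euclidean_space"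
 assumes g: "\<And>c d. g integrable_on {c..d}"
 obtains N where "negligible N"
  "\<And>x c. x \<notin> N \<Longrightarrow> c < x \<Longrightarrow> ((\<lambda>x. integral {c..x} g) has_vector_derivative g x) (at_right x)"
proof -
 obtain N where N: "negligible N"
    "\<And>x e. \<lbrakk>x \<notin> N; 0 < e\<rbrakk> \<Longrightarrow> \<exists>d>0. \<forall>h. 0 < h \<and> h < d \<longrightarrow>
             norm(integral (cbox x (x + h *\<^sub>R One)) g /\<^sub>R h ^ DIM(real) - g x) < e"
  using integrable_ccontinuous_explicit[of g] g by auto
 show thesis
 proof (rule that[OF N(1)])
  fix x c assume x: "x \<notin> N" "c < x"
  have comb: "integral {c..y} g - integral {c..x} g = integral {x..y} g" if "y > x" for y
   using Henstock_Kurzweil_Integration.integral_combine[of c x y g] g x that by (simp add: algebra_simps)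
  show "((\<lambda>x. integral {c..x} g) has_vector_derivative g x) (at_right x)"
   unfolding has_vector_derivative_def has_derivative_within_alt
  proof (intro conjI allI impI)
   show "bounded_linear (\<lambda>h. h *\<^sub>R g x)" by (rule bounded_linear_scaleR_left)
   fix e :: real assume e: "e > 0"
   then obtain d where d: "d > 0" "\<And>h. 0 < h \<Longrightarrow> h < d \<Longrightarrow> norm (integral {x..x+h} g /\<^sub>R h - g x) < e"
    using N(2)[OF x(1) e] by auto
   show "\<exists>d>0. \<forall>y\<in>{x<..}. norm (y - x) < d \<longrightarrow>
     norm (integral {c..y} g - integral {c..x} g - (y - x) *\<^sub>R g x) \<le> e * norm (y - x)"
   proof (intro exI[of _ d] conjI ballI impI)
    fix y assume y: "y \<in> {x<..}" "norm (y - x) < d"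
    have "norm (integral {x..y} g /\<^sub>R (y - x) - g x) < e" using d(2)[of "y - x"] y by simp
    then have "norm ((y - x) *\<^sub>R (integral {x..y} g /\<^sub>R (y - x) - g x)) \<le> (y - x) * e"
     using y by simp
    moreover have "(y - x) *\<^sub>R (integral {x..y} g /\<^sub>R (y - x) - g x) = integral {x..y} g - (y - x) *\<^sub>R g x"
     using y by (simp add: scaleR_diff_right)
    ultimately show "norm (integral {c..y} g - integral {c..x} g - (y - x) *\<^sub>R g x) \<le> e * norm (y - x)"
     using y by (simp add: comb mult.commute)
   qed (use d in auto)
  qed
 qed
qed

text \<open>The left derivative of the primitive of g is the right derivative of the primitive of
  the reflected function, so the one-sided statement is used twice and the second exceptional set is
  reflected back. Extension by zero makes g integrable on all intervals.\<close>

lemma indefinite_integral_derivative_AE: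
 fixes g :: "real \<Rightarrow> 'a::euclidean_space"
 assumes g: "g integrable_on {c..d}"
 obtains N where "negligible N"
  "\<And>x. x \<in> {c<..<d} - N \<Longrightarrow> ((\<lambda>x. integral {c..x} g) has_vector_derivative g x) (at x)"
proof -
 define f where "f x = (if x \<in> {c..d} then g x else 0)" for x
 have fi0: "f integrable_on UNIV" unfolding f_def using g by (subst integrable_restrict_UNIV)
 then have fi: "f integrable_on {u..v}" for u v
  by (metis integrable_on_subcbox subset_UNIV interval_cbox)
 define f' where "f' x = f (- x)" for x
 have fi': "f' integrable_on {u..v}" for u v
  using fi[of "- v" "- u"] Henstock_Kurzweil_Integration.integrable_reflect_real[where f=f and a="- v" and b="- u"] unfolding f'_def[abs_def] by simp
 obtain N1 where N1: "negligible N1"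
  "\<And>x c. x \<notin> N1 \<Longrightarrow> c < x \<Longrightarrow> ((\<lambda>x. integral {c..x} f) has_vector_derivative f x) (at_right x)"
  using indefinite_integral_right_derivative[OF fi] by metis
 obtain N2 where N2: "negligible N2"
  "\<And>x c. x \<notin> N2 \<Longrightarrow> c < x \<Longrightarrow> ((\<lambda>x. integral {c..x} f') has_vector_derivative f' x) (at_right x)"
  using indefinite_integral_right_derivative[OF fi'] by metis
 have N2': "negligible (uminus ` N2)"
  by (rule negligible_differentiable_image_negligible[OF _ N2(1)])
   (auto simp: differentiable_on_def intro!: derivative_intros differentiable_minus)
 show thesis
 proof (rule that[of "N1 \<union> uminus ` N2"])
  show "negligible (N1 \<union> uminus ` N2)" using N1 N2' by simp
  fix x assume x: "x \<in> {c<..<d} - (N1 \<union> uminus ` N2)"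
  have feq: "integral {c..y} f = integral {c..y} g" if "y \<le> d" for y
   using that by (intro Henstock_Kurzweil_Integration.integral_cong) (auto simp: f_def)
  have R: "((\<lambda>x. integral {c..x} f) has_vector_derivative f x) (at_right x)" using N1 x by auto
  have "- x \<notin> N2" using x by (metis DiffD2 UnCI image_eqI minus_minus)
  then have L0: "((\<lambda>x. integral {- d..x} f') has_vector_derivative f' (- x)) (at_right (- x))" using N2 x by auto
  have L1: "(((\<lambda>x. integral {- d..x} f') \<circ> uminus) has_vector_derivative (- 1) *\<^sub>R f' (- x)) (at x within {..<x})"
  proof (rule vector_diff_chain_within)
   show "(uminus has_vector_derivative - 1) (at x within {..<x})"
    by (auto intro!: derivative_eq_intros)
   have "uminus ` {..<x} = {- x<..}" by (auto simp: image_iff intro!: bexI[of _ "- _"])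
   then show "((\<lambda>x. integral {- d..x} f') has_vector_derivative f' (- x)) (at (- x) within uminus ` {..<x})"
    using L0 by simp
  qed
  have refl: "integral {- d.. - y} f' = integral {c..d} f - integral {c..y} f" if "c \<le> y" "y \<le> d" for y
   using Henstock_Kurzweil_Integration.integral_combine[of c y d f] fi that
    Henstock_Kurzweil_Integration.integral_reflect_real[where f=f and a=y and b=d]
   unfolding f'_def[abs_def] by (simp add: algebra_simps)
  have L: "((\<lambda>y. integral {c..y} f) has_vector_derivative f x) (at_left x)"
  proof -
   have "((\<lambda>y. integral {c..d} f - integral {- d.. - y} f') has_vector_derivative 0 - (- 1) *\<^sub>R f' (- x)) (at x within {..<x})"
    using has_vector_derivative_diff[OF has_vector_derivative_const L1] by (simp only: o_def)
   then have 2: "((\<lambda>y. integral {c..d} f - integral {- d.. - y} f') has_vector_derivative f x) (at x within {..<x})"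
    by (simp add: f'_def)
   have "{..<x} - {x} = {..x} - {x}" by auto
   then have at: "at x within {..<x} = at x within {..x}" by (simp only: at_within_def)
   show ?thesis unfolding at
   proof (rule has_vector_derivative_transform_within[OF 2[unfolded at], of "x - c"])
    show "x - c > 0" using x by simp
    fix y assume "y \<in> {..x}" "dist y x < x - c"
    then show "integral {c..d} f - integral {- d.. - y} f' = integral {c..y} f"
     using refl[of y] x by (auto simp: dist_real_def)
   qed (use refl[of x] x in auto)
  qed
  have "((\<lambda>x. integral {c..x} f) has_vector_derivative f x) (at x)"
   using L R unfolding has_vector_derivative_def has_derivative_within filterlim_at_split by simp
  then have "((\<lambda>x. integral {c..x} g) has_vector_derivative f x) (at x)"
  proof (rule has_vector_derivative_transform_within_open[of _ _ _ "{c<..<d}"])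
  qed (use x feq in auto)
  then show "((\<lambda>x. integral {c..x} g) has_vector_derivative g x) (at x)" using x by (simp add: f_def)
 qed
qed

section \<open>Uniqueness for a linear second-order equation\<close>

text \<open>Gronwall for the energy E = |y|^2 + |y'|^2: since |E'| is at most k E, the function E
  exp(-k x) decreases and E exp(k x) increases. The first settles the points to the right of t, the
  second those to the left.\<close>

lemma linear_ode_zero:
 fixes y y' :: "real \<Rightarrow> 'a::real_inner" and Q :: "real \<Rightarrow> real"
 assumes Q: "continuous_on {c..d} Q"
  and y: "\<And>x. x \<in> {c..d} \<Longrightarrow> (y has_vector_derivative y' x) (at x within {c..d})"
  and y': "\<And>x. x \<in> {c..d} \<Longrightarrow> (y' has_vector_derivative Q x *\<^sub>R y x) (at x within {c..d})"
  and t: "t \<in> {c..d}" "y t = 0" "y' t = 0" and x: "x \<in> {c..d}"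
 shows "y x = 0"
proof -
 obtain B where B: "\<And>x. x \<in> {c..d} \<Longrightarrow> \<bar>Q x\<bar> \<le> B"
  using compact_imp_bounded[OF compact_continuous_image[OF Q compact_Icc]]
  unfolding bounded_iff by fastforce
 define k where "k = 1 + B"
 define E where "E x = y x \<bullet> y x + y' x \<bullet> y' x" for x
 define E' where "E' x = 2 * (1 + Q x) * (y x \<bullet> y' x)" for x
 have dE: "(E has_real_derivative E' x) (at x within {c..d})" if "x \<in> {c..d}" for x
  unfolding E_def E'_def has_real_derivative_iff_has_vector_derivative
  by (rule derivative_eq_intros y y' that refl has_vector_derivative_def
     | rule has_vector_derivative_add bounded_bilinear.has_vector_derivative[OF bounded_bilinear_inner])+
    (simp add: algebra_simps inner_commute)
 have bE: "\<bar>E' x\<bar> \<le> k * E x" if "x \<in> {c..d}" for x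
 proof -
  have "2 * \<bar>y x \<bullet> y' x\<bar> \<le> 2 * (norm (y x) * norm (y' x))" using Cauchy_Schwarz_ineq2[of "y x" "y' x"] by simp
  also have "\<dots> \<le> E x" unfolding E_def power2_norm_eq_inner[symmetric]
   by (rule sum_squares_bound[of "norm (y x)" "norm (y' x)", unfolded mult.assoc])
  finally have 1: "2 * \<bar>y x \<bullet> y' x\<bar> \<le> E x" .
  have "\<bar>E' x\<bar> = \<bar>1 + Q x\<bar> * (2 * \<bar>y x \<bullet> y' x\<bar>)" by (simp only: E'_def abs_mult abs_numeral mult_ac)
  also have "\<dots> \<le> k * E x" using B[OF that] 1 by (intro mult_mono) (auto simp: k_def)
  finally show ?thesis .
 qed
 have E0: "E z \<ge> 0" for z by (simp add: E_def)
 have "E x = 0"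
 proof (cases "t \<le> x")
  case True
  have "\<exists>z. z \<in> {t<..<x} \<and> (x - t) * ((E' z - k * E z) * exp (- k * z)) = E x * exp (- k * x) - E t * exp (- k * t)" if "t < x"
  proof -
   have "\<exists>z\<in>{t<..<x}. (\<lambda>z. E z * exp (- k * z)) x - (\<lambda>z. E z * exp (- k * z)) t = ((\<lambda>h. ((E' z - k * E z) * exp (- k * z)) * h)) (x - t)"
   proof (rule mvt_simple[OF that])
    fix s assume s: "t \<le> s" "s \<le> x"
    have d1: "(E has_real_derivative E' s) (at s within {t..x})"
     by (rule DERIV_subset[OF dE]) (use s t x in auto)
    have "((\<lambda>z. E z * exp (- k * z)) has_real_derivative (E' s - k * E s) * exp (- k * s)) (at s within {t..x})"
     by (rule derivative_eq_intros d1 refl)+ (simp add: algebra_simps)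
    then show "((\<lambda>z. E z * exp (- k * z)) has_derivative (\<lambda>h. ((E' s - k * E s) * exp (- k * s)) * h)) (at s within {t..x})"
     by (simp only: has_field_derivative_def)
   qed
   then show ?thesis by (auto simp: algebra_simps)
  qed
  moreover have "E' z - k * E z \<le> 0" if "z \<in> {t<..<x}" for z using bE[of z] that t x by auto
  ultimately have "t < x \<Longrightarrow> E x * exp (- k * x) - E t * exp (- k * t) \<le> 0"
   using True by (smt (verit) exp_gt_zero mult_nonneg_nonpos mult_nonpos_nonneg less_imp_le)
  moreover have "E t = 0" using t by (simp add: E_def)
  ultimately have "E x * exp (- k * x) \<le> 0" using True by (cases "t = x") auto
  then show ?thesis using E0[of x] by (simp add: mult_le_0_iff)
 next
  case False
  then have xt: "x < t" by simp
  have "\<exists>z\<in>{x<..<t}. (\<lambda>z. E z * exp (k * z)) t - (\<lambda>z. E z * exp (k * z)) x = ((\<lambda>h. ((E' z + k * E z) * exp (k * z)) * h)) (t - x)"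
  proof (rule mvt_simple[OF xt])
   fix s assume s: "x \<le> s" "s \<le> t"
   have d1: "(E has_real_derivative E' s) (at s within {x..t})"
    by (rule DERIV_subset[OF dE]) (use s t x in auto)
   have "((\<lambda>z. E z * exp (k * z)) has_real_derivative (E' s + k * E s) * exp (k * s)) (at s within {x..t})"
    by (rule derivative_eq_intros d1 refl)+ (simp add: algebra_simps)
   then show "((\<lambda>z. E z * exp (k * z)) has_derivative (\<lambda>h. ((E' s + k * E s) * exp (k * s)) * h)) (at s within {x..t})"
    by (simp only: has_field_derivative_def)
  qed
  then obtain z where z: "z \<in> {x<..<t}" "E t * exp (k * t) - E x * exp (k * x) = (t - x) * ((E' z + k * E z) * exp (k * z))" by auto
  have "E' z + k * E z \<ge> 0" using bE[of z] z t x by auto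
  then have "E t * exp (k * t) - E x * exp (k * x) \<ge> 0" unfolding z(2) using xt by simp
  moreover have "E t = 0" using t by (simp add: E_def)
  ultimately have "E x * exp (k * x) \<le> 0" by simp
  then show ?thesis using E0[of x] by (simp add: mult_le_0_iff)
 qed
 then show ?thesis by (simp add: E_def add_nonneg_eq_0_iff)
qed

section \<open>Square-integrable real functions and Bessel's inequality\<close>

text \<open>A predicate on functions, not on classes modulo null sets, because continuous
  representatives are evaluated at points throughout. Complex functions are treated through their
  real and imaginary parts.\<close>

definition sq_int :: "'a measure \<Rightarrow> ('a \<Rightarrow> real) \<Rightarrow> bool" where
 "sq_int M f \<longleftrightarrow> f \<in> borel_measurable M \<and> integrable M (\<lambda>x. (f x)\<^sup>2)"

lemma sq_intD [dest]:
 assumes "sq_int M f"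
 shows "f \<in> borel_measurable M" "integrable M (\<lambda>x. (f x)\<^sup>2)"
 using assms by (auto simp: sq_int_def)

lemma sq_int_mult:
 assumes "sq_int M f" "sq_int M g"
 shows "integrable M (\<lambda>x. f x * g x)"
proof (rule Bochner_Integration.integrable_bound)
 show "integrable M (\<lambda>x. (f x)\<^sup>2 + (g x)\<^sup>2)" using assms by (auto simp: sq_int_def)
 show "(\<lambda>x. f x * g x) \<in> borel_measurable M" using assms by (auto simp: sq_int_def)
 show "AE x in M. norm (f x * g x) \<le> norm ((f x)\<^sup>2 + (g x)\<^sup>2)"
 proof (rule AE_I2)
  fix x
  have "2 * (\<bar>f x\<bar> * \<bar>g x\<bar>) \<le> \<bar>f x\<bar>\<^sup>2 + \<bar>g x\<bar>\<^sup>2" using sum_squares_bound[of "\<bar>f x\<bar>" "\<bar>g x\<bar>"] by (simp add: mult.assoc)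
  moreover have "0 \<le> \<bar>f x\<bar> * \<bar>g x\<bar>" by simp
  ultimately have "\<bar>f x\<bar> * \<bar>g x\<bar> \<le> (f x)\<^sup>2 + (g x)\<^sup>2" unfolding power2_abs by linarith
  then show "norm (f x * g x) \<le> norm ((f x)\<^sup>2 + (g x)\<^sup>2)" by (simp add: abs_mult)
 qed
qed

lemma sq_int_cmult: "sq_int M f \<Longrightarrow> sq_int M (\<lambda>x. c * f x)"
 by (auto simp: sq_int_def power_mult_distrib)

lemma sq_int_add:
 assumes "sq_int M f" "sq_int M g"
 shows "sq_int M (\<lambda>x. f x + g x)"
proof -
 have "integrable M (\<lambda>x. (f x)\<^sup>2 + (g x)\<^sup>2 + 2 * (f x * g x))"
  using assms sq_int_mult[OF assms] by (intro Bochner_Integration.integrable_add integrable_mult_right) (auto simp: sq_int_def)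
 then have "integrable M (\<lambda>x. (f x + g x)\<^sup>2)" by (simp add: power2_sum algebra_simps)
 then show ?thesis using assms by (auto simp: sq_int_def)
qed

lemma sq_int_diff:
 assumes "sq_int M f" "sq_int M g"
 shows "sq_int M (\<lambda>x. f x - g x)"
 using sq_int_add[OF assms(1) sq_int_cmult[OF assms(2), of "- 1"]] by simp

lemma sq_int_zero [simp]: "sq_int M (\<lambda>x. 0)"
 by (simp add: sq_int_def)

lemma sq_int_abs: "sq_int M f \<Longrightarrow> sq_int M (\<lambda>x. \<bar>f x\<bar>)"
 by (auto simp: sq_int_def)

lemma (in finite_measure) sq_int_bounded:
 assumes "f \<in> borel_measurable M" "\<And>x. x \<in> space M \<Longrightarrow> \<bar>f x\<bar> \<le> B"
 shows "sq_int M f"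
 unfolding sq_int_def
proof
 show "integrable M (\<lambda>x. (f x)\<^sup>2)"
  by (rule integrable_const_bound[where B="B\<^sup>2"])
   (use assms in \<open>auto intro!: AE_I2 simp: abs_le_square_iff[symmetric] intro: order_trans[OF _ abs_ge_self]\<close>)
qed fact

lemma sq_int_diff_expand:
 assumes "sq_int M f" "sq_int M g"
 shows "(\<integral>x. (f x - t * g x)\<^sup>2 \<partial>M) = (\<integral>x. (f x)\<^sup>2 \<partial>M) - 2 * t * (\<integral>x. f x * g x \<partial>M) + t\<^sup>2 * (\<integral>x. (g x)\<^sup>2 \<partial>M)"
proof -
 have "(\<integral>x. (f x - t * g x)\<^sup>2 \<partial>M) = (\<integral>x. (f x)\<^sup>2 - 2 * t * (f x * g x) + t\<^sup>2 * (g x)\<^sup>2 \<partial>M)"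
  by (simp add: power2_diff power_mult_distrib algebra_simps)
 also have "\<dots> = (\<integral>x. (f x)\<^sup>2 \<partial>M) - 2 * t * (\<integral>x. f x * g x \<partial>M) + t\<^sup>2 * (\<integral>x. (g x)\<^sup>2 \<partial>M)"
  using assms sq_int_mult[OF assms] by (subst Bochner_Integration.integral_add Bochner_Integration.integral_diff; auto)+
 finally show ?thesis .
qed

text \<open>The square integral of f - t g is a nonnegative quadratic polynomial in t. It is
  evaluated at its minimum t = B / C, or along a linear polynomial when C = 0.\<close>

lemma integral_Cauchy_Schwarz:
 assumes "sq_int M f" "sq_int M g"
 shows "(\<integral>x. f x * g x \<partial>M)\<^sup>2 \<le> (\<integral>x. (f x)\<^sup>2 \<partial>M) * (\<integral>x. (g x)\<^sup>2 \<partial>M)"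
proof -
 define A B C where "A = (\<integral>x. (f x)\<^sup>2 \<partial>M)" and "B = (\<integral>x. f x * g x \<partial>M)" and "C = (\<integral>x. (g x)\<^sup>2 \<partial>M)"
 have t: "0 \<le> A - 2 * t * B + t\<^sup>2 * C" for t
  unfolding A_def B_def C_def sq_int_diff_expand[OF assms, symmetric] by (rule Bochner_Integration.integral_nonneg) simp
 have C0: "C \<ge> 0" unfolding C_def by (rule Bochner_Integration.integral_nonneg) simp
 show ?thesis
 proof (cases "C = 0")
  case True
  have "B = 0"
  proof (rule ccontr)
   assume "B \<noteq> 0"
   \<comment> \<open>At this t the linear polynomial A - 2 t B takes the value -1.\<close>
   then show False using t[of "(A + 1) / (2 * B)"] True by (simp add: field_simps)
  qed
  then show ?thesis using True by (simp add: A_def B_def C_def)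
 next
  case False
  then have "0 \<le> A - B\<^sup>2 / C" using t[of "B / C"] C0 by (simp add: field_simps power2_eq_square)
  then show ?thesis using False C0 unfolding A_def[symmetric] B_def[symmetric] C_def[symmetric]
   by (simp add: field_simps)
 qed
qed

lemma integral_Cauchy_Schwarz_abs:
 assumes "sq_int M f" "sq_int M g"
 shows "(\<integral>x. \<bar>f x\<bar> * \<bar>g x\<bar> \<partial>M) \<le> sqrt (\<integral>x. (f x)\<^sup>2 \<partial>M) * sqrt (\<integral>x. (g x)\<^sup>2 \<partial>M)"
proof -
 have "(\<integral>x. \<bar>f x\<bar> * \<bar>g x\<bar> \<partial>M)\<^sup>2 \<le> (\<integral>x. (f x)\<^sup>2 \<partial>M) * (\<integral>x. (g x)\<^sup>2 \<partial>M)"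
  using integral_Cauchy_Schwarz[OF sq_int_abs[OF assms(1)] sq_int_abs[OF assms(2)]] by simp
 then have "sqrt ((\<integral>x. \<bar>f x\<bar> * \<bar>g x\<bar> \<partial>M)\<^sup>2) \<le> sqrt ((\<integral>x. (f x)\<^sup>2 \<partial>M) * (\<integral>x. (g x)\<^sup>2 \<partial>M))" by (rule real_sqrt_le_mono)
 then show ?thesis by (simp add: real_sqrt_mult)
qed

text \<open>Induction by subtracting the projection on the new \<open>e k\<close>: orthogonality
  leaves the other coefficients unchanged. Only orthogonality is assumed; the division by the square
  norm suits the solutions \<open>u l\<close>, which are not normalized.\<close>

lemma Bessel_inequality:
 fixes e :: "'i \<Rightarrow> 'a \<Rightarrow> real"
 assumes "finite S" and f: "sq_int M f" and e: "\<And>i. i \<in> S \<Longrightarrow> sq_int M (e i)"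
  and orth: "\<And>i j. i \<in> S \<Longrightarrow> j \<in> S \<Longrightarrow> i \<noteq> j \<Longrightarrow> (\<integral>x. e i x * e j x \<partial>M) = 0"
  and pos: "\<And>i. i \<in> S \<Longrightarrow> (\<integral>x. (e i x)\<^sup>2 \<partial>M) > 0"
 shows "(\<Sum>i\<in>S. (\<integral>x. f x * e i x \<partial>M)\<^sup>2 / (\<integral>x. (e i x)\<^sup>2 \<partial>M)) \<le> (\<integral>x. (f x)\<^sup>2 \<partial>M)"
 using assms(1,3-) f
proof (induction S arbitrary: f rule: finite_induct)
 case empty
 then show ?case by (simp add: Bochner_Integration.integral_nonneg)
next
 case (insert k S)
 define N where "N = (\<integral>x. (e k x)\<^sup>2 \<partial>M)"
 define c where "c = (\<integral>x. f x * e k x \<partial>M)"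
 have N: "N > 0" using insert by (simp add: N_def)
 define g where "g x = f x - c / N * e k x" for x
 have ek: "sq_int M (e k)" using insert by simp
 have f: "sq_int M f" by fact
 have g: "sq_int M g" unfolding g_def by (intro sq_int_diff f sq_int_cmult ek)
 have ge: "(\<integral>x. g x * e i x \<partial>M) = (\<integral>x. f x * e i x \<partial>M)" if "i \<in> S" for i
 proof -
  have ei: "sq_int M (e i)" using insert that by simp
  have "k \<noteq> i" using that insert by auto
  have "(\<integral>x. g x * e i x \<partial>M) = (\<integral>x. f x * e i x - c / N * (e k x * e i x) \<partial>M)"
   by (simp add: g_def algebra_simps)
  also have "\<dots> = (\<integral>x. f x * e i x \<partial>M) - c / N * (\<integral>x. e k x * e i x \<partial>M)"
   using sq_int_mult[OF f ei] sq_int_mult[OF ek ei] by simp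
  also have "(\<integral>x. e k x * e i x \<partial>M) = 0" using insert that \<open>k \<noteq> i\<close> by auto
  finally show ?thesis by simp
 qed
 have "(\<integral>x. (g x)\<^sup>2 \<partial>M) = (\<integral>x. (f x)\<^sup>2 \<partial>M) - c\<^sup>2 / N"
  unfolding g_def sq_int_diff_expand[OF f ek] using N
  by (simp only: N_def[symmetric] c_def[symmetric]) (simp add: power2_eq_square field_simps)
 moreover have "(\<Sum>i\<in>S. (\<integral>x. g x * e i x \<partial>M)\<^sup>2 / (\<integral>x. (e i x)\<^sup>2 \<partial>M)) \<le> (\<integral>x. (g x)\<^sup>2 \<partial>M)"
  using insert g by auto
 moreover have "(\<Sum>i\<in>S. (\<integral>x. g x * e i x \<partial>M)\<^sup>2 / (\<integral>x. (e i x)\<^sup>2 \<partial>M)) = (\<Sum>i\<in>S. (\<integral>x. f x * e i x \<partial>M)\<^sup>2 / (\<integral>x. (e i x)\<^sup>2 \<partial>M))"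
  using ge by simp
 ultimately show ?case using insert by (simp add: c_def N_def)
qed

section \<open>The Bessel series and the free solution near zero\<close>

definition bes_coeff :: "real \<Rightarrow> nat \<Rightarrow> real" where
 "bes_coeff \<nu> k = (-1) ^ k / (4 ^ k * (fact k * Gamma (\<nu> + real k + 1)))"

text \<open>In the variable s = z x^2 this entire series is J_\<nu>(sqrt s) divided by (sqrt s /
  2)^\<nu>, so the branch of the square root disappears. The generic field lets one definition serve
  real and complex arguments.\<close>

definition bes_ser :: "real \<Rightarrow> 'a::{real_normed_field,banach} \<Rightarrow> 'a" where
 "bes_ser \<nu> s = (\<Sum>k. of_real (bes_coeff \<nu> k) * s ^ k)"

definition bes_ser' :: "real \<Rightarrow> 'a::{real_normed_field,banach} \<Rightarrow> 'a" where
 "bes_ser' \<nu> s = (\<Sum>k. diffs (\<lambda>k. of_real (bes_coeff \<nu> k)) k * s ^ k)"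

definition bes_ser'' :: "real \<Rightarrow> 'a::{real_normed_field,banach} \<Rightarrow> 'a" where
 "bes_ser'' \<nu> s = (\<Sum>k. diffs (diffs (\<lambda>k. of_real (bes_coeff \<nu> k))) k * s ^ k)"

lemma bes_coeff_Suc:
 assumes "\<nu> > 0"
 shows "bes_coeff \<nu> (Suc k) * (4 * (real k + 1) * (\<nu> + real k + 1)) = - bes_coeff \<nu> k"
proof -
 have "Gamma (\<nu> + real k + 1 + 1) = (\<nu> + real k + 1) * Gamma (\<nu> + real k + 1)"
  using assms by (intro Gamma_plus1) (auto elim!: nonpos_Ints_cases)
 moreover have "Gamma (\<nu> + real k + 1) > 0" using assms by (intro Gamma_real_pos) auto
 ultimately show ?thesis using assms
  by (simp add: bes_coeff_def add_ac divide_simps)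
qed

text \<open>In the recursion 4 (k+1) (\<nu>+k+1) is at least k + 1, so the coefficients decay at
  least like 1/k! and the series converges everywhere.\<close>

lemma bes_coeff_bound:
 assumes "\<nu> > 0"
 shows "\<bar>bes_coeff \<nu> k\<bar> \<le> \<bar>bes_coeff \<nu> 0\<bar> / fact k"
proof (induction k)
 case (Suc k)
 have "\<bar>bes_coeff \<nu> k\<bar> = \<bar>bes_coeff \<nu> (Suc k)\<bar> * (4 * (real k + 1) * (\<nu> + real k + 1))"
  using arg_cong[OF bes_coeff_Suc[OF assms, of k], of abs] assms by (simp add: abs_mult)
 moreover have "\<bar>bes_coeff \<nu> (Suc k)\<bar> * (real k + 1) \<le> \<bar>bes_coeff \<nu> (Suc k)\<bar> * (4 * (real k + 1) * (\<nu> + real k + 1))"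
 proof (rule mult_left_mono)
  have "(real k + 1) * 1 \<le> (real k + 1) * (4 * (\<nu> + real k + 1))"
   using assms by (intro mult_left_mono) auto
  then show "real k + 1 \<le> 4 * (real k + 1) * (\<nu> + real k + 1)" by (simp add: algebra_simps)
 qed auto
 ultimately have "\<bar>bes_coeff \<nu> (Suc k)\<bar> * (real k + 1) \<le> \<bar>bes_coeff \<nu> 0\<bar> / fact k" using Suc by linarith
 then have "\<bar>bes_coeff \<nu> (Suc k)\<bar> \<le> \<bar>bes_coeff \<nu> 0\<bar> / fact k / (real k + 1)"
  by (subst pos_le_divide_eq) auto
 then show ?case by (simp add: add.commute mult.commute)
qed simp

lemma bes_ser_summable:
 fixes s :: "'a::{real_normed_field,banach}"
 assumes "\<nu> > 0"
 shows "summable (\<lambda>k. of_real (bes_coeff \<nu> k) * s ^ k)"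
proof (rule summable_comparison_test[OF _ summable_mult[OF summable_exp, of "\<bar>bes_coeff \<nu> 0\<bar>" "norm s"]], intro exI allI impI)
 fix k
 have "norm (of_real (bes_coeff \<nu> k) * s ^ k) \<le> \<bar>bes_coeff \<nu> 0\<bar> / fact k * norm s ^ k"
  using mult_right_mono[OF bes_coeff_bound[OF assms, of k], of "norm s ^ k"] by (simp add: norm_mult norm_power)
 then show "norm (of_real (bes_coeff \<nu> k) * s ^ k) \<le> \<bar>bes_coeff \<nu> 0\<bar> * (inverse (fact k) * norm s ^ k)"
  by (simp add: divide_inverse mult.assoc)
qed

lemma bes_ser_DERIV:
 fixes s :: "'a::{real_normed_field,banach}"
 assumes "\<nu> > 0"
 shows "(bes_ser \<nu> has_field_derivative bes_ser' \<nu> s) (at s)"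
 unfolding bes_ser_def[abs_def] bes_ser'_def
 by (rule termdiffs_strong_converges_everywhere) (rule bes_ser_summable[OF assms])

lemma bes_ser'_DERIV:
 fixes s :: "'a::{real_normed_field,banach}"
 assumes "\<nu> > 0"
 shows "(bes_ser' \<nu> has_field_derivative bes_ser'' \<nu> s) (at s)"
 unfolding bes_ser'_def[abs_def] bes_ser''_def
 by (rule termdiffs_strong_converges_everywhere, rule termdiff_converges_all)
  (rule bes_ser_summable[OF assms])

lemma bes_ser_of_real: "\<nu> > 0 \<Longrightarrow> bes_ser \<nu> (of_real s :: 'a::{real_normed_field,banach}) = of_real (bes_ser \<nu> s)"
 unfolding bes_ser_def by (subst suminf_of_real) (use bes_ser_summable[of \<nu> s] in auto)

text \<open>Bessel's equation in the variable s = z x^2; coefficient by coefficient it is the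
  recursion for \<open>bes_coeff\<close>.\<close>

lemma bes_ser_ode:
 fixes s :: "'a::{real_normed_field,banach}"
 assumes "\<nu> > 0"
 shows "s * bes_ser'' \<nu> s + (of_real \<nu> + 1) * bes_ser' \<nu> s + bes_ser \<nu> s / 4 = 0"
proof -
 let ?c = "\<lambda>k. of_real (bes_coeff \<nu> k) :: 'a"
 have s0: "summable (\<lambda>k. ?c k * s ^ k)" for s by (rule bes_ser_summable[OF assms])
 have s1: "summable (\<lambda>k. diffs ?c k * s ^ k)" for s by (rule termdiff_converges_all[OF s0])
 have s2: "summable (\<lambda>k. diffs (diffs ?c) k * s ^ k)" for s by (rule termdiff_converges_all[OF s1])
 \<comment> \<open>The factor k annihilates the term at index 0, so the shifted series, which
   represents s times the second derivative, has the same sum as the unshifted one.\<close>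
 define d where "d = (\<lambda>k. of_nat k * diffs ?c k * s ^ k)"
 have dsuc: "(\<lambda>k. d (Suc k)) sums (s * bes_ser'' \<nu> s)"
  using sums_mult[OF summable_sums[OF s2[of s]], of s]
  unfolding d_def bes_ser''_def by (simp add: diffs_def algebra_simps)
 then have "d sums (s * bes_ser'' \<nu> s)" using sums_Suc_iff[of d] by (simp add: d_def)
 moreover have "(\<lambda>k. (of_real \<nu> + 1) * (diffs ?c k * s ^ k)) sums ((of_real \<nu> + 1) * bes_ser' \<nu> s)"
  unfolding bes_ser'_def by (intro sums_mult summable_sums s1)
 moreover have "(\<lambda>k. ?c k * s ^ k / 4) sums (bes_ser \<nu> s / 4)"
  unfolding bes_ser_def by (intro sums_divide summable_sums s0)
 ultimately have "(\<lambda>k. d k + (of_real \<nu> + 1) * (diffs ?c k * s ^ k) + ?c k * s ^ k / 4) sums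
   (s * bes_ser'' \<nu> s + (of_real \<nu> + 1) * bes_ser' \<nu> s + bes_ser \<nu> s / 4)"
  by (intro sums_add)
 moreover have "d k + (of_real \<nu> + 1) * (diffs ?c k * s ^ k) + ?c k * s ^ k / 4 = 0" for k
 proof -
  have "of_real (bes_coeff \<nu> (Suc k) * (4 * (real k + 1) * (\<nu> + real k + 1))) = (- of_real (bes_coeff \<nu> k) :: 'a)"
   by (simp only: bes_coeff_Suc[OF assms] of_real_minus)
  then have "?c k = - (?c (Suc k) * (4 * (of_nat k + 1) * (of_real \<nu> + of_nat k + 1)))" by simp
  then show ?thesis unfolding d_def diffs_def by (simp only:) (simp add: field_simps)
 qed
 ultimately have "(\<lambda>k. 0) sums (s * bes_ser'' \<nu> s + (of_real \<nu> + 1) * bes_ser' \<nu> s + bes_ser \<nu> s / 4)" by simp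
 from sums_unique2[OF this sums_zero] show ?thesis .
qed

lemma bes_ser_0: "bes_ser \<nu> 0 = of_real (1 / Gamma (\<nu> + 1))"
proof -
 have "bes_ser \<nu> (0::'a) = (\<Sum>k\<in>{0}. of_real (bes_coeff \<nu> k) * 0 ^ k)"
  unfolding bes_ser_def by (rule suminf_finite) auto
 then show ?thesis by (simp add: bes_coeff_def)
qed

definition free_const :: "real \<Rightarrow> real" where
 "free_const \<nu> = sqrt (pi / 2) / 2 powr \<nu>"

lemma free_const_pos: "free_const \<nu> > 0" by (simp add: free_const_def)

text \<open>The coefficient of x^(\<nu>+1/2) in the free solution at x = 0. It does not depend on z,
  which makes all the solutions comparable near 0.\<close>

definition lead_const :: "real \<Rightarrow> real" where
 "lead_const \<nu> = free_const \<nu> / Gamma (\<nu> + 1)"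

lemma lead_const_pos: "\<nu> > 0 \<Longrightarrow> lead_const \<nu> > 0"
 by (simp add: lead_const_def free_const_pos)

lemma xi_free_eq:
 assumes "x > 0"
 shows "xi_free \<nu> z x = of_real (free_const \<nu> * x powr (\<nu> + 1/2)) * bes_ser \<nu> (z * of_real (x\<^sup>2))"
proof -
 have 1: "sqrt (pi * x / 2) * (x / 2) powr \<nu> = free_const \<nu> * x powr (\<nu> + 1/2)"
  using assms by (simp add: free_const_def powr_divide powr_add powr_half_sqrt real_sqrt_mult real_sqrt_divide)
 have "(-1) ^ k / of_real (fact k * Gamma (\<nu> + real k + 1)) * of_real ((x / 2) ^ (2 * k)) * z ^ k
   = of_real (bes_coeff \<nu> k) * (z * of_real (x\<^sup>2)) ^ k" for k

 proof -
  have "(x / 2) ^ (2 * k) = (x\<^sup>2) ^ k / 4 ^ k" by (simp add: power_mult power_divide)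
  then show ?thesis by (simp only: bes_coeff_def) (simp add: power_mult_distrib mult_ac)
 qed
 then show ?thesis unfolding xi_free_series[OF assms] bes_ser_def 1 by simp
qed

definition xi_free' :: "real \<Rightarrow> complex \<Rightarrow> real \<Rightarrow> complex" where
 "xi_free' \<nu> z x = of_real (free_const \<nu>) * (of_real ((\<nu> + 1/2) * x powr (\<nu> - 1/2)) * bes_ser \<nu> (z * of_real (x\<^sup>2))
   + of_real (x powr (\<nu> + 1/2)) * (bes_ser' \<nu> (z * of_real (x\<^sup>2)) * (2 * z * of_real x)))"

lemma xi_free_deriv:
 assumes "x > 0" "\<nu> > 0"
 shows "(xi_free \<nu> z has_vector_derivative xi_free' \<nu> z x) (at x)"
proof -
 have 1: "((\<lambda>x. complex_of_real (free_const \<nu> * x powr (\<nu> + 1/2))) has_vector_derivative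
   of_real (free_const \<nu> * ((\<nu> + 1/2) * x powr (\<nu> - 1/2)))) (at x)"
  using assms by (intro has_vector_derivative_of_real) (auto intro!: derivative_eq_intros simp: field_simps)
 have 2: "((\<lambda>x. bes_ser \<nu> (z * of_real (x\<^sup>2))) has_vector_derivative ((2 * z * of_real x) * bes_ser' \<nu> (z * of_real (x\<^sup>2)))) (at x)"
 proof -
  have "((\<lambda>x. z * of_real (x\<^sup>2)) has_vector_derivative z * of_real (2 * x)) (at x)"
   by (intro has_vector_derivative_mult_right has_vector_derivative_of_real) (auto intro!: derivative_eq_intros)
  from field_vector_diff_chain_at[OF this bes_ser_DERIV[OF assms(2)]] show ?thesis
   by (simp add: o_def algebra_simps)
 qed
 have "((\<lambda>x. of_real (free_const \<nu> * x powr (\<nu> + 1/2)) * bes_ser \<nu> (z * of_real (x\<^sup>2))) has_vector_derivative xi_free' \<nu> z x) (at x)"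
  using has_vector_derivative_mult[OF 1 2] by (simp add: xi_free'_def algebra_simps)
 then show ?thesis
  by (rule has_vector_derivative_transform_within_open[of _ _ _ "{0<..}"]) (use assms in \<open>auto simp: xi_free_eq\<close>)
qed

text \<open>The series depends on z and x only through z x^2 and is Lipschitz on a disc, so it
  deviates from its value at 0 by a multiple of x^2, uniformly for bounded z.\<close>

lemma xi_free_near_zero:
 assumes "\<nu> > 0" "b > 0" "R > 0"
 obtains C where "C > 0" "\<And>z x. norm z \<le> R \<Longrightarrow> 0 < x \<Longrightarrow> x \<le> b \<Longrightarrow>
   norm (xi_free \<nu> z x - of_real (lead_const \<nu> * x powr (\<nu> + 1/2))) \<le> C * x\<^sup>2 * x powr (\<nu> + 1/2) \<and>
   norm (xi_free' \<nu> z x - of_real ((\<nu> + 1/2) * lead_const \<nu> * x powr (\<nu> - 1/2))) \<le> C * x\<^sup>2 * x powr (\<nu> - 1/2)"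
proof -
 \<comment> \<open>Radius of a disc that contains every argument z x^2 under consideration.\<close>
 define T where "T = R * b\<^sup>2"
 have T: "T > 0" using assms by (simp add: T_def)
 have "continuous_on (cball 0 T) (bes_ser' \<nu> :: complex \<Rightarrow> _)"
  using bes_ser'_DERIV[OF assms(1)] by (meson DERIV_isCont continuous_at_imp_continuous_on)
 then have "bounded (bes_ser' \<nu> ` cball (0::complex) T)"
  by (intro compact_imp_bounded compact_continuous_image) auto
 then obtain L where L: "L > 0" "\<And>s. norm s \<le> T \<Longrightarrow> norm (bes_ser' \<nu> (s::complex)) \<le> L"
  unfolding bounded_pos by auto
 have P: "norm (bes_ser \<nu> s - of_real (1 / Gamma (\<nu> + 1))) \<le> L * norm s" if "norm s \<le> T" for s :: complex
 proof -
  have "norm (bes_ser \<nu> s - bes_ser \<nu> 0) \<le> L * norm (s - 0)"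
   by (rule field_differentiable_bound[of "cball 0 T"])
     (use L T that bes_ser_DERIV[OF assms(1)] in \<open>auto intro: has_field_derivative_at_within\<close>)
  then show ?thesis by (simp add: bes_ser_0)
 qed
 define k where "k = free_const \<nu>"
 have k: "k > 0" by (simp add: k_def free_const_pos)
 define C where "C = k * (L * R * (\<nu> + 1/2) + 2 * L * R)"
 have C: "C > 0" "k * (L * R) \<le> C" using k L assms by (auto simp: C_def intro!: mult_pos_pos add_pos_pos mult_left_mono)
 show thesis
 proof (rule that[OF C(1)])
  fix z x assume z: "norm (z::complex) \<le> R" and x: "0 < x" "x \<le> b"
  define s where "s = z * of_real (x\<^sup>2)"
  have ns: "norm s \<le> R * x\<^sup>2" using z by (auto simp: s_def norm_mult norm_power intro!: mult_right_mono)
  moreover have "R * x\<^sup>2 \<le> T" unfolding T_def using x assms by (intro mult_left_mono power_mono) auto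
  ultimately have sT: "norm s \<le> T" by simp
  have P1: "norm (bes_ser \<nu> s - of_real (1 / Gamma (\<nu> + 1))) \<le> L * (R * x\<^sup>2)"
   using P[OF sT] ns L by (meson mult_left_mono order_trans less_imp_le)
  have "xi_free \<nu> z x - of_real (lead_const \<nu> * x powr (\<nu> + 1/2)) = of_real (k * x powr (\<nu> + 1/2)) * (bes_ser \<nu> s - of_real (1 / Gamma (\<nu> + 1)))"
   using x by (simp add: xi_free_eq lead_const_def k_def s_def algebra_simps)
  then have "norm (xi_free \<nu> z x - of_real (lead_const \<nu> * x powr (\<nu> + 1/2))) = k * x powr (\<nu> + 1/2) * norm (bes_ser \<nu> s - of_real (1 / Gamma (\<nu> + 1)))"
   using k by (simp add: norm_mult)
  also have "\<dots> \<le> k * x powr (\<nu> + 1/2) * (L * (R * x\<^sup>2))"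
   using k P1 by (intro mult_left_mono) auto
  also have "\<dots> = k * (L * R) * (x\<^sup>2 * x powr (\<nu> + 1/2))" by simp
  also have "\<dots> \<le> C * (x\<^sup>2 * x powr (\<nu> + 1/2))" using C by (intro mult_right_mono) auto
  finally have A: "norm (xi_free \<nu> z x - of_real (lead_const \<nu> * x powr (\<nu> + 1/2))) \<le> C * x\<^sup>2 * x powr (\<nu> + 1/2)" by (simp add: mult.assoc)
  have xp: "x powr (\<nu> + 1/2) * x = x\<^sup>2 * x powr (\<nu> - 1/2)"
  proof -
   have "\<nu> + 1/2 = 1 + (\<nu> - 1/2)" by simp
   then have "x powr (\<nu> + 1/2) = x * x powr (\<nu> - 1/2)" using x by (simp only: powr_add) simp
   then show ?thesis by (simp add: power2_eq_square)
  qed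
  have "xi_free' \<nu> z x - of_real ((\<nu> + 1/2) * lead_const \<nu> * x powr (\<nu> - 1/2)) =
    of_real (k * (\<nu> + 1/2) * x powr (\<nu> - 1/2)) * (bes_ser \<nu> s - of_real (1 / Gamma (\<nu> + 1)))
    + of_real (k * 2 * (x powr (\<nu> + 1/2) * x)) * (bes_ser' \<nu> s * z)"
  proof -
   define g where "g = 1 / Gamma (\<nu> + 1)"
   have "lead_const \<nu> = k * g" by (simp add: lead_const_def k_def g_def)
   then show ?thesis unfolding g_def[symmetric] xi_free'_def k_def[symmetric] s_def[symmetric]
    by (simp add: field_simps)
  qed
  also have "norm \<dots> \<le> k * (\<nu> + 1/2) * x powr (\<nu> - 1/2) * norm (bes_ser \<nu> s - of_real (1 / Gamma (\<nu> + 1)))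
    + (k * 2 * (x powr (\<nu> + 1/2) * x)) * (norm (bes_ser' \<nu> s) * norm z)"
   by (rule order_trans[OF norm_triangle_ineq]) (use k x assms in \<open>simp only: norm_mult norm_of_real, simp add: abs_mult\<close>)
  also have "\<dots> \<le> k * (\<nu> + 1/2) * x powr (\<nu> - 1/2) * (L * (R * x\<^sup>2)) + (k * 2 * (x powr (\<nu> + 1/2) * x)) * (L * R)"
   using k P1 L(2)[OF sT] z L(1) x assms by (intro add_mono mult_left_mono mult_mono) auto
  also have "\<dots> = C * x\<^sup>2 * x powr (\<nu> - 1/2)" unfolding xp C_def by (simp add: algebra_simps)
  finally show "norm (xi_free \<nu> z x - of_real (lead_const \<nu> * x powr (\<nu> + 1/2))) \<le> C * x\<^sup>2 * x powr (\<nu> + 1/2) \<and>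
   norm (xi_free' \<nu> z x - of_real ((\<nu> + 1/2) * lead_const \<nu> * x powr (\<nu> - 1/2))) \<le> C * x\<^sup>2 * x powr (\<nu> - 1/2)"
   using A by simp
 qed
qed

section \<open>The free solution at spectral parameter 1 and its scaling\<close>

text \<open>The free solution for z = 1, that is sqrt(pi t / 2) J_\<nu>(t). By scaling it describes
  the free solution at every positive z.\<close>

definition f0 :: "real \<Rightarrow> real \<Rightarrow> real" where
 "f0 \<nu> t = free_const \<nu> * t powr (\<nu> + 1/2) * bes_ser \<nu> (t\<^sup>2)"

definition f0' :: "real \<Rightarrow> real \<Rightarrow> real" where
 "f0' \<nu> t = free_const \<nu> * ((\<nu> + 1/2) * t powr (\<nu> - 1/2) * bes_ser \<nu> (t\<^sup>2) + t powr (\<nu> + 1/2) * (bes_ser' \<nu> (t\<^sup>2) * (2 * t)))"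

lemma f0_deriv:
 assumes "\<nu> > 0" "t > 0"
 shows "(f0 \<nu> has_real_derivative f0' \<nu> t) (at t)"
 unfolding f0_def[abs_def] f0'_def
 by (rule derivative_eq_intros DERIV_chain2[OF bes_ser_DERIV] assms refl)+ (use assms in \<open>auto simp: field_simps\<close>)

lemma f0'_deriv:
 assumes "\<nu> > 0" "t > 0"
 shows "(f0' \<nu> has_real_derivative ((\<nu>\<^sup>2 - 1/4) / t\<^sup>2 - 1) * f0 \<nu> t) (at t)"
proof -
 have p1: "t powr (\<nu> - 1/2) = t * t powr (\<nu> - 3/2)" and p2: "t powr (\<nu> + 1/2) = t\<^sup>2 * t powr (\<nu> - 3/2)"
 proof -
  have e: "\<nu> - 1/2 = 1 + (\<nu> - 3/2)" "\<nu> + 1/2 = 2 + (\<nu> - 3/2)" by simp_all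
  show "t powr (\<nu> - 1/2) = t * t powr (\<nu> - 3/2)" "t powr (\<nu> + 1/2) = t\<^sup>2 * t powr (\<nu> - 3/2)"
   using assms by (simp_all only: e powr_add) (simp_all add: powr_numeral)
 qed
 define B0 B1 B2 X where "B0 = bes_ser \<nu> (t\<^sup>2)" and "B1 = bes_ser' \<nu> (t\<^sup>2)" and "B2 = bes_ser'' \<nu> (t\<^sup>2)" and "X = t powr (\<nu> - 3/2)"
 have ode: "t\<^sup>2 * B2 = - (\<nu> + 1) * B1 - B0 / 4"
  using bes_ser_ode[OF assms(1), of "t\<^sup>2"] by (simp add: B0_def B1_def B2_def algebra_simps)
 have "(f0' \<nu> has_real_derivative free_const \<nu> * ((\<nu> + 1/2) * ((\<nu> - 1/2) * X * B0 + t powr (\<nu> - 1/2) * (B1 * (2 * t)))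
   + ((\<nu> + 1/2) * t powr (\<nu> - 1/2) * (B1 * (2 * t)) + t powr (\<nu> + 1/2) * (B2 * (2 * t) * (2 * t) + B1 * 2)))) (at t)"
  unfolding f0'_def[abs_def] B0_def B1_def B2_def X_def
  by (rule derivative_eq_intros DERIV_chain2[OF bes_ser_DERIV] DERIV_chain2[OF bes_ser'_DERIV] assms refl)+
    (use assms in \<open>auto simp: field_simps\<close>)
 moreover have "free_const \<nu> * ((\<nu> + 1/2) * ((\<nu> - 1/2) * X * B0 + t powr (\<nu> - 1/2) * (B1 * (2 * t)))
   + ((\<nu> + 1/2) * t powr (\<nu> - 1/2) * (B1 * (2 * t)) + t powr (\<nu> + 1/2) * (B2 * (2 * t) * (2 * t) + B1 * 2)))
   = ((\<nu>\<^sup>2 - 1/4) / t\<^sup>2 - 1) * f0 \<nu> t"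
 proof -
  have "(\<nu> + 1/2) * ((\<nu> - 1/2) * X * B0 + t powr (\<nu> - 1/2) * (B1 * (2 * t)))
   + ((\<nu> + 1/2) * t powr (\<nu> - 1/2) * (B1 * (2 * t)) + t powr (\<nu> + 1/2) * (B2 * (2 * t) * (2 * t) + B1 * 2))
   = X * ((\<nu>\<^sup>2 - 1/4) * B0 + 4 * (\<nu> + 1) * t\<^sup>2 * B1 + 4 * t\<^sup>2 * (t\<^sup>2 * B2))"
   unfolding p1 p2 X_def[symmetric] by (simp add: algebra_simps power2_eq_square)
  also have "\<dots> = X * ((\<nu>\<^sup>2 - 1/4) * B0 - t\<^sup>2 * B0)" unfolding ode by (simp add: algebra_simps)
  also have "\<dots> = ((\<nu>\<^sup>2 - 1/4) / t\<^sup>2 - 1) * (t powr (\<nu> + 1/2) * B0)"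
   unfolding p2 X_def[symmetric] using assms by (simp add: field_simps)
  finally show ?thesis by (simp add: f0_def B0_def)
 qed
 ultimately show ?thesis by simp
qed

text \<open>In E = f0^2 + f0'^2 the oscillating terms of the derivative cancel and |E'| is at most
  \<kappa> / t^2 times E. As 1/t^2 is integrable at infinity, E stays between two positive
  constants; this replaces the asymptotic expansion of the Bessel function.\<close>

lemma f0_energy:
 assumes "\<nu> > 0"
 obtains t0 e0 C where "t0 > 0" "e0 > 0" "C > 0"
  "\<And>t. t \<ge> t0 \<Longrightarrow> e0 \<le> (f0 \<nu> t)\<^sup>2 + (f0' \<nu> t)\<^sup>2"
  "\<And>t. t > 0 \<Longrightarrow> \<bar>f0 \<nu> t\<bar> \<le> C" "\<And>t. t \<ge> t0 \<Longrightarrow> \<bar>f0' \<nu> t\<bar> \<le> C"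
proof -
 have cont: "isCont (bes_ser \<nu>) (s::real)" for s
  using bes_ser_DERIV[OF assms] DERIV_isCont by blast
 have "bes_ser \<nu> (0::real) > 0" using assms by (simp add: bes_ser_0)
 then obtain d where d: "d > 0" "\<And>s. \<bar>s\<bar> < d \<Longrightarrow> bes_ser \<nu> (s::real) > 0"
  using order_tendstoD(1)[OF cont[of 0, unfolded isCont_def], of 0] unfolding eventually_at
  by (metis dist_real_def diff_zero UNIV_I)
 \<comment> \<open>On the interval up to t0 squared the series is still positive, hence f0 and the
   energy are positive at t0.\<close>
 define t0 where "t0 = sqrt (d / 2)"
 have t0: "t0 > 0" "t0\<^sup>2 < d" using d by (auto simp: t0_def)
 have f0t0: "f0 \<nu> t0 > 0" using d(2)[of "t0\<^sup>2"] t0 by (simp add: f0_def free_const_pos)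
 define \<kappa> where "\<kappa> = \<bar>\<nu>\<^sup>2 - 1/4\<bar>"
 define E where "E t = (f0 \<nu> t)\<^sup>2 + (f0' \<nu> t)\<^sup>2" for t
 define E' where "E' t = 2 * (f0 \<nu> t * f0' \<nu> t) * ((\<nu>\<^sup>2 - 1/4) / t\<^sup>2)" for t
 have dE: "(E has_real_derivative E' t) (at t)" if "t > 0" for t
  unfolding E_def[abs_def] E'_def
  by (rule derivative_eq_intros f0_deriv f0'_deriv assms that refl)+ (simp add: algebra_simps)
 have bE: "\<bar>E' t\<bar> \<le> \<kappa> / t\<^sup>2 * E t" if "t > 0" for t
 proof -
  have "2 * (\<bar>f0 \<nu> t\<bar> * \<bar>f0' \<nu> t\<bar>) \<le> E t" unfolding E_def
   using sum_squares_bound[of "\<bar>f0 \<nu> t\<bar>" "\<bar>f0' \<nu> t\<bar>"] by simp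
  then have "2 * (\<bar>f0 \<nu> t\<bar> * \<bar>f0' \<nu> t\<bar>) * (\<kappa> / t\<^sup>2) \<le> E t * (\<kappa> / t\<^sup>2)"
   by (intro mult_right_mono) (auto simp: \<kappa>_def)
  then show ?thesis by (simp add: E'_def abs_mult \<kappa>_def mult.commute)
 qed
 \<comment> \<open>Here \<kappa> / t is an antiderivative of -\<kappa> / t^2, so the weights
   exp(\<kappa> / t) and exp(-\<kappa> / t) turn the differential inequality into two monotonicity
   statements.\<close>
 have up: "E t * exp (\<kappa> / t) \<le> E t0 * exp (\<kappa> / t0)" and lo: "E t0 * exp (- \<kappa> / t0) \<le> E t * exp (- \<kappa> / t)" if "t \<ge> t0" for t
 proof -
  show "E t * exp (\<kappa> / t) \<le> E t0 * exp (\<kappa> / t0)"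
  proof (rule DERIV_nonpos_imp_nonincreasing[OF that])
   fix s assume "t0 \<le> s" "s \<le> t"
   then have s: "s > 0" using t0 by simp
   have "((\<lambda>a. E a * exp (\<kappa> / a)) has_real_derivative (E' s - \<kappa> / s\<^sup>2 * E s) * exp (\<kappa> / s)) (at s)"
   proof -
    have "((\<lambda>a. exp (\<kappa> / a)) has_real_derivative exp (\<kappa> / s) * (- \<kappa> / s\<^sup>2)) (at s)"
     using s by (auto intro!: derivative_eq_intros simp: power2_eq_square)
    from DERIV_mult[OF dE[OF s] this] show ?thesis by (simp add: algebra_simps)
   qed
   moreover have "(E' s - \<kappa> / s\<^sup>2 * E s) * exp (\<kappa> / s) \<le> 0" using bE[OF s] by (intro mult_nonpos_nonneg) auto
   ultimately show "\<exists>y. ((\<lambda>a. E a * exp (\<kappa> / a)) has_real_derivative y) (at s) \<and> y \<le> 0" by blast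
  qed
  show "E t0 * exp (- \<kappa> / t0) \<le> E t * exp (- \<kappa> / t)"
  proof (rule DERIV_nonneg_imp_nondecreasing[OF that])
   fix s assume "t0 \<le> s" "s \<le> t"
   then have s: "s > 0" using t0 by simp
   have "((\<lambda>a. E a * exp (- \<kappa> / a)) has_real_derivative (E' s + \<kappa> / s\<^sup>2 * E s) * exp (- \<kappa> / s)) (at s)"
   proof -
    have "((\<lambda>a. exp (- \<kappa> / a)) has_real_derivative exp (- \<kappa> / s) * (\<kappa> / s\<^sup>2)) (at s)"
     using s by (auto intro!: derivative_eq_intros simp: power2_eq_square)
    from DERIV_mult[OF dE[OF s] this] show ?thesis by (simp add: algebra_simps)
   qed
   moreover have "(E' s + \<kappa> / s\<^sup>2 * E s) * exp (- \<kappa> / s) \<ge> 0" using bE[OF s] by (intro mult_nonneg_nonneg) auto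
   ultimately show "\<exists>y. ((\<lambda>a. E a * exp (- \<kappa> / a)) has_real_derivative y) (at s) \<and> y \<ge> 0" by blast
  qed
 qed
 have Epos: "E t \<ge> 0" for t by (simp add: E_def)
 have kp: "\<kappa> \<ge> 0" by (simp add: \<kappa>_def)
 define U where "U = E t0 * exp (\<kappa> / t0)"
 define e0 where "e0 = E t0 * exp (- \<kappa> / t0)"
 have E0: "E t0 > 0" using f0t0 by (simp add: E_def add_pos_nonneg)
 have e0: "e0 > 0" using E0 by (simp add: e0_def)
 have U: "E t \<le> U" if "t \<ge> t0" for t
 proof -
  have "E t * 1 \<le> E t * exp (\<kappa> / t)" using Epos[of t] that t0 kp by (intro mult_left_mono) auto
  then show ?thesis using up[OF that] by (simp add: U_def)
 qed
 have lo': "e0 \<le> E t" if "t \<ge> t0" for t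
 proof -
  have "E t * exp (- \<kappa> / t) \<le> E t * 1" using Epos[of t] that t0 kp by (intro mult_left_mono) auto
  then show ?thesis using lo[OF that] by (simp add: e0_def)
 qed
 have "continuous_on {0..t0\<^sup>2} (bes_ser \<nu> :: real \<Rightarrow> real)" using cont by (simp add: continuous_at_imp_continuous_on)
 then have "bounded (bes_ser \<nu> ` {0..t0\<^sup>2} :: real set)" by (intro compact_imp_bounded compact_continuous_image) auto
 then obtain L where L: "L > 0" "\<And>s. 0 \<le> s \<Longrightarrow> s \<le> t0\<^sup>2 \<Longrightarrow> \<bar>bes_ser \<nu> (s::real)\<bar> \<le> L"
  unfolding bounded_pos by auto
 define C where "C = free_const \<nu> * t0 powr (\<nu> + 1/2) * L + sqrt U"
 have Up: "U > 0" using E0 by (simp add: U_def)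
 have C: "C > 0" unfolding C_def using L free_const_pos[of \<nu>] Up t0 by (intro add_nonneg_pos) auto
 have C2: "sqrt U \<le> C" unfolding C_def using L free_const_pos[of \<nu>] by (simp add: less_imp_le)
 have b1: "\<bar>f0 \<nu> t\<bar> \<le> C" if "t > 0" for t
 proof (cases "t \<ge> t0")
  case True
  have "(f0 \<nu> t)\<^sup>2 \<le> U" using U[OF True] by (simp add: E_def) (smt (verit) zero_le_power2)
  then show ?thesis using C2 real_sqrt_le_mono by fastforce
 next
  case False
  have "\<bar>f0 \<nu> t\<bar> = free_const \<nu> * t powr (\<nu> + 1/2) * \<bar>bes_ser \<nu> (t\<^sup>2)\<bar>"
   using free_const_pos[of \<nu>] by (simp add: f0_def abs_mult)
  also have "\<dots> \<le> free_const \<nu> * t0 powr (\<nu> + 1/2) * L"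
   using free_const_pos[of \<nu>] False that assms L(1)
   by (intro mult_mono powr_mono2 L(2) power_mono) auto
  also have "\<dots> \<le> C" unfolding C_def using Up by simp
  finally show ?thesis .
 qed
 have b2: "\<bar>f0' \<nu> t\<bar> \<le> C" if "t \<ge> t0" for t
 proof -
  have "(f0' \<nu> t)\<^sup>2 \<le> U" using U[OF that] by (simp add: E_def) (smt (verit) zero_le_power2)
  then show ?thesis using C2 real_sqrt_le_mono by fastforce
 qed
 show thesis using that[OF t0(1) e0 C _ b1 b2] lo' unfolding E_def by blast
qed

text \<open>The series sees only l x^2 = (sqrt l x)^2, so passing from spectral parameter l to 1
  rescales x by sqrt l and multiplies by the power of l that x^(\<nu>+1/2) produces. The derivative
  gains one more factor sqrt l.\<close>

lemma xi_free_scale: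
 assumes "\<nu> > 0" "l > 0" "x > 0"
 shows "xi_free \<nu> (of_real l) x = of_real (l powr (- (\<nu> + 1/2) / 2) * f0 \<nu> (sqrt l * x))"
  and "xi_free' \<nu> (of_real l) x = of_real (l powr (- (\<nu> + 1/2) / 2) * sqrt l * f0' \<nu> (sqrt l * x))"
proof -
 define L where "L = l powr ((\<nu> + 1/2) / 2)"
 have "- (\<nu> + 1/2) / 2 = - ((\<nu> + 1/2) / 2)" by (simp add: field_simps)
 then have L: "L > 0" "l powr (- (\<nu> + 1/2) / 2) = 1 / L" using assms by (simp_all only: L_def powr_minus_divide) simp
 have p: "(sqrt l * x) powr (\<nu> + 1/2) = L * x powr (\<nu> + 1/2)"
  using assms by (simp add: powr_mult L_def powr_half_sqrt[symmetric] powr_powr)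
 have p2: "sqrt l * (sqrt l * x) powr (\<nu> - 1/2) = L * x powr (\<nu> - 1/2)"
 proof -
  have "sqrt l * (sqrt l * x) powr (\<nu> - 1/2) = (l powr (1/2) * l powr ((\<nu> - 1/2) / 2)) * x powr (\<nu> - 1/2)"
   using assms by (simp add: powr_mult powr_half_sqrt[symmetric] powr_powr)
  also have "l powr (1/2) * l powr ((\<nu> - 1/2) / 2) = L" by (simp add: L_def powr_add[symmetric] field_simps)
  finally show ?thesis .
 qed
 have s: "(sqrt l * x)\<^sup>2 = l * x\<^sup>2" using assms by (simp add: power_mult_distrib)
 have B: "bes_ser \<nu> (of_real l * of_real (x\<^sup>2)) = (of_real (bes_ser \<nu> (l * x\<^sup>2)) :: complex)"
  using bes_ser_of_real[OF assms(1), of "l * x\<^sup>2", where 'a=complex] by simp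
 show 1: "xi_free \<nu> (of_real l) x = of_real (l powr (- (\<nu> + 1/2) / 2) * f0 \<nu> (sqrt l * x))"
  unfolding f0_def p s xi_free_eq[OF assms(3)] B using L by simp
 have "xi_free' \<nu> (of_real l) x = vector_derivative (xi_free \<nu> (of_real l)) (at x)"
  by (rule vector_derivative_at[symmetric]) (rule xi_free_deriv[OF assms(3,1)])
 also have "\<dots> = of_real (l powr (- (\<nu> + 1/2) / 2) * sqrt l * f0' \<nu> (sqrt l * x))"
 proof (rule vector_derivative_at)
  have "((\<lambda>x. l powr (- (\<nu> + 1/2) / 2) * f0 \<nu> (sqrt l * x)) has_real_derivative l powr (- (\<nu> + 1/2) / 2) * sqrt l * f0' \<nu> (sqrt l * x)) (at x)"
   by (rule derivative_eq_intros DERIV_chain2[OF f0_deriv] refl)+ (use assms in auto)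
  then have "((\<lambda>x. complex_of_real (l powr (- (\<nu> + 1/2) / 2) * f0 \<nu> (sqrt l * x))) has_vector_derivative of_real (l powr (- (\<nu> + 1/2) / 2) * sqrt l * f0' \<nu> (sqrt l * x))) (at x)"
   by (rule has_vector_derivative_of_real)
  then show "(xi_free \<nu> (of_real l) has_vector_derivative of_real (l powr (- (\<nu> + 1/2) / 2) * sqrt l * f0' \<nu> (sqrt l * x))) (at x)"
  proof (rule has_vector_derivative_transform_within_open[of _ _ _ "{0<..}"])
   fix y :: real assume "y \<in> {0<..}"
   then have y: "y > 0" by simp
   have p: "(sqrt l * y) powr (\<nu> + 1/2) = L * y powr (\<nu> + 1/2)"
    using assms y by (simp add: powr_mult L_def powr_half_sqrt[symmetric] powr_powr)
   have s: "(sqrt l * y)\<^sup>2 = l * y\<^sup>2" using assms by (simp add: power_mult_distrib)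
   have B: "bes_ser \<nu> (of_real l * of_real (y\<^sup>2)) = (of_real (bes_ser \<nu> (l * y\<^sup>2)) :: complex)"
    using bes_ser_of_real[OF assms(1), of "l * y\<^sup>2", where 'a=complex] by simp
   show "complex_of_real (l powr (- (\<nu> + 1/2) / 2) * f0 \<nu> (sqrt l * y)) = xi_free \<nu> (of_real l) y"
    unfolding f0_def p s xi_free_eq[OF y] B using L by simp
  qed (use assms in auto)
 qed
 finally show "xi_free' \<nu> (of_real l) x = of_real (l powr (- (\<nu> + 1/2) / 2) * sqrt l * f0' \<nu> (sqrt l * x))" .
qed

lemma powr_half_nu:
 fixes x :: real
 assumes "x > 0"
 shows "x powr (p + 1/2) = x * x powr (p - 1/2)"
proof -
 have e: "p + 1/2 = 1 + (p - 1/2)" by simp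
 have "x powr (p + 1/2) = x powr (1 + (p - 1/2))" by (simp only: e[symmetric])
 also have "\<dots> = x * x powr (p - 1/2)" using assms by (simp only: powr_add) simp
 finally show ?thesis .
qed

section \<open>The regular solution: behaviour at zero and at large spectral parameter\<close>

text \<open>The content of \<open>regular_solution\<close> with its existential witnesses made
  parameters: the derivative \<open>\<xi>'\<close>, a positive constant, and the equation solved for
  the second derivative. Of q only continuity and the integrability of x q(x) remain.\<close>

locale regular_bessel =
 fixes \<nu> b :: real and q :: "real \<Rightarrow> real" and \<xi> \<xi>' :: "complex \<Rightarrow> real \<Rightarrow> complex" and C0 :: real
 assumes nu: "\<nu> > 0" and b: "b > 0" and q_cont: "continuous_on {0<..b} q"
  and q_int: "set_integrable lborel {0<..<b} (\<lambda>u. u * \<bar>q u\<bar>)"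
  and xi_deriv: "\<And>z x. x \<in> {0<..b} \<Longrightarrow> (\<xi> z has_vector_derivative \<xi>' z x) (at x within {0<..b})"
  and xi'_deriv: "\<And>z x. x \<in> {0<..b} \<Longrightarrow>
   (\<xi>' z has_vector_derivative (of_real ((\<nu>\<^sup>2 - 1/4) / x\<^sup>2 + q x) - z) * \<xi> z x) (at x within {0<..b})"
  and C0: "C0 > 0"
  and xi_est: "\<And>z x. x \<in> {0<..b} \<Longrightarrow> norm (\<xi> z x - xi_free \<nu> z x) \<le>
      C0 * (x / (1 + norm (csqrt z) * x)) powr (\<nu> + 1/2) * exp (\<bar>Im (csqrt z)\<bar> * x) *
      (LINT u:{0<..<x}|lborel. u * \<bar>q u\<bar> / (1 + norm (csqrt z) * u))"
  and xi'_est: "\<And>z x. x \<in> {0<..b} \<Longrightarrow> norm (\<xi>' z x - xi_free' \<nu> z x) \<le>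
      C0 * (x / (1 + norm (csqrt z) * x)) powr (\<nu> - 1/2) * exp (\<bar>Im (csqrt z)\<bar> * x) *
      (LINT u:{0<..<x}|lborel. u * \<bar>q u\<bar> / (1 + norm (csqrt z) * u))"
begin

definition V :: "real \<Rightarrow> real" where "V x = (\<nu>\<^sup>2 - 1/4) / x\<^sup>2 + q x"

lemma V_cont: "continuous_on {0<..b} V"
 unfolding V_def[abs_def] by (intro continuous_intros q_cont) auto

text \<open>The integral on the right of both estimates, with s for the modulus of the square root
  of z. It decreases in s and increases in x.\<close>

definition qI :: "real \<Rightarrow> real \<Rightarrow> real" where
 "qI s x = (LINT u:{0<..<x}|lborel. u * \<bar>q u\<bar> / (1 + s * u))"

lemma q_int_div:
 assumes "s \<ge> 0" "x \<le> b"
 shows "set_integrable lborel {0<..<x} (\<lambda>u. u * \<bar>q u\<bar> / (1 + s * u))"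
proof -
 have q0: "set_integrable lborel {0<..<x} (\<lambda>u. u * \<bar>q u\<bar>)"
  by (rule set_integrable_subset[OF q_int]) (use assms in auto)
 show ?thesis unfolding set_integrable_def
 proof (rule Bochner_Integration.integrable_bound[OF q0[unfolded set_integrable_def]])
  have "(\<lambda>u. (indicator {0<..<x} u *\<^sub>R (u * \<bar>q u\<bar>)) / (1 + s * u)) \<in> borel_measurable lborel"
   using borel_measurable_integrable[OF q0[unfolded set_integrable_def]]
   by (intro borel_measurable_divide) auto
  then show "(\<lambda>u. indicator {0<..<x} u *\<^sub>R (u * \<bar>q u\<bar> / (1 + s * u))) \<in> borel_measurable lborel" by simp
  show "AE u in lborel. norm (indicator {0<..<x} u *\<^sub>R (u * \<bar>q u\<bar> / (1 + s * u))) \<le> norm (indicator {0<..<x} u *\<^sub>R (u * \<bar>q u\<bar>))"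
  proof (rule AE_I2)
   fix u
   have "u * \<bar>q u\<bar> / (1 + s * u) \<le> u * \<bar>q u\<bar>" if "0 < u"
   proof -
    have "1 \<le> 1 + s * u" using that assms by simp
    moreover from this have "0 < 1 * (1 + s * u)" by simp
    ultimately have "u * \<bar>q u\<bar> / (1 + s * u) \<le> u * \<bar>q u\<bar> / 1" using that by (intro divide_left_mono) auto
    then show ?thesis by simp
   qed
   moreover have "u * \<bar>q u\<bar> / (1 + s * u) \<ge> 0" if "0 < u" using that assms by simp
   ultimately show "norm (indicator {0<..<x} u *\<^sub>R (u * \<bar>q u\<bar> / (1 + s * u))) \<le> norm (indicator {0<..<x} u *\<^sub>R (u * \<bar>q u\<bar>))"
    by (auto simp: indicator_def simp del: abs_divide abs_mult)
  qed
 qed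
qed

lemma qI_nonneg: "s \<ge> 0 \<Longrightarrow> qI s x \<ge> 0"
 unfolding qI_def set_lebesgue_integral_def by (rule Bochner_Integration.integral_nonneg) (auto simp: indicator_def)

lemma qI_mono:
 assumes "0 \<le> t" "t \<le> s" "x \<le> y" "y \<le> b"
 shows "qI s x \<le> qI t y"
 unfolding qI_def set_lebesgue_integral_def
proof (rule integral_mono)
 show "integrable lborel (\<lambda>u. indicat_real {0<..<x} u *\<^sub>R (u * \<bar>q u\<bar> / (1 + s * u)))"
  using q_int_div[of s x] assms by (simp add: set_integrable_def)
 show "integrable lborel (\<lambda>u. indicat_real {0<..<y} u *\<^sub>R (u * \<bar>q u\<bar> / (1 + t * u)))"
  using q_int_div[of t y] assms by (simp add: set_integrable_def)
 fix u
 have "u * \<bar>q u\<bar> / (1 + s * u) \<le> u * \<bar>q u\<bar> / (1 + t * u)" if "0 < u"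
  using that assms by (intro divide_left_mono) (auto intro!: mult_pos_pos add_pos_nonneg)
 moreover have "u * \<bar>q u\<bar> / (1 + t * u) \<ge> 0" if "0 < u" using that assms by simp
 ultimately show "indicat_real {0<..<x} u *\<^sub>R (u * \<bar>q u\<bar> / (1 + s * u)) \<le> indicat_real {0<..<y} u *\<^sub>R (u * \<bar>q u\<bar> / (1 + t * u))"
  using assms by (auto simp: indicator_def)
qed

lemma qI_tendsto_0: "((\<lambda>x. qI 0 x) \<longlongrightarrow> 0) (at_right 0)"
proof -
 let ?f = "\<lambda>u. u * \<bar>q u\<bar>"
 have hk: "?f integrable_on {0..b}"
  using set_borel_integral_eq_integral(1)[OF q_int] integrable_on_open_interval_real by blast
 have "qI 0 x = integral {0..x} ?f" if "x \<in> {0..b}" for x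
 proof -
  have "set_integrable lborel {0<..<x} ?f"
   by (rule set_integrable_subset[OF q_int]) (use that in auto)
  then show ?thesis unfolding qI_def using set_borel_integral_eq_integral(2)[of "{0<..<x}" ?f]
   by (simp add: integral_open_interval_real)
 qed
 moreover have "continuous_on {0..b} (\<lambda>x. integral {0..x} ?f)"
  by (rule indefinite_integral_continuous_1[OF hk])
 ultimately have "continuous_on {0..b} (qI 0)" by (subst continuous_on_cong[OF refl, of _ _ "\<lambda>x. integral {0..x} ?f"]) auto
 then have "(qI 0 \<longlongrightarrow> qI 0 0) (at 0 within {0..b})" using b by (simp add: continuous_on)
 then have "(qI 0 \<longlongrightarrow> qI 0 0) (at_right 0)"
  using b by (simp add: at_within_Icc_at_right)
 moreover have "qI 0 0 = 0" by (simp add: qI_def set_lebesgue_integral_def)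
 ultimately show ?thesis by simp
qed

text \<open>The integrand tends to 0 pointwise and is dominated by u |q u|; this is why the
  perturbation by q is negligible at high energy. The \<open>max 0 s\<close> keeps the denominators
  at least 1 for all s.\<close>

lemma qI_at_top: "((\<lambda>s. qI s b) \<longlongrightarrow> 0) at_top"
proof -
 have "((\<lambda>s. \<integral>u. indicator {0<..<b} u *\<^sub>R (u * \<bar>q u\<bar> / (1 + max 0 s * u)) \<partial>lborel) \<longlongrightarrow> (\<integral>u. 0 \<partial>(lborel :: real measure))) at_top"
 proof (rule Bochner_Integration.integral_dominated_convergence_at_top[where w="\<lambda>u. indicator {0<..<b} u *\<^sub>R (u * \<bar>q u\<bar>)" and f="\<lambda>u. 0" and M=lborel
    and s="\<lambda>s u. indicator {0<..<b} u *\<^sub>R (u * \<bar>q u\<bar> / (1 + max 0 s * u))"])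
  show "integrable lborel (\<lambda>u. indicator {0<..<b} u *\<^sub>R (u * \<bar>q u\<bar>))" using q_int by (simp add: set_integrable_def)
  show "\<forall>\<^sub>F s in at_top. AE u in lborel. norm (indicator {0<..<b} u *\<^sub>R (u * \<bar>q u\<bar> / (1 + max 0 s * u))) \<le> indicator {0<..<b} u *\<^sub>R (u * \<bar>q u\<bar>)"
  proof (intro always_eventually allI AE_I2)
   fix s u :: real
   have "u * \<bar>q u\<bar> / (1 + max 0 s * u) \<le> u * \<bar>q u\<bar>" if "0 < u"
   proof -
    have "1 \<le> 1 + max 0 s * u" using that by simp
    moreover from this have "0 < 1 * (1 + max 0 s * u)" by simp
    ultimately have "u * \<bar>q u\<bar> / (1 + max 0 s * u) \<le> u * \<bar>q u\<bar> / 1" using that by (intro divide_left_mono) auto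
    then show ?thesis by simp
   qed
   moreover have "u * \<bar>q u\<bar> / (1 + max 0 s * u) \<ge> 0" if "0 < u" using that by simp
   ultimately show "norm (indicator {0<..<b} u *\<^sub>R (u * \<bar>q u\<bar> / (1 + max 0 s * u))) \<le> indicator {0<..<b} u *\<^sub>R (u * \<bar>q u\<bar>)"
    by (auto simp: indicator_def simp del: abs_divide abs_mult)
  qed
  show "AE u in lborel. ((\<lambda>s. indicator {0<..<b} u *\<^sub>R (u * \<bar>q u\<bar> / (1 + max 0 s * u))) \<longlongrightarrow> 0) at_top"
  proof (rule AE_I2)
   fix u
   show "((\<lambda>s. indicator {0<..<b} u *\<^sub>R (u * \<bar>q u\<bar> / (1 + max 0 s * u))) \<longlongrightarrow> 0) at_top"
   proof (cases "u \<in> {0<..<b}")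
    case True
    have "filterlim (\<lambda>s. 1 + s * u) at_top at_top"
     using True by (intro filterlim_tendsto_add_at_top[OF tendsto_const]
       filterlim_at_top_mult_tendsto_pos[OF tendsto_const _ filterlim_ident, of u]) auto
    then have "((\<lambda>s. u * \<bar>q u\<bar> / (1 + s * u)) \<longlongrightarrow> 0) at_top"
     by (intro tendsto_divide_0[OF tendsto_const] filterlim_at_top_imp_at_infinity)
    moreover have "\<forall>\<^sub>F s in at_top. u * \<bar>q u\<bar> / (1 + s * u) = indicator {0<..<b} u *\<^sub>R (u * \<bar>q u\<bar> / (1 + max 0 s * u))"
     using eventually_ge_at_top[of 0] by eventually_elim (use True in auto)
    ultimately show ?thesis by (rule Lim_transform_eventually)
   qed simp
  qed
  show "(\<lambda>u. indicat_real {0<..<b} u *\<^sub>R (u * \<bar>q u\<bar> / (1 + max 0 s * u))) \<in> borel_measurable lborel" for s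
   using q_int_div[of "max 0 s" b] borel_measurable_integrable by (simp add: set_integrable_def)
 qed simp
 then have "((\<lambda>s. qI (max 0 s) b) \<longlongrightarrow> 0) at_top" by (simp add: qI_def set_lebesgue_integral_def)
 moreover have "\<forall>\<^sub>F s in at_top. qI (max 0 s) b = qI s b"
  using eventually_ge_at_top[of 0] by eventually_elim auto
 ultimately show ?thesis by (rule Lim_transform_eventually)
qed

text \<open>Both the free solution and the perturbation estimate deviate from the leading power by a
  relative error that tends to 0 with x. One \<omega> serves all z with norm z at most R; this
  uniformity later excludes accumulation of eigenvalues.\<close>

lemma xi_near_zero:
 assumes R: "R > 0"
 obtains \<omega> B where "B > 0" "\<And>x. x \<in> {0<..b} \<Longrightarrow> 0 \<le> \<omega> x \<and> \<omega> x \<le> B" "(\<omega> \<longlongrightarrow> 0) (at_right 0)"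
  "\<And>z x. norm z \<le> R \<Longrightarrow> x \<in> {0<..b} \<Longrightarrow>
   norm (\<xi> z x - of_real (lead_const \<nu> * x powr (\<nu> + 1/2))) \<le> \<omega> x * x powr (\<nu> + 1/2)"
  "\<And>z x. norm z \<le> R \<Longrightarrow> x \<in> {0<..b} \<Longrightarrow>
   norm (\<xi>' z x - of_real ((\<nu> + 1/2) * lead_const \<nu> * x powr (\<nu> - 1/2))) \<le> \<omega> x * x powr (\<nu> - 1/2)"
proof -
 obtain Cf where Cf: "Cf > 0" "\<And>z x. norm z \<le> R \<Longrightarrow> 0 < x \<Longrightarrow> x \<le> b \<Longrightarrow>
   norm (xi_free \<nu> z x - of_real (lead_const \<nu> * x powr (\<nu> + 1/2))) \<le> Cf * x\<^sup>2 * x powr (\<nu> + 1/2) \<and>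
   norm (xi_free' \<nu> z x - of_real ((\<nu> + 1/2) * lead_const \<nu> * x powr (\<nu> - 1/2))) \<le> Cf * x\<^sup>2 * x powr (\<nu> - 1/2)"
  using xi_free_near_zero[OF nu b R] by metis
 define A where "A = C0 * (1 + sqrt R * b) * exp (sqrt R * b)"
 have A: "A > 0" using C0 R b by (auto simp: A_def intro!: mult_pos_pos add_pos_pos)
 define \<omega> where "\<omega> x = Cf * x\<^sup>2 + A * qI 0 x" for x
 define B where "B = Cf * b\<^sup>2 + A * qI 0 b"
 have key: "norm (\<xi> z x - xi_free \<nu> z x) \<le> A * qI 0 x * x powr (\<nu> + 1/2) \<and>
       norm (\<xi>' z x - xi_free' \<nu> z x) \<le> A * qI 0 x * x powr (\<nu> - 1/2)" if z: "norm z \<le> R" and x: "x \<in> {0<..b}" for z x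
 proof -
  define s where "s = norm (csqrt z)"
  have s2: "s\<^sup>2 = norm z" unfolding s_def by (metis norm_power power2_csqrt)
  have s: "s \<ge> 0" "s \<le> sqrt R" using z s2 by (auto simp: s_def intro!: real_le_rsqrt)
  have x0: "x > 0" "x \<le> b" using x by auto
  have sx: "s * x \<le> sqrt R * b" using s x0 R by (intro mult_mono) auto
  have sx0: "0 \<le> s * x" using s x0 by simp
  have e: "exp (\<bar>Im (csqrt z)\<bar> * x) \<le> exp (sqrt R * b)"
  proof -
   have "\<bar>Im (csqrt z)\<bar> * x \<le> s * x" unfolding s_def using x0 by (intro mult_right_mono abs_Im_le_cmod) auto
   then show ?thesis using sx by simp
  qed
  have q: "qI s x \<le> qI 0 x" using s x0 by (intro qI_mono) auto
  have p1: "(x / (1 + s * x)) powr (\<nu> + 1/2) \<le> x powr (\<nu> + 1/2)"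
   using x0 sx0 nu by (intro powr_mono2) (auto simp: divide_le_eq)
  \<comment> \<open>The exponent \<nu> - 1/2 may be negative, and then the denominator works in the
    wrong direction. As 1/2 - \<nu> is less than 1, the loss is at most the factor 1 + s x.\<close>
  have p2: "(x / (1 + s * x)) powr (\<nu> - 1/2) \<le> x powr (\<nu> - 1/2) * (1 + sqrt R * b)"
  proof -
   have "(x / (1 + s * x)) powr (\<nu> - 1/2) = x powr (\<nu> - 1/2) * (1 + s * x) powr (1/2 - \<nu>)"
   proof -
    have "1/2 - \<nu> = - (\<nu> - 1/2)" by simp
    then show ?thesis using x0 sx0 by (simp only: powr_divide powr_minus_divide) (simp add: powr_divide)
   qed
   moreover have "(1 + s * x) powr (1/2 - \<nu>) \<le> (1 + s * x) powr 1" using sx0 nu by (intro powr_mono) auto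
   moreover have "(1 + s * x) powr 1 = 1 + s * x" using sx0 by simp
   ultimately show ?thesis using sx by (smt (verit) mult_left_mono powr_ge_zero)
  qed
  have E: "C0 * P * exp (\<bar>Im (csqrt z)\<bar> * x) * qI s x \<le> A * qI 0 x * X"
   if "P \<le> X * (1 + sqrt R * b)" "0 \<le> P" "0 \<le> X" for P X
  proof -
   have "C0 * P * exp (\<bar>Im (csqrt z)\<bar> * x) * qI s x \<le> C0 * (X * (1 + sqrt R * b)) * exp (sqrt R * b) * qI 0 x"
    using that C0 e q qI_nonneg[of s x] s R b by (intro mult_mono mult_left_mono mult_nonneg_nonneg) auto
   also have "\<dots> = A * qI 0 x * X" by (simp add: A_def)
   finally show ?thesis .
  qed
  have "x powr (\<nu> + 1/2) * 1 \<le> x powr (\<nu> + 1/2) * (1 + sqrt R * b)" using R b by (intro mult_left_mono) auto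
  with p1 have p1': "(x / (1 + s * x)) powr (\<nu> + 1/2) \<le> x powr (\<nu> + 1/2) * (1 + sqrt R * b)" by linarith
  show ?thesis
   using xi_est[OF x, of z] xi'_est[OF x, of z] E[OF p1'] E[OF p2]
   unfolding s_def[symmetric] qI_def[symmetric] by auto
 qed
 show thesis
 proof (rule that[of B \<omega>])
  show "B > 0" unfolding B_def using Cf b A qI_nonneg[of 0 b] by (intro add_pos_nonneg) auto
  show "0 \<le> \<omega> x \<and> \<omega> x \<le> B" if "x \<in> {0<..b}" for x
   unfolding \<omega>_def B_def using that Cf A qI_nonneg[of 0 x] qI_mono[of 0 0 x b]
   by (auto intro!: add_nonneg_nonneg add_mono mult_left_mono power_mono)
  show "(\<omega> \<longlongrightarrow> 0) (at_right 0)"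
   unfolding \<omega>_def[abs_def] by (rule tendsto_eq_intros qI_tendsto_0 refl)+ simp
  fix z x assume z: "norm (z::complex) \<le> R" and x: "x \<in> {0<..b}"
  have x0: "x > 0" "x \<le> b" using x by auto
  show "norm (\<xi> z x - of_real (lead_const \<nu> * x powr (\<nu> + 1/2))) \<le> \<omega> x * x powr (\<nu> + 1/2)"
   using norm_diff_triangle_le[OF conjunct1[OF key[OF z x]] conjunct1[OF Cf(2)[OF z x0]]]
   by (simp only: \<omega>_def distrib_right add.commute)
  show "norm (\<xi>' z x - of_real ((\<nu> + 1/2) * lead_const \<nu> * x powr (\<nu> - 1/2))) \<le> \<omega> x * x powr (\<nu> - 1/2)"
   using norm_diff_triangle_le[OF conjunct2[OF key[OF z x]] conjunct2[OF Cf(2)[OF z x0]]]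
   by (simp only: \<omega>_def distrib_right add.commute)
 qed
qed

lemma xi_bounds:
 assumes R: "R > 0"
 obtains B where "B > 0"
  "\<And>z x. norm z \<le> R \<Longrightarrow> x \<in> {0<..b} \<Longrightarrow> norm (\<xi> z x) \<le> B * x powr (\<nu> + 1/2)"
  "\<And>z x. norm z \<le> R \<Longrightarrow> x \<in> {0<..b} \<Longrightarrow> norm (\<xi>' z x) \<le> B * x powr (\<nu> - 1/2)"
proof -
 obtain \<omega> B where w: "B > 0" "\<And>x. x \<in> {0<..b} \<Longrightarrow> 0 \<le> \<omega> x \<and> \<omega> x \<le> B"
  "\<And>z x. norm z \<le> R \<Longrightarrow> x \<in> {0<..b} \<Longrightarrow>
   norm (\<xi> z x - of_real (lead_const \<nu> * x powr (\<nu> + 1/2))) \<le> \<omega> x * x powr (\<nu> + 1/2)"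
  "\<And>z x. norm z \<le> R \<Longrightarrow> x \<in> {0<..b} \<Longrightarrow>
   norm (\<xi>' z x - of_real ((\<nu> + 1/2) * lead_const \<nu> * x powr (\<nu> - 1/2))) \<le> \<omega> x * x powr (\<nu> - 1/2)"
  using xi_near_zero[OF R] by metis
 define L where "L = lead_const \<nu>"
 have L: "L > 0" using lead_const_pos[OF nu] by (simp add: L_def)
 define D where "D = B + L * (1 + (\<nu> + 1/2))"
 have "norm (\<xi> z x) \<le> D * x powr (\<nu> + 1/2) \<and> norm (\<xi>' z x) \<le> D * x powr (\<nu> - 1/2)"
  if z: "norm z \<le> R" and x: "x \<in> {0<..b}" for z x
 proof -
  have "L * \<nu> > 0" "D = B + L + (\<nu> + 1/2) * L" "(\<nu> + 1/2) * L = L * \<nu> + L / 2" using L nu by (simp_all add: D_def algebra_simps)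
  then have D: "\<omega> x + L \<le> D" "\<omega> x + (\<nu> + 1/2) * L \<le> D" using w(2)[OF x] L by linarith+
  have "norm (\<xi> z x) \<le> \<omega> x * x powr (\<nu> + 1/2) + L * x powr (\<nu> + 1/2)"
   using w(3)[OF z x] norm_triangle_sub[of "\<xi> z x" "of_real (L * x powr (\<nu> + 1/2))"] L
   by (simp only: norm_of_real L_def[symmetric]) (simp add: abs_mult)
  also have "\<dots> = (\<omega> x + L) * x powr (\<nu> + 1/2)" by (simp add: distrib_right)
  also have "\<dots> \<le> D * x powr (\<nu> + 1/2)" using D by (intro mult_right_mono) auto
  finally have 1: "norm (\<xi> z x) \<le> D * x powr (\<nu> + 1/2)" .
  have "norm (\<xi>' z x) \<le> \<omega> x * x powr (\<nu> - 1/2) + (\<nu> + 1/2) * L * x powr (\<nu> - 1/2)"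
   using w(4)[OF z x] norm_triangle_sub[of "\<xi>' z x" "of_real ((\<nu> + 1/2) * L * x powr (\<nu> - 1/2))"] L nu
   by (simp only: norm_of_real L_def[symmetric]) (simp add: abs_mult)
  also have "\<dots> = (\<omega> x + (\<nu> + 1/2) * L) * x powr (\<nu> - 1/2)" by (simp add: distrib_right)
  also have "\<dots> \<le> D * x powr (\<nu> - 1/2)" using D by (intro mult_right_mono) auto
  finally show ?thesis using 1 by simp
 qed
 moreover have "D > 0" using w L nu by (simp add: D_def add_pos_pos)
 ultimately show thesis using that by blast
qed

text \<open>Real parts are taken because \<xi> is not yet known to be real on the real line; the
  real part solves the real equation and has the right leading term in any case.\<close>

definition u :: "real \<Rightarrow> real \<Rightarrow> real" where "u l x = Re (\<xi> (of_real l) x)"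
definition u' :: "real \<Rightarrow> real \<Rightarrow> real" where "u' l x = Re (\<xi>' (of_real l) x)"

lemma u_deriv: "x \<in> {0<..b} \<Longrightarrow> (u l has_real_derivative u' l x) (at x within {0<..b})"
 unfolding u_def[abs_def] u'_def has_real_derivative_iff_has_vector_derivative
 using bounded_linear.has_vector_derivative[OF bounded_linear_Re xi_deriv] by simp

lemma u'_deriv: "x \<in> {0<..b} \<Longrightarrow> (u' l has_real_derivative (V x - l) * u l x) (at x within {0<..b})"
 unfolding u_def u'_def[abs_def] has_real_derivative_iff_has_vector_derivative V_def
 using bounded_linear.has_vector_derivative[OF bounded_linear_Re xi'_deriv[of x "of_real l"]]
 by simp

text \<open>The spectral parameter is s^2. The free part is bounded by scaling, and in the error x /
  (1 + s x) is at most 1/s. The bound holds uniformly down to x = 0.\<close>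

lemma u_large:
 obtains s0 C where "s0 > 0" "C > 0"
  "\<And>s x. s \<ge> s0 \<Longrightarrow> x \<in> {0<..b} \<Longrightarrow> \<bar>u (s\<^sup>2) x\<bar> \<le> C * s powr - (\<nu> + 1/2)"
proof -
 obtain t0 e0 C where f: "t0 > 0" "e0 > 0" "C > 0" "\<And>t. t \<ge> t0 \<Longrightarrow> e0 \<le> (f0 \<nu> t)\<^sup>2 + (f0' \<nu> t)\<^sup>2"
  "\<And>t. t > 0 \<Longrightarrow> \<bar>f0 \<nu> t\<bar> \<le> C" "\<And>t. t \<ge> t0 \<Longrightarrow> \<bar>f0' \<nu> t\<bar> \<le> C"
  by (rule f0_energy[OF nu]) blast
 show thesis
 proof (rule that[of 1 "C + C0 * qI 0 b"])
  show "C + C0 * qI 0 b > 0" using f C0 qI_nonneg[of 0 b] by (intro add_pos_nonneg) auto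
  fix s x :: real assume s: "s \<ge> 1" and x: "x \<in> {0<..b}"
  have x0: "x > 0" "x \<le> b" using x by auto
  define S where "S = s powr - (\<nu> + 1/2)"
  have S: "S > 0" using s by (simp add: S_def)
  have "sqrt (s\<^sup>2) = s" using s by simp
  then have cs: "csqrt (of_real (s\<^sup>2)) = of_real s" using s by (simp flip: of_real_power)
  have l: "(s\<^sup>2) powr (- (\<nu> + 1/2) / 2) = S"
  proof -
   have "s\<^sup>2 = s powr 2" using s by (simp add: powr_numeral)
   moreover have "2 * (- (\<nu> + 1/2) / 2) = - (\<nu> + 1/2)" by (simp add: field_simps)
   ultimately show ?thesis by (simp only: powr_powr S_def)
  qed
  have fr: "xi_free \<nu> (of_real (s\<^sup>2)) x = of_real (S * f0 \<nu> (s * x))"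
   using xi_free_scale(1)[OF nu, of "s\<^sup>2" x] s x0 l by simp
  have p: "(x / (1 + s * x)) powr (\<nu> + 1/2) \<le> S"
  proof -
   have "x / (1 + s * x) \<le> 1 / s" using s x0 by (simp add: field_simps add_pos_pos)
   then have "(x / (1 + s * x)) powr (\<nu> + 1/2) \<le> (1 / s) powr (\<nu> + 1/2)"
    using s x0 nu by (intro powr_mono2) auto
   also have "\<dots> = S" using s by (simp only: S_def powr_minus_divide powr_divide powr_one_eq_one)
   finally show ?thesis .
  qed
  have "norm (\<xi> (of_real (s\<^sup>2)) x - xi_free \<nu> (of_real (s\<^sup>2)) x) \<le> C0 * (x / (1 + s * x)) powr (\<nu> + 1/2) * qI s x"
   using xi_est[OF x, of "of_real (s\<^sup>2)"] s unfolding cs qI_def[symmetric] by simp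
  also have "\<dots> \<le> C0 * S * qI 0 b"
   using p C0 S qI_nonneg[of s x] qI_mono[of 0 s x b] s x0 by (intro mult_mono mult_left_mono) auto
  finally have 1: "norm (\<xi> (of_real (s\<^sup>2)) x - xi_free \<nu> (of_real (s\<^sup>2)) x) \<le> C0 * S * qI 0 b" .
  have "\<bar>u (s\<^sup>2) x - S * f0 \<nu> (s * x)\<bar> \<le> C0 * S * qI 0 b"
   using abs_Re_le_cmod[of "\<xi> (of_real (s\<^sup>2)) x - xi_free \<nu> (of_real (s\<^sup>2)) x"] 1 unfolding fr u_def by simp
  moreover have "\<bar>S * f0 \<nu> (s * x)\<bar> \<le> S * C" using f(5)[of "s * x"] s x0 S by (simp add: abs_mult)
  ultimately show "\<bar>u (s\<^sup>2) x\<bar> \<le> (C + C0 * qI 0 b) * s powr - (\<nu> + 1/2)"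
   unfolding S_def[symmetric] by (simp add: algebra_simps)
 qed simp
qed

text \<open>Away from 0 the argument s x of the free solution is large, where its energy is bounded
  below, and the error relative to that size tends to 0 with \<open>qI s b\<close>. So u and u'/s
  cannot be small at the same point.\<close>

lemma u_large_energy:
 assumes a: "0 < a" "a < b"
 obtains s0 C e where "s0 > 0" "C > 0" "e > 0"
  "\<And>s x. s \<ge> s0 \<Longrightarrow> x \<in> {a..b} \<Longrightarrow> \<bar>u (s\<^sup>2) x\<bar> \<le> C * s powr - (\<nu> + 1/2)"
  "\<And>s x. s \<ge> s0 \<Longrightarrow> x \<in> {a..b} \<Longrightarrow> \<bar>u' (s\<^sup>2) x\<bar> \<le> C * s * s powr - (\<nu> + 1/2)"
  "\<And>s x. s \<ge> s0 \<Longrightarrow> x \<in> {a..b} \<Longrightarrow> e * (s * s powr - (\<nu> + 1/2))\<^sup>2 \<le> s\<^sup>2 * (u (s\<^sup>2) x)\<^sup>2 + (u' (s\<^sup>2) x)\<^sup>2"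
proof -
 obtain t0 e0 C where f: "t0 > 0" "e0 > 0" "C > 0" "\<And>t. t \<ge> t0 \<Longrightarrow> e0 \<le> (f0 \<nu> t)\<^sup>2 + (f0' \<nu> t)\<^sup>2"
  "\<And>t. t > 0 \<Longrightarrow> \<bar>f0 \<nu> t\<bar> \<le> C" "\<And>t. t \<ge> t0 \<Longrightarrow> \<bar>f0' \<nu> t\<bar> \<le> C"
  by (rule f0_energy[OF nu]) blast
 \<comment> \<open>The factor 2 anticipates the loss in the derivative estimate; errors below a
   quarter of sqrt e0 leave part of the free energy e0.\<close>
 have "((\<lambda>s. 2 * C0 * qI s b) \<longlongrightarrow> 0) at_top"
  by (rule tendsto_eq_intros qI_at_top refl)+ simp
 from order_tendstoD(2)[OF this, of "sqrt e0 / 4"] f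
 have "\<forall>\<^sub>F s in at_top. 2 * C0 * qI s b < sqrt e0 / 4" by simp
 then obtain s1 where s1: "\<And>s. s \<ge> s1 \<Longrightarrow> 2 * C0 * qI s b < sqrt e0 / 4"
  unfolding eventually_at_top_linorder by blast
 obtain s2 C2 where s2: "s2 > 0" "C2 > 0" "\<And>s x. s \<ge> s2 \<Longrightarrow> x \<in> {0<..b} \<Longrightarrow> \<bar>u (s\<^sup>2) x\<bar> \<le> C2 * s powr - (\<nu> + 1/2)"
  using u_large by metis
 \<comment> \<open>The entries 1 / a and t0 / a force s x to be at least 1 and at least t0 on the
   whole of [a,b].\<close>
 define s0 where "s0 = Max {1, s1, s2, 1 / a, t0 / a}"
 define C3 where "C3 = C2 + C + sqrt e0 / 4"
 have sq: "sqrt e0 > 0" using f by simp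
 show thesis
 proof (rule that[of s0 C3 "e0 / 4"])
  show "s0 > 0" unfolding s0_def by (simp add: less_max_iff_disj)
  show "C3 > 0" using f sq s2 by (simp add: C3_def add_pos_pos)
  show "e0 / 4 > 0" using f by simp
  fix s x :: real assume ss: "s \<ge> s0" and x: "x \<in> {a..b}"
  have s: "s \<ge> 1" "s \<ge> s1" "s \<ge> s2" "s \<ge> 1 / a" "s \<ge> t0 / a" using ss by (auto simp: s0_def)
  have x0: "x > 0" "x \<le> b" "x \<ge> a" and xx: "x \<in> {0<..b}" using x a by auto
  have sx: "s * x \<ge> 1" "s * x \<ge> t0"
  proof -
   have "s * a \<ge> 1" "s * a \<ge> t0" using s a by (simp_all add: field_simps)
   moreover have "s * x \<ge> s * a" using x0 s by (intro mult_left_mono) auto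
   ultimately show "s * x \<ge> 1" "s * x \<ge> t0" by linarith+
  qed
  define S where "S = s powr - (\<nu> + 1/2)"
  have S: "S > 0" using s by (simp add: S_def)
  have "sqrt (s\<^sup>2) = s" using s by simp
  then have cs: "csqrt (of_real (s\<^sup>2)) = of_real s" using s by (simp flip: of_real_power)
  have l: "(s\<^sup>2) powr (- (\<nu> + 1/2) / 2) = S"
  proof -
   have "s\<^sup>2 = s powr 2" using s by (simp add: powr_numeral)
   moreover have "2 * (- (\<nu> + 1/2) / 2) = - (\<nu> + 1/2)" by (simp add: field_simps)
   ultimately show ?thesis by (simp only: powr_powr S_def)
  qed
  have fr: "xi_free \<nu> (of_real (s\<^sup>2)) x = of_real (S * f0 \<nu> (s * x))"
   "xi_free' \<nu> (of_real (s\<^sup>2)) x = of_real (S * s * f0' \<nu> (s * x))"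
   using xi_free_scale[OF nu, of "s\<^sup>2" x] s x0 l by simp_all
  have q: "qI s x \<le> qI s b" "0 \<le> qI s x" using qI_mono[of s s x b] qI_nonneg[of s x] s x0 by auto
  have p: "(x / (1 + s * x)) powr (\<nu> + 1/2) \<le> S"
  proof -
   have "x / (1 + s * x) \<le> 1 / s" using s x0 by (simp add: field_simps add_pos_pos)
   then have "(x / (1 + s * x)) powr (\<nu> + 1/2) \<le> (1 / s) powr (\<nu> + 1/2)"
    using s x0 nu by (intro powr_mono2) auto
   also have "\<dots> = S" using s by (simp only: S_def powr_minus_divide powr_divide powr_one_eq_one)
   finally show ?thesis .
  qed
  \<comment> \<open>Since \<nu> - 1/2 may be negative, the power is written as y^(\<nu>+1/2) divided
    by y; with s x at least 1 the reciprocal of y is at most 2 s.\<close>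
  have p': "(x / (1 + s * x)) powr (\<nu> - 1/2) \<le> 2 * (s * S)"
  proof -
   define y where "y = x / (1 + s * x)"
   have y: "y > 0" "1 / y \<le> 2 * s" using x0 s sx by (auto simp: y_def field_simps add_pos_pos)
   have "y powr (\<nu> - 1/2) = y powr (\<nu> + 1/2) * (1 / y)"
    using powr_half_nu[OF y(1), of \<nu>] y by simp
   also have "\<dots> \<le> S * (2 * s)" using p y S unfolding y_def[symmetric] by (intro mult_mono) auto
   finally show ?thesis by (simp add: y_def mult_ac)
  qed
  have "norm (\<xi> (of_real (s\<^sup>2)) x - xi_free \<nu> (of_real (s\<^sup>2)) x) \<le> C0 * (x / (1 + s * x)) powr (\<nu> + 1/2) * qI s x"
   using xi_est[OF xx, of "of_real (s\<^sup>2)"] s unfolding cs qI_def[symmetric] by simp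
  also have "\<dots> \<le> C0 * S * qI s b" using p C0 q S by (intro mult_mono mult_left_mono) auto
  also have "\<dots> \<le> S * (sqrt e0 / 4)"
  proof -
   have "0 \<le> C0 * qI s b" using C0 q by simp
   moreover have "2 * (C0 * qI s b) < sqrt e0 / 4" using s1[OF s(2)] by (simp only: mult.assoc)
   ultimately have "C0 * qI s b \<le> sqrt e0 / 4" by linarith
   then show ?thesis using mult_left_mono[of "C0 * qI s b" "sqrt e0 / 4" S] S by (simp add: mult_ac)
  qed
  finally have 1: "norm (\<xi> (of_real (s\<^sup>2)) x - xi_free \<nu> (of_real (s\<^sup>2)) x) \<le> S * (sqrt e0 / 4)" .
  have d1: "\<bar>u (s\<^sup>2) x - S * f0 \<nu> (s * x)\<bar> \<le> S * (sqrt e0 / 4)"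
   using abs_Re_le_cmod[of "\<xi> (of_real (s\<^sup>2)) x - xi_free \<nu> (of_real (s\<^sup>2)) x"] 1 unfolding fr u_def by simp
  have "norm (\<xi>' (of_real (s\<^sup>2)) x - xi_free' \<nu> (of_real (s\<^sup>2)) x) \<le> C0 * (x / (1 + s * x)) powr (\<nu> - 1/2) * qI s x"
   using xi'_est[OF xx, of "of_real (s\<^sup>2)"] s unfolding cs qI_def[symmetric] by simp
  also have "\<dots> \<le> C0 * (2 * (s * S)) * qI s b" using p' C0 q S s by (intro mult_mono mult_left_mono) auto
  also have "\<dots> \<le> s * S * (sqrt e0 / 4)"
   using mult_left_mono[of "2 * C0 * qI s b" "sqrt e0 / 4" "s * S"] S s s1[OF s(2)] by (simp add: mult_ac)
  finally have 2: "norm (\<xi>' (of_real (s\<^sup>2)) x - xi_free' \<nu> (of_real (s\<^sup>2)) x) \<le> s * S * (sqrt e0 / 4)" .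
  have d2: "\<bar>u' (s\<^sup>2) x - S * s * f0' \<nu> (s * x)\<bar> \<le> s * S * (sqrt e0 / 4)"
   using abs_Re_le_cmod[of "\<xi>' (of_real (s\<^sup>2)) x - xi_free' \<nu> (of_real (s\<^sup>2)) x"] 2 unfolding fr u'_def by simp
  have SS: "s * S > 0" using s S by simp
  show "\<bar>u (s\<^sup>2) x\<bar> \<le> C3 * s powr - (\<nu> + 1/2)"
  proof -
   have "\<bar>u (s\<^sup>2) x\<bar> \<le> C2 * S" using s2(3)[OF s(3) xx] by (simp add: S_def)
   also have "\<dots> \<le> C3 * S" using S f sq by (intro mult_right_mono) (auto simp: C3_def)
   finally show ?thesis by (simp add: S_def)
  qed
  show "\<bar>u' (s\<^sup>2) x\<bar> \<le> C3 * s * s powr - (\<nu> + 1/2)"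
  proof -
   have "\<bar>S * s * f0' \<nu> (s * x)\<bar> \<le> s * S * C"
    using mult_left_mono[OF f(6)[OF sx(2)], of "s * S"] SS S s by (simp add: abs_mult mult_ac)
   then have "\<bar>u' (s\<^sup>2) x\<bar> \<le> s * S * (C + sqrt e0 / 4)"
    using d2 abs_triangle_ineq[of "u' (s\<^sup>2) x - S * s * f0' \<nu> (s * x)" "S * s * f0' \<nu> (s * x)"]
    unfolding distrib_left diff_add_cancel by linarith
   also have "\<dots> \<le> s * S * C3" using SS s2 by (intro mult_left_mono) (auto simp: C3_def)
   finally show ?thesis by (simp add: S_def mult_ac)
  qed
  show "e0 / 4 * (s * s powr - (\<nu> + 1/2))\<^sup>2 \<le> s\<^sup>2 * (u (s\<^sup>2) x)\<^sup>2 + (u' (s\<^sup>2) x)\<^sup>2"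
  proof -
   \<comment> \<open>Replacing r by a nearby p costs half of the square and the square of the error;
     this transfers the lower bound from the free energy.\<close>
   have half: "p\<^sup>2 / 2 - d\<^sup>2 \<le> r\<^sup>2" if "\<bar>r - p\<bar> \<le> d" for p r d :: real
   proof -
    have "(r - p)\<^sup>2 \<le> d\<^sup>2" using that by (metis abs_ge_zero power2_abs power_mono)
    moreover have "p\<^sup>2 \<le> 2 * r\<^sup>2 + 2 * (r - p)\<^sup>2"
     using zero_le_power2[of "2 * r - p"] by (simp add: power2_eq_square algebra_simps)
    ultimately show ?thesis by linarith
   qed
   define A B where "A = f0 \<nu> (s * x)" and "B = f0' \<nu> (s * x)"
   have AB: "e0 \<le> A\<^sup>2 + B\<^sup>2" using f(4)[OF sx(2)] by (simp add: A_def B_def)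
   have h1: "(S * A)\<^sup>2 / 2 - (S * (sqrt e0 / 4))\<^sup>2 \<le> (u (s\<^sup>2) x)\<^sup>2" using half[OF d1] by (simp add: A_def)
   have h2: "(S * s * B)\<^sup>2 / 2 - (s * S * (sqrt e0 / 4))\<^sup>2 \<le> (u' (s\<^sup>2) x)\<^sup>2" using half[OF d2] by (simp add: B_def)
   have h3: "s\<^sup>2 * ((S * A)\<^sup>2 / 2 - (S * (sqrt e0 / 4))\<^sup>2) \<le> s\<^sup>2 * (u (s\<^sup>2) x)\<^sup>2" using h1 by (intro mult_left_mono) auto
   have e4: "(sqrt e0)\<^sup>2 = e0" using f by simp
   have "s\<^sup>2 * ((S * A)\<^sup>2 / 2 - (S * (sqrt e0 / 4))\<^sup>2) + ((S * s * B)\<^sup>2 / 2 - (s * S * (sqrt e0 / 4))\<^sup>2)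
     = (s * S)\<^sup>2 * ((A\<^sup>2 + B\<^sup>2) / 2 - (sqrt e0)\<^sup>2 / 8)"
    by (simp add: power_mult_distrib power_divide algebra_simps)
   also have "\<dots> \<ge> (s * S)\<^sup>2 * (e0 / 4)"
   proof -
    have "e0 / 4 \<le> P / 2 - e0 / 8" if "e0 \<le> P" for P :: real using that f(2) by linarith
    from this[OF AB] have "e0 / 4 \<le> (A\<^sup>2 + B\<^sup>2) / 2 - e0 / 8" .
    then show ?thesis unfolding e4 by (intro mult_left_mono) auto
   qed
   finally show ?thesis using h2 h3 unfolding S_def[symmetric] by (simp add: mult.commute)
  qed
 qed
qed

end

section \<open>Closure properties of absolute continuity\<close>

lemma AC_on_subinterval: "AC_on f c d \<Longrightarrow> c \<le> c' \<Longrightarrow> d' \<le> d \<Longrightarrow> AC_on f c' d'"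
 unfolding AC_on_def
proof (intro allI impI)
 fix e :: real
 assume *: "\<forall>\<epsilon>>0. \<exists>\<delta>>0. \<forall>D :: (real \<times> real) set. finite D \<and> (\<forall>(u, v)\<in>D. c \<le> u \<and> u \<le> v \<and> v \<le> d) \<and>
    disjoint_family_on (\<lambda>(u, v). {u<..<v}) D \<and> (\<Sum>(u, v)\<in>D. v - u) < \<delta> \<longrightarrow> (\<Sum>(u, v)\<in>D. norm (f v - f u)) < \<epsilon>"
  and cd: "c \<le> c'" "d' \<le> d" and e: "e > 0"
 obtain \<delta> where d: "\<delta> > 0" "\<And>D :: (real \<times> real) set. finite D \<and> (\<forall>(u, v)\<in>D. c \<le> u \<and> u \<le> v \<and> v \<le> d) \<and>
    disjoint_family_on (\<lambda>(u, v). {u<..<v}) D \<and> (\<Sum>(u, v)\<in>D. v - u) < \<delta> \<Longrightarrow> (\<Sum>(u, v)\<in>D. norm (f v - f u)) < e"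
  using *[rule_format, OF e] by blast
 show "\<exists>\<delta>>0. \<forall>D :: (real \<times> real) set. finite D \<and> (\<forall>(u, v)\<in>D. c' \<le> u \<and> u \<le> v \<and> v \<le> d') \<and>
    disjoint_family_on (\<lambda>(u, v). {u<..<v}) D \<and> (\<Sum>(u, v)\<in>D. v - u) < \<delta> \<longrightarrow> (\<Sum>(u, v)\<in>D. norm (f v - f u)) < e"
 proof (intro exI[of _ \<delta>] conjI allI impI d)
  fix D :: "(real \<times> real) set"
  assume D: "finite D \<and> (\<forall>(u, v)\<in>D. c' \<le> u \<and> u \<le> v \<and> v \<le> d') \<and>
    disjoint_family_on (\<lambda>(u, v). {u<..<v}) D \<and> (\<Sum>(u, v)\<in>D. v - u) < \<delta>"
  then show "finite D" "disjoint_family_on (\<lambda>(u, v). {u<..<v}) D" "(\<Sum>(u, v)\<in>D. v - u) < \<delta>" by blast+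
  show "\<forall>(u, v)\<in>D. c \<le> u \<and> u \<le> v \<and> v \<le> d"
  proof clarify
   fix x y assume "(x, y) \<in> D"
   then have "c' \<le> x \<and> x \<le> y \<and> y \<le> d'" using D by blast
   then show "c \<le> x \<and> x \<le> y \<and> y \<le> d" using cd by linarith
  qed
 qed
qed

lemma AC_on_lipschitz:
 fixes f :: "real \<Rightarrow> 'a::real_normed_vector"
 assumes "\<And>u v. c \<le> u \<Longrightarrow> u \<le> v \<Longrightarrow> v \<le> d \<Longrightarrow> norm (f v - f u) \<le> B * (v - u)"
 shows "AC_on f c d"
 unfolding AC_on_def
proof (intro allI impI)
 fix e :: real assume e: "e > 0"
 define K where "K = \<bar>B\<bar> + 1"
 have K: "K > 0" by (simp add: K_def)
 show "\<exists>\<delta>>0. \<forall>D :: (real \<times> real) set. finite D \<and> (\<forall>(u, v)\<in>D. c \<le> u \<and> u \<le> v \<and> v \<le> d) \<and>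
    disjoint_family_on (\<lambda>(u, v). {u<..<v}) D \<and> (\<Sum>(u, v)\<in>D. v - u) < \<delta> \<longrightarrow> (\<Sum>(u, v)\<in>D. norm (f v - f u)) < e"
 proof (intro exI[of _ "e / K"] conjI allI impI; (elim conjE)?)
  show "e / K > 0" using e K by simp
  fix D :: "(real \<times> real) set"
  assume D: "\<forall>(u, v)\<in>D. c \<le> u \<and> u \<le> v \<and> v \<le> d" "(\<Sum>(u, v)\<in>D. v - u) < e / K"
  have "(\<Sum>(u, v)\<in>D. norm (f v - f u)) \<le> (\<Sum>(u, v)\<in>D. K * (v - u))"
  proof (rule sum_mono, clarify)
   fix u v assume "(u, v) \<in> D"
   then have uv: "c \<le> u" "u \<le> v" "v \<le> d" using D by auto
   have "norm (f v - f u) \<le> B * (v - u)" by (rule assms[OF uv])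
   also have "\<dots> \<le> K * (v - u)" using uv by (intro mult_right_mono) (auto simp: K_def)
   finally show "norm (f v - f u) \<le> K * (v - u)" .
  qed
  also have "\<dots> = K * (\<Sum>(u, v)\<in>D. v - u)" by (simp add: sum_distrib_left split_def)
  also have "\<dots> < K * (e / K)" using D(2) K by (rule mult_strict_left_mono)
  finally show "(\<Sum>(u, v)\<in>D. norm (f v - f u)) < e" using K by simp
 qed
qed

text \<open>A function whose increments are dominated by those of two absolutely continuous
  functions. Sums, products, and the passage between complex functions and their components are all
  instances; a constant g gives domination by one function.\<close>

lemma AC_on_combine:
 fixes f :: "real \<Rightarrow> 'a::real_normed_vector" and g :: "real \<Rightarrow> 'b::real_normed_vector" and h :: "real \<Rightarrow> 'c::real_normed_vector"
 assumes f: "AC_on f c d" and g: "AC_on g c d"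
  and h: "\<And>u v. c \<le> u \<Longrightarrow> u \<le> v \<Longrightarrow> v \<le> d \<Longrightarrow> norm (h v - h u) \<le> B * (norm (f v - f u) + norm (g v - g u))"
 shows "AC_on h c d"
 unfolding AC_on_def
proof (intro allI impI)
 fix e :: real assume e: "e > 0"
 define K where "K = \<bar>B\<bar> + 1"
 have K: "K > 0" by (simp add: K_def)
 have eK: "e / (2 * K) > 0" using e K by simp
 obtain d1 where d1: "d1 > 0" "\<And>D :: (real \<times> real) set. finite D \<and> (\<forall>(u, v)\<in>D. c \<le> u \<and> u \<le> v \<and> v \<le> d) \<and>
    disjoint_family_on (\<lambda>(u, v). {u<..<v}) D \<and> (\<Sum>(u, v)\<in>D. v - u) < d1 \<Longrightarrow> (\<Sum>(u, v)\<in>D. norm (f v - f u)) < e / (2 * K)"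
  using f[unfolded AC_on_def, rule_format, OF eK] by blast
 obtain d2 where d2: "d2 > 0" "\<And>D :: (real \<times> real) set. finite D \<and> (\<forall>(u, v)\<in>D. c \<le> u \<and> u \<le> v \<and> v \<le> d) \<and>
    disjoint_family_on (\<lambda>(u, v). {u<..<v}) D \<and> (\<Sum>(u, v)\<in>D. v - u) < d2 \<Longrightarrow> (\<Sum>(u, v)\<in>D. norm (g v - g u)) < e / (2 * K)"
  using g[unfolded AC_on_def, rule_format, OF eK] by blast
 show "\<exists>\<delta>>0. \<forall>D :: (real \<times> real) set. finite D \<and> (\<forall>(u, v)\<in>D. c \<le> u \<and> u \<le> v \<and> v \<le> d) \<and>
    disjoint_family_on (\<lambda>(u, v). {u<..<v}) D \<and> (\<Sum>(u, v)\<in>D. v - u) < \<delta> \<longrightarrow> (\<Sum>(u, v)\<in>D. norm (h v - h u)) < e"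
 proof (intro exI[of _ "min d1 d2"] conjI allI impI)
  show "min d1 d2 > 0" using d1 d2 by simp
  fix D :: "(real \<times> real) set"
  assume D: "finite D \<and> (\<forall>(u, v)\<in>D. c \<le> u \<and> u \<le> v \<and> v \<le> d) \<and>
    disjoint_family_on (\<lambda>(u, v). {u<..<v}) D \<and> (\<Sum>(u, v)\<in>D. v - u) < min d1 d2"
  have "(\<Sum>(u, v)\<in>D. norm (h v - h u)) \<le> (\<Sum>(u, v)\<in>D. K * (norm (f v - f u) + norm (g v - g u)))"
  proof (rule sum_mono, clarify)
   fix u v assume "(u, v) \<in> D"
   then have uv: "c \<le> u" "u \<le> v" "v \<le> d" using D by auto
   have "norm (h v - h u) \<le> B * (norm (f v - f u) + norm (g v - g u))" by (rule h[OF uv])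
   also have "\<dots> \<le> K * (norm (f v - f u) + norm (g v - g u))" by (intro mult_right_mono) (auto simp: K_def)
   finally show "norm (h v - h u) \<le> K * (norm (f v - f u) + norm (g v - g u))" .
  qed
  also have "\<dots> = K * ((\<Sum>(u, v)\<in>D. norm (f v - f u)) + (\<Sum>(u, v)\<in>D. norm (g v - g u)))"
   by (simp only: split_def sum_distrib_left[symmetric] sum.distrib)
  also have "\<dots> < K * (e / (2 * K) + e / (2 * K))"
   using d1(2)[of D] d2(2)[of D] D K by (intro mult_strict_left_mono add_strict_mono) auto
  also have "\<dots> = e" using K by (simp add: field_simps)
  finally show "(\<Sum>(u, v)\<in>D. norm (h v - h u)) < e" .
 qed
qed

lemma AC_on_add: "AC_on f c d \<Longrightarrow> AC_on g c d \<Longrightarrow> AC_on (\<lambda>x. f x + g x) c d"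
proof (erule AC_on_combine[where B=1], assumption)
 fix u v
 have "f v + g v - (f u + g u) = (f v - f u) + (g v - g u)" by simp
 then show "norm (f v + g v - (f u + g u)) \<le> 1 * (norm (f v - f u) + norm (g v - g u))"
  by (metis mult_1 norm_triangle_ineq)
qed

lemma AC_on_diff: "AC_on f c d \<Longrightarrow> AC_on g c d \<Longrightarrow> AC_on (\<lambda>x. f x - g x) c d"
proof (erule AC_on_combine[where B=1], assumption)
 fix u v
 have "f v - g v - (f u - g u) = (f v - f u) - (g v - g u)" by simp
 then show "norm (f v - g v - (f u - g u)) \<le> 1 * (norm (f v - f u) + norm (g v - g u))"
  by (metis mult_1 norm_triangle_ineq4)
qed

lemma AC_on_const: "AC_on (\<lambda>x. k) c d" by (rule AC_on_lipschitz[where B=0]) simp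

lemma AC_on_mult:
 fixes f g :: "real \<Rightarrow> real"
 assumes f: "AC_on f c d" and g: "AC_on g c d" and cf: "continuous_on {c..d} f" and cg: "continuous_on {c..d} g"
 shows "AC_on (\<lambda>x. f x * g x) c d"
proof -
 have bf: "bounded (f ` {c..d})" and bg: "bounded (g ` {c..d})"
  using cf cg by (intro compact_imp_bounded compact_continuous_image; simp)+
 obtain B1 where B1: "B1 > 0" "\<And>x. x \<in> {c..d} \<Longrightarrow> \<bar>f x\<bar> \<le> B1" using bf unfolding bounded_pos by auto
 obtain B2 where B2: "B2 > 0" "\<And>x. x \<in> {c..d} \<Longrightarrow> \<bar>g x\<bar> \<le> B2" using bg unfolding bounded_pos by auto
 show ?thesis
 proof (rule AC_on_combine[OF f g, where B="B1 + B2"])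
  fix u v assume uv: "c \<le> u" "u \<le> v" "v \<le> d"
  have "f v * g v - f u * g u = (f v - f u) * g v + f u * (g v - g u)" by (simp add: algebra_simps)
  then have "\<bar>f v * g v - f u * g u\<bar> \<le> \<bar>f v - f u\<bar> * \<bar>g v\<bar> + \<bar>f u\<bar> * \<bar>g v - g u\<bar>"
   by (metis abs_mult abs_triangle_ineq)
  also have "\<dots> \<le> \<bar>f v - f u\<bar> * (B1 + B2) + (B1 + B2) * \<bar>g v - g u\<bar>"
   using B1(2)[of u] B2(2)[of v] B1(1) B2(1) uv by (intro add_mono mult_mono) auto
  finally show "norm (f v * g v - f u * g u) \<le> (B1 + B2) * (norm (f v - f u) + norm (g v - g u))"
   by (simp add: algebra_simps)
 qed
qed

lemma AC_on_C1:
 fixes f :: "real \<Rightarrow> 'a::real_normed_vector"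
 assumes f: "\<And>x. x \<in> {c..d} \<Longrightarrow> (f has_vector_derivative f' x) (at x within {c..d})" and f': "continuous_on {c..d} f'"
 shows "AC_on f c d"
proof -
 have "bounded (f' ` {c..d})" using f' by (intro compact_imp_bounded compact_continuous_image) auto
 then obtain B where B: "\<And>x. x \<in> {c..d} \<Longrightarrow> norm (f' x) \<le> B" unfolding bounded_pos by blast
 show ?thesis
 proof (rule AC_on_lipschitz[where B=B])
  fix u v assume uv: "c \<le> u" "u \<le> v" "v \<le> d"
  have on: "onorm (\<lambda>h. h *\<^sub>R f' x) \<le> B" if "x \<in> {c..d}" for x
  proof (rule onorm_le)
   fix h :: real
   have "norm (h *\<^sub>R f' x) = \<bar>h\<bar> * norm (f' x)" by (rule norm_scaleR)
   also have "\<dots> \<le> \<bar>h\<bar> * B" by (rule mult_left_mono[OF B[OF that]]) simp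
   finally show "norm (h *\<^sub>R f' x) \<le> B * norm h" by (simp only: real_norm_def mult.commute)
  qed
  have "norm (f v - f u) \<le> B * norm (v - u)"
   by (rule differentiable_bound[OF convex_real_interval(5) f[unfolded has_vector_derivative_def] on]) (use uv in auto)
  then show "norm (f v - f u) \<le> B * (v - u)" using uv by simp
 qed
qed

lemma AC_on_uminus: "AC_on f c d \<Longrightarrow> AC_on (\<lambda>x. - f x) c d"
 using AC_on_diff[OF AC_on_const[of 0]] by simp

section \<open>Lebesgue measure on the interval (0,b)\<close>

text \<open>The interval becomes the space of the measure, so integrals and statements almost
  everywhere on (0,b) need no indicator, and constants are integrable because the measure is
  finite.\<close>

abbreviation lb :: "real \<Rightarrow> real measure" where
 "lb b \<equiv> restrict_space lborel {0<..<b}"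

lemma integrable_lb_iff:
 fixes f :: "real \<Rightarrow> 'a::{banach, second_countable_topology}"
 shows "integrable (lb b) f \<longleftrightarrow> set_integrable lborel {0<..<b} f"
 unfolding set_integrable_def by (rule integrable_restrict_space) simp

lemma integral_lb:
 fixes f :: "real \<Rightarrow> 'a::{banach, second_countable_topology}"
 shows "integral\<^sup>L (lb b) f = (LINT x:{0<..<b}|lborel. f x)"
 unfolding set_lebesgue_integral_def by (rule integral_restrict_space) simp

lemma finite_measure_lb: "finite_measure (lb b)"
proof (rule finite_measureI)
 have "emeasure lborel {0<..<b} < \<infinity>" by (rule emeasure_bounded_finite) (rule bounded_Ioo)
 then show "emeasure (lb b) (space (lb b)) \<noteq> \<infinity>" by (simp add: emeasure_restrict_space space_restrict_space)
qed

lemma set_integrable_open_closed: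
 fixes f :: "real \<Rightarrow> 'a::{banach, second_countable_topology}"
 assumes "set_integrable lborel {c<..<d} f"
 shows "set_integrable lborel {c..d} f"
proof -
 have "set_integrable lborel {c..d} f \<longleftrightarrow> set_integrable lborel {c<..<d} f"
  by (rule set_integrable_discrete_difference[of "{c,d}"]) auto
 then show ?thesis using assms by simp
qed

lemma lb_absolutely_integrable:
 fixes f :: "real \<Rightarrow> 'a::euclidean_space"
 assumes "integrable (lb b) f"
 shows "f absolutely_integrable_on {0..b}"
 using set_integrable_open_closed[of 0 b f] assms
 unfolding integrable_lb_iff set_integrable_def
 by (subst integrable_completion) (auto simp: dest: borel_measurable_integrable)

text \<open>Bridge to the gauge integral, in which the fundamental theorem of calculus and the
  splitting of intervals are used.\<close>

lemma integral_lb_hk: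
 fixes f :: "real \<Rightarrow> 'a::euclidean_space"
 assumes "integrable (lb b) f"
 shows "integral\<^sup>L (lb b) f = integral {0..b} f"
 using assms set_borel_integral_eq_integral(2)[of "{0<..<b}" f]
 by (simp add: integrable_lb_iff integral_lb integral_open_interval_real)

lemma integral_lb_indicator:
 fixes f :: "real \<Rightarrow> 'a::euclidean_space"
 assumes "integrable (lb b) f" "0 \<le> c" "d \<le> b"
 shows "integrable (lb b) (\<lambda>x. indicator {c..d} x *\<^sub>R f x)"
  "integral\<^sup>L (lb b) (\<lambda>x. indicator {c..d} x *\<^sub>R f x) = integral {c..d} f"
proof -
 show i: "integrable (lb b) (\<lambda>x. indicator {c..d} x *\<^sub>R f x)"
 proof (rule Bochner_Integration.integrable_bound[OF assms(1)])
  have "(indicator {c..d} :: real \<Rightarrow> real) \<in> borel_measurable (lb b)"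
   by (rule measurable_restrict_space1) simp
  then show "(\<lambda>x. indicator {c..d} x *\<^sub>R f x) \<in> borel_measurable (lb b)"
   using assms(1) by (intro borel_measurable_scaleR) auto
 qed (auto simp: indicator_def)
 have "integral\<^sup>L (lb b) (\<lambda>x. indicator {c..d} x *\<^sub>R f x) = integral {0..b} (\<lambda>x. indicator {c..d} x *\<^sub>R f x)"
  by (rule integral_lb_hk[OF i])
 also have "\<dots> = integral {0..b} (\<lambda>x. if x \<in> {c..d} then f x else 0)"
  by (rule integral_cong) (auto simp: indicator_def)
 also have "\<dots> = integral ({c..d} \<inter> {0..b}) f" by (rule Henstock_Kurzweil_Integration.integral_restrict_Int)
 also have "{c..d} \<inter> {0..b} = {c..d}" using assms by auto
 finally show "integral\<^sup>L (lb b) (\<lambda>x. indicator {c..d} x *\<^sub>R f x) = integral {c..d} f" .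
qed

lemma continuous_on_lb_measurable:
 fixes f :: "real \<Rightarrow> 'a::topological_space"
 assumes "continuous_on {0<..b} f"
 shows "f \<in> borel_measurable (lb b)"
proof -
 have "f \<in> borel_measurable (restrict_space borel {0<..<b})"
  by (rule borel_measurable_continuous_on_restrict[OF continuous_on_subset[OF assms]]) auto
 moreover have "sets (lb b) = sets (restrict_space borel {0<..<b})" by (intro sets_restrict_space_cong) simp
 from measurable_cong_sets[OF this refl] have "borel_measurable (lb b) = (borel_measurable (restrict_space borel {0<..<b}) :: (real \<Rightarrow> 'a) set)" .
 ultimately show ?thesis by blast
qed

section \<open>Solutions of the singular equation: growth and uniqueness\<close>

text \<open>The real equation y'' = Q y with a distinguished solution u that is small at 0. The
  spectral parameter is absorbed in Q, so later Q is V - l or V - m. Nothing is assumed on Q at 0;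
  its singularity is seen only through the behaviour of u.\<close>

locale sl_solution =
 fixes \<nu> b :: real and Q u u' \<omega> :: "real \<Rightarrow> real" and L B :: real
 assumes nu: "\<nu> > 0" and b: "b > 0" and Q_cont: "continuous_on {0<..b} Q"
  and u_der: "\<And>x. x \<in> {0<..b} \<Longrightarrow> (u has_real_derivative u' x) (at x within {0<..b})"
  and u'_der: "\<And>x. x \<in> {0<..b} \<Longrightarrow> (u' has_real_derivative Q x * u x) (at x within {0<..b})"
  and L: "L > 0" and om: "\<And>x. x \<in> {0<..b} \<Longrightarrow> 0 \<le> \<omega> x \<and> \<omega> x \<le> B" and om_0: "(\<omega> \<longlongrightarrow> 0) (at_right 0)"
  and u_asym: "\<And>x. x \<in> {0<..b} \<Longrightarrow> \<bar>u x - L * x powr (\<nu> + 1/2)\<bar> \<le> \<omega> x * x powr (\<nu> + 1/2)"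
  and u'_asym: "\<And>x. x \<in> {0<..b} \<Longrightarrow> \<bar>u' x - (\<nu> + 1/2) * L * x powr (\<nu> - 1/2)\<bar> \<le> \<omega> x * x powr (\<nu> - 1/2)"
begin

definition solves :: "(real \<Rightarrow> real) \<Rightarrow> (real \<Rightarrow> real) \<Rightarrow> bool" where
 "solves y y' \<longleftrightarrow> (\<forall>x\<in>{0<..b}. (y has_real_derivative y' x) (at x within {0<..b}) \<and>
   (y' has_real_derivative Q x * y x) (at x within {0<..b}))"

lemma u_solves: "solves u u'" by (simp add: solves_def u_der u'_der)

lemma solves_cont: "solves y y' \<Longrightarrow> continuous_on {0<..b} y" "solves y y' \<Longrightarrow> continuous_on {0<..b} y'"
 unfolding solves_def continuous_on_eq_continuous_within by (meson DERIV_continuous)+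

lemma om_lt:
 assumes "e > 0"
 obtains d where "d > 0" "d \<le> b" "\<And>x. 0 < x \<Longrightarrow> x \<le> d \<Longrightarrow> \<omega> x < e"
proof -
 obtain d where d: "d > 0" "\<And>x. 0 < x \<Longrightarrow> x < d \<Longrightarrow> \<omega> x < e"
  using order_tendstoD(2)[OF om_0 assms] unfolding eventually_at_right_field by auto
 show thesis by (rule that[of "min (d / 2) b"]) (use d b in auto)
qed

text \<open>Up to this point u stays above half of its leading term, so it has no zero there and
  division by u is allowed.\<close>

definition x0 where "x0 = (SOME d. 0 < d \<and> d < b \<and> (\<forall>x. 0 < x \<longrightarrow> x \<le> d \<longrightarrow> \<omega> x < L / 2))"

lemma x0: "0 < x0" "x0 < b" "0 < x \<Longrightarrow> x \<le> x0 \<Longrightarrow> \<omega> x < L / 2"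
proof -
 obtain d where d: "d > 0" "d \<le> b" "\<And>x. 0 < x \<Longrightarrow> x \<le> d \<Longrightarrow> \<omega> x < L / 2"
  using om_lt[of "L / 2"] L by auto
 then have "\<exists>d. 0 < d \<and> d < b \<and> (\<forall>x. 0 < x \<longrightarrow> x \<le> d \<longrightarrow> \<omega> x < L / 2)"
  by (intro exI[of _ "d / 2"]) auto
 from someI_ex[OF this] show "0 < x0" "x0 < b" "0 < x \<Longrightarrow> x \<le> x0 \<Longrightarrow> \<omega> x < L / 2"
  unfolding x0_def by blast+
qed

lemma u_near_zero:
 assumes "0 < x" "x \<le> x0"
 shows "L / 2 * x powr (\<nu> + 1/2) \<le> u x" "u x \<le> 2 * L * x powr (\<nu> + 1/2)" "u x > 0"
proof -
 have x: "x \<in> {0<..b}" using assms x0(2) by auto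
 have P: "x powr (\<nu> + 1/2) > 0" using assms by simp
 have w: "\<omega> x * x powr (\<nu> + 1/2) \<le> L / 2 * x powr (\<nu> + 1/2)"
  using x0(3)[OF assms] by (intro mult_right_mono) auto
 have "\<bar>u x - L * x powr (\<nu> + 1/2)\<bar> \<le> L / 2 * x powr (\<nu> + 1/2)" using u_asym[OF x] w by linarith
 moreover have "0 < L / 2 * x powr (\<nu> + 1/2)" using P L by simp
 ultimately show "L / 2 * x powr (\<nu> + 1/2) \<le> u x" "u x \<le> 2 * L * x powr (\<nu> + 1/2)" "u x > 0" by linarith+
qed

definition Bu where "Bu = B + L * (\<nu> + 3/2)"

lemma Bu_pos: "Bu > 0"
 using om[of b] b L nu unfolding Bu_def by (intro add_nonneg_pos) auto

lemma u_bound: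
 assumes x: "x \<in> {0<..b}"
 shows "\<bar>u x\<bar> \<le> Bu * x powr (\<nu> + 1/2)" "\<bar>u' x\<bar> \<le> Bu * x powr (\<nu> - 1/2)"
proof -
 have "L * \<nu> > 0" using L nu by simp
 then have D: "\<omega> x + L \<le> Bu" "\<omega> x + (\<nu> + 1/2) * L \<le> Bu"
  using om[OF x] L unfolding Bu_def by (auto simp: algebra_simps)
 have P: "x powr (\<nu> + 1/2) > 0" "x powr (\<nu> - 1/2) > 0" using x by auto
 have "\<bar>u x\<bar> \<le> \<omega> x * x powr (\<nu> + 1/2) + L * x powr (\<nu> + 1/2)"
  using u_asym[OF x] mult_pos_pos[OF L P(1)] by linarith
 also have "\<dots> = (\<omega> x + L) * x powr (\<nu> + 1/2)" by (simp add: algebra_simps)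
 also have "\<dots> \<le> Bu * x powr (\<nu> + 1/2)" using D P by (intro mult_right_mono) auto
 finally show "\<bar>u x\<bar> \<le> Bu * x powr (\<nu> + 1/2)" .
 have "(\<nu> + 1/2) * L * x powr (\<nu> - 1/2) > 0" using nu L P by (intro mult_pos_pos) auto
 then have "\<bar>u' x\<bar> \<le> \<omega> x * x powr (\<nu> - 1/2) + (\<nu> + 1/2) * L * x powr (\<nu> - 1/2)"
  using u'_asym[OF x] by linarith
 also have "\<dots> = (\<omega> x + (\<nu> + 1/2) * L) * x powr (\<nu> - 1/2)" by (simp add: algebra_simps)
 also have "\<dots> \<le> Bu * x powr (\<nu> - 1/2)" using D P by (intro mult_right_mono) auto
 finally show "\<bar>u' x\<bar> \<le> Bu * x powr (\<nu> - 1/2)" .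
qed

text \<open>The expression (\<nu>+1/2) y - x y' annihilates the leading power x^(\<nu>+1/2); only
  the remainders contribute.\<close>

lemma u_boundary_form:
 assumes x: "x \<in> {0<..b}"
 shows "\<bar>(\<nu> + 1/2) * u x - x * u' x\<bar> \<le> (\<nu> + 3/2) * \<omega> x * x powr (\<nu> + 1/2)"
proof -
 have xp: "x powr (\<nu> + 1/2) = x * x powr (\<nu> - 1/2)" using x by (intro powr_half_nu) auto
 have "(\<nu> + 1/2) * u x - x * u' x = (\<nu> + 1/2) * (u x - L * x powr (\<nu> + 1/2)) - x * (u' x - (\<nu> + 1/2) * L * x powr (\<nu> - 1/2))"
  unfolding xp by (simp add: algebra_simps)
 also have "\<bar>\<dots>\<bar> \<le> (\<nu> + 1/2) * \<bar>u x - L * x powr (\<nu> + 1/2)\<bar> + x * \<bar>u' x - (\<nu> + 1/2) * L * x powr (\<nu> - 1/2)\<bar>"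
  using nu x by (intro order_trans[OF abs_triangle_ineq4]) (simp add: abs_mult)
 also have "\<dots> \<le> (\<nu> + 1/2) * (\<omega> x * x powr (\<nu> + 1/2)) + x * (\<omega> x * x powr (\<nu> - 1/2))"
  using u_asym[OF x] u'_asym[OF x] nu x by (intro add_mono mult_left_mono) auto
 also have "\<dots> = (\<nu> + 3/2) * \<omega> x * x powr (\<nu> + 1/2)" unfolding xp by (simp add: algebra_simps)
 finally show ?thesis .
qed

lemma ode_zero:
 assumes "solves y y'" "t \<in> {0<..b}" "y t = 0" "y' t = 0" "x \<in> {0<..b}"
 shows "y x = 0"
proof (rule linear_ode_zero[of "min t x" b Q y y' t x])
 have sub: "{min t x..b} \<subseteq> {0<..b}" using assms by auto
 show "continuous_on {min t x..b} Q" by (rule continuous_on_subset[OF Q_cont sub])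
 fix s assume s: "s \<in> {min t x..b}"
 show "(y has_vector_derivative y' s) (at s within {min t x..b})"
  "(y' has_vector_derivative Q s *\<^sub>R y s) (at s within {min t x..b})"
  using assms(1)[unfolded solves_def] s sub DERIV_subset[OF _ sub]
  unfolding has_real_derivative_iff_has_vector_derivative[symmetric] real_scaleR_def by blast+
qed (use assms in auto)

lemma ode_zero':
 assumes "solves y y'" and z: "\<And>x. x \<in> {0<..b} \<Longrightarrow> y x = 0" and x: "x \<in> {0<..b}"
 shows "y' x = 0"
proof (rule vector_derivative_unique_within_closed_interval[of "x / 2" b x y])
 have sub: "{x / 2..b} \<subseteq> {0<..b}" using x by auto
 show "(y has_vector_derivative y' x) (at x within cbox (x / 2) b)"
  using assms(1)[unfolded solves_def] x DERIV_subset[OF _ sub]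
  unfolding has_real_derivative_iff_has_vector_derivative[symmetric] interval_cbox by blast
 show "(y has_vector_derivative 0) (at x within cbox (x / 2) b)"
  by (rule has_vector_derivative_transform[of x _ y "\<lambda>x. 0"]) (use z x in auto)
qed (use x in auto)

lemma wronskian_const:
 assumes y: "solves y y'" and z: "solves z z'"
 shows "\<exists>w. \<forall>x\<in>{0<..b}. y x * z' x - y' x * z x = w"
proof (rule has_field_derivative_zero_constant)
 show "((\<lambda>x. y x * z' x - y' x * z x) has_field_derivative 0) (at x within {0<..b})" if x: "x \<in> {0<..b}" for x
 proof -
  have d: "(y has_real_derivative y' x) (at x within {0<..b})" "(y' has_real_derivative Q x * y x) (at x within {0<..b})"
   "(z has_real_derivative z' x) (at x within {0<..b})" "(z' has_real_derivative Q x * z x) (at x within {0<..b})"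
   using y z x unfolding solves_def by blast+
  show ?thesis by (rule derivative_eq_intros d refl)+ (simp add: algebra_simps)
 qed
qed simp

text \<open>Subtracting the multiple of u that agrees with y at x0 gives a solution that vanishes
  there, and the zero Wronskian makes its derivative vanish there too.\<close>

lemma wronskian_zero:
 assumes y: "solves y y'" and W: "t \<in> {0<..b}" "u t * y' t - u' t * y t = 0"
 obtains k where "\<And>x. x \<in> {0<..b} \<Longrightarrow> y x = k * u x" "\<And>x. x \<in> {0<..b} \<Longrightarrow> y' x = k * u' x"
proof -
 have xx: "x0 \<in> {0<..b}" using x0 by auto
 have W0: "u x0 * y' x0 - u' x0 * y x0 = 0" using wronskian_const[OF u_solves y] W xx by metis
 have u0: "u x0 > 0" using u_near_zero[of x0] x0 by simp
 define k where "k = y x0 / u x0"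
 have sol: "solves (\<lambda>x. y x - k * u x) (\<lambda>x. y' x - k * u' x)"
  unfolding solves_def
 proof (intro ballI conjI)
  fix x assume x: "x \<in> {0<..b}"
  have d: "(y has_real_derivative y' x) (at x within {0<..b})" "(y' has_real_derivative Q x * y x) (at x within {0<..b})"
   using y x unfolding solves_def by blast+
  show "((\<lambda>x. y x - k * u x) has_real_derivative y' x - k * u' x) (at x within {0<..b})"
   by (rule derivative_eq_intros d u_der x refl)+ simp
  show "((\<lambda>x. y' x - k * u' x) has_real_derivative Q x * (y x - k * u x)) (at x within {0<..b})"
   by (rule derivative_eq_intros d u'_der x refl)+ (simp add: algebra_simps)
 qed
 have z: "y x = k * u x" if "x \<in> {0<..b}" for x
  using ode_zero[OF sol xx _ _ that] u0 W0 by (simp add: k_def field_simps)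
 have "y' x = k * u' x" if x: "x \<in> {0<..b}" for x
  using ode_zero'[OF sol _ x] z by simp
 then show thesis using z that by blast
qed

lemma solves_at:
 assumes "solves y y'" "0 < x" "x < b"
 shows "(y has_real_derivative y' x) (at x)" "(y' has_real_derivative Q x * y x) (at x)"
proof -
 have "at x within {0<..b} = at x"
  by (rule at_within_nhd[where S="{0<..<b}"]) (use assms(2,3) in auto)
 then show "(y has_real_derivative y' x) (at x)" "(y' has_real_derivative Q x * y x) (at x)"
  using assms unfolding solves_def by force+
qed

text \<open>Reduction of order near 0: the derivative of y / u is the Wronskian over u squared, and
  u squared is comparable with x^(2\<nu>+1), whose reciprocal has the explicit primitive recorded
  last.\<close>

lemma quotient_deriv:
 assumes y: "solves y y'" and w: "\<And>x. x \<in> {0<..b} \<Longrightarrow> u x * y' x - u' x * y x = w" and x: "0 < x" "x \<le> x0"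
 shows "((\<lambda>x. y x / u x) has_real_derivative w / (u x)\<^sup>2) (at x)"
  "1 / (4 * L\<^sup>2) * x powr (- 2 * \<nu> - 1) \<le> 1 / (u x)\<^sup>2" "1 / (u x)\<^sup>2 \<le> 4 / L\<^sup>2 * x powr (- 2 * \<nu> - 1)"
  "((\<lambda>x. x powr (- 2 * \<nu>) / (2 * \<nu>)) has_real_derivative - (x powr (- 2 * \<nu> - 1))) (at x)"
proof -
 have xb: "x < b" using x x0 by simp
 have u0: "u x > 0" using u_near_zero[OF x] by simp
 have "((\<lambda>x. y x / u x) has_real_derivative (y' x * u x - y x * u' x) / (u x * u x)) (at x)"
  using DERIV_divide[OF solves_at(1)[OF y x(1) xb] solves_at(1)[OF u_solves x(1) xb]] u0 by simp
 then show "((\<lambda>x. y x / u x) has_real_derivative w / (u x)\<^sup>2) (at x)"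
  using w[of x] x xb by (simp add: power2_eq_square mult.commute)
 have e: "- 2 * \<nu> - 1 = - (2 * (\<nu> + 1/2))" by simp
 have sq: "(x powr (\<nu> + 1/2))\<^sup>2 = x powr (2 * (\<nu> + 1/2))" using x by (simp add: powr_power mult.commute)
 define P where "P = x powr (\<nu> + 1/2)"
 have P: "P > 0" "x powr (- 2 * \<nu> - 1) = 1 / P\<^sup>2"
  unfolding P_def sq e using x by (simp_all only: powr_minus_divide powr_gt_zero)
 have l: "L / 2 * P \<le> u x" "u x \<le> 2 * L * P" using u_near_zero[OF x] by (auto simp: P_def)
 have "(L / 2 * P)\<^sup>2 \<le> (u x)\<^sup>2" "(u x)\<^sup>2 \<le> (2 * L * P)\<^sup>2"
  using l u0 L P by (intro power_mono; simp)+
 then have "1 / (2 * L * P)\<^sup>2 \<le> 1 / (u x)\<^sup>2" "1 / (u x)\<^sup>2 \<le> 1 / (L / 2 * P)\<^sup>2"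
  using u0 L P by (intro divide_left_mono; simp)+
 moreover have "1 / (2 * L * P)\<^sup>2 = 1 / (4 * L\<^sup>2) * (1 / P\<^sup>2)" "1 / (L / 2 * P)\<^sup>2 = 4 / L\<^sup>2 * (1 / P\<^sup>2)"
  using L P by (simp_all add: power_mult_distrib power_divide)
 ultimately show "1 / (4 * L\<^sup>2) * x powr (- 2 * \<nu> - 1) \<le> 1 / (u x)\<^sup>2" "1 / (u x)\<^sup>2 \<le> 4 / L\<^sup>2 * x powr (- 2 * \<nu> - 1)"
  unfolding P(2) by simp_all
 show "((\<lambda>x. x powr (- 2 * \<nu>) / (2 * \<nu>)) has_real_derivative - (x powr (- 2 * \<nu> - 1))) (at x)"
  using nu x by (auto intro!: derivative_eq_intros simp: field_simps)
qed

text \<open>With G the primitive of the comparison function, y/u - K G is increasing and y/u + K G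
  decreasing; comparing with x0 bounds the quotient.\<close>

lemma quotient_upper:
 assumes y: "solves y y'" and w: "\<And>x. x \<in> {0<..b} \<Longrightarrow> u x * y' x - u' x * y x = w" and x: "0 < x" "x \<le> x0"
 shows "\<bar>y x / u x\<bar> \<le> \<bar>y x0 / u x0\<bar> + 2 * \<bar>w\<bar> / (L\<^sup>2 * \<nu>) * x powr (- 2 * \<nu>)"
proof -
 define K where "K = 4 * \<bar>w\<bar> / L\<^sup>2"
 define G where "G x = x powr (- 2 * \<nu>) / (2 * \<nu>)" for x :: real
 have K: "\<bar>w / (u s)\<^sup>2\<bar> \<le> K * s powr (- 2 * \<nu> - 1)" if "0 < s" "s \<le> x0" for s
  using mult_left_mono[OF quotient_deriv(3)[OF y w that], of "\<bar>w\<bar>"] by (simp add: K_def abs_mult mult_ac)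
 have 1: "y x / u x - K * G x \<le> y x0 / u x0 - K * G x0"
 proof (rule DERIV_nonneg_imp_nondecreasing[OF x(2)])
  fix s assume "x \<le> s" "s \<le> x0"
  then have s: "0 < s" "s \<le> x0" using x by auto
  have "((\<lambda>s. y s / u s - K * G s) has_real_derivative w / (u s)\<^sup>2 - K * - (s powr (- 2 * \<nu> - 1))) (at s)"
   unfolding G_def by (intro DERIV_diff DERIV_cmult quotient_deriv(1)[OF y w s] quotient_deriv(4)[OF y w s])
  moreover have "w / (u s)\<^sup>2 - K * - (s powr (- 2 * \<nu> - 1)) \<ge> 0" using K[OF s] unfolding mult_minus_right by linarith
  ultimately show "\<exists>d. ((\<lambda>s. y s / u s - K * G s) has_real_derivative d) (at s) \<and> 0 \<le> d" by blast
 qed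
 have 2: "y x0 / u x0 + K * G x0 \<le> y x / u x + K * G x"
 proof (rule DERIV_nonpos_imp_nonincreasing[OF x(2)])
  fix s assume "x \<le> s" "s \<le> x0"
  then have s: "0 < s" "s \<le> x0" using x by auto
  have "((\<lambda>s. y s / u s + K * G s) has_real_derivative w / (u s)\<^sup>2 + K * - (s powr (- 2 * \<nu> - 1))) (at s)"
   unfolding G_def by (intro DERIV_add DERIV_cmult quotient_deriv(1)[OF y w s] quotient_deriv(4)[OF y w s])
  moreover have "w / (u s)\<^sup>2 + K * - (s powr (- 2 * \<nu> - 1)) \<le> 0" using K[OF s] unfolding mult_minus_right by linarith
  ultimately show "\<exists>d. ((\<lambda>s. y s / u s + K * G s) has_real_derivative d) (at s) \<and> d \<le> 0" by blast
 qed
 have "K * G x0 \<ge> 0" using nu by (simp add: K_def G_def)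
 then have "\<bar>y x / u x\<bar> \<le> \<bar>y x0 / u x0\<bar> + K * G x" using 1 2 by linarith
 also have "K * G x = 2 * \<bar>w\<bar> / (L\<^sup>2 * \<nu>) * x powr (- 2 * \<nu>)" by (simp add: K_def G_def field_simps)
 finally show ?thesis .
qed

text \<open>Since y/u is O(x^(-2\<nu>)) near 0, every solution is O(x^(1/2-\<nu>)), the second
  exponent of the equation at 0. On [x0,b] compactness suffices.\<close>

lemma solves_growth:
 assumes y: "solves y y'"
 obtains C where "C > 0" "\<And>x. x \<in> {0<..b} \<Longrightarrow> \<bar>y x\<bar> \<le> C * x powr (1/2 - \<nu>)"
  "\<And>x. x \<in> {0<..b} \<Longrightarrow> \<bar>y' x\<bar> \<le> C * x powr (- 1/2 - \<nu>)"
proof -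
 obtain w where w: "\<And>x. x \<in> {0<..b} \<Longrightarrow> u x * y' x - u' x * y x = w"
  using wronskian_const[OF u_solves y] by auto
 define M where "M = \<bar>y x0 / u x0\<bar>"
 define N where "N = 2 * \<bar>w\<bar> / (L\<^sup>2 * \<nu>)"
 have MN: "M \<ge> 0" "N \<ge> 0" using nu by (auto simp: M_def N_def)
 define C1 where "C1 = 2 * L * (M * b powr (2 * \<nu>) + N)"
 have C1: "C1 \<ge> 0" using MN L by (simp add: C1_def)
 define C2 where "C2 = (\<bar>w\<bar> + Bu * C1) * (2 / L)"
 have near: "\<bar>y x\<bar> \<le> C1 * x powr (1/2 - \<nu>)" "\<bar>y' x\<bar> \<le> C2 * x powr (- 1/2 - \<nu>)" if x: "0 < x" "x \<le> x0" for x
 proof -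
  have xb: "x \<in> {0<..b}" using x x0 by auto
  note u = u_near_zero[OF x]
  define P where "P = x powr (\<nu> + 1/2)"
  have P: "P > 0" using x by (simp add: P_def)
  have e1: "P * x powr (- 2 * \<nu>) = x powr (1/2 - \<nu>)" unfolding P_def by (simp add: powr_add[symmetric])
  have e2: "P = x powr (1/2 - \<nu>) * x powr (2 * \<nu>)" unfolding P_def by (simp add: powr_add[symmetric])
  have "x powr (2 * \<nu>) \<le> b powr (2 * \<nu>)" using xb nu by (intro powr_mono2) auto
  then have e3: "P \<le> x powr (1/2 - \<nu>) * b powr (2 * \<nu>)" unfolding e2 by (intro mult_left_mono) auto
  have "\<bar>y x\<bar> = \<bar>y x / u x\<bar> * u x" using u by (simp add: abs_mult)
  also have "\<dots> \<le> (M + N * x powr (- 2 * \<nu>)) * (2 * L * P)"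
   using quotient_upper[OF y w x] u MN unfolding M_def[symmetric] N_def[symmetric] P_def[symmetric]
   by (intro mult_mono) auto
  also have "\<dots> = 2 * L * (M * P + N * (P * x powr (- 2 * \<nu>)))" by (simp add: algebra_simps)
  also have "\<dots> \<le> 2 * L * (M * (x powr (1/2 - \<nu>) * b powr (2 * \<nu>)) + N * x powr (1/2 - \<nu>))"
   unfolding e1 using e3 MN L by (intro mult_left_mono add_mono) auto
  also have "\<dots> = C1 * x powr (1/2 - \<nu>)" by (simp add: C1_def algebra_simps)
  finally show 1: "\<bar>y x\<bar> \<le> C1 * x powr (1/2 - \<nu>)" .
  have "\<bar>u' x * y x\<bar> \<le> (Bu * x powr (\<nu> - 1/2)) * (C1 * x powr (1/2 - \<nu>))"
   unfolding abs_mult using u_bound(2)[OF xb] 1 Bu_pos by (intro mult_mono) auto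
  also have "\<dots> = Bu * C1 * (x powr (\<nu> - 1/2) * x powr (1/2 - \<nu>))" by (simp add: mult_ac)
  also have "x powr (\<nu> - 1/2) * x powr (1/2 - \<nu>) = 1" using x by (simp add: powr_add[symmetric])
  finally have "\<bar>w + u' x * y x\<bar> \<le> \<bar>w\<bar> + Bu * C1" by simp
  \<comment> \<open>No asymptotics of y' are needed: the Wronskian identity is solved for it, and
    both summands of the numerator are bounded.\<close>
  moreover have "y' x = (w + u' x * y x) / u x" using w[OF xb] u by (simp add: field_simps)
  ultimately have "\<bar>y' x\<bar> \<le> (\<bar>w\<bar> + Bu * C1) / u x" using u by (simp add: divide_right_mono)
  also have "\<dots> \<le> (\<bar>w\<bar> + Bu * C1) / (L / 2 * P)"
   using u L P C1 Bu_pos unfolding P_def by (intro divide_left_mono mult_pos_pos) auto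
  also have "\<dots> = C2 * (1 / P)" by (simp add: C2_def)
  also have "1 / P = x powr (- 1/2 - \<nu>)"
  proof -
   have "- 1/2 - \<nu> = - (\<nu> + 1/2)" by simp
   then show ?thesis unfolding P_def by (simp only: powr_minus_divide)
  qed
  finally show "\<bar>y' x\<bar> \<le> C2 * x powr (- 1/2 - \<nu>)" .
 qed
 have sub: "{x0..b} \<subseteq> {0<..b}" using x0 by auto
 have "continuous_on {x0..b} (\<lambda>x. y x * x powr (\<nu> - 1/2))" "continuous_on {x0..b} (\<lambda>x. y' x * x powr (\<nu> + 1/2))"
  using solves_cont[OF y] sub x0 by (auto intro!: continuous_intros intro: continuous_on_subset)
 then have bd: "bounded ((\<lambda>x. y x * x powr (\<nu> - 1/2)) ` {x0..b})" "bounded ((\<lambda>x. y' x * x powr (\<nu> + 1/2)) ` {x0..b})"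
  by (auto intro!: compact_imp_bounded compact_continuous_image)
 obtain C3 where C3: "C3 > 0" "\<And>x. x \<in> {x0..b} \<Longrightarrow> \<bar>y x * x powr (\<nu> - 1/2)\<bar> \<le> C3"
  using bd(1) unfolding bounded_pos by fastforce
 obtain C4 where C4: "C4 > 0" "\<And>x. x \<in> {x0..b} \<Longrightarrow> \<bar>y' x * x powr (\<nu> + 1/2)\<bar> \<le> C4"
  using bd(2) unfolding bounded_pos by fastforce
 define C where "C = C1 + \<bar>C2\<bar> + C3 + C4"
 have C: "C1 \<le> C" "C2 \<le> C" "C3 \<le> C" "C4 \<le> C" "C > 0" using C1 C3 C4 by (auto simp: C_def)
 have "\<bar>y x\<bar> \<le> C * x powr (1/2 - \<nu>) \<and> \<bar>y' x\<bar> \<le> C * x powr (- 1/2 - \<nu>)" if x: "x \<in> {0<..b}" for x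
 proof (cases "x \<le> x0")
  case True
  have h: "C1 * x powr (1/2 - \<nu>) \<le> C * x powr (1/2 - \<nu>)" "C2 * x powr (- 1/2 - \<nu>) \<le> C * x powr (- 1/2 - \<nu>)"
   using C by (intro mult_right_mono; simp)+
  show ?thesis using order_trans[OF near(1)[OF _ True] h(1)] order_trans[OF near(2)[OF _ True] h(2)] x by simp
 next
  case False
  then have xx: "x \<in> {x0..b}" using x by auto
  have i: "x powr (\<nu> - 1/2) * x powr (1/2 - \<nu>) = 1" "x powr (\<nu> + 1/2) * x powr (- 1/2 - \<nu>) = 1"
   using x by (simp_all add: powr_add[symmetric])
  have "\<bar>y x\<bar> = \<bar>y x * x powr (\<nu> - 1/2)\<bar> * x powr (1/2 - \<nu>)"
   using i(1) by (simp add: abs_mult mult.assoc)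
  also have "\<dots> \<le> C * x powr (1/2 - \<nu>)" using C3(2)[OF xx] C by (intro mult_right_mono) auto
  finally have 1: "\<bar>y x\<bar> \<le> C * x powr (1/2 - \<nu>)" .
  have "\<bar>y' x\<bar> = \<bar>y' x * x powr (\<nu> + 1/2)\<bar> * x powr (- 1/2 - \<nu>)"
   using i(2) x by (simp only: abs_mult mult.assoc) (simp add: abs_mult)
  also have "\<dots> \<le> C * x powr (- 1/2 - \<nu>)" using C4(2)[OF xx] C by (intro mult_right_mono) auto
  finally show ?thesis using 1 by simp
 qed
 then show thesis using that C(5) by blast
qed

text \<open>The Wronskian can be rewritten through the boundary expressions of u and y. For u the
  leading power cancels, for y the limit is assumed to be 0, and the growth bounds keep the
  cofactors under control.\<close>

lemma wronskian_zero_of_boundary: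
 assumes y: "solves y y'" and w: "\<And>x. x \<in> {0<..b} \<Longrightarrow> u x * y' x - u' x * y x = w"
  and bc: "((\<lambda>x. x powr (\<nu> - 1/2) * ((\<nu> + 1/2) * y x - x * y' x)) \<longlongrightarrow> 0) (at_right 0)"
 shows "w = 0"
proof -
 obtain C where C: "C > 0" "\<And>x. x \<in> {0<..b} \<Longrightarrow> \<bar>y x\<bar> \<le> C * x powr (1/2 - \<nu>)"
  using solves_growth[OF y] by metis
 define By where "By x = x powr (\<nu> - 1/2) * ((\<nu> + 1/2) * y x - x * y' x)" for x
 have le: "\<bar>w\<bar> \<le> C * (\<nu> + 3/2) * \<omega> x + Bu * \<bar>By x\<bar>" if x: "x \<in> {0<..b}" for x
 proof -
  have x0: "x > 0" using x by simp
  define P where "P = x powr (\<nu> + 1/2)"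
  have P: "P > 0" "P = x * x powr (\<nu> - 1/2)" using x0 powr_half_nu[OF x0, of \<nu>] by (auto simp: P_def)
  have py: "P * x powr (1/2 - \<nu>) = x" unfolding P(2) using x0 by (simp add: powr_add[symmetric] mult.assoc)
  \<comment> \<open>The terms with (\<nu>+1/2) u y cancel, which leaves the Wronskian times
    x^(\<nu>+1/2).\<close>
  have "P * w = y x * (x powr (\<nu> - 1/2) * ((\<nu> + 1/2) * u x - x * u' x)) - u x * By x"
   unfolding w[OF x, symmetric] By_def P(2) by (simp add: algebra_simps)
  then have "P * \<bar>w\<bar> \<le> \<bar>y x\<bar> * (x powr (\<nu> - 1/2) * \<bar>(\<nu> + 1/2) * u x - x * u' x\<bar>) + \<bar>u x\<bar> * \<bar>By x\<bar>"
   using P(1) abs_triangle_ineq4[of "y x * (x powr (\<nu> - 1/2) * ((\<nu> + 1/2) * u x - x * u' x))" "u x * By x"]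
   by (simp add: abs_mult) (metis abs_mult abs_of_pos)
  also have "\<dots> \<le> (C * x powr (1/2 - \<nu>)) * (x powr (\<nu> - 1/2) * ((\<nu> + 3/2) * \<omega> x * P)) + (Bu * P) * \<bar>By x\<bar>"
   using C(2)[OF x] u_boundary_form[OF x] u_bound(1)[OF x] C(1) Bu_pos unfolding P_def
   by (intro add_mono mult_mono mult_left_mono) auto
  also have "\<dots> = P * (C * (\<nu> + 3/2) * \<omega> x * (x powr (1/2 - \<nu>) * x powr (\<nu> - 1/2)) + Bu * \<bar>By x\<bar>)"
   by (simp add: algebra_simps)
  also have "x powr (1/2 - \<nu>) * x powr (\<nu> - 1/2) = 1" using x0 by (simp add: powr_add[symmetric])
  finally show ?thesis using P(1) by simp
 qed
 have "((\<lambda>x. C * (\<nu> + 3/2) * \<omega> x + Bu * \<bar>By x\<bar>) \<longlongrightarrow> C * (\<nu> + 3/2) * 0 + Bu * \<bar>0\<bar>) (at_right 0)"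
  unfolding By_def by (intro tendsto_intros om_0 bc)
 moreover have "\<forall>\<^sub>F x in at_right 0. \<bar>w\<bar> \<le> C * (\<nu> + 3/2) * \<omega> x + Bu * \<bar>By x\<bar>"
  unfolding eventually_at_right_field using b le by (intro exI[of _ b]) auto
 ultimately have "\<bar>w\<bar> \<le> C * (\<nu> + 3/2) * 0 + Bu * \<bar>0\<bar>"
  by (intro tendsto_lowerbound) auto
 then show ?thesis by simp
qed

text \<open>A nonzero Wronskian makes |y| at least a multiple of x^(1/2-\<nu>) near 0. For \<nu> at
  least 1 this dominates x^(-1/2), whose square is not integrable: the limit-point case.\<close>

lemma wronskian_zero_of_L2:
 assumes y: "solves y y'" and w: "\<And>x. x \<in> {0<..b} \<Longrightarrow> u x * y' x - u' x * y x = w"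
  and nu1: "\<nu> \<ge> 1" and L2: "integrable (lb b) (\<lambda>x. (y x)\<^sup>2)"
 shows "w = 0"
proof (rule ccontr)
 assume w0: "w \<noteq> 0"
 define k where "k = \<bar>w\<bar> / (4 * L\<^sup>2)"
 have k: "k > 0" using w0 L by (simp add: k_def)
 define G where "G x = x powr (- 2 * \<nu>) / (2 * \<nu>)" for x :: real
 define M where "M = \<bar>y x0 / u x0\<bar> + k * G x0"
 have lower: "k * G x - M \<le> \<bar>y x / u x\<bar>" if x: "0 < x" "x \<le> x0" for x
 proof -
  have "sgn w * (y x / u x) + k * G x \<le> sgn w * (y x0 / u x0) + k * G x0"
  proof (rule DERIV_nonneg_imp_nondecreasing[OF x(2)])
   fix s assume "x \<le> s" "s \<le> x0"
   then have s: "0 < s" "s \<le> x0" using x by auto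
   have "((\<lambda>s. sgn w * (y s / u s) + k * G s) has_real_derivative sgn w * (w / (u s)\<^sup>2) + k * - (s powr (- 2 * \<nu> - 1))) (at s)"
    unfolding G_def by (intro DERIV_add DERIV_cmult quotient_deriv(1)[OF y w s] quotient_deriv(4)[OF y w s])
   moreover have "sgn w * (w / (u s)\<^sup>2) + k * - (s powr (- 2 * \<nu> - 1)) \<ge> 0"
   proof -
    have "sgn w * w = \<bar>w\<bar>" by (simp add: abs_sgn mult.commute)
    moreover have "sgn w * (w / (u s)\<^sup>2) = (sgn w * w) * (1 / (u s)\<^sup>2)" by (simp only: times_divide_eq_right mult_1_right)
    ultimately have e3: "sgn w * (w / (u s)\<^sup>2) = \<bar>w\<bar> * (1 / (u s)\<^sup>2)" by simp
    moreover have "\<bar>w\<bar> * (1 / (4 * L\<^sup>2) * s powr (- 2 * \<nu> - 1)) \<le> \<bar>w\<bar> * (1 / (u s)\<^sup>2)"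
     by (intro mult_left_mono quotient_deriv(2)[OF y w s]) auto
    ultimately show ?thesis unfolding e3 k_def by simp
   qed
   ultimately show "\<exists>d. ((\<lambda>s. sgn w * (y s / u s) + k * G s) has_real_derivative d) (at s) \<and> 0 \<le> d" by blast
  qed
  moreover have "\<bar>sgn w * (y x / u x)\<bar> = \<bar>y x / u x\<bar>" "\<bar>sgn w * (y x0 / u x0)\<bar> = \<bar>y x0 / u x0\<bar>"
   using w0 by (simp_all add: abs_mult abs_sgn_eq)
  ultimately show ?thesis unfolding M_def by linarith
 qed
 have M: "M \<ge> 0" unfolding M_def G_def using k nu by simp
 \<comment> \<open>Small enough for k G to exceed 2 M, so that half of k G survives the subtraction
   of M; the bound by 1 allows the comparison of powers of x.\<close>
 define x1 where "x1 = min (min x0 1) (((2 * M + 1) / k * (2 * \<nu>)) powr (- 1 / (2 * \<nu>)))"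
 have base: "(2 * M + 1) / k * (2 * \<nu>) > 0" using M k nu by (intro mult_pos_pos divide_pos_pos) auto
 have x1: "x1 > 0" "x1 \<le> x0" "x1 \<le> 1" unfolding x1_def using x0 base by auto
 define c where "c = L * k / (8 * \<nu>)"
 have c: "c > 0" using L k nu by (simp add: c_def)
 have ylow: "c\<^sup>2 / x \<le> (y x)\<^sup>2" if x: "0 < x" "x \<le> x1" for x
 proof -
  have xx: "x \<le> x0" "x \<le> 1" using x x1 by auto
  have "2 * M \<le> k * G x"
  proof -
   have "x \<le> ((2 * M + 1) / k * (2 * \<nu>)) powr (- 1 / (2 * \<nu>))" using x unfolding x1_def by simp
   then have "(((2 * M + 1) / k * (2 * \<nu>)) powr (- 1 / (2 * \<nu>))) powr (- 2 * \<nu>) \<le> x powr (- 2 * \<nu>)"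
    using nu x by (intro powr_mono2') auto
   moreover have "- 1 / (2 * \<nu>) * (- 2 * \<nu>) = 1" using nu by simp
   ultimately have "(2 * M + 1) / k * (2 * \<nu>) \<le> x powr (- 2 * \<nu>)"
    using powr_one[OF less_imp_le[OF base]] by (simp only: powr_powr)
   then have "k * ((2 * M + 1) / k * (2 * \<nu>) / (2 * \<nu>)) \<le> k * G x"
    unfolding G_def using nu k by (intro mult_left_mono divide_right_mono) auto
   then show ?thesis using k nu by simp
  qed
  then have h: "k * G x / 2 \<le> \<bar>y x / u x\<bar>" using lower[OF x(1) xx(1)] by linarith
  have "(k * G x / 2) * (L / 2 * x powr (\<nu> + 1/2)) \<le> \<bar>y x / u x\<bar> * u x"
   using h u_near_zero[OF x(1) xx(1)] L k nu by (intro mult_mono) (auto simp: G_def)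
  also have "\<bar>y x / u x\<bar> * u x = \<bar>y x\<bar>" using u_near_zero[OF x(1) xx(1)] by (simp add: abs_mult)
  also have "(k * G x / 2) * (L / 2 * x powr (\<nu> + 1/2)) = c * (x powr (- 2 * \<nu>) * x powr (\<nu> + 1/2))"
   by (simp add: G_def c_def)
  also have "x powr (- 2 * \<nu>) * x powr (\<nu> + 1/2) = x powr (1/2 - \<nu>)" by (simp add: powr_add[symmetric])
  finally have 1: "c * x powr (1/2 - \<nu>) \<le> \<bar>y x\<bar>" .
  have "x powr (- 1/2) \<le> x powr (1/2 - \<nu>)" using x xx nu1 by (intro powr_mono') auto
  then have "c * x powr (- 1/2) \<le> \<bar>y x\<bar>" using 1 c by (meson mult_left_mono order_trans less_imp_le)
  then have "(c * x powr (- 1/2))\<^sup>2 \<le> \<bar>y x\<bar>\<^sup>2" using c by (intro power_mono) auto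
  moreover have "(x powr (- 1/2))\<^sup>2 = 1 / x" using x by (simp add: powr_power powr_minus_divide powr_half_sqrt power_divide)
  ultimately show ?thesis by (simp add: power_mult_distrib)
 qed
 define I where "I = integral\<^sup>L (lb b) (\<lambda>x. (y x)\<^sup>2)"
 have I: "c\<^sup>2 * (ln x1 - ln e) \<le> I" if e: "0 < e" "e \<le> x1" for e
 proof -
  have x1b: "x1 \<le> b" using x1 x0 by simp
  have "((\<lambda>x. c\<^sup>2 / x) has_integral c\<^sup>2 * ln x1 - c\<^sup>2 * ln e) {e..x1}"
  proof (rule fundamental_theorem_of_calculus)
   fix x assume "x \<in> {e..x1}"
   then have "((\<lambda>x. c\<^sup>2 * ln x) has_real_derivative c\<^sup>2 / x) (at x within {e..x1})"
    using e by (auto intro!: derivative_eq_intros)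
   then show "((\<lambda>x. c\<^sup>2 * ln x) has_vector_derivative c\<^sup>2 / x) (at x within {e..x1})"
    by (simp add: has_real_derivative_iff_has_vector_derivative)
  qed (use e in auto)
  moreover have "((\<lambda>x. (y x)\<^sup>2) has_integral integral {e..x1} (\<lambda>x. (y x)\<^sup>2)) {e..x1}"
  proof -
   have "continuous_on {e..x1} y"
    by (rule continuous_on_subset[OF solves_cont(1)[OF y]]) (use e x1b in auto)
   then show ?thesis by (intro integrable_integral integrable_continuous_interval continuous_intros)
  qed
  ultimately have "c\<^sup>2 * ln x1 - c\<^sup>2 * ln e \<le> integral {e..x1} (\<lambda>x. (y x)\<^sup>2)"
   by (rule has_integral_le) (use ylow e in auto)
  also have "\<dots> = integral\<^sup>L (lb b) (\<lambda>x. indicator {e..x1} x *\<^sub>R (y x)\<^sup>2)"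
   using integral_lb_indicator(2)[OF L2, of e x1] e x1b by simp
  also have "\<dots> \<le> I" unfolding I_def
   using integral_lb_indicator(1)[OF L2, of e x1] L2 e x1b
   by (intro integral_mono) (auto simp: indicator_def)
  finally show ?thesis by (simp add: algebra_simps)
 qed
 have I0: "I \<ge> 0" unfolding I_def by (rule Bochner_Integration.integral_nonneg) simp
 \<comment> \<open>Chosen so that the logarithmic lower bound on [e,x1] equals I + 1, which exceeds
   the integral over the whole interval.\<close>
 define e where "e = x1 * exp (- ((I + 1) / c\<^sup>2))"
 have "0 < e" "e \<le> x1" using x1 I0 by (auto simp: e_def intro!: mult_left_le)
 from I[OF this] have "c\<^sup>2 * ((I + 1) / c\<^sup>2) \<le> I" using x1 by (simp add: e_def ln_mult)
 then show False using c by simp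
qed

text \<open>The domain condition at 0, square integrability for \<nu> at least 1 and the vanishing
  boundary expression for \<nu> below 1, singles out the multiples of u.\<close>

lemma solves_unique:
 assumes y: "solves y y'" and L2: "integrable (lb b) (\<lambda>x. (y x)\<^sup>2)"
  and bc: "\<nu> < 1 \<Longrightarrow> ((\<lambda>x. x powr (\<nu> - 1/2) * ((\<nu> + 1/2) * y x - x * y' x)) \<longlongrightarrow> 0) (at_right 0)"
 obtains k where "\<And>x. x \<in> {0<..b} \<Longrightarrow> y x = k * u x" "\<And>x. x \<in> {0<..b} \<Longrightarrow> y' x = k * u' x"
proof -
 obtain w where w: "\<And>x. x \<in> {0<..b} \<Longrightarrow> u x * y' x - u' x * y x = w"
  using wronskian_const[OF u_solves y] by auto
 have "w = 0"
  using wronskian_zero_of_boundary[OF y w bc] wronskian_zero_of_L2[OF y w _ L2] by (cases "\<nu> < 1") auto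
 then show thesis using wronskian_zero[OF y, of b] w[of b] b that by auto
qed

end

text \<open>The integral is taken from b because h need not be integrable at 0.\<close>

lemma antiderivative_from_right:
 fixes h :: "real \<Rightarrow> real"
 assumes h: "continuous_on {0<..b} h" and x: "x \<in> {0<..b}"
 shows "((\<lambda>x. c - integral {x..b} h) has_real_derivative h x) (at x within {0<..b})"
proof -
 have x': "0 < x / 2" "x / 2 < x" "x \<le> b" using x by auto
 have ch: "continuous_on {x / 2..b} h" by (rule continuous_on_subset[OF h]) (use x' in auto)
 have d: "((\<lambda>y. integral {x / 2..y} h) has_real_derivative h x) (at x within {x / 2..b})"
  by (rule integral_has_real_derivative[OF ch]) (use x' in auto)
 have "((\<lambda>x. c - integral {x..b} h) has_real_derivative h x) (at x within {x / 2..b})"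
  unfolding has_real_derivative_iff_has_vector_derivative
 proof (rule has_vector_derivative_transform[where f="\<lambda>y. c - integral {x / 2..b} h + integral {x / 2..y} h"])
  show "((\<lambda>y. c - integral {x / 2..b} h + integral {x / 2..y} h) has_vector_derivative h x) (at x within {x / 2..b})"
   using DERIV_add[OF DERIV_const d] unfolding has_real_derivative_iff_has_vector_derivative by simp
  fix y assume y: "y \<in> {x / 2..b}"
  have "integral {x / 2..y} h + integral {y..b} h = integral {x / 2..b} h"
   by (rule Henstock_Kurzweil_Integration.integral_combine) (use y ch in \<open>auto intro: integrable_continuous_interval\<close>)
  then show "c - integral {y..b} h = c - integral {x / 2..b} h + integral {x / 2..y} h" by simp
 qed (use x' in auto)
 moreover have "at x within {x / 2..b} = at x within {0<..b}"
  by (rule at_within_nhd[where S="{x / 2<..}"]) (use x' in auto)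
 ultimately show ?thesis by simp
qed

section \<open>The Green operator\<close>

text \<open>The extra assumption says that u violates the boundary condition at b: 0 is not an
  eigenvalue of the operator with coefficient Q, and the inverse can be constructed.\<close>

locale sl_green = sl_solution +
 fixes \<alpha> \<beta> :: real
 assumes D: "\<alpha> * u b + \<beta> * u' b \<noteq> 0"
begin

definition rho where "rho x = (u x)\<^sup>2 + (u' x)\<^sup>2"

lemma rho_pos: "x \<in> {0<..b} \<Longrightarrow> rho x > 0"
proof (rule ccontr)
 assume x: "x \<in> {0<..b}" and "\<not> rho x > 0"
 then have "u x = 0" "u' x = 0" unfolding rho_def by (auto simp: not_less sum_power2_le_zero_iff)
 from ode_zero[OF u_solves x this, of x0] show False using u_near_zero[of x0] x0 by simp
qed

definition hh where "hh x = (1 + Q x) * ((u x)\<^sup>2 - (u' x)\<^sup>2) / (rho x)\<^sup>2"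

lemma u_cont: "continuous_on {0<..b} u" "continuous_on {0<..b} u'"
 using solves_cont[OF u_solves] by auto

lemma rho_cont: "continuous_on {0<..b} rho"
 unfolding rho_def[abs_def] by (intro continuous_intros u_cont)

lemma hh_cont: "continuous_on {0<..b} hh"
 unfolding hh_def[abs_def] by (intro continuous_intros u_cont rho_cont Q_cont) (use rho_pos in force)

text \<open>The value of \<open>gg\<close> at b that makes \<open>chi\<close> satisfy the boundary
  condition there; the denominator does not vanish because u violates that condition.\<close>

definition gb where "gb = (\<alpha> * u' b - \<beta> * u b) / (rho b * (\<alpha> * u b + \<beta> * u' b))"

definition gg where "gg x = gb - integral {x..b} hh"

definition chi where "chi x = gg x * u x - u' x / rho x"
definition chi' where "chi' x = gg x * u' x + u x / rho x"

lemma rho_der: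
 assumes x: "x \<in> {0<..b}"
 shows "(rho has_real_derivative 2 * u x * u' x * (1 + Q x)) (at x within {0<..b})"
 unfolding rho_def[abs_def]
 by (rule derivative_eq_intros u_der u'_der x refl)+ (simp add: algebra_simps)

text \<open>The reduction of order \<open>u * \<integral> 1 / u\<^sup>2\<close> breaks down at zeros of \<open>u\<close>; moving in the phase plane
 along the direction orthogonal to \<open>(u, u')\<close> avoids this, at the price of the factor \<open>hh\<close>.\<close>

lemma chi_solves: "solves chi chi'"
 unfolding solves_def
proof (intro ballI conjI)
 fix x assume x: "x \<in> {0<..b}"
 have r: "rho x \<noteq> 0" using rho_pos[OF x] by simp
 have g: "(gg has_real_derivative hh x) (at x within {0<..b})"
  unfolding gg_def[abs_def] by (rule antiderivative_from_right[OF hh_cont x])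
 have "(chi has_real_derivative hh x * u x + u' x * gg x - (Q x * u x * rho x - u' x * (2 * u x * u' x * (1 + Q x))) / (rho x * rho x)) (at x within {0<..b})"
  unfolding chi_def[abs_def] by (intro DERIV_diff DERIV_mult DERIV_divide g u_der u'_der rho_der x r)
 moreover have "hh x * u x + u' x * gg x - (Q x * u x * rho x - u' x * (2 * u x * u' x * (1 + Q x))) / (rho x * rho x) = chi' x"
 proof -
  have "hh x * u x - (Q x * u x * rho x - u' x * (2 * u x * u' x * (1 + Q x))) / (rho x * rho x)
    = u x * ((1 + Q x) * ((u x)\<^sup>2 - (u' x)\<^sup>2) - Q x * rho x + 2 * (u' x)\<^sup>2 * (1 + Q x)) / (rho x)\<^sup>2"
   unfolding hh_def by (simp add: diff_divide_distrib add_divide_distrib power2_eq_square algebra_simps)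
  also have "(1 + Q x) * ((u x)\<^sup>2 - (u' x)\<^sup>2) - Q x * rho x + 2 * (u' x)\<^sup>2 * (1 + Q x) = rho x"
   unfolding rho_def by (simp add: algebra_simps)
  finally show ?thesis using r by (simp add: chi'_def power2_eq_square)
 qed
 ultimately show "(chi has_real_derivative chi' x) (at x within {0<..b})" by simp
 have "(chi' has_real_derivative hh x * u' x + Q x * u x * gg x + (u' x * rho x - u x * (2 * u x * u' x * (1 + Q x))) / (rho x * rho x)) (at x within {0<..b})"
  unfolding chi'_def[abs_def] by (intro DERIV_add DERIV_mult DERIV_divide g u_der u'_der rho_der x r)
 moreover have "hh x * u' x + Q x * u x * gg x + (u' x * rho x - u x * (2 * u x * u' x * (1 + Q x))) / (rho x * rho x) = Q x * chi x"
 proof -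
  have "hh x * u' x + (u' x * rho x - u x * (2 * u x * u' x * (1 + Q x))) / (rho x * rho x)
    = u' x * ((1 + Q x) * ((u x)\<^sup>2 - (u' x)\<^sup>2) + rho x - 2 * (u x)\<^sup>2 * (1 + Q x)) / (rho x)\<^sup>2"
   unfolding hh_def by (simp add: diff_divide_distrib add_divide_distrib power2_eq_square algebra_simps)
  also have "(1 + Q x) * ((u x)\<^sup>2 - (u' x)\<^sup>2) + rho x - 2 * (u x)\<^sup>2 * (1 + Q x) = - Q x * rho x"
   unfolding rho_def by (simp add: algebra_simps)
  finally show ?thesis using r by (simp add: chi_def power2_eq_square algebra_simps)
 qed
 ultimately show "(chi' has_real_derivative Q x * chi x) (at x within {0<..b})" by simp
qed

lemma chi_wronskian: "x \<in> {0<..b} \<Longrightarrow> u x * chi' x - u' x * chi x = 1"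
proof -
 assume x: "x \<in> {0<..b}"
 have "u x * chi' x - u' x * chi x = (u x * u x + u' x * u' x) / rho x"
  by (simp add: chi_def chi'_def add_divide_distrib algebra_simps)
 also have "u x * u x + u' x * u' x = rho x" by (simp add: rho_def power2_eq_square)
 finally show ?thesis using rho_pos[OF x] by simp
qed

lemma chi_boundary: "\<alpha> * chi b + \<beta> * chi' b = 0"
proof -
 have r: "rho b \<noteq> 0" using rho_pos[of b] b by simp
 have "\<alpha> * chi b + \<beta> * chi' b = gb * (\<alpha> * u b + \<beta> * u' b) - (\<alpha> * u' b - \<beta> * u b) / rho b"
  by (simp add: chi_def chi'_def gg_def diff_divide_distrib algebra_simps)
 then show ?thesis using D r by (simp add: gb_def)
qed

definition Cc where "Cc = (SOME C. C > 0 \<and> (\<forall>x\<in>{0<..b}. \<bar>chi x\<bar> \<le> C * x powr (1/2 - \<nu>) \<and> \<bar>chi' x\<bar> \<le> C * x powr (- 1/2 - \<nu>)))"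

lemma Cc: "Cc > 0" "x \<in> {0<..b} \<Longrightarrow> \<bar>chi x\<bar> \<le> Cc * x powr (1/2 - \<nu>)" "x \<in> {0<..b} \<Longrightarrow> \<bar>chi' x\<bar> \<le> Cc * x powr (- 1/2 - \<nu>)"
proof -
 have "\<exists>C. C > 0 \<and> (\<forall>x\<in>{0<..b}. \<bar>chi x\<bar> \<le> C * x powr (1/2 - \<nu>) \<and> \<bar>chi' x\<bar> \<le> C * x powr (- 1/2 - \<nu>))"
  using solves_growth[OF chi_solves] by metis
 from someI_ex[OF this] show "Cc > 0" "x \<in> {0<..b} \<Longrightarrow> \<bar>chi x\<bar> \<le> Cc * x powr (1/2 - \<nu>)" "x \<in> {0<..b} \<Longrightarrow> \<bar>chi' x\<bar> \<le> Cc * x powr (- 1/2 - \<nu>)"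
  unfolding Cc_def by blast+
qed

text \<open>The Green kernel up to sign: \<open>chi\<close>, which fits the condition at b, takes
  the larger argument and \<open>u\<close>, which fits the one at 0, the smaller. No normalizing
  factor appears since their Wronskian is 1.\<close>

definition kern where "kern x y = (if y \<le> x then chi x * u y else u x * chi y)"
definition kern' where "kern' x y = (if y \<le> x then chi' x * u y else u' x * chi y)"

definition Ck where "Ck = Cc * Bu"

lemma Ck_pos: "Ck > 0" by (simp add: Ck_def Cc Bu_pos)

lemma kern_sym: "kern x y = kern y x" by (auto simp: kern_def)

text \<open>The kernel is of order min^(1/2+\<nu>) max^(1/2-\<nu>), and replacing min^\<nu> by
  max^\<nu> symmetrizes this to sqrt x sqrt y. The bound is square integrable and vanishes at 0,
  which the compactness argument uses.\<close>

lemma kern_bound: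
 assumes x: "x \<in> {0<..b}" and y: "y \<in> {0<..b}"
 shows "\<bar>kern x y\<bar> \<le> Ck * (sqrt x * sqrt y)" "\<bar>kern' x y\<bar> \<le> Ck * (sqrt y / sqrt x)"
proof -
 have x0: "x > 0" "y > 0" using x y by auto
 have s: "sqrt x = x powr (1/2)" "sqrt y = y powr (1/2)" using x0 by (simp_all add: powr_half_sqrt)
 have Cpos: "Cc \<ge> 0" "Bu \<ge> 0" using Cc(1) Bu_pos by auto
 have "\<bar>kern x y\<bar> \<le> Ck * (sqrt x * sqrt y) \<and> \<bar>kern' x y\<bar> \<le> Ck * (sqrt y / sqrt x)"
 proof (cases "y \<le> x")
  case True
  have p: "y powr \<nu> \<le> x powr \<nu>" using True x0 nu by (intro powr_mono2) auto
  have "\<bar>chi x * u y\<bar> \<le> (Cc * x powr (1/2 - \<nu>)) * (Bu * y powr (\<nu> + 1/2))"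
   unfolding abs_mult using Cc(2)[OF x] u_bound(1)[OF y] Cpos by (intro mult_mono) auto
  also have "\<dots> = Ck * (x powr (1/2 - \<nu>) * (y powr \<nu> * y powr (1/2)))" by (simp add: Ck_def powr_add)
  also have "\<dots> \<le> Ck * (x powr (1/2 - \<nu>) * (x powr \<nu> * y powr (1/2)))"
   using p Ck_pos by (intro mult_left_mono mult_right_mono) auto
  also have "x powr (1/2 - \<nu>) * (x powr \<nu> * y powr (1/2)) = (x powr (1/2 - \<nu>) * x powr \<nu>) * y powr (1/2)" by simp
  also have "x powr (1/2 - \<nu>) * x powr \<nu> = x powr (1/2)" by (simp add: powr_add[symmetric])
  finally have 1: "\<bar>chi x * u y\<bar> \<le> Ck * (sqrt x * sqrt y)" by (simp add: s)
  have "\<bar>chi' x * u y\<bar> \<le> (Cc * x powr (- 1/2 - \<nu>)) * (Bu * y powr (\<nu> + 1/2))"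
   unfolding abs_mult using Cc(3)[OF x] u_bound(1)[OF y] Cpos by (intro mult_mono) auto
  also have "\<dots> = Ck * (x powr (- 1/2 - \<nu>) * (y powr \<nu> * y powr (1/2)))" by (simp add: Ck_def powr_add)
  also have "\<dots> \<le> Ck * (x powr (- 1/2 - \<nu>) * (x powr \<nu> * y powr (1/2)))"
   using p Ck_pos by (intro mult_left_mono mult_right_mono) auto
  also have "x powr (- 1/2 - \<nu>) * (x powr \<nu> * y powr (1/2)) = (x powr (- 1/2 - \<nu>) * x powr \<nu>) * y powr (1/2)" by simp
  also have "x powr (- 1/2 - \<nu>) * x powr \<nu> = x powr (- (1/2))" by (simp add: powr_add[symmetric])
  finally have "\<bar>chi' x * u y\<bar> \<le> Ck * (sqrt y / sqrt x)" unfolding s by (simp add: powr_minus_divide)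
  then show ?thesis using 1 True by (simp add: kern_def kern'_def)
 next
  case False
  then have p: "x powr \<nu> \<le> y powr \<nu>" using x0 nu by (intro powr_mono2) auto
  have yy: "y powr (1/2 - \<nu>) * y powr \<nu> = y powr (1/2)" by (simp add: powr_add[symmetric])
  have "\<bar>u x * chi y\<bar> \<le> (Bu * x powr (\<nu> + 1/2)) * (Cc * y powr (1/2 - \<nu>))"
   unfolding abs_mult using Cc(2)[OF y] u_bound(1)[OF x] Cpos by (intro mult_mono) auto
  also have "\<dots> = Ck * (x powr (1/2) * (y powr (1/2 - \<nu>) * x powr \<nu>))" by (simp add: Ck_def powr_add)
  also have "\<dots> \<le> Ck * (x powr (1/2) * (y powr (1/2 - \<nu>) * y powr \<nu>))"
   using p Ck_pos by (intro mult_left_mono) auto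
  finally have 1: "\<bar>u x * chi y\<bar> \<le> Ck * (sqrt x * sqrt y)" unfolding yy by (simp add: s)
  have xm: "x powr (\<nu> - 1/2) = x powr (- (1/2)) * x powr \<nu>" by (simp add: powr_add[symmetric])
  have "\<bar>u' x * chi y\<bar> \<le> (Bu * x powr (\<nu> - 1/2)) * (Cc * y powr (1/2 - \<nu>))"
   unfolding abs_mult using Cc(2)[OF y] u_bound(2)[OF x] Cpos by (intro mult_mono) auto
  also have "\<dots> = Ck * (x powr (- (1/2)) * (y powr (1/2 - \<nu>) * x powr \<nu>))" unfolding xm by (simp add: Ck_def)
  also have "\<dots> \<le> Ck * (x powr (- (1/2)) * (y powr (1/2 - \<nu>) * y powr \<nu>))"
   using p Ck_pos by (intro mult_left_mono) auto
  finally have "\<bar>u' x * chi y\<bar> \<le> Ck * (sqrt y / sqrt x)" unfolding yy s by (simp add: powr_minus_divide)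
  then show ?thesis using 1 False by (simp add: kern_def kern'_def)
 qed
 then show "\<bar>kern x y\<bar> \<le> Ck * (sqrt x * sqrt y)" "\<bar>kern' x y\<bar> \<le> Ck * (sqrt y / sqrt x)" by auto
qed

lemma chi_cont: "continuous_on {0<..b} chi" "continuous_on {0<..b} chi'"
 using solves_cont[OF chi_solves] by auto

abbreviation "M \<equiv> lb b"

lemma space_M: "space M = {0<..<b}" by (simp add: space_restrict_space)

lemma mM [measurable]: "u \<in> borel_measurable M" "u' \<in> borel_measurable M" "chi \<in> borel_measurable M" "chi' \<in> borel_measurable M"
 by (intro continuous_on_lb_measurable u_cont chi_cont)+

lemma ident_M [measurable]: "(\<lambda>x. x) \<in> borel_measurable M" "sqrt \<in> borel_measurable M"
 by (rule measurable_restrict_space1; simp)+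

lemma sqrt_sq_int: "sq_int M sqrt"
 by (rule finite_measure.sq_int_bounded[OF finite_measure_lb, of _ _ "sqrt b"]) (auto simp: space_M)

lemma kern_measurable [measurable]: "kern x \<in> borel_measurable M" "kern' x \<in> borel_measurable M"
 unfolding kern_def[abs_def] kern'_def[abs_def] by measurable

lemma sqrt_phi_integrable: "sq_int M \<phi> \<Longrightarrow> integrable M (\<lambda>y. sqrt y * \<bar>\<phi> y\<bar>)"
 by (rule sq_int_mult[OF sqrt_sq_int sq_int_abs])

lemma kern_integrable:
 assumes x: "x \<in> {0<..b}" and phi: "sq_int M \<phi>"
 shows "integrable M (\<lambda>y. kern x y * \<phi> y)" "integrable M (\<lambda>y. kern' x y * \<phi> y)"
proof -
 have [measurable]: "\<phi> \<in> borel_measurable M" using phi by auto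
 show "integrable M (\<lambda>y. kern x y * \<phi> y)"
 proof (rule Bochner_Integration.integrable_bound[OF integrable_mult_right[OF sqrt_phi_integrable[OF phi], of "Ck * sqrt x"]])
  show "AE y in M. norm (kern x y * \<phi> y) \<le> norm (Ck * sqrt x * (sqrt y * \<bar>\<phi> y\<bar>))"
  proof (rule AE_I2)
   fix y assume "y \<in> space M"
   then have y: "y \<in> {0<..b}" by (auto simp: space_M)
   have "\<bar>kern x y\<bar> * \<bar>\<phi> y\<bar> \<le> (Ck * (sqrt x * sqrt y)) * \<bar>\<phi> y\<bar>" by (rule mult_right_mono[OF kern_bound(1)[OF x y]]) simp
   then show "norm (kern x y * \<phi> y) \<le> norm (Ck * sqrt x * (sqrt y * \<bar>\<phi> y\<bar>))"
    using x y Ck_pos by (simp add: abs_mult mult.assoc)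
  qed
 qed measurable
 show "integrable M (\<lambda>y. kern' x y * \<phi> y)"
 proof (rule Bochner_Integration.integrable_bound[OF integrable_mult_right[OF sqrt_phi_integrable[OF phi], of "Ck / sqrt x"]])
  show "AE y in M. norm (kern' x y * \<phi> y) \<le> norm (Ck / sqrt x * (sqrt y * \<bar>\<phi> y\<bar>))"
  proof (rule AE_I2)
   fix y assume "y \<in> space M"
   then have y: "y \<in> {0<..b}" by (auto simp: space_M)
   have "\<bar>kern' x y\<bar> * \<bar>\<phi> y\<bar> \<le> (Ck * (sqrt y / sqrt x)) * \<bar>\<phi> y\<bar>" by (rule mult_right_mono[OF kern_bound(2)[OF x y]]) simp
   then show "norm (kern' x y * \<phi> y) \<le> norm (Ck / sqrt x * (sqrt y * \<bar>\<phi> y\<bar>))"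
    using x y Ck_pos by (simp add: abs_mult)
  qed
 qed measurable
qed

definition Gr :: "(real \<Rightarrow> real) \<Rightarrow> real \<Rightarrow> real" where "Gr \<phi> x = - (\<integral>y. kern x y * \<phi> y \<partial>M)"
definition Gr' :: "(real \<Rightarrow> real) \<Rightarrow> real \<Rightarrow> real" where "Gr' \<phi> x = - (\<integral>y. kern' x y * \<phi> y \<partial>M)"

definition nrm :: "(real \<Rightarrow> real) \<Rightarrow> real" where "nrm f = sqrt (\<integral>x. (f x)\<^sup>2 \<partial>M)"

lemma nrm_nonneg: "nrm f \<ge> 0" by (simp add: nrm_def Bochner_Integration.integral_nonneg)

lemma sqrt_phi_bound: "sq_int M \<phi> \<Longrightarrow> (\<integral>y. sqrt y * \<bar>\<phi> y\<bar> \<partial>M) \<le> b * nrm \<phi>"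
proof -
 assume phi: "sq_int M \<phi>"
 have "(\<integral>y. sqrt y * \<bar>\<phi> y\<bar> \<partial>M) = (\<integral>y. \<bar>sqrt y\<bar> * \<bar>\<phi> y\<bar> \<partial>M)"
  by (rule Bochner_Integration.integral_cong) (auto simp: space_M)
 also have "\<dots> \<le> sqrt (\<integral>y. (sqrt y)\<^sup>2 \<partial>M) * nrm \<phi>"
  unfolding nrm_def by (rule integral_Cauchy_Schwarz_abs[OF sqrt_sq_int phi])
 also have "sqrt (\<integral>y. (sqrt y)\<^sup>2 \<partial>M) \<le> b"
 proof -
  have "(\<integral>y. (sqrt y)\<^sup>2 \<partial>M) \<le> (\<integral>y. b \<partial>M)"
   by (rule integral_mono) (use sqrt_sq_int finite_measure.integrable_const[OF finite_measure_lb] in \<open>auto simp: space_M sq_int_def\<close>)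
  also have "\<dots> = b * measure M (space M)" by simp
  also have "measure M (space M) = b" using b by (simp add: measure_restrict_space space_M)
  finally have "(\<integral>y. (sqrt y)\<^sup>2 \<partial>M) \<le> b\<^sup>2" by (simp add: power2_eq_square)
  then show ?thesis using b real_le_lsqrt by (simp add: real_sqrt_le_iff real_le_lsqrt)
 qed
 finally show ?thesis using nrm_nonneg[of \<phi>] by (simp add: mult_right_mono)
qed

text \<open>The first bound controls images of the unit ball near 0, the second makes them
  equi-Lipschitz away from 0.\<close>

lemma Gr_bound:
 assumes x: "x \<in> {0<..b}" and phi: "sq_int M \<phi>"
 shows "\<bar>Gr \<phi> x\<bar> \<le> Ck * b * sqrt x * nrm \<phi>" "\<bar>Gr' \<phi> x\<bar> \<le> Ck * b / sqrt x * nrm \<phi>"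
proof -
 have "\<bar>Gr \<phi> x\<bar> \<le> (\<integral>y. Ck * sqrt x * (sqrt y * \<bar>\<phi> y\<bar>) \<partial>M)"
  unfolding Gr_def abs_minus_cancel
 proof (rule order_trans[OF integral_abs_bound integral_mono])
  show "integrable M (\<lambda>y. \<bar>kern x y * \<phi> y\<bar>)" using kern_integrable(1)[OF x phi] by simp
  show "integrable M (\<lambda>y. Ck * sqrt x * (sqrt y * \<bar>\<phi> y\<bar>))" by (intro integrable_mult_right sqrt_phi_integrable phi)
  fix y assume "y \<in> space M"
  then have y: "y \<in> {0<..b}" by (auto simp: space_M)
  have "\<bar>kern x y\<bar> * \<bar>\<phi> y\<bar> \<le> (Ck * (sqrt x * sqrt y)) * \<bar>\<phi> y\<bar>" by (rule mult_right_mono[OF kern_bound(1)[OF x y]]) simp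
  then show "\<bar>kern x y * \<phi> y\<bar> \<le> Ck * sqrt x * (sqrt y * \<bar>\<phi> y\<bar>)" by (simp add: abs_mult mult.assoc)
 qed
 also have "\<dots> = Ck * sqrt x * (\<integral>y. sqrt y * \<bar>\<phi> y\<bar> \<partial>M)" by simp
 also have "\<dots> \<le> Ck * sqrt x * (b * nrm \<phi>)"
  using sqrt_phi_bound[OF phi] Ck_pos x by (intro mult_left_mono) auto
 finally show "\<bar>Gr \<phi> x\<bar> \<le> Ck * b * sqrt x * nrm \<phi>" by (simp add: mult_ac)
 have "\<bar>Gr' \<phi> x\<bar> \<le> (\<integral>y. Ck / sqrt x * (sqrt y * \<bar>\<phi> y\<bar>) \<partial>M)"
  unfolding Gr'_def abs_minus_cancel
 proof (rule order_trans[OF integral_abs_bound integral_mono])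
  show "integrable M (\<lambda>y. \<bar>kern' x y * \<phi> y\<bar>)" using kern_integrable(2)[OF x phi] by simp
  show "integrable M (\<lambda>y. Ck / sqrt x * (sqrt y * \<bar>\<phi> y\<bar>))" by (intro integrable_mult_right sqrt_phi_integrable phi)
  fix y assume "y \<in> space M"
  then have y: "y \<in> {0<..b}" by (auto simp: space_M)
  have "\<bar>kern' x y\<bar> * \<bar>\<phi> y\<bar> \<le> (Ck * (sqrt y / sqrt x)) * \<bar>\<phi> y\<bar>" by (rule mult_right_mono[OF kern_bound(2)[OF x y]]) simp
  then show "\<bar>kern' x y * \<phi> y\<bar> \<le> Ck / sqrt x * (sqrt y * \<bar>\<phi> y\<bar>)" by (simp add: abs_mult)
 qed
 also have "\<dots> = Ck / sqrt x * (\<integral>y. sqrt y * \<bar>\<phi> y\<bar> \<partial>M)" by simp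
 also have "\<dots> \<le> Ck / sqrt x * (b * nrm \<phi>)"
  using sqrt_phi_bound[OF phi] Ck_pos x by (intro mult_left_mono) auto
 finally show "\<bar>Gr' \<phi> x\<bar> \<le> Ck * b / sqrt x * nrm \<phi>" by (simp add: mult_ac)
qed

lemma Gr_linear:
 assumes "sq_int M \<phi>" "sq_int M \<psi>" "x \<in> {0<..b}"
 shows "Gr (\<lambda>y. s * \<phi> y + t * \<psi> y) x = s * Gr \<phi> x + t * Gr \<psi> x"
proof -
 have "(\<integral>y. kern x y * (s * \<phi> y + t * \<psi> y) \<partial>M) = (\<integral>y. s * (kern x y * \<phi> y) + t * (kern x y * \<psi> y) \<partial>M)"
  by (simp add: algebra_simps)
 also have "\<dots> = s * (\<integral>y. kern x y * \<phi> y \<partial>M) + t * (\<integral>y. kern x y * \<psi> y \<partial>M)"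
  using kern_integrable(1)[OF assms(3,1)] kern_integrable(1)[OF assms(3,2)] by simp
 finally show ?thesis by (simp add: Gr_def)
qed

lemma kern_pair_measurable [measurable]: "(\<lambda>(x, y). kern x y) \<in> borel_measurable (M \<Otimes>\<^sub>M M)"
 unfolding kern_def by measurable

lemma Gr_measurable:
 assumes phi: "sq_int M \<phi>" shows "Gr \<phi> \<in> borel_measurable M"
proof -
 interpret finite_measure M by (rule finite_measure_lb)
 have [measurable]: "\<phi> \<in> borel_measurable M" using phi by auto
 show ?thesis unfolding Gr_def[abs_def] by measurable
qed

lemma Gr_sq_int: "sq_int M \<phi> \<Longrightarrow> sq_int M (Gr \<phi>)"
proof -
 assume phi: "sq_int M \<phi>"
 show ?thesis
 proof (rule finite_measure.sq_int_bounded[OF finite_measure_lb Gr_measurable[OF phi], of "Ck * b * sqrt b * nrm \<phi>"])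
  fix x assume "x \<in> space M"
  then have x: "x \<in> {0<..b}" by (auto simp: space_M)
  have "Ck * b * sqrt x * nrm \<phi> \<le> Ck * b * sqrt b * nrm \<phi>"
   using x Ck_pos b nrm_nonneg[of \<phi>] by (intro mult_right_mono mult_left_mono) auto
  then show "\<bar>Gr \<phi> x\<bar> \<le> Ck * b * sqrt b * nrm \<phi>" using Gr_bound(1)[OF x phi] by linarith
 qed
qed

text \<open>Fubini and the symmetry of the kernel; the factorized kernel bound supplies the absolute
  integrability.\<close>

lemma Gr_symmetric:
 assumes phi: "sq_int M \<phi>" and psi: "sq_int M \<psi>"
 shows "(\<integral>x. Gr \<phi> x * \<psi> x \<partial>M) = (\<integral>x. \<phi> x * Gr \<psi> x \<partial>M)"
proof -
 interpret finite_measure M by (rule finite_measure_lb)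
 interpret pair_sigma_finite M M ..
 have [measurable]: "\<phi> \<in> borel_measurable M" "\<psi> \<in> borel_measurable M" using phi psi by auto
 define f where "f x y = kern x y * \<phi> y * \<psi> x" for x y
 have fm [measurable]: "(\<lambda>(x, y). f x y) \<in> borel_measurable (M \<Otimes>\<^sub>M M)" unfolding f_def by measurable
 have int: "integrable (M \<Otimes>\<^sub>M M) (\<lambda>(x, y). f x y)"
 proof (rule Fubini_integrable[OF fm])
  have "integrable M (\<lambda>x. Ck * sqrt x * \<bar>\<psi> x\<bar> * (\<integral>y. sqrt y * \<bar>\<phi> y\<bar> \<partial>M))"
   using integrable_mult_left[OF sqrt_phi_integrable[OF psi], of "Ck * (\<integral>y. sqrt y * \<bar>\<phi> y\<bar> \<partial>M)"] by (simp only: mult_ac)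
  then show "integrable M (\<lambda>x. \<integral>y. norm (case (x, y) of (x, y) \<Rightarrow> f x y) \<partial>M)"
  proof (rule Bochner_Integration.integrable_bound)
   show "AE x in M. norm (\<integral>y. norm (case (x, y) of (x, y) \<Rightarrow> f x y) \<partial>M) \<le> norm (Ck * sqrt x * \<bar>\<psi> x\<bar> * (\<integral>y. sqrt y * \<bar>\<phi> y\<bar> \<partial>M))"
   proof (rule AE_I2)
    fix x assume "x \<in> space M"
    then have x: "x \<in> {0<..b}" by (auto simp: space_M)
    have "(\<integral>y. \<bar>f x y\<bar> \<partial>M) \<le> (\<integral>y. Ck * sqrt x * \<bar>\<psi> x\<bar> * (sqrt y * \<bar>\<phi> y\<bar>) \<partial>M)"
    proof (rule integral_mono)
     show "integrable M (\<lambda>y. \<bar>f x y\<bar>)" unfolding f_def using kern_integrable(1)[OF x phi] by (intro integrable_abs integrable_mult_left)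
     show "integrable M (\<lambda>y. Ck * sqrt x * \<bar>\<psi> x\<bar> * (sqrt y * \<bar>\<phi> y\<bar>))" by (intro integrable_mult_right sqrt_phi_integrable phi)
     fix y assume "y \<in> space M"
     then have y: "y \<in> {0<..b}" by (auto simp: space_M)
     have "\<bar>kern x y\<bar> * (\<bar>\<phi> y\<bar> * \<bar>\<psi> x\<bar>) \<le> (Ck * (sqrt x * sqrt y)) * (\<bar>\<phi> y\<bar> * \<bar>\<psi> x\<bar>)" by (rule mult_right_mono[OF kern_bound(1)[OF x y]]) simp
     then show "\<bar>f x y\<bar> \<le> Ck * sqrt x * \<bar>\<psi> x\<bar> * (sqrt y * \<bar>\<phi> y\<bar>)" by (simp add: f_def abs_mult mult_ac)
    qed
    moreover have "0 \<le> (\<integral>y. \<bar>f x y\<bar> \<partial>M)" by (rule Bochner_Integration.integral_nonneg) simp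
    ultimately show "norm (\<integral>y. norm (case (x, y) of (x, y) \<Rightarrow> f x y) \<partial>M) \<le> norm (Ck * sqrt x * \<bar>\<psi> x\<bar> * (\<integral>y. sqrt y * \<bar>\<phi> y\<bar> \<partial>M))"
     by simp
   qed
  qed measurable
  show "AE x in M. integrable M (\<lambda>y. case (x, y) of (x, y) \<Rightarrow> f x y)"
  proof (rule AE_I2)
   fix x assume "x \<in> space M"
   then have x: "x \<in> {0<..b}" by (auto simp: space_M)
   show "integrable M (\<lambda>y. case (x, y) of (x, y) \<Rightarrow> f x y)" unfolding f_def using kern_integrable(1)[OF x phi] by simp
  qed
 qed
 have "(\<integral>x. Gr \<phi> x * \<psi> x \<partial>M) = - (\<integral>x. (\<integral>y. f x y \<partial>M) \<partial>M)"
  by (simp add: Gr_def f_def)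
 also have "(\<integral>x. (\<integral>y. f x y \<partial>M) \<partial>M) = (\<integral>y. (\<integral>x. f x y \<partial>M) \<partial>M)"
  using Fubini_integral[OF int] by simp
 also have "\<dots> = (\<integral>y. \<phi> y * (\<integral>x. kern y x * \<psi> x \<partial>M) \<partial>M)"
 proof (rule Bochner_Integration.integral_cong[OF refl])
  fix y
  have "(\<integral>x. f x y \<partial>M) = (\<integral>x. \<phi> y * (kern y x * \<psi> x) \<partial>M)"
   by (rule Bochner_Integration.integral_cong) (auto simp: f_def kern_sym[of _ y])
  then show "(\<integral>x. f x y \<partial>M) = \<phi> y * (\<integral>x. kern y x * \<psi> x \<partial>M)" by simp
 qed
 finally show ?thesis by (simp add: Gr_def)
qed

end

section \<open>Regularity, boundary values and inverse property of the Green operator\<close>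

text \<open>The difference of f and the primitive of g is absolutely continuous with derivative 0
  almost everywhere, hence constant. This upgrades derivatives almost everywhere to derivatives at
  every point, endpoints included.\<close>

lemma AC_on_continuous_derivative:
 fixes f g :: "real \<Rightarrow> 'a::euclidean_space"
 assumes f: "AC_on f c d" and g: "continuous_on {c..d} g" and N: "negligible N"
  and der: "\<And>x. x \<in> {c<..<d} - N \<Longrightarrow> (f has_vector_derivative g x) (at x)"
  and x: "x \<in> {c..d}"
 shows "(f has_vector_derivative g x) (at x within {c..d})"
proof -
 define I where "I y = integral {c..y} g" for y
 have dI: "(I has_vector_derivative g y) (at y within {c..d})" if "y \<in> {c..d}" for y
  unfolding I_def by (rule integral_has_vector_derivative[OF g that])
 have acI: "AC_on I c d" by (rule AC_on_C1[OF dI g])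
 have eq: "f y - I y = f c - I c" if y: "y \<in> {c..d}" for y
 proof (rule AC_on_zero_derivative[where N="N \<union> {c, y}"])
  show "AC_on (\<lambda>y. f y - I y) c y" by (rule AC_on_subinterval[OF AC_on_diff[OF f acI]]) (use y in auto)
  show "negligible (N \<union> {c, y})" using N by simp
  fix s assume s: "s \<in> {c..y} - (N \<union> {c, y})"
  have sub: "{c..y} \<subseteq> {c..d}" using y by auto
  have "(f has_vector_derivative g s) (at s within {c..y})"
   by (rule has_vector_derivative_at_within[OF der]) (use s y in auto)
  moreover have "(I has_vector_derivative g s) (at s within {c..y})"
   by (rule has_vector_derivative_within_subset[OF dI sub]) (use s y in auto)
  ultimately show "((\<lambda>y. f y - I y) has_vector_derivative 0) (at s within {c..y})"
   using has_vector_derivative_diff by fastforce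
 qed (use y in auto)
 have "((\<lambda>y. f c - I c + I y) has_vector_derivative g x) (at x within {c..d})"
  using has_vector_derivative_add[OF has_vector_derivative_const dI[OF x]] by simp
 then show ?thesis
  by (rule has_vector_derivative_transform[OF x, rotated]) (use eq in \<open>simp add: algebra_simps\<close>)
qed

context sl_green
begin

lemma at_within_left:
 assumes "0 < c" "c < x" "x \<le> b"
 shows "at x within {c..b} = at x within {0<..b}"
 by (rule at_within_nhd[where S="{c<..}"]) (use assms in auto)

lemma u_sq_int: "sq_int M u"
proof (rule finite_measure.sq_int_bounded[OF finite_measure_lb mM(1), of "Bu * b powr (\<nu> + 1/2)"])
 fix x assume "x \<in> space M"
 then have x: "x \<in> {0<..b}" by (auto simp: space_M)
 have "Bu * x powr (\<nu> + 1/2) \<le> Bu * b powr (\<nu> + 1/2)"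
  using x nu Bu_pos by (intro mult_left_mono powr_mono2) auto
 then show "\<bar>u x\<bar> \<le> Bu * b powr (\<nu> + 1/2)" using u_bound(1)[OF x] by linarith
qed

text \<open>Variation of parameters: on [c,b] the Green integral is a combination of
  \<open>chi\<close> and \<open>u\<close> whose coefficients are primitives of the products u \<phi>
  and chi \<phi>.\<close>

lemma Gr_rep:
 assumes c: "0 < c" "c < b" and phi: "sq_int M \<phi>"
 obtains T A E N where "negligible N" "AC_on A 0 b" "AC_on E 0 b" "continuous_on {0..b} A" "continuous_on {0..b} E"
  "E b = T"
  "\<And>x. x \<in> {c..b} \<Longrightarrow> Gr \<phi> x = - (chi x * A x + u x * (T - E x))"
  "\<And>x. x \<in> {c..b} \<Longrightarrow> Gr' \<phi> x = - (chi' x * A x + u' x * (T - E x))"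
  "\<And>x. x \<in> {c<..<b} - N \<Longrightarrow> (A has_real_derivative u x * \<phi> x) (at x)"
  "\<And>x. x \<in> {c<..<b} - N \<Longrightarrow> (E has_real_derivative chi x * \<phi> x) (at x)"
proof -
 \<comment> \<open>Near 0 \<open>chi\<close> may fail to be square integrable, so it is cut off
   below c. For x at least c only E b - E x enters, where the cutoff is invisible.\<close>
 define cc where "cc x = (if x < c then 0 else chi x)" for x
 have cc_m [measurable]: "cc \<in> borel_measurable M" unfolding cc_def[abs_def] by measurable
 have "compact (chi ` {c..b})"
  by (rule compact_continuous_image[OF continuous_on_subset[OF chi_cont(1)]]) (use c in auto)
 then have "bounded (chi ` {c..b})" by (rule compact_imp_bounded)
 then obtain B' where B': "\<And>x. x \<in> {c..b} \<Longrightarrow> \<bar>chi x\<bar> \<le> B'"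
  unfolding bounded_iff by (metis image_eqI real_norm_def)
 have cc_sq: "sq_int M cc"
 proof (rule finite_measure.sq_int_bounded[OF finite_measure_lb cc_m, of "\<bar>B'\<bar>"])
  fix x assume "x \<in> space M"
  then show "\<bar>cc x\<bar> \<le> \<bar>B'\<bar>" using B'[of x] by (auto simp: cc_def space_M)
 qed
 have i1: "integrable M (\<lambda>y. u y * \<phi> y)" by (rule sq_int_mult[OF u_sq_int phi])
 have i2: "integrable M (\<lambda>y. cc y * \<phi> y)" by (rule sq_int_mult[OF cc_sq phi])
 have ai1: "(\<lambda>y. u y * \<phi> y) absolutely_integrable_on {0..b}" and ai2: "(\<lambda>y. cc y * \<phi> y) absolutely_integrable_on {0..b}"
  using lb_absolutely_integrable i1 i2 by blast+
 have h1: "(\<lambda>y. u y * \<phi> y) integrable_on {0..b}" and h2: "(\<lambda>y. cc y * \<phi> y) integrable_on {0..b}"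
  using ai1 ai2 set_lebesgue_integral_eq_integral(1) by blast+
 define A where "A x = integral {0..x} (\<lambda>y. u y * \<phi> y)" for x
 define E where "E x = integral {0..x} (\<lambda>y. cc y * \<phi> y)" for x
 obtain N1 where N1: "negligible N1" "\<And>x. x \<in> {0<..<b} - N1 \<Longrightarrow> (A has_vector_derivative u x * \<phi> x) (at x)"
  using indefinite_integral_derivative_AE[OF h1] unfolding A_def by metis
 obtain N2 where N2: "negligible N2" "\<And>x. x \<in> {0<..<b} - N2 \<Longrightarrow> (E has_vector_derivative cc x * \<phi> x) (at x)"
  using indefinite_integral_derivative_AE[OF h2] unfolding E_def by metis
 have split: "(\<integral>y. k y * \<phi> y \<partial>M) = p * A x + r * (E b - E x)"
  if x: "x \<in> {c..b}" and k: "\<And>y. k y = (if y \<le> x then p * u y else r * chi y)" for x p r and k :: "real \<Rightarrow> real"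
 proof -
  have x': "0 \<le> x" "x \<le> b" using x c by auto
  define f1 f2 f3 where "f1 y = indicator {0..x} y *\<^sub>R (u y * \<phi> y)"
   and "f2 y = indicator {0..x} y *\<^sub>R (cc y * \<phi> y)" and "f3 y = cc y * \<phi> y" for y
  have f: "integrable M f1" "integrable M f2" "integrable M f3"
   unfolding f1_def[abs_def] f2_def[abs_def] f3_def[abs_def]
   by (rule integral_lb_indicator(1)[OF i1 order_refl x'(2)], rule integral_lb_indicator(1)[OF i2 order_refl x'(2)], rule i2)
  have v: "integral\<^sup>L M f1 = A x" "integral\<^sup>L M f2 = E x" "integral\<^sup>L M f3 = E b"
   unfolding f1_def[abs_def] f2_def[abs_def] f3_def[abs_def] A_def E_def
   by (rule integral_lb_indicator(2)[OF i1 order_refl x'(2)], rule integral_lb_indicator(2)[OF i2 order_refl x'(2)], rule integral_lb_hk[OF i2])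
  have "(\<integral>y. k y * \<phi> y \<partial>M) = (\<integral>y. p * f1 y + r * (f3 y - f2 y) \<partial>M)"
   by (rule Bochner_Integration.integral_cong) (use x in \<open>auto simp: k cc_def indicator_def space_M f1_def f2_def f3_def\<close>)
  also have "\<dots> = p * A x + r * (E b - E x)" using f by (simp add: v)
  finally show ?thesis .
 qed
 show thesis
 proof (rule that[of "N1 \<union> N2" A E "E b"])
  show "negligible (N1 \<union> N2)" using N1 N2 by simp
  show "AC_on A 0 b" "AC_on E 0 b" unfolding A_def E_def by (rule AC_on_indefinite_integral[OF ai1], rule AC_on_indefinite_integral[OF ai2])
  show "continuous_on {0..b} A" "continuous_on {0..b} E" unfolding A_def E_def
   by (rule indefinite_integral_continuous_1[OF h1], rule indefinite_integral_continuous_1[OF h2])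
  fix x assume x: "x \<in> {c..b}"
  show "Gr \<phi> x = - (chi x * A x + u x * (E b - E x))" unfolding Gr_def by (subst split[OF x]) (auto simp: kern_def)
  show "Gr' \<phi> x = - (chi' x * A x + u' x * (E b - E x))" unfolding Gr'_def by (subst split[OF x]) (auto simp: kern'_def)
 next
  fix x assume x: "x \<in> {c<..<b} - (N1 \<union> N2)"
  then have xx: "x \<in> {0<..<b} - N1" "x \<in> {0<..<b} - N2" "cc x = chi x" using c by (auto simp: cc_def)
  show "(A has_real_derivative u x * \<phi> x) (at x)" using N1(2)[OF xx(1)] by (simp add: has_real_derivative_iff_has_vector_derivative)
  show "(E has_real_derivative chi x * \<phi> x) (at x)" using N2(2)[OF xx(2)] xx(3) by (simp add: has_real_derivative_iff_has_vector_derivative)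
 qed simp
qed

lemma AC_on_solves:
 assumes "solves y y'" "0 < c" "c < b"
 shows "AC_on y c b" "AC_on y' c b"
proof -
 have sub: "{c..b} \<subseteq> {0<..b}" using assms by auto
 have d: "(y has_vector_derivative y' x) (at x within {c..b})" "(y' has_vector_derivative Q x * y x) (at x within {c..b})" if "x \<in> {c..b}" for x
  using assms(1)[unfolded solves_def] sub that DERIV_subset[OF _ sub]
  unfolding has_real_derivative_iff_has_vector_derivative[symmetric] by blast+
 show "AC_on y c b" by (rule AC_on_C1[OF d(1) continuous_on_subset[OF solves_cont(2)[OF assms(1)] sub]])
 show "AC_on y' c b"
  by (rule AC_on_C1[OF d(2)]) (auto intro!: continuous_intros continuous_on_subset[OF solves_cont(1)[OF assms(1)] sub] continuous_on_subset[OF Q_cont sub])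
qed

text \<open>Differentiating the representation, the terms with A' and E' cancel at first order; at
  second order they combine to \<phi> times the Wronskian, which is 1.\<close>

lemma Gr_regular:
 assumes c: "0 < c" "c < b" and phi: "sq_int M \<phi>"
 obtains N where "negligible N" "AC_on (Gr \<phi>) c b" "AC_on (Gr' \<phi>) c b" "continuous_on {c..b} (Gr \<phi>)" "continuous_on {c..b} (Gr' \<phi>)"
  "\<And>x. x \<in> {c<..<b} - N \<Longrightarrow> (Gr \<phi> has_real_derivative Gr' \<phi> x) (at x)"
  "\<And>x. x \<in> {c<..<b} - N \<Longrightarrow> (Gr' \<phi> has_real_derivative Q x * Gr \<phi> x - \<phi> x) (at x)"
proof -
 obtain T A E N where *: "negligible N" "AC_on A 0 b" "AC_on E 0 b" "continuous_on {0..b} A" "continuous_on {0..b} E"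
  "E b = T"
  "\<And>x. x \<in> {c..b} \<Longrightarrow> Gr \<phi> x = - (chi x * A x + u x * (T - E x))"
  "\<And>x. x \<in> {c..b} \<Longrightarrow> Gr' \<phi> x = - (chi' x * A x + u' x * (T - E x))"
  "\<And>x. x \<in> {c<..<b} - N \<Longrightarrow> (A has_real_derivative u x * \<phi> x) (at x)"
  "\<And>x. x \<in> {c<..<b} - N \<Longrightarrow> (E has_real_derivative chi x * \<phi> x) (at x)"
  using Gr_rep[OF c phi] by metis
 have sub: "{c..b} \<subseteq> {0<..b}" "{c..b} \<subseteq> {0..b}" using c by auto
 note cont = continuous_on_subset[OF u_cont(1) sub(1)] continuous_on_subset[OF u_cont(2) sub(1)]
  continuous_on_subset[OF chi_cont(1) sub(1)] continuous_on_subset[OF chi_cont(2) sub(1)]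
  continuous_on_subset[OF *(4) sub(2)] continuous_on_subset[OF *(5) sub(2)]
 have AC: "AC_on A c b" "AC_on E c b" using *(2,3) c by (auto intro: AC_on_subinterval)
 note ac = AC_on_solves[OF u_solves c] AC_on_solves[OF chi_solves c] AC
 have tr: "AC_on f c b \<and> continuous_on {c..b} f"
  if "\<And>x. x \<in> {c..b} \<Longrightarrow> f x = - (p x * A x + r x * (T - E x))" "AC_on p c b" "AC_on r c b" "continuous_on {c..b} p" "continuous_on {c..b} r" for f p r
 proof
  have "AC_on (\<lambda>x. - (p x * A x + r x * (T - E x))) c b"
   using that cont ac by (intro AC_on_uminus AC_on_add AC_on_mult AC_on_diff AC_on_const continuous_intros)
  then show "AC_on f c b"
   by (rule AC_on_combine[OF _ AC_on_const[of 0], where B=1]) (use that(1) in simp)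
  have "continuous_on {c..b} (\<lambda>x. - (p x * A x + r x * (T - E x)))"
   using that cont by (intro continuous_intros)
  then show "continuous_on {c..b} f" by (rule continuous_on_eq) (simp add: that(1))
 qed
 have 1: "AC_on (Gr \<phi>) c b \<and> continuous_on {c..b} (Gr \<phi>)" by (rule tr[OF *(7)]) (use ac cont in auto)
 have 2: "AC_on (Gr' \<phi>) c b \<and> continuous_on {c..b} (Gr' \<phi>)" by (rule tr[OF *(8)]) (use ac cont in auto)
 show thesis
 proof (rule that[OF *(1)])
  fix x assume x: "x \<in> {c<..<b} - N"
  then have x': "0 < x" "x < b" "x \<in> {c..b}" "x \<in> {c<..<b}" "x \<in> {0<..b}" using c by auto
  note d = solves_at[OF u_solves x'(1,2)] solves_at[OF chi_solves x'(1,2)] *(9)[OF x] *(10)[OF x]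
  have "((\<lambda>x. - (chi x * A x + u x * (T - E x))) has_real_derivative Gr' \<phi> x) (at x)"
   by (rule derivative_eq_intros d refl)+ (simp add: *(8)[OF x'(3)] algebra_simps)
  then show "(Gr \<phi> has_real_derivative Gr' \<phi> x) (at x)"
   by (rule has_field_derivative_transform_within_open[of _ _ _ "{c<..<b}"]) (use x' *(7) in auto)
  have w: "chi' x * (u x * \<phi> x) - u' x * (chi x * \<phi> x) = \<phi> x"
   using arg_cong[OF chi_wronskian[OF x'(5)], of "\<lambda>t. t * \<phi> x"] by (simp add: algebra_simps)
  have "((\<lambda>x. - (chi' x * A x + u' x * (T - E x))) has_real_derivative
    - ((Q x * chi x * A x + u x * \<phi> x * chi' x) + (Q x * u x * (T - E x) + (0 - chi x * \<phi> x) * u' x))) (at x)"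
   by (intro DERIV_minus DERIV_add DERIV_mult DERIV_diff DERIV_const d)
  also have "- ((Q x * chi x * A x + u x * \<phi> x * chi' x) + (Q x * u x * (T - E x) + (0 - chi x * \<phi> x) * u' x)) = Q x * Gr \<phi> x - \<phi> x"
   using w unfolding *(7)[OF x'(3)] by (simp add: algebra_simps)
  finally have "((\<lambda>x. - (chi' x * A x + u' x * (T - E x))) has_real_derivative Q x * Gr \<phi> x - \<phi> x) (at x)" .
  then show "(Gr' \<phi> has_real_derivative Q x * Gr \<phi> x - \<phi> x) (at x)"
   by (rule has_field_derivative_transform_within_open[of _ _ _ "{c<..<b}"]) (use x' *(8) in auto)
 qed (use 1 2 in auto)
qed

text \<open>\<open>Gr' \<phi>\<close> is continuous although \<phi> is not, so the derivative almost
  everywhere is the derivative at every point.\<close>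

lemma Gr_deriv:
 assumes phi: "sq_int M \<phi>" and x: "x \<in> {0<..b}"
 shows "(Gr \<phi> has_real_derivative Gr' \<phi> x) (at x within {0<..b})"
proof -
 have c: "0 < x / 2" "x / 2 < b" "x / 2 < x" "x \<le> b" using x by auto
 obtain N where N: "negligible N" "AC_on (Gr \<phi>) (x/2) b" "continuous_on {x/2..b} (Gr' \<phi>)"
  "\<And>x'. x' \<in> {x/2<..<b} - N \<Longrightarrow> (Gr \<phi> has_real_derivative Gr' \<phi> x') (at x')"
  using Gr_regular[OF c(1,2) phi] by metis
 have "(Gr \<phi> has_vector_derivative Gr' \<phi> x) (at x within {x/2..b})"
  by (rule AC_on_continuous_derivative[OF N(2,3,1)]) (use N(4) c in \<open>auto simp: has_real_derivative_iff_has_vector_derivative\<close>)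
 then show ?thesis unfolding at_within_left[OF c(1,3,4)] by (simp add: has_real_derivative_iff_has_vector_derivative)
qed

lemma Gr'_AC: "sq_int M \<phi> \<Longrightarrow> AC_loc (Gr' \<phi>) b"
 unfolding AC_loc_def by (metis Gr_regular)

lemma Gr_cont: "sq_int M \<phi> \<Longrightarrow> continuous_on {0<..b} (Gr \<phi>)"
 unfolding continuous_on_eq_continuous_within using Gr_deriv DERIV_continuous by blast

lemma Gr'_deriv_AE:
 assumes phi: "sq_int M \<phi>"
 shows "AE x in lborel. x \<in> {0<..<b} \<longrightarrow> (Gr' \<phi> has_real_derivative Q x * Gr \<phi> x - \<phi> x) (at x)"
proof -
 \<comment> \<open>Left endpoints that decrease to 0; the countable union of their exceptional sets
   is still negligible.\<close>
 define c where "c n = b / (real n + 2)" for n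
 have c: "0 < c n" "c n < b" for n using b by (auto simp: c_def divide_less_eq algebra_simps intro!: divide_pos_pos add_pos_nonneg)
 have "\<exists>N. negligible N \<and> (\<forall>x\<in>{c n<..<b} - N. (Gr' \<phi> has_real_derivative Q x * Gr \<phi> x - \<phi> x) (at x))" for n
  using Gr_regular[OF c phi] by metis
 then obtain N where N: "\<And>n. negligible (N n)" "\<And>n x. x \<in> {c n<..<b} - N n \<Longrightarrow> (Gr' \<phi> has_real_derivative Q x * Gr \<phi> x - \<phi> x) (at x)"
  by metis
 have "negligible (\<Union>n. N n)" by (rule negligible_Union_nat) (rule N)
 then have "AE x in lebesgue. x \<notin> (\<Union>n. N n)" by (intro AE_not_in) (simp add: negligible_iff_null_sets)
 then have "AE x in lebesgue. x \<in> {0<..<b} \<longrightarrow> (Gr' \<phi> has_real_derivative Q x * Gr \<phi> x - \<phi> x) (at x)"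
 proof eventually_elim
  case (elim x)
  show ?case
  proof
   assume x: "x \<in> {0<..<b}"
   obtain n where "b / x < real n" using reals_Archimedean2 by blast
   then have "b / x < real n + 2" by simp
   then have "c n < x" using x by (simp add: c_def field_simps)
   then show "(Gr' \<phi> has_real_derivative Q x * Gr \<phi> x - \<phi> x) (at x)" using N(2)[of x n] x elim by auto
  qed
 qed
 then show ?thesis by (simp add: AE_completion_iff)
qed

lemma Gr_boundary_b:
 assumes phi: "sq_int M \<phi>"
 shows "\<alpha> * Gr \<phi> b + \<beta> * Gr' \<phi> b = 0"
proof -
 have c: "0 < b / 2" "b / 2 < b" using b by auto
 obtain T A E where "E b = T"
  "\<And>x. x \<in> {b/2..b} \<Longrightarrow> Gr \<phi> x = - (chi x * A x + u x * (T - E x))"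
  "\<And>x. x \<in> {b/2..b} \<Longrightarrow> Gr' \<phi> x = - (chi' x * A x + u' x * (T - E x))"
  using Gr_rep[OF c phi] by metis
 then have e: "Gr \<phi> b = - (chi b * A b)" "Gr' \<phi> b = - (chi' b * A b)" using b by simp_all
 have "\<alpha> * Gr \<phi> b + \<beta> * Gr' \<phi> b = - (\<alpha> * chi b + \<beta> * chi' b) * A b" unfolding e by (simp add: algebra_simps)
 then show ?thesis by (simp add: chi_boundary)
qed

text \<open>Power counting in the kernel: for y below x and for y above x the boundary expression is
  O(x^\<nu> sqrt y). After integration the factor x^\<nu> forces the limit 0, for every positive
  \<nu>.\<close>

lemma Gr_boundary_0:
 assumes phi: "sq_int M \<phi>"
 shows "((\<lambda>x. x powr (\<nu> - 1/2) * ((\<nu> + 1/2) * Gr \<phi> x - x * Gr' \<phi> x)) \<longlongrightarrow> 0) (at_right 0)"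
proof -
 define C where "C = Cc * Bu * (\<nu> + 3/2) + Cc * (\<nu> + 3/2) * B"
 have B0: "B \<ge> 0" using om[of b] b by auto
 have C0: "C \<ge> 0" "Cc * Bu * (\<nu> + 3/2) \<le> C" "Cc * (\<nu> + 3/2) * B \<le> C"
  unfolding C_def using Cc(1) Bu_pos nu B0 by simp_all
 have kb: "x powr (\<nu> - 1/2) * \<bar>(\<nu> + 1/2) * kern x y - x * kern' x y\<bar> \<le> C * x powr \<nu> * sqrt y"
  if x: "x \<in> {0<..b}" and y: "y \<in> {0<..b}" for x y
 proof -
  have p: "x > 0" "y > 0" using x y by auto
  have sy: "sqrt y = y powr (1/2)" using p by (simp add: powr_half_sqrt)
  show ?thesis
  proof (cases "y \<le> x")
   case True
   have xx: "x * x powr (- 1/2 - \<nu>) = x powr (1/2 - \<nu>)"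
   proof -
    have "- \<nu> + 1/2 = 1/2 - \<nu>" "- \<nu> - 1/2 = - 1/2 - \<nu>" by simp_all
    then show ?thesis using powr_half_nu[OF p(1), of "- \<nu>"] by (simp only:)
   qed
   have "\<bar>(\<nu> + 1/2) * chi x - x * chi' x\<bar> \<le> (\<nu> + 1/2) * \<bar>chi x\<bar> + x * \<bar>chi' x\<bar>"
    using nu p by (intro order_trans[OF abs_triangle_ineq4]) (simp add: abs_mult)
   also have "\<dots> \<le> (\<nu> + 1/2) * (Cc * x powr (1/2 - \<nu>)) + x * (Cc * x powr (- 1/2 - \<nu>))"
    using Cc(2,3)[OF x] nu p by (intro add_mono mult_left_mono) auto
   also have "\<dots> = (\<nu> + 1/2) * (Cc * x powr (1/2 - \<nu>)) + Cc * (x * x powr (- 1/2 - \<nu>))" by simp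
   also have "\<dots> = Cc * (\<nu> + 3/2) * x powr (1/2 - \<nu>)" unfolding xx by (simp add: algebra_simps)
   finally have 1: "\<bar>(\<nu> + 1/2) * chi x - x * chi' x\<bar> \<le> Cc * (\<nu> + 3/2) * x powr (1/2 - \<nu>)" .
   have yx: "y powr \<nu> \<le> x powr \<nu>" using True p nu by (intro powr_mono2) auto
   have "\<bar>(\<nu> + 1/2) * kern x y - x * kern' x y\<bar> = \<bar>(\<nu> + 1/2) * chi x - x * chi' x\<bar> * \<bar>u y\<bar>"
    using True by (simp add: kern_def kern'_def abs_mult[symmetric] algebra_simps)
   also have "\<dots> \<le> (Cc * (\<nu> + 3/2) * x powr (1/2 - \<nu>)) * (Bu * (y powr \<nu> * y powr (1/2)))"
    using 1 u_bound(1)[OF y] Cc(1) nu by (intro mult_mono) (auto simp: powr_add)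
   finally have "x powr (\<nu> - 1/2) * \<bar>(\<nu> + 1/2) * kern x y - x * kern' x y\<bar>
     \<le> x powr (\<nu> - 1/2) * ((Cc * (\<nu> + 3/2) * x powr (1/2 - \<nu>)) * (Bu * (y powr \<nu> * y powr (1/2))))"
    by (rule mult_left_mono) simp
   also have "\<dots> = (x powr (\<nu> - 1/2) * x powr (1/2 - \<nu>)) * (Cc * Bu * (\<nu> + 3/2)) * (y powr \<nu> * y powr (1/2))" by simp
   also have "x powr (\<nu> - 1/2) * x powr (1/2 - \<nu>) = 1" using p by (simp add: powr_add[symmetric])
   also have "1 * (Cc * Bu * (\<nu> + 3/2)) * (y powr \<nu> * y powr (1/2)) \<le> C * (x powr \<nu> * y powr (1/2))"
    using C0 yx by (intro mult_mono mult_right_mono) auto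
   finally show ?thesis by (simp add: sy)
  next
   case False
   have yx: "y powr (- \<nu>) \<le> x powr (- \<nu>)" using False p nu by (intro powr_mono2') auto
   have e: "x powr (\<nu> - 1/2) * x powr (\<nu> + 1/2) * x powr (- \<nu>) = x powr \<nu>" by (simp add: powr_add[symmetric])
   have "\<bar>(\<nu> + 1/2) * kern x y - x * kern' x y\<bar> = \<bar>(\<nu> + 1/2) * u x - x * u' x\<bar> * \<bar>chi y\<bar>"
    using False by (simp add: kern_def kern'_def abs_mult[symmetric] algebra_simps)
   also have "\<dots> \<le> ((\<nu> + 3/2) * B * x powr (\<nu> + 1/2)) * (Cc * y powr (1/2 - \<nu>))"
   proof (rule mult_mono)
    have "(\<nu> + 3/2) * \<omega> x * x powr (\<nu> + 1/2) \<le> (\<nu> + 3/2) * B * x powr (\<nu> + 1/2)"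
     using om[OF x] nu by (intro mult_right_mono mult_left_mono) auto
    then show "\<bar>(\<nu> + 1/2) * u x - x * u' x\<bar> \<le> (\<nu> + 3/2) * B * x powr (\<nu> + 1/2)" using u_boundary_form[OF x] by linarith
   qed (use Cc(2)[OF y] nu B0 in auto)
   also have "y powr (1/2 - \<nu>) = y powr (- \<nu>) * y powr (1/2)" by (simp add: powr_add[symmetric])
   finally have "x powr (\<nu> - 1/2) * \<bar>(\<nu> + 1/2) * kern x y - x * kern' x y\<bar>
     \<le> x powr (\<nu> - 1/2) * (((\<nu> + 3/2) * B * x powr (\<nu> + 1/2)) * (Cc * (y powr (- \<nu>) * y powr (1/2))))"
    by (rule mult_left_mono) simp
   also have "\<dots> \<le> x powr (\<nu> - 1/2) * (((\<nu> + 3/2) * B * x powr (\<nu> + 1/2)) * (Cc * (x powr (- \<nu>) * y powr (1/2))))"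
    using yx nu B0 Cc(1) by (intro mult_left_mono mult_right_mono) auto
   also have "\<dots> = (Cc * (\<nu> + 3/2) * B) * ((x powr (\<nu> - 1/2) * x powr (\<nu> + 1/2) * x powr (- \<nu>)) * y powr (1/2))" by (simp only: mult_ac)
   also have "\<dots> \<le> C * (x powr \<nu> * y powr (1/2))" unfolding e using C0 by (intro mult_right_mono) auto
   finally show ?thesis by (simp add: sy)
  qed
 qed
 have bd: "\<bar>x powr (\<nu> - 1/2) * ((\<nu> + 1/2) * Gr \<phi> x - x * Gr' \<phi> x)\<bar> \<le> C * x powr \<nu> * (b * nrm \<phi>)" if x: "x \<in> {0<..b}" for x
 proof -
  define k where "k y = x powr (\<nu> - 1/2) * ((\<nu> + 1/2) * (kern x y * \<phi> y) - x * (kern' x y * \<phi> y))" for y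
  have ki: "integrable M k" unfolding k_def[abs_def] using kern_integrable[OF x phi]
   by (intro integrable_mult_right Bochner_Integration.integrable_diff)
  define I1 I2 where "I1 = (\<integral>y. kern x y * \<phi> y \<partial>M)" and "I2 = (\<integral>y. kern' x y * \<phi> y \<partial>M)"
  have "(\<integral>y. k y \<partial>M) = x powr (\<nu> - 1/2) * ((\<nu> + 1/2) * I1 - x * I2)"
   unfolding k_def[abs_def] I1_def I2_def using kern_integrable[OF x phi] by simp
  then have "x powr (\<nu> - 1/2) * ((\<nu> + 1/2) * Gr \<phi> x - x * Gr' \<phi> x) = - (\<integral>y. k y \<partial>M)"
   unfolding Gr_def Gr'_def I1_def[symmetric] I2_def[symmetric] by (simp add: algebra_simps)
  then have "\<bar>x powr (\<nu> - 1/2) * ((\<nu> + 1/2) * Gr \<phi> x - x * Gr' \<phi> x)\<bar> \<le> (\<integral>y. \<bar>k y\<bar> \<partial>M)" by simp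
  also have "\<dots> \<le> (\<integral>y. C * x powr \<nu> * (sqrt y * \<bar>\<phi> y\<bar>) \<partial>M)"
  proof (rule integral_mono)
   show "integrable M (\<lambda>y. \<bar>k y\<bar>)" using ki by simp
   show "integrable M (\<lambda>y. C * x powr \<nu> * (sqrt y * \<bar>\<phi> y\<bar>))" by (intro integrable_mult_right sqrt_phi_integrable phi)
   fix y assume "y \<in> space M"
   then have y: "y \<in> {0<..b}" by (auto simp: space_M)
   have "k y = x powr (\<nu> - 1/2) * ((\<nu> + 1/2) * kern x y - x * kern' x y) * \<phi> y" by (simp add: k_def algebra_simps)
   then have "\<bar>k y\<bar> = x powr (\<nu> - 1/2) * \<bar>(\<nu> + 1/2) * kern x y - x * kern' x y\<bar> * \<bar>\<phi> y\<bar>" by (simp only: abs_mult abs_of_nonneg[OF powr_ge_zero])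
   also have "\<dots> \<le> C * x powr \<nu> * sqrt y * \<bar>\<phi> y\<bar>" by (rule mult_right_mono[OF kb[OF x y]]) simp
   finally show "\<bar>k y\<bar> \<le> C * x powr \<nu> * (sqrt y * \<bar>\<phi> y\<bar>)" by (simp add: mult.assoc)
  qed
  also have "\<dots> = C * x powr \<nu> * (\<integral>y. sqrt y * \<bar>\<phi> y\<bar> \<partial>M)" by simp
  also have "\<dots> \<le> C * x powr \<nu> * (b * nrm \<phi>)" using sqrt_phi_bound[OF phi] C0 by (intro mult_left_mono) auto
  finally show ?thesis .
 qed
 show ?thesis
 proof (rule Lim_null_comparison)
  show "\<forall>\<^sub>F x in at_right 0. norm (x powr (\<nu> - 1/2) * ((\<nu> + 1/2) * Gr \<phi> x - x * Gr' \<phi> x)) \<le> C * x powr \<nu> * (b * nrm \<phi>)"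
   unfolding eventually_at_right_field using b bd by (intro exI[of _ b]) auto
  have "((\<lambda>x::real. x powr \<nu>) \<longlongrightarrow> 0) (at_right 0)"
  proof -
   have "((\<lambda>x::real. x powr \<nu>) \<longlongrightarrow> 0 powr \<nu>) (at_right 0)"
    using nu by (intro tendsto_powr2 tendsto_ident_at tendsto_const) (auto simp: eventually_at_right_field intro: exI[of _ 1])
   then show ?thesis using nu by simp
  qed
  from tendsto_mult_left[OF tendsto_mult_right[OF this, of "b * nrm \<phi>"], of C]
  show "((\<lambda>x. C * x powr \<nu> * (b * nrm \<phi>)) \<longlongrightarrow> 0) (at_right 0)" by (simp add: mult.assoc)
 qed
qed

text \<open>If \<open>Gr \<phi>\<close> vanishes identically, so does its derivative, and the
  equation reads \<phi> = 0 almost everywhere.\<close>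

lemma Gr_injective:
 assumes phi: "sq_int M \<phi>" and z: "\<And>x. x \<in> {0<..<b} \<Longrightarrow> Gr \<phi> x = 0"
 shows "AE x in M. \<phi> x = 0"
proof -
 have z': "Gr' \<phi> x = 0" if x: "x \<in> {0<..<b}" for x
 proof -
  have "at x within {0<..b} = at x" by (rule at_within_nhd[where S="{0<..<b}"]) (use x in auto)
  then have "(Gr \<phi> has_real_derivative Gr' \<phi> x) (at x)" using Gr_deriv[OF phi, of x] x by simp
  moreover have "(Gr \<phi> has_real_derivative 0) (at x)"
   by (rule has_field_derivative_transform_within_open[OF DERIV_const[of 0], of "{0<..<b}"]) (use x z in auto)
  ultimately show ?thesis by (rule DERIV_unique)
 qed
 have "AE x in lborel. x \<in> {0<..<b} \<longrightarrow> \<phi> x = 0"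
  using Gr'_deriv_AE[OF phi]
 proof eventually_elim
  case (elim x)
  show ?case
  proof
   assume x: "x \<in> {0<..<b}"
   with elim have "(Gr' \<phi> has_real_derivative Q x * Gr \<phi> x - \<phi> x) (at x)" by simp
   moreover have "(Gr' \<phi> has_real_derivative 0) (at x)"
    by (rule has_field_derivative_transform_within_open[OF DERIV_const[of 0], of "{0<..<b}"]) (use x z' in auto)
   ultimately have "Q x * Gr \<phi> x - \<phi> x = 0" by (rule DERIV_unique)
   then show "\<phi> x = 0" using z[OF x] by simp
  qed
 qed
 then show ?thesis by (simp add: AE_restrict_space_iff)
qed

lemma Gr'_deriv_classical:
 assumes phi: "sq_int M \<phi>" and cont: "continuous_on {0<..b} \<phi>" and x: "x \<in> {0<..b}"
 shows "(Gr' \<phi> has_real_derivative Q x * Gr \<phi> x - \<phi> x) (at x within {0<..b})"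
proof -
 have c: "0 < x / 2" "x / 2 < b" "x / 2 < x" "x \<le> b" using x by auto
 have sub: "{x/2..b} \<subseteq> {0<..b}" using x by auto
 obtain N where N: "negligible N" "AC_on (Gr' \<phi>) (x/2) b"
  "\<And>x'. x' \<in> {x/2<..<b} - N \<Longrightarrow> (Gr' \<phi> has_real_derivative Q x' * Gr \<phi> x' - \<phi> x') (at x')"
  using Gr_regular[OF c(1,2) phi] by metis
 have cc: "continuous_on {x/2..b} (\<lambda>x. Q x * Gr \<phi> x - \<phi> x)"
  by (rule continuous_on_subset[OF _ sub]) (intro continuous_intros Q_cont Gr_cont[OF phi] cont)
 have "(Gr' \<phi> has_vector_derivative Q x * Gr \<phi> x - \<phi> x) (at x within {x/2..b})"
  by (rule AC_on_continuous_derivative[OF N(2) cc N(1)]) (use N(3) c in \<open>auto simp: has_real_derivative_iff_has_vector_derivative\<close>)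
 then show ?thesis unfolding at_within_left[OF c(1,3,4)] by (simp add: has_real_derivative_iff_has_vector_derivative)
qed

text \<open>The difference y - \<open>Gr \<phi>\<close> solves the homogeneous equation and meets
  the condition at 0, so it is a multiple of u; the condition at b, which u violates, makes the
  factor 0.\<close>

lemma Gr_inverse:
 assumes y: "sq_int M y" and phi: "sq_int M \<phi>"
  and d: "\<And>x. x \<in> {0<..b} \<Longrightarrow> ((\<lambda>x. y x - Gr \<phi> x) has_real_derivative y' x - Gr' \<phi> x) (at x within {0<..b})"
   "\<And>x. x \<in> {0<..b} \<Longrightarrow> ((\<lambda>x. y' x - Gr' \<phi> x) has_real_derivative Q x * (y x - Gr \<phi> x)) (at x within {0<..b})"
  and bb: "\<alpha> * y b + \<beta> * y' b = 0"
  and b0: "\<nu> < 1 \<Longrightarrow> ((\<lambda>x. x powr (\<nu> - 1/2) * ((\<nu> + 1/2) * y x - x * y' x)) \<longlongrightarrow> 0) (at_right 0)"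
  and x: "x \<in> {0<..b}"
 shows "y x = Gr \<phi> x"
proof -
 have sol: "solves (\<lambda>x. y x - Gr \<phi> x) (\<lambda>x. y' x - Gr' \<phi> x)"
  unfolding solves_def using d by blast
 obtain k where k: "\<And>x. x \<in> {0<..b} \<Longrightarrow> y x - Gr \<phi> x = k * u x" "\<And>x. x \<in> {0<..b} \<Longrightarrow> y' x - Gr' \<phi> x = k * u' x"
 proof (rule solves_unique[OF sol])
  show "integrable M (\<lambda>x. (y x - Gr \<phi> x)\<^sup>2)" using sq_int_diff[OF y Gr_sq_int[OF phi]] by auto
  assume "\<nu> < 1"
  from tendsto_diff[OF b0[OF this] Gr_boundary_0[OF phi]]
  show "((\<lambda>x. x powr (\<nu> - 1/2) * ((\<nu> + 1/2) * (y x - Gr \<phi> x) - x * (y' x - Gr' \<phi> x))) \<longlongrightarrow> 0) (at_right 0)"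
   by (simp add: algebra_simps)
 qed auto
 have bb': "b \<in> {0<..b}" using b by simp
 have "k * (\<alpha> * u b + \<beta> * u' b) = \<alpha> * (y b - Gr \<phi> b) + \<beta> * (y' b - Gr' \<phi> b)"
  using k[OF bb'] by (simp add: algebra_simps)
 also have "\<dots> = 0" using bb Gr_boundary_b[OF phi] by (simp add: algebra_simps)
 finally have "k = 0" using D by simp
 then show ?thesis using k(1)[OF x] by simp
qed

end

section \<open>Real values and the Lagrange identity\<close>

context regular_bessel
begin

text \<open>One pair of \<omega> and B serves all l with |l| at most R. The imaginary parts have no
  leading term and are bounded by the same \<omega>.\<close>

lemma sl_solution_u:
 assumes R: "R > 0"
 obtains \<omega> B where "\<And>l. \<bar>l\<bar> \<le> R \<Longrightarrow> sl_solution \<nu> b (\<lambda>x. V x - l) (u l) (u' l) \<omega> (lead_const \<nu>) B"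
  "\<And>l x. \<bar>l\<bar> \<le> R \<Longrightarrow> x \<in> {0<..b} \<Longrightarrow> \<bar>Im (\<xi> (of_real l) x)\<bar> \<le> \<omega> x * x powr (\<nu> + 1/2)"
  "\<And>l x. \<bar>l\<bar> \<le> R \<Longrightarrow> x \<in> {0<..b} \<Longrightarrow> \<bar>Im (\<xi>' (of_real l) x)\<bar> \<le> \<omega> x * x powr (\<nu> - 1/2)"
proof -
 obtain \<omega> B where w: "B > 0" "\<And>x. x \<in> {0<..b} \<Longrightarrow> 0 \<le> \<omega> x \<and> \<omega> x \<le> B" "(\<omega> \<longlongrightarrow> 0) (at_right 0)"
  "\<And>z x. norm z \<le> R \<Longrightarrow> x \<in> {0<..b} \<Longrightarrow>
   norm (\<xi> z x - of_real (lead_const \<nu> * x powr (\<nu> + 1/2))) \<le> \<omega> x * x powr (\<nu> + 1/2)"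
  "\<And>z x. norm z \<le> R \<Longrightarrow> x \<in> {0<..b} \<Longrightarrow>
   norm (\<xi>' z x - of_real ((\<nu> + 1/2) * lead_const \<nu> * x powr (\<nu> - 1/2))) \<le> \<omega> x * x powr (\<nu> - 1/2)"
  using xi_near_zero[OF R] by metis
 show thesis
 proof (rule that[of \<omega> B])
  fix l :: real assume "\<bar>l\<bar> \<le> R"
  then have l: "norm (of_real l :: complex) \<le> R" by simp
  show "sl_solution \<nu> b (\<lambda>x. V x - l) (u l) (u' l) \<omega> (lead_const \<nu>) B"
  proof
   show "continuous_on {0<..b} (\<lambda>x. V x - l)" by (intro continuous_intros V_cont)
   fix x assume x: "x \<in> {0<..b}"
   have "\<bar>Re (\<xi> (of_real l) x - of_real (lead_const \<nu> * x powr (\<nu> + 1/2)))\<bar> \<le> \<omega> x * x powr (\<nu> + 1/2)"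
    by (rule order_trans[OF abs_Re_le_cmod w(4)[OF l x]])
   then show "\<bar>u l x - lead_const \<nu> * x powr (\<nu> + 1/2)\<bar> \<le> \<omega> x * x powr (\<nu> + 1/2)" by (simp add: u_def)
   have "\<bar>Re (\<xi>' (of_real l) x - of_real ((\<nu> + 1/2) * lead_const \<nu> * x powr (\<nu> - 1/2)))\<bar> \<le> \<omega> x * x powr (\<nu> - 1/2)"
    by (rule order_trans[OF abs_Re_le_cmod w(5)[OF l x]])
   then show "\<bar>u' l x - (\<nu> + 1/2) * lead_const \<nu> * x powr (\<nu> - 1/2)\<bar> \<le> \<omega> x * x powr (\<nu> - 1/2)"
    by (simp only: minus_complex.sel Re_complex_of_real u'_def)
  qed (use nu b w u_deriv u'_deriv lead_const_pos in auto)
  fix x assume x: "x \<in> {0<..b}"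
  have "\<bar>Im (\<xi> (of_real l) x - of_real (lead_const \<nu> * x powr (\<nu> + 1/2)))\<bar> \<le> \<omega> x * x powr (\<nu> + 1/2)"
   by (rule order_trans[OF abs_Im_le_cmod w(4)[OF l x]])
  then show "\<bar>Im (\<xi> (of_real l) x)\<bar> \<le> \<omega> x * x powr (\<nu> + 1/2)" by simp
  have "\<bar>Im (\<xi>' (of_real l) x - of_real ((\<nu> + 1/2) * lead_const \<nu> * x powr (\<nu> - 1/2)))\<bar> \<le> \<omega> x * x powr (\<nu> - 1/2)"
   by (rule order_trans[OF abs_Im_le_cmod w(5)[OF l x]])
  then show "\<bar>Im (\<xi>' (of_real l) x)\<bar> \<le> \<omega> x * x powr (\<nu> - 1/2)"
   by (simp only: minus_complex.sel Im_complex_of_real diff_0_right)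
 qed
qed

text \<open>The imaginary part solves the same real equation but is of smaller order than u at 0.
  Hence its Wronskian with u tends to 0, it is a multiple k u, and comparing orders once more gives
  k = 0.\<close>

lemma xi_real:
 assumes x: "x \<in> {0<..b}"
 shows "\<xi> (of_real l) x = of_real (u l x)" "\<xi>' (of_real l) x = of_real (u' l x)"
proof -
 obtain \<omega> B where sl: "sl_solution \<nu> b (\<lambda>x. V x - l) (u l) (u' l) \<omega> (lead_const \<nu>) B"
  and im: "\<And>x. x \<in> {0<..b} \<Longrightarrow> \<bar>Im (\<xi> (of_real l) x)\<bar> \<le> \<omega> x * x powr (\<nu> + 1/2)"
   "\<And>x. x \<in> {0<..b} \<Longrightarrow> \<bar>Im (\<xi>' (of_real l) x)\<bar> \<le> \<omega> x * x powr (\<nu> - 1/2)"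
  using sl_solution_u[of "\<bar>l\<bar> + 1"] by (metis abs_ge_zero add_nonneg_pos less_add_one less_imp_le zero_less_one)
 interpret S: sl_solution \<nu> b "\<lambda>x. V x - l" "u l" "u' l" \<omega> "lead_const \<nu>" B by (rule sl)
 define v v' where "v x = Im (\<xi> (of_real l) x)" and "v' x = Im (\<xi>' (of_real l) x)" for x
 have sol: "S.solves v v'"
  unfolding S.solves_def v_def[abs_def] v'_def[abs_def] has_real_derivative_iff_has_vector_derivative
 proof (intro ballI conjI)
  fix x assume x: "x \<in> {0<..b}"
  show "((\<lambda>x. Im (\<xi> (of_real l) x)) has_vector_derivative Im (\<xi>' (of_real l) x)) (at x within {0<..b})"
   by (rule bounded_linear.has_vector_derivative[OF bounded_linear_Im xi_deriv[OF x]])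
  show "((\<lambda>x. Im (\<xi>' (of_real l) x)) has_vector_derivative (V x - l) * Im (\<xi> (of_real l) x)) (at x within {0<..b})"
   using bounded_linear.has_vector_derivative[OF bounded_linear_Im xi'_deriv[OF x, of "of_real l"]] by (simp add: V_def)
 qed
 obtain w where w: "\<And>x. x \<in> {0<..b} \<Longrightarrow> u l x * v' x - u' l x * v x = w"
  using S.wronskian_const[OF S.u_solves sol] by auto
 have wle: "\<bar>w\<bar> \<le> 2 * S.Bu * b powr (2 * \<nu>) * \<omega> x" if x: "x \<in> {0<..b}" for x
 proof -
  have e: "x powr (\<nu> + 1/2) * x powr (\<nu> - 1/2) = x powr (2 * \<nu>)" by (simp add: powr_add[symmetric])
  have "\<bar>w\<bar> \<le> \<bar>u l x\<bar> * \<bar>v' x\<bar> + \<bar>u' l x\<bar> * \<bar>v x\<bar>"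
   unfolding w[OF x, symmetric] by (rule order_trans[OF abs_triangle_ineq4]) (simp add: abs_mult)
  also have "\<dots> \<le> (S.Bu * x powr (\<nu> + 1/2)) * (\<omega> x * x powr (\<nu> - 1/2)) + (S.Bu * x powr (\<nu> - 1/2)) * (\<omega> x * x powr (\<nu> + 1/2))"
   using S.u_bound[OF x] im[OF x] S.Bu_pos unfolding v_def v'_def by (intro add_mono mult_mono) auto
  also have "\<dots> = 2 * S.Bu * (x powr (\<nu> + 1/2) * x powr (\<nu> - 1/2)) * \<omega> x" by (simp add: algebra_simps)
  also have "\<dots> \<le> 2 * S.Bu * b powr (2 * \<nu>) * \<omega> x"
   unfolding e using x nu S.Bu_pos S.om[OF x] by (intro mult_right_mono mult_left_mono powr_mono2) auto
  finally show ?thesis .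
 qed
 have "((\<lambda>x. 2 * S.Bu * b powr (2 * \<nu>) * \<omega> x) \<longlongrightarrow> 2 * S.Bu * b powr (2 * \<nu>) * 0) (at_right 0)"
  by (intro tendsto_intros S.om_0)
 moreover have "\<forall>\<^sub>F x in at_right 0. \<bar>w\<bar> \<le> 2 * S.Bu * b powr (2 * \<nu>) * \<omega> x"
  unfolding eventually_at_right_field using b wle by (intro exI[of _ b]) auto
 ultimately have "\<bar>w\<bar> \<le> 2 * S.Bu * b powr (2 * \<nu>) * 0" by (intro tendsto_lowerbound) auto
 then have "w = 0" by simp
 then obtain k where k: "\<And>x. x \<in> {0<..b} \<Longrightarrow> v x = k * u l x" "\<And>x. x \<in> {0<..b} \<Longrightarrow> v' x = k * u' l x"
  using S.wronskian_zero[OF sol, of b] w[of b] b by auto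
 \<comment> \<open>Near 0 the solution u is at least half its leading term while k u is bounded by
   \<omega> times the same power; \<omega> tends to 0.\<close>
 have kle: "\<bar>k\<bar> * (lead_const \<nu> / 2) \<le> \<omega> x" if x: "0 < x" "x \<le> S.x0" for x
 proof -
  have xb: "x \<in> {0<..b}" using x S.x0 by auto
  have "\<bar>k\<bar> * (lead_const \<nu> / 2 * x powr (\<nu> + 1/2)) \<le> \<bar>k\<bar> * u l x"
   using S.u_near_zero(1)[OF x] by (intro mult_left_mono) auto
  also have "\<dots> = \<bar>v x\<bar>" using k(1)[OF xb] S.u_near_zero(3)[OF x] by (simp add: abs_mult)
  also have "\<dots> \<le> \<omega> x * x powr (\<nu> + 1/2)" using im(1)[OF xb] by (simp add: v_def)
  finally have "(\<bar>k\<bar> * (lead_const \<nu> / 2)) * x powr (\<nu> + 1/2) \<le> \<omega> x * x powr (\<nu> + 1/2)" by simp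
  then show ?thesis using x by simp
 qed
 have "\<forall>\<^sub>F x in at_right 0. \<bar>k\<bar> * (lead_const \<nu> / 2) \<le> \<omega> x"
  unfolding eventually_at_right_field using S.x0 kle by (intro exI[of _ S.x0]) auto
 with S.om_0 have "\<bar>k\<bar> * (lead_const \<nu> / 2) \<le> 0" by (intro tendsto_lowerbound) auto
 then have "k = 0" using S.L by (simp add: mult_le_0_iff)
 then show "\<xi> (of_real l) x = of_real (u l x)" "\<xi>' (of_real l) x = of_real (u' l x)"
  using k x by (auto simp: complex_eq_iff v_def v'_def u_def u'_def)
qed

lemma xi_cont: "continuous_on {0<..b} (\<xi> z)" "continuous_on {0<..b} (\<xi>' z)"
 unfolding continuous_on_eq_continuous_within
 using xi_deriv xi'_deriv has_vector_derivative_continuous by blast+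

lemma u_cont: "continuous_on {0<..b} (u l)" "continuous_on {0<..b} (u' l)"
 unfolding continuous_on_eq_continuous_within using u_deriv u'_deriv DERIV_continuous by blast+

lemma xi_bounded:
 assumes "R > 0"
 obtains C where "C > 0" "\<And>z x. norm z \<le> R \<Longrightarrow> x \<in> {0<..b} \<Longrightarrow> norm (\<xi> z x) \<le> C"
proof -
 obtain B where B: "B > 0" "\<And>z x. norm z \<le> R \<Longrightarrow> x \<in> {0<..b} \<Longrightarrow> norm (\<xi> z x) \<le> B * x powr (\<nu> + 1/2)"
  using xi_bounds[OF assms] by metis
 show thesis
 proof (rule that[of "B * b powr (\<nu> + 1/2)"])
  fix z :: complex and x assume z: "norm z \<le> R" and x: "x \<in> {0<..b}"
  have "B * x powr (\<nu> + 1/2) \<le> B * b powr (\<nu> + 1/2)" using B x nu by (intro mult_left_mono powr_mono2) auto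
  then show "norm (\<xi> z x) \<le> B * b powr (\<nu> + 1/2)" using B(2)[OF z x] by linarith
 qed (use B b in simp)
qed

lemma u_bounded: obtains C where "C > 0" "\<And>x. x \<in> {0<..b} \<Longrightarrow> \<bar>u l x\<bar> \<le> C"
proof -
 obtain C where C: "C > 0" "\<And>z x. norm z \<le> \<bar>l\<bar> + 1 \<Longrightarrow> x \<in> {0<..b} \<Longrightarrow> norm (\<xi> z x) \<le> C"
  using xi_bounded[of "\<bar>l\<bar> + 1"] by (metis abs_ge_zero add_nonneg_pos zero_less_one)
 show thesis
 proof (rule that[OF C(1)])
  fix x assume x: "x \<in> {0<..b}"
  show "\<bar>u l x\<bar> \<le> C" unfolding u_def by (rule order_trans[OF abs_Re_le_cmod C(2)]) (use x in auto)
 qed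
qed

abbreviation "M \<equiv> lb b"

lemma space_M: "space M = {0<..<b}" by (simp add: space_restrict_space)

lemma u_sq_int: "sq_int M (u l)"
proof -
 obtain C where C: "\<And>x. x \<in> {0<..b} \<Longrightarrow> \<bar>u l x\<bar> \<le> C" using u_bounded by metis
 show ?thesis
  by (rule finite_measure.sq_int_bounded[OF finite_measure_lb continuous_on_lb_measurable[OF u_cont(1)], of _ C])
   (use C in \<open>auto simp: space_M\<close>)
qed

text \<open>The fundamental theorem for R times the Wronskian of \<xi>(z,.) and u. The Wronskian is
  O(x^(2\<nu>)), so there is no contribution from 0. The finite set S admits corners of R.\<close>

lemma lagrange_identity:
 fixes R R' :: "real \<Rightarrow> real"
 assumes R: "continuous_on {0..b} R" and S: "finite S"
  and R': "\<And>x. x \<in> {0<..<b} - S \<Longrightarrow> (R has_real_derivative R' x) (at x)"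
 shows "((\<lambda>x. of_real (R x) * ((z - of_real l) * \<xi> z x * of_real (u l x)) + of_real (R' x) * (\<xi> z x * of_real (u' l x) - \<xi>' z x * of_real (u l x)))
   has_integral of_real (R b) * (\<xi> z b * of_real (u' l b) - \<xi>' z b * of_real (u l b))) {0..b}"
proof -
 define W where "W x = \<xi> z x * of_real (u' l x) - \<xi>' z x * of_real (u l x)" for x
 \<comment> \<open>The value 0 at the origin is the continuous extension, by the bound on W.\<close>
 define F where "F x = (if x = 0 then 0 else of_real (R x) * W x)" for x
 obtain B1 where B1: "B1 > 0"
  "\<And>y x. norm y \<le> norm z + \<bar>l\<bar> + 1 \<Longrightarrow> x \<in> {0<..b} \<Longrightarrow> norm (\<xi> y x) \<le> B1 * x powr (\<nu> + 1/2)"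
  "\<And>y x. norm y \<le> norm z + \<bar>l\<bar> + 1 \<Longrightarrow> x \<in> {0<..b} \<Longrightarrow> norm (\<xi>' y x) \<le> B1 * x powr (\<nu> - 1/2)"
 proof -
  have "norm z + \<bar>l\<bar> + 1 > 0" by (simp add: add_nonneg_pos add_nonneg_nonneg)
  from xi_bounds[OF this] show ?thesis using that by metis
 qed
 obtain BR where BR: "BR > 0" "\<And>x. x \<in> {0..b} \<Longrightarrow> \<bar>R x\<bar> \<le> BR"
  using compact_imp_bounded[OF compact_continuous_image[OF R compact_Icc]] unfolding bounded_pos by fastforce
 have Wb: "norm (W x) \<le> 2 * B1\<^sup>2 * x powr (2 * \<nu>)" if x: "x \<in> {0<..b}" for x
 proof -
  have e: "x powr (\<nu> + 1/2) * x powr (\<nu> - 1/2) = x powr (2 * \<nu>)" by (simp add: powr_add[symmetric])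
  have ul: "norm (\<xi> (of_real l) x) \<le> B1 * x powr (\<nu> + 1/2)" "norm (\<xi>' (of_real l) x) \<le> B1 * x powr (\<nu> - 1/2)"
   by (rule B1(2)[OF _ x], simp) (rule B1(3)[OF _ x], simp)
  have "norm (W x) \<le> norm (\<xi> z x) * norm (\<xi>' (of_real l) x) + norm (\<xi>' z x) * norm (\<xi> (of_real l) x)"
   unfolding W_def xi_real[OF x, symmetric] by (rule order_trans[OF norm_triangle_ineq4]) (simp add: norm_mult)
  also have "\<dots> \<le> (B1 * x powr (\<nu> + 1/2)) * (B1 * x powr (\<nu> - 1/2)) + (B1 * x powr (\<nu> - 1/2)) * (B1 * x powr (\<nu> + 1/2))"
   using B1 ul x by (intro add_mono mult_mono B1(2,3)) auto
  also have "\<dots> = 2 * B1\<^sup>2 * (x powr (\<nu> + 1/2) * x powr (\<nu> - 1/2))" by (simp add: power2_eq_square)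
  finally show ?thesis unfolding e .
 qed
 have dW: "(W has_vector_derivative (z - of_real l) * \<xi> z x * of_real (u l x)) (at x)" if x: "x \<in> {0<..<b}" for x
 proof -
  have xb: "x \<in> {0<..b}" using x by auto
  have at: "at x within {0<..b} = at x" by (rule at_within_nhd[where S="{0<..<b}"]) (use x in auto)
  have d: "(\<xi> z has_vector_derivative \<xi>' z x) (at x)" "(\<xi>' z has_vector_derivative (of_real (V x) - z) * \<xi> z x) (at x)"
   using xi_deriv[OF xb, of z] xi'_deriv[OF xb, of z] unfolding at V_def by auto
  have dr: "((\<lambda>x. complex_of_real (u l x)) has_vector_derivative of_real (u' l x)) (at x)"
   "((\<lambda>x. complex_of_real (u' l x)) has_vector_derivative of_real ((V x - l) * u l x)) (at x)"
   using u_deriv[OF xb, of l] u'_deriv[OF xb, of l] unfolding at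
   by - (erule has_vector_derivative_of_real)+
  have "(W has_vector_derivative (\<xi> z x * of_real ((V x - l) * u l x) + \<xi>' z x * of_real (u' l x))
    - (\<xi>' z x * of_real (u' l x) + (of_real (V x) - z) * \<xi> z x * of_real (u l x))) (at x)"
   unfolding W_def[abs_def] by (intro has_vector_derivative_diff has_vector_derivative_mult d dr)
  then show ?thesis by (simp add: algebra_simps)
 qed
 have Wc: "continuous_on {0<..b} W" unfolding W_def[abs_def]
  by (intro continuous_intros xi_cont u_cont)
 have Fc: "continuous_on {0..b} F"
  unfolding continuous_on_eq_continuous_within
 proof
  fix x assume x: "x \<in> {0..b}"
  show "continuous (at x within {0..b}) F"
  proof (cases "x = 0")
   case True
   have bd: "norm (F y) \<le> BR * (2 * B1\<^sup>2 * \<bar>y\<bar> powr (2 * \<nu>))" if "y \<in> {0..b}" for y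
   proof (cases "y = 0")
    case False
    then have "y \<in> {0<..b}" using that by auto
    then show ?thesis using Wb[of y] BR that by (auto simp: F_def norm_mult intro!: mult_mono)
   qed (simp add: F_def)
   have "((\<lambda>y::real. \<bar>y\<bar> powr (2 * \<nu>)) \<longlongrightarrow> \<bar>0\<bar> powr (2 * \<nu>)) (at 0 within {0..b})"
    using nu by (intro tendsto_powr2 tendsto_rabs tendsto_ident_at tendsto_const) (auto intro: always_eventually)
   then have t: "((\<lambda>y. BR * (2 * B1\<^sup>2 * \<bar>y\<bar> powr (2 * \<nu>))) \<longlongrightarrow> BR * (2 * B1\<^sup>2 * (\<bar>0\<bar> powr (2 * \<nu>)))) (at 0 within {0..b})"
    by (intro tendsto_mult tendsto_const)
   have "(F \<longlongrightarrow> 0) (at 0 within {0..b})"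
    by (rule Lim_null_comparison[of _ "\<lambda>y. BR * (2 * B1\<^sup>2 * \<bar>y\<bar> powr (2 * \<nu>))"])
     (use bd t nu in \<open>auto simp: eventually_at intro!: exI[of _ 1]\<close>)
   then show ?thesis using True by (simp add: continuous_within F_def)
  next
   case False
   then have x': "x \<in> {0<..b}" using x by auto
   have "continuous_on {0<..b} (\<lambda>x. of_real (R x) * W x)"
    by (intro continuous_intros Wc continuous_on_subset[OF R]) auto
   then have "continuous (at x within {0<..b}) (\<lambda>x. of_real (R x) * W x)" using x' by (simp add: continuous_on_eq_continuous_within)
   moreover have "at x within {0<..b} = at x within {0..b}" by (rule at_within_nhd[where S="{0<..}"]) (use x' in auto)
   ultimately have "continuous (at x within {0..b}) (\<lambda>x. of_real (R x) * W x)" by simp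
   then show ?thesis
    by (rule continuous_transform_within[where \<delta>=x]) (use x' in \<open>auto simp: F_def dist_real_def\<close>)
  qed
 qed
 have "((\<lambda>x. of_real (R x) * ((z - of_real l) * \<xi> z x * of_real (u l x)) + of_real (R' x) * W x) has_integral F b - F 0) {0..b}"
 proof (rule fundamental_theorem_of_calculus_interior_strong[OF S _ _ Fc])
  fix x assume x: "x \<in> {0<..<b} - S"
  have "((\<lambda>x. of_real (R x) * W x) has_vector_derivative of_real (R x) * ((z - of_real l) * \<xi> z x * of_real (u l x)) + of_real (R' x) * W x) (at x)"
   by (intro has_vector_derivative_mult dW has_vector_derivative_of_real R') (use x in auto)
  then show "(F has_vector_derivative of_real (R x) * ((z - of_real l) * \<xi> z x * of_real (u l x)) + of_real (R' x) * W x) (at x)"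
   by (rule has_vector_derivative_transform_within_open[of _ _ _ "{0<..<b}"]) (use x in \<open>auto simp: F_def\<close>)
 qed (use b in auto)
 then show ?thesis using b by (simp add: F_def W_def)
qed

lemma u_lagrange: "(m - l) * (\<integral>x. u m x * u l x \<partial>M) = u m b * u' l b - u' m b * u l b"
proof -
 have i: "integrable M (\<lambda>x. u m x * u l x)" by (rule sq_int_mult[OF u_sq_int u_sq_int])
 have bb: "b \<in> {0<..b}" using b by simp
 have "((\<lambda>x. of_real 1 * ((of_real m - of_real l) * \<xi> (of_real m) x * of_real (u l x)) + of_real 0 * (\<xi> (of_real m) x * of_real (u' l x) - \<xi>' (of_real m) x * of_real (u l x)))
   has_integral of_real 1 * (\<xi> (of_real m) b * of_real (u' l b) - \<xi>' (of_real m) b * of_real (u l b))) {0..b}"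
  by (rule lagrange_identity[of "\<lambda>x. 1" "{}" "\<lambda>x. 0"]) (auto intro!: derivative_eq_intros)
 then have "((\<lambda>x. (of_real m - of_real l) * \<xi> (of_real m) x * of_real (u l x)) has_integral of_real (u m b * u' l b - u' m b * u l b)) {0..b}"
  using xi_real[OF bb] by simp
 from has_integral_linear[OF this bounded_linear_Re]
 have "((\<lambda>x. (m - l) * (u m x * u l x)) has_integral (u m b * u' l b - u' m b * u l b)) {0..b}"
  by (simp add: o_def u_def mult.assoc flip: of_real_diff)
 moreover have "((\<lambda>x. (m - l) * (u m x * u l x)) has_integral (m - l) * integral {0..b} (\<lambda>x. u m x * u l x)) {0..b}"
  using set_lebesgue_integral_eq_integral(1)[OF lb_absolutely_integrable[OF i]]
  by (intro has_integral_mult_right integrable_integral)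
 ultimately show ?thesis unfolding integral_lb_hk[OF i] by (rule has_integral_unique[symmetric])
qed

text \<open>The value of the reproducing kernel of the full interval at (l,l).\<close>

definition Nsq :: "real \<Rightarrow> real" where "Nsq l = (\<integral>x. (u l x)\<^sup>2 \<partial>M)"

lemma integral_zero_cont:
 assumes f: "continuous_on {0<..b} f" "sq_int M f" and z: "(\<integral>x. (f x)\<^sup>2 \<partial>M) = 0" and x: "x \<in> {0<..b}"
 shows "f x = 0"
proof -
 have c: "0 \<le> x / 2" "x / 2 < b" "x / 2 < x" using x by auto
 have sub: "{x/2..b} \<subseteq> {0<..b}" using x by auto
 have cf: "continuous_on {x/2..b} (\<lambda>x. (f x)\<^sup>2)" by (intro continuous_intros continuous_on_subset[OF f(1) sub])
 have i: "integrable M (\<lambda>x. (f x)\<^sup>2)" using f by auto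
 have "integral {x/2..b} (\<lambda>x. (f x)\<^sup>2) = (\<integral>y. indicator {x/2..b} y *\<^sub>R (f y)\<^sup>2 \<partial>M)"
  using integral_lb_indicator(2)[OF i c(1) order_refl] by simp
 also have "\<dots> \<le> (\<integral>y. (f y)\<^sup>2 \<partial>M)"
  using integral_lb_indicator(1)[OF i c(1) order_refl] i by (intro integral_mono) (auto simp: indicator_def)
 finally have "integral {x/2..b} (\<lambda>x. (f x)\<^sup>2) \<le> 0" using z by simp
 moreover have "integral {x/2..b} (\<lambda>x. (f x)\<^sup>2) \<ge> 0"
  by (rule Henstock_Kurzweil_Integration.integral_nonneg[OF integrable_continuous_interval[OF cf]]) simp
 ultimately have "integral {x/2..b} (\<lambda>x. (f x)\<^sup>2) = 0" by simp
 then show ?thesis using integral_eq_0_iff[OF cf c(2)] x by auto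
qed

lemma Nsq_pos: "Nsq l > 0"
proof -
 have "Nsq l \<ge> 0" unfolding Nsq_def by (rule Bochner_Integration.integral_nonneg) simp
 moreover have "Nsq l \<noteq> 0"
 proof
  assume "Nsq l = 0"
  then have z: "u l x = 0" if "x \<in> {0<..b}" for x using integral_zero_cont[OF u_cont(1) u_sq_int _ that] by (simp add: Nsq_def)
  obtain \<omega> B where sl: "sl_solution \<nu> b (\<lambda>x. V x - l) (u l) (u' l) \<omega> (lead_const \<nu>) B"
   using sl_solution_u[of "\<bar>l\<bar> + 1"] by (metis abs_ge_zero add_nonneg_pos less_add_one less_imp_le zero_less_one)
  interpret S: sl_solution \<nu> b "\<lambda>x. V x - l" "u l" "u' l" \<omega> "lead_const \<nu>" B by (rule sl)
  show False using S.u_near_zero(3)[of S.x0] S.x0(1,2) z[of S.x0] by auto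
 qed
 ultimately show ?thesis by simp
qed

end

section \<open>The boundary condition at b and its eigenvalues\<close>

text \<open>The coefficients \<alpha> and \<beta> later become the cosine and sine of \<gamma>;
  until then only that they are not both 0 matters.\<close>

locale bessel_bc = regular_bessel +
 fixes \<alpha> \<beta> :: real
 assumes ab: "\<alpha> \<noteq> 0 \<or> \<beta> \<noteq> 0"
begin

definition eigen :: "real \<Rightarrow> bool" where "eigen l \<longleftrightarrow> \<alpha> * u l b + \<beta> * u' l b = 0"

text \<open>Two functions under the same boundary condition have Wronskian 0 at b: both \<alpha> and
  \<beta> times it vanish. The Lagrange identity with R = 1 then gives orthogonality.\<close>

lemma eigen_orthogonal:
 assumes "eigen l" "eigen m" "l \<noteq> m"
 shows "(\<integral>x. u m x * u l x \<partial>M) = 0"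
proof -
 define W where "W = u m b * u' l b - u' m b * u l b"
 have a: "\<alpha> * u m b = - \<beta> * u' m b" "\<alpha> * u l b = - \<beta> * u' l b"
  and b': "\<beta> * u' m b = - \<alpha> * u m b" "\<beta> * u' l b = - \<alpha> * u l b" using assms by (simp_all add: eigen_def)
 have "\<alpha> * W = (\<alpha> * u m b) * u' l b - u' m b * (\<alpha> * u l b)" by (simp add: W_def algebra_simps)
 then have "\<alpha> * W = 0" unfolding a by simp
 moreover have "\<beta> * W = u m b * (\<beta> * u' l b) - (\<beta> * u' m b) * u l b" by (simp add: W_def algebra_simps)
 then have "\<beta> * W = 0" unfolding b' by simp
 ultimately have "\<alpha> * W = 0" "\<beta> * W = 0" by simp_all
 then have "W = 0" using ab by auto
 then show ?thesis using u_lagrange[of m l] assms by (simp add: W_def)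
qed

lemma eigen_Bessel:
 assumes "finite S" "\<And>l. l \<in> S \<Longrightarrow> eigen l" "sq_int M f"
 shows "(\<Sum>l\<in>S. (\<integral>x. f x * u l x \<partial>M)\<^sup>2 / Nsq l) \<le> (\<integral>x. (f x)\<^sup>2 \<partial>M)"
 unfolding Nsq_def
 by (rule Bessel_inequality[OF assms(1,3)]) (use assms(2) u_sq_int eigen_orthogonal Nsq_pos in \<open>auto simp: Nsq_def\<close>)

lemma indicator_sq_int: "sq_int M (\<lambda>x. indicator {c..d} x)"
proof (rule finite_measure.sq_int_bounded[OF finite_measure_lb, of _ _ 1])
 show "(\<lambda>x. indicator {c..d} x) \<in> borel_measurable M" by (rule measurable_restrict_space1) simp
qed (auto simp: indicator_def)

lemma integral_indicator_u:
 assumes "0 \<le> c" "d \<le> b"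
 shows "(\<integral>x. indicator {c..d} x * u l x \<partial>M) = integral {c..d} (u l)"
proof -
 have "integrable M (u l)" using sq_int_mult[OF indicator_sq_int[of 0 b] u_sq_int[of l]]
  by (rule Bochner_Integration.integrable_cong[THEN iffD1, rotated 2]) (auto simp: space_M indicator_def)
 from integral_lb_indicator(2)[OF this assms] show ?thesis by simp
qed

lemma indicator_norm:
 assumes "0 \<le> c" "c \<le> d" "d \<le> b"
 shows "(\<integral>x. (indicator {c..d} x)\<^sup>2 \<partial>M) = d - c"
proof -
 have "integrable M (\<lambda>x. 1::real)" by (rule finite_measure.integrable_const[OF finite_measure_lb])
 from integral_lb_indicator(2)[OF this assms(1,3)] have "(\<integral>x. indicator {c..d} x *\<^sub>R (1::real) \<partial>M) = d - c" using assms by simp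
 moreover have "(\<lambda>x. (indicator {c..d} x)\<^sup>2) = (\<lambda>x. indicator {c..d} x *\<^sub>R (1::real))" by (auto simp: indicator_def)
 ultimately show ?thesis by simp
qed

text \<open>No analyticity in l is used. Near 0 all u with |l| at most R are positive with a common
  lower bound, so each takes a fixed share of the norm of one indicator function, and Bessel's
  inequality limits their number.\<close>

lemma finite_eigen:
 assumes R: "R > 0"
 shows "finite {l. \<bar>l\<bar> \<le> R \<and> eigen l}"
proof -
 obtain \<omega> B where sl: "\<And>l. \<bar>l\<bar> \<le> R \<Longrightarrow> sl_solution \<nu> b (\<lambda>x. V x - l) (u l) (u' l) \<omega> (lead_const \<nu>) B"
  using sl_solution_u[OF R] by metis
 define L where "L = lead_const \<nu>"
 have L: "L > 0" using lead_const_pos[OF nu] by (simp add: L_def)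
 have "sl_solution \<nu> b (\<lambda>x. V x - 0) (u 0) (u' 0) \<omega> (lead_const \<nu>) B" using sl[of 0] R by simp
 from sl_solution.om_lt[OF this, of "L / 2"] L
 obtain d where d: "d > 0" "d \<le> b" "\<And>x. 0 < x \<Longrightarrow> x \<le> d \<Longrightarrow> \<omega> x < L / 2" by auto
 define k where "k = L / 2 * (d / 2) powr (\<nu> + 1/2)"
 have k: "k > 0" using L d by (simp add: k_def)
 have low: "k \<le> u l x" if l: "\<bar>l\<bar> \<le> R" and x: "x \<in> {d/2..d}" for l x
 proof -
  interpret S: sl_solution \<nu> b "\<lambda>x. V x - l" "u l" "u' l" \<omega> "lead_const \<nu>" B by (rule sl[OF l])
  have xb: "x \<in> {0<..b}" and xd: "0 < x" "x \<le> d" using x d by auto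
  have w: "\<omega> x * x powr (\<nu> + 1/2) \<le> L / 2 * x powr (\<nu> + 1/2)"
   using d(3)[OF xd] by (intro mult_right_mono) auto
  have "L * x powr (\<nu> + 1/2) - u l x \<le> L / 2 * x powr (\<nu> + 1/2)" using S.u_asym[OF xb] w unfolding L_def[symmetric] by linarith
  moreover have "L / 2 * (d / 2) powr (\<nu> + 1/2) \<le> L / 2 * x powr (\<nu> + 1/2)"
   using x d nu L by (intro mult_left_mono powr_mono2) auto
  ultimately show ?thesis by (simp add: k_def)
 qed
 obtain C where C: "C > 0" "\<And>z x. norm z \<le> R \<Longrightarrow> x \<in> {0<..b} \<Longrightarrow> norm (\<xi> z x) \<le> C" using xi_bounded[OF R] by metis
 have NC: "Nsq l \<le> C\<^sup>2 * b" if l: "\<bar>l\<bar> \<le> R" for l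
 proof -
  have "Nsq l \<le> (\<integral>x. C\<^sup>2 \<partial>M)" unfolding Nsq_def
  proof (rule integral_mono)
   show "integrable M (\<lambda>x. (u l x)\<^sup>2)" using u_sq_int by auto
   show "integrable M (\<lambda>x. C\<^sup>2)" by (rule finite_measure.integrable_const[OF finite_measure_lb])
   fix x assume "x \<in> space M"
   then have x: "x \<in> {0<..b}" by (auto simp: space_M)
   have "\<bar>u l x\<bar> \<le> C" unfolding u_def by (rule order_trans[OF abs_Re_le_cmod C(2)]) (use x l in auto)
   then have "\<bar>u l x\<bar>\<^sup>2 \<le> C\<^sup>2" by (intro power_mono) auto
   then show "(u l x)\<^sup>2 \<le> C\<^sup>2" by simp
  qed
  also have "\<dots> = C\<^sup>2 * b" using b by (simp add: measure_restrict_space space_M)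
  finally show ?thesis .
 qed
 define c where "c = (k * (d / 2))\<^sup>2 / (C\<^sup>2 * b)"
 have c: "c > 0" using k d C b by (simp add: c_def)
 \<comment> \<open>Each eigenvalue contributes at least c to a sum bounded by the length of the
   interval.\<close>
 have "finite F \<and> card F \<le> nat \<lceil>d / c\<rceil>" if F: "F \<subseteq> {l. \<bar>l\<bar> \<le> R \<and> eigen l}" "finite F" for F
 proof -
  have "real (card F) * c = (\<Sum>l\<in>F. c)" by simp
  also have "\<dots> \<le> (\<Sum>l\<in>F. (\<integral>x. indicator {d/2..d} x * u l x \<partial>M)\<^sup>2 / Nsq l)"
  proof (rule sum_mono)
   fix l assume "l \<in> F"
   then have l: "\<bar>l\<bar> \<le> R" using F by auto
   have cont: "continuous_on {d/2..d} (u l)" by (rule continuous_on_subset[OF u_cont(1)]) (use d in auto)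
   have "integral {d/2..d} (\<lambda>x. k) \<le> integral {d/2..d} (u l)"
    using low[OF l] by (intro integral_le integrable_continuous_interval cont) auto
   then have "k * (d / 2) \<le> integral {d/2..d} (u l)" using d by (simp add: mult.commute)
   then have "(k * (d / 2))\<^sup>2 \<le> (integral {d/2..d} (u l))\<^sup>2" using k d by (intro power_mono) auto
   then show "c \<le> (\<integral>x. indicator {d/2..d} x * u l x \<partial>M)\<^sup>2 / Nsq l"
    using NC[OF l] Nsq_pos[of l] d unfolding c_def by (subst integral_indicator_u) (auto intro!: frac_le)
  qed
  also have "\<dots> \<le> (\<integral>x. (indicator {d/2..d} x)\<^sup>2 \<partial>M)"
   by (rule eigen_Bessel) (use F indicator_sq_int in auto)
  also have "\<dots> = d - d / 2" by (rule indicator_norm) (use d in auto)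
  also have "\<dots> \<le> d" using d by simp
  finally have "real (card F) \<le> d / c" using c by (simp add: field_simps)
  then show ?thesis using F by linarith
 qed
 then show ?thesis using finite_if_finite_subsets_card_bdd[of "{l. \<bar>l\<bar> \<le> R \<and> eigen l}" "nat \<lceil>d / c\<rceil>"] by blast
qed

lemma exists_non_eigen: obtains m where "\<not> eigen m"
proof -
 have "\<exists>m. \<bar>m\<bar> \<le> 1 \<and> \<not> eigen m"
 proof (rule ccontr)
  assume "\<not> (\<exists>m. \<bar>m\<bar> \<le> 1 \<and> \<not> eigen m)"
  then have "{-1..1::real} \<subseteq> {l. \<bar>l\<bar> \<le> 1 \<and> eigen l}" by auto
  then have "finite {-1..1::real}" using finite_eigen[of 1] finite_subset by simp
  then show False using infinite_Icc[of "-1::real" 1] by simp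
 qed
 then show thesis using that by blast
qed

end

section \<open>Norms of solutions and of their primitives at large spectral parameter\<close>

context regular_bessel
begin

lemma u_deriv_sub:
 assumes "0 < a" "c \<le> b" "x \<in> {a..c}"
 shows "(u l has_real_derivative u' l x) (at x within {a..c})"
  "(u' l has_real_derivative (V x - l) * u l x) (at x within {a..c})"
proof -
 have sub: "{a..c} \<subseteq> {0<..b}" and xb: "x \<in> {0<..b}" using assms by auto
 show "(u l has_real_derivative u' l x) (at x within {a..c})" "(u' l has_real_derivative (V x - l) * u l x) (at x within {a..c})"
  by (rule DERIV_subset[OF u_deriv[OF xb] sub], rule DERIV_subset[OF u'_deriv[OF xb] sub])
qed

lemma u_cont_sub:
 assumes "0 < a" "c \<le> b"
 shows "continuous_on {a..c} (u l)" "continuous_on {a..c} (u' l)" "continuous_on {a..c} V"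
proof -
 have sub: "{a..c} \<subseteq> {0<..b}" using assms by auto
 show "continuous_on {a..c} (u l)" "continuous_on {a..c} (u' l)" "continuous_on {a..c} V"
  by (rule continuous_on_subset[OF _ sub], rule u_cont V_cont)+
qed

text \<open>The energy bound controls only u and u' together. Integrating the derivative of u u'
  expresses the integral of u'^2 by that of u^2 up to boundary terms of order s, so the energy of
  order s^2 must be carried by u^2. Below, S abbreviates the common size of the solutions.\<close>

lemma u_large_L2:
 assumes a: "0 < a" "a < c" "c \<le> b" "a < b"
 obtains s0 k where "s0 > 0" "k > 0"
  "\<And>s. s \<ge> s0 \<Longrightarrow> k * (s powr - (\<nu> + 1/2))\<^sup>2 \<le> integral {a..c} (\<lambda>x. (u (s\<^sup>2) x)\<^sup>2)"
proof -
 obtain s1 C e where E: "s1 > 0" "C > 0" "e > 0"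
  "\<And>s x. s \<ge> s1 \<Longrightarrow> x \<in> {a..b} \<Longrightarrow> \<bar>u (s\<^sup>2) x\<bar> \<le> C * s powr - (\<nu> + 1/2)"
  "\<And>s x. s \<ge> s1 \<Longrightarrow> x \<in> {a..b} \<Longrightarrow> \<bar>u' (s\<^sup>2) x\<bar> \<le> C * s * s powr - (\<nu> + 1/2)"
  "\<And>s x. s \<ge> s1 \<Longrightarrow> x \<in> {a..b} \<Longrightarrow> e * (s * s powr - (\<nu> + 1/2))\<^sup>2 \<le> s\<^sup>2 * (u (s\<^sup>2) x)\<^sup>2 + (u' (s\<^sup>2) x)\<^sup>2"
  using u_large_energy[OF a(1,4)] by metis
 obtain Vm where Vm: "Vm > 0" "\<And>x. x \<in> {a..c} \<Longrightarrow> \<bar>V x\<bar> \<le> Vm"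
  using compact_imp_bounded[OF compact_continuous_image[OF u_cont_sub(3)[OF a(1,3)] compact_Icc]]
  unfolding bounded_pos by fastforce
 define D where "D = e * (c - a)"
 have D: "D > 0" using E a by (simp add: D_def)
 show thesis
 \<comment> \<open>The threshold 4 C^2 / D makes the boundary terms at most half of the
   energy.\<close>
 proof (rule that[of "max (max s1 1) (4 * C\<^sup>2 / D)" "D / (2 * (2 + Vm))"])
  show "max (max s1 1) (4 * C\<^sup>2 / D) > 0" by simp
  show "D / (2 * (2 + Vm)) > 0" using D Vm by simp
  fix s assume ss: "s \<ge> max (max s1 1) (4 * C\<^sup>2 / D)"
  then have s: "s \<ge> s1" "s \<ge> 1" "4 * C\<^sup>2 \<le> D * s" using D by (auto simp: field_simps)
  define S where "S = s powr - (\<nu> + 1/2)"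
  have S: "S > 0" using s by (simp add: S_def)
  define I where "I = integral {a..c} (\<lambda>x. (u (s\<^sup>2) x)\<^sup>2)"
  note cont = u_cont_sub[OF a(1,3)]
  have hI: "((\<lambda>x. (u (s\<^sup>2) x)\<^sup>2) has_integral I) {a..c}" unfolding I_def
   by (intro integrable_integral integrable_continuous_interval continuous_intros cont)
  have I0: "I \<ge> 0" unfolding I_def
   by (intro Henstock_Kurzweil_Integration.integral_nonneg integrable_continuous_interval continuous_intros cont) simp
  have F: "((\<lambda>x. (u' (s\<^sup>2) x)\<^sup>2 + (V x - s\<^sup>2) * (u (s\<^sup>2) x)\<^sup>2) has_integral u (s\<^sup>2) c * u' (s\<^sup>2) c - u (s\<^sup>2) a * u' (s\<^sup>2) a) {a..c}"
  proof (rule fundamental_theorem_of_calculus)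
   fix x assume x: "x \<in> {a..c}"
   have "((\<lambda>x. u (s\<^sup>2) x * u' (s\<^sup>2) x) has_real_derivative u' (s\<^sup>2) x * u' (s\<^sup>2) x + (V x - s\<^sup>2) * u (s\<^sup>2) x * u (s\<^sup>2) x) (at x within {a..c})"
    by (rule DERIV_mult[OF u_deriv_sub[OF a(1,3) x]])
   then show "((\<lambda>x. u (s\<^sup>2) x * u' (s\<^sup>2) x) has_vector_derivative (u' (s\<^sup>2) x)\<^sup>2 + (V x - s\<^sup>2) * (u (s\<^sup>2) x)\<^sup>2) (at x within {a..c})"
    by (simp add: has_real_derivative_iff_has_vector_derivative power2_eq_square mult.assoc)
  qed (use a in simp)
  have bnd: "\<bar>u (s\<^sup>2) x * u' (s\<^sup>2) x\<bar> \<le> C\<^sup>2 * (s * S\<^sup>2)" if "x \<in> {a..b}" for x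
  proof -
   have "\<bar>u (s\<^sup>2) x\<bar> * \<bar>u' (s\<^sup>2) x\<bar> \<le> (C * S) * (C * s * S)"
    using E(4)[OF s(1) that] E(5)[OF s(1) that] E(2) S unfolding S_def[symmetric] by (intro mult_mono) auto
   then show ?thesis by (simp add: abs_mult power2_eq_square mult_ac)
  qed
  have "((\<lambda>x. e * (s * S)\<^sup>2) has_integral (c - a) *\<^sub>R (e * (s * S)\<^sup>2)) {a..c}"
   using has_integral_const_real[of "e * (s * S)\<^sup>2" a c] a by simp
  moreover have "((\<lambda>x. ((u' (s\<^sup>2) x)\<^sup>2 + (V x - s\<^sup>2) * (u (s\<^sup>2) x)\<^sup>2) + (2 * s\<^sup>2 + Vm) * (u (s\<^sup>2) x)\<^sup>2) has_integral
    (u (s\<^sup>2) c * u' (s\<^sup>2) c - u (s\<^sup>2) a * u' (s\<^sup>2) a) + (2 * s\<^sup>2 + Vm) * I) {a..c}"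
   by (intro has_integral_add F has_integral_mult_right hI)
  ultimately have "(c - a) *\<^sub>R (e * (s * S)\<^sup>2) \<le> (u (s\<^sup>2) c * u' (s\<^sup>2) c - u (s\<^sup>2) a * u' (s\<^sup>2) a) + (2 * s\<^sup>2 + Vm) * I"
  proof (rule has_integral_le)
   fix x assume x: "x \<in> {a..c}"
   then have "x \<in> {a..b}" using a by auto
   from E(6)[OF s(1) this] have "e * (s * S)\<^sup>2 \<le> s\<^sup>2 * (u (s\<^sup>2) x)\<^sup>2 + (u' (s\<^sup>2) x)\<^sup>2" by (simp add: S_def)
   moreover have "- Vm * (u (s\<^sup>2) x)\<^sup>2 \<le> V x * (u (s\<^sup>2) x)\<^sup>2" using Vm(2)[OF x] by (intro mult_right_mono) auto
   ultimately show "e * (s * S)\<^sup>2 \<le> ((u' (s\<^sup>2) x)\<^sup>2 + (V x - s\<^sup>2) * (u (s\<^sup>2) x)\<^sup>2) + (2 * s\<^sup>2 + Vm) * (u (s\<^sup>2) x)\<^sup>2"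
    by (simp add: algebra_simps)
  qed
  moreover have "u (s\<^sup>2) c * u' (s\<^sup>2) c - u (s\<^sup>2) a * u' (s\<^sup>2) a \<le> 2 * (C\<^sup>2 * (s * S\<^sup>2))"
   using bnd[of a] bnd[of c] a by (simp add: abs_le_iff)
  ultimately have 1: "D * (s * S)\<^sup>2 \<le> 2 * (C\<^sup>2 * (s * S\<^sup>2)) + (2 * s\<^sup>2 + Vm) * I"
   by (simp add: D_def mult_ac)
  have 2: "2 * (C\<^sup>2 * (s * S\<^sup>2)) \<le> D * (s * S)\<^sup>2 / 2"
  proof -
   have "4 * C\<^sup>2 * (s * S\<^sup>2) \<le> D * s * (s * S\<^sup>2)" using s by (intro mult_right_mono) auto
   then show ?thesis by (simp add: power2_eq_square algebra_simps)
  qed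
  have "(2 * s\<^sup>2 + Vm) * I \<le> ((2 + Vm) * s\<^sup>2) * I"
  proof (rule mult_right_mono[OF _ I0])
   have "Vm * 1 \<le> Vm * s\<^sup>2" using Vm s by (intro mult_left_mono) auto
   then show "2 * s\<^sup>2 + Vm \<le> (2 + Vm) * s\<^sup>2" by (simp add: algebra_simps)
  qed
  with 1 2 have "D * (s * S)\<^sup>2 / 2 \<le> (2 + Vm) * s\<^sup>2 * I" by linarith
  then have "s\<^sup>2 * (D * S\<^sup>2 / 2) \<le> s\<^sup>2 * ((2 + Vm) * I)" by (simp add: power_mult_distrib mult_ac)
  then have "D * S\<^sup>2 / 2 \<le> (2 + Vm) * I" by (rule mult_left_le_imp_le) (use s in simp)
  then show "D / (2 * (2 + Vm)) * (s powr - (\<nu> + 1/2))\<^sup>2 \<le> integral {a..c} (\<lambda>x. (u (s\<^sup>2) x)\<^sup>2)"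
   using Vm unfolding S_def[symmetric] I_def[symmetric] by (simp add: field_simps)
 qed
qed

text \<open>Two-sided: the norm at s^2 is comparable with s^(-(\<nu>+1/2)). The lower bound needs
  only the right half of the interval, the upper one uses the bound valid down to 0.\<close>

lemma Nsq_large:
 obtains s0 k K where "s0 > 0" "k > 0" "K > 0"
  "\<And>s. s \<ge> s0 \<Longrightarrow> k * (s powr - (\<nu> + 1/2))\<^sup>2 \<le> Nsq (s\<^sup>2)" "\<And>s. s \<ge> s0 \<Longrightarrow> Nsq (s\<^sup>2) \<le> K * (s powr - (\<nu> + 1/2))\<^sup>2"
proof -
 have h: "0 < b / 2" "b / 2 < b" "b \<le> b" using b by auto
 obtain s0 k where A: "s0 > 0" "k > 0" "\<And>s. s \<ge> s0 \<Longrightarrow> k * (s powr - (\<nu> + 1/2))\<^sup>2 \<le> integral {b/2..b} (\<lambda>x. (u (s\<^sup>2) x)\<^sup>2)"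
  using u_large_L2[OF h h(2)] by metis
 obtain s1 C where B: "s1 > 0" "C > 0" "\<And>s x. s \<ge> s1 \<Longrightarrow> x \<in> {0<..b} \<Longrightarrow> \<bar>u (s\<^sup>2) x\<bar> \<le> C * s powr - (\<nu> + 1/2)"
  using u_large by metis
 show thesis
 proof (rule that[of "max s0 s1" k "C\<^sup>2 * b"])
  fix s assume s: "s \<ge> max s0 s1"
  have i: "integrable M (\<lambda>x. (u (s\<^sup>2) x)\<^sup>2)" using u_sq_int by auto
  have "integral {b/2..b} (\<lambda>x. (u (s\<^sup>2) x)\<^sup>2) = (\<integral>x. indicator {b/2..b} x *\<^sub>R (u (s\<^sup>2) x)\<^sup>2 \<partial>M)"
   using integral_lb_indicator(2)[OF i] b by simp
  also have "\<dots> \<le> Nsq (s\<^sup>2)" unfolding Nsq_def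
   using integral_lb_indicator(1)[OF i, of "b/2" b] i b by (intro integral_mono) (auto simp: indicator_def)
  finally show "k * (s powr - (\<nu> + 1/2))\<^sup>2 \<le> Nsq (s\<^sup>2)" using A(3)[of s] s by simp
  have "Nsq (s\<^sup>2) \<le> (\<integral>x. (C * s powr - (\<nu> + 1/2))\<^sup>2 \<partial>M)" unfolding Nsq_def
  proof (rule integral_mono[OF i])
   show "integrable M (\<lambda>x. (C * s powr - (\<nu> + 1/2))\<^sup>2)" by (rule finite_measure.integrable_const[OF finite_measure_lb])
   fix x assume "x \<in> space M"
   then have x: "x \<in> {0<..b}" by (auto simp: space_M)
   have "\<bar>u (s\<^sup>2) x\<bar>\<^sup>2 \<le> (C * s powr - (\<nu> + 1/2))\<^sup>2" using B(3)[of s x] s x by (intro power_mono) auto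
   then show "(u (s\<^sup>2) x)\<^sup>2 \<le> (C * s powr - (\<nu> + 1/2))\<^sup>2" by simp
  qed
  also have "\<dots> = C\<^sup>2 * b * (s powr - (\<nu> + 1/2))\<^sup>2" using b by (simp add: measure_restrict_space space_M power_mult_distrib mult_ac)
  finally show "Nsq (s\<^sup>2) \<le> C\<^sup>2 * b * (s powr - (\<nu> + 1/2))\<^sup>2" .
 qed (use A B b in auto)
qed

text \<open>The primitive of an eigenfunction from \<open>a\<close> is its inner product with an indicator function; it is
 only a factor \<open>1 / sqrt l\<close> smaller than the eigenfunction itself.\<close>

lemma primitive_large:
 assumes a: "0 < a" "a < b"
 obtains s0 k where "s0 > 0" "k > 0"
  "\<And>s. s \<ge> s0 \<Longrightarrow> k * (s powr - (\<nu> + 1/2))\<^sup>2 / s\<^sup>2 \<le> integral {a..b} (\<lambda>x. (integral {a..x} (u (s\<^sup>2)))\<^sup>2)"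
proof -
 define c where "c = (a + b) / 2"
 have c: "a < c" "c < b" using a by (auto simp: c_def)
 obtain s1 C e where E: "s1 > 0" "C > 0" "e > 0"
  "\<And>s x. s \<ge> s1 \<Longrightarrow> x \<in> {a..b} \<Longrightarrow> \<bar>u (s\<^sup>2) x\<bar> \<le> C * s powr - (\<nu> + 1/2)"
  "\<And>s x. s \<ge> s1 \<Longrightarrow> x \<in> {a..b} \<Longrightarrow> \<bar>u' (s\<^sup>2) x\<bar> \<le> C * s * s powr - (\<nu> + 1/2)"
  "\<And>s x. s \<ge> s1 \<Longrightarrow> x \<in> {a..b} \<Longrightarrow> e * (s * s powr - (\<nu> + 1/2))\<^sup>2 \<le> s\<^sup>2 * (u (s\<^sup>2) x)\<^sup>2 + (u' (s\<^sup>2) x)\<^sup>2"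
  using u_large_energy[OF a] by metis
 obtain s2 k where A: "s2 > 0" "k > 0" "\<And>s. s \<ge> s2 \<Longrightarrow> k * (s powr - (\<nu> + 1/2))\<^sup>2 \<le> integral {a..c} (\<lambda>x. (u (s\<^sup>2) x)\<^sup>2)"
  using u_large_L2[OF a(1) c(1) less_imp_le[OF c(2)] a(2)] by metis
 define C3 where "C3 = C * (1 + b)"
 have C3: "C3 > 0" using E a by (simp add: C3_def)
 define k1 where "k1 = (b - c) * k"
 have k1: "k1 > 0" using A c by (simp add: k1_def)
 \<comment> \<open>The parameter in the weighted square inequality below, chosen so that the term
   without p absorbs exactly half of the lower bound for J.\<close>
 define \<eta> where "\<eta> = k1 / (2 * (b - a))"
 have eta: "\<eta> > 0" "\<eta> * (b - a) = k1 / 2" using k1 a by (auto simp: \<eta>_def field_simps)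
 show thesis
 proof (rule that[of "max (max s1 s2) 1" "k1 / 2 * (4 * \<eta>) / C3\<^sup>2"])
  show "k1 / 2 * (4 * \<eta>) / C3\<^sup>2 > 0" using k1 eta C3 by simp
  fix s assume "s \<ge> max (max s1 s2) 1"
  then have s: "s \<ge> s1" "s \<ge> s2" "s \<ge> 1" by auto
  define S where "S = s powr - (\<nu> + 1/2)"
  have S: "S > 0" using s by (simp add: S_def)
  define p where "p x = integral {a..x} (u (s\<^sup>2))" for x
  note cont = u_cont_sub[OF a(1) order_refl]
  have dp: "(p has_real_derivative u (s\<^sup>2) x) (at x within {a..b})" if "x \<in> {a..b}" for x
   unfolding p_def by (rule integral_has_real_derivative[OF cont(1) that])
  have pc: "continuous_on {a..b} p" unfolding continuous_on_eq_continuous_within using dp DERIV_continuous by blast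
  define P where "P = integral {a..b} (\<lambda>x. (p x)\<^sup>2)"
  have hP: "((\<lambda>x. (p x)\<^sup>2) has_integral P) {a..b}" unfolding P_def
   by (intro integrable_integral integrable_continuous_interval continuous_intros pc)
  \<comment> \<open>The derivative of (b - x) u p: the weight b - x removes the boundary term at b,
    and p vanishes at a. So the weighted integral of u^2 equals an integral of p against a function
    of size s S.\<close>
  have F: "((\<lambda>x. (b - x) * (u (s\<^sup>2) x)\<^sup>2 - p x * (u (s\<^sup>2) x - (b - x) * u' (s\<^sup>2) x)) has_integral
    (b - b) * u (s\<^sup>2) b * p b - (b - a) * u (s\<^sup>2) a * p a) {a..b}"
  proof (rule fundamental_theorem_of_calculus)
   fix x assume x: "x \<in> {a..b}"
   have "((\<lambda>x. (b - x) * u (s\<^sup>2) x * p x) has_real_derivative ((0 - 1) * u (s\<^sup>2) x + u' (s\<^sup>2) x * (b - x)) * p x + u (s\<^sup>2) x * ((b - x) * u (s\<^sup>2) x)) (at x within {a..b})"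
    by (intro DERIV_mult DERIV_diff DERIV_const DERIV_ident u_deriv_sub(1)[OF a(1) order_refl x] dp x)
   also have "((0 - 1) * u (s\<^sup>2) x + u' (s\<^sup>2) x * (b - x)) * p x + u (s\<^sup>2) x * ((b - x) * u (s\<^sup>2) x)
     = (b - x) * (u (s\<^sup>2) x)\<^sup>2 - p x * (u (s\<^sup>2) x - (b - x) * u' (s\<^sup>2) x)"
    by (simp add: power2_eq_square algebra_simps)
   finally show "((\<lambda>x. (b - x) * u (s\<^sup>2) x * p x) has_vector_derivative (b - x) * (u (s\<^sup>2) x)\<^sup>2 - p x * (u (s\<^sup>2) x - (b - x) * u' (s\<^sup>2) x)) (at x within {a..b})"
    by (simp add: has_real_derivative_iff_has_vector_derivative)
  qed (use a in simp)
  have "p a = 0" by (simp add: p_def)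
  with F have F0: "((\<lambda>x. (b - x) * (u (s\<^sup>2) x)\<^sup>2 - p x * (u (s\<^sup>2) x - (b - x) * u' (s\<^sup>2) x)) has_integral 0) {a..b}" by simp
  define J where "J = integral {a..b} (\<lambda>x. (b - x) * (u (s\<^sup>2) x)\<^sup>2)"
  have hJ: "((\<lambda>x. (b - x) * (u (s\<^sup>2) x)\<^sup>2) has_integral J) {a..b}" unfolding J_def
   by (intro integrable_integral integrable_continuous_interval continuous_intros cont)
  have lowJ: "k1 * S\<^sup>2 \<le> J"
  proof -
   have "k1 * S\<^sup>2 \<le> (b - c) * integral {a..c} (\<lambda>x. (u (s\<^sup>2) x)\<^sup>2)"
    using mult_left_mono[OF A(3)[OF s(2)], of "b - c"] c by (simp add: k1_def S_def mult.assoc)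
   also have "\<dots> = integral {a..c} (\<lambda>x. (b - c) * (u (s\<^sup>2) x)\<^sup>2)" by simp
   also have "\<dots> \<le> integral {a..c} (\<lambda>x. (b - x) * (u (s\<^sup>2) x)\<^sup>2)"
    by (intro integral_le integrable_continuous_interval continuous_intros u_cont_sub[OF a(1) less_imp_le[OF c(2)]] mult_right_mono) auto
   also have "\<dots> \<le> J" unfolding J_def
    by (intro integral_subset_le integrable_continuous_interval continuous_intros u_cont_sub[OF a(1) less_imp_le[OF c(2)]] cont) (use c in auto)
   finally show ?thesis .
  qed
  have g1: "((\<lambda>x. \<eta> * S\<^sup>2 + (C3 * s)\<^sup>2 / (4 * \<eta>) * (p x)\<^sup>2) has_integral (b - a) *\<^sub>R (\<eta> * S\<^sup>2) + (C3 * s)\<^sup>2 / (4 * \<eta>) * P) {a..b}"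
   using has_integral_add[OF has_integral_const_real[of "\<eta> * S\<^sup>2" a b] has_integral_mult_right[OF hP, of "(C3 * s)\<^sup>2 / (4 * \<eta>)"]] a by simp
  have f1: "((\<lambda>x. (b - x) * (u (s\<^sup>2) x)\<^sup>2 - ((b - x) * (u (s\<^sup>2) x)\<^sup>2 - p x * (u (s\<^sup>2) x - (b - x) * u' (s\<^sup>2) x))) has_integral J - 0) {a..b}"
   by (intro has_integral_diff hJ F0)
  have r: "J - 0 \<le> (b - a) *\<^sub>R (\<eta> * S\<^sup>2) + (C3 * s)\<^sup>2 / (4 * \<eta>) * P"
  proof (rule has_integral_le[OF f1 g1])
   fix x assume x: "x \<in> {a..b}"
   have "\<bar>u (s\<^sup>2) x - (b - x) * u' (s\<^sup>2) x\<bar> \<le> \<bar>u (s\<^sup>2) x\<bar> + (b - x) * \<bar>u' (s\<^sup>2) x\<bar>"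
    using x by (intro order_trans[OF abs_triangle_ineq4]) (simp add: abs_mult)
   also have "\<dots> \<le> C * S * s + b * (C * s * S)"
   proof (intro add_mono mult_mono)
    have "C * S * 1 \<le> C * S * s" using E S s by (intro mult_left_mono) auto
    then show "\<bar>u (s\<^sup>2) x\<bar> \<le> C * S * s" using E(4)[OF s(1) x] by (simp add: S_def)
    show "\<bar>u' (s\<^sup>2) x\<bar> \<le> C * s * S" using E(5)[OF s(1) x] by (simp add: S_def)
   qed (use x a in auto)
   also have "\<dots> = C3 * s * S" by (simp add: C3_def algebra_simps)
   finally have w: "\<bar>u (s\<^sup>2) x - (b - x) * u' (s\<^sup>2) x\<bar> \<le> C3 * s * S" .
   define ap where "ap = \<bar>p x\<bar>"
   have ap: "ap\<^sup>2 = (p x)\<^sup>2" "ap \<ge> 0" by (simp_all add: ap_def)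
   have "p x * (u (s\<^sup>2) x - (b - x) * u' (s\<^sup>2) x) \<le> \<bar>p x * (u (s\<^sup>2) x - (b - x) * u' (s\<^sup>2) x)\<bar>" by (rule abs_ge_self)
   also have "\<dots> = ap * \<bar>u (s\<^sup>2) x - (b - x) * u' (s\<^sup>2) x\<bar>" by (simp only: abs_mult ap_def)
   also have "\<dots> \<le> ap * (C3 * s * S)" by (rule mult_left_mono[OF w ap(2)])
   also have "\<dots> \<le> \<eta> * S\<^sup>2 + (C3 * s)\<^sup>2 / (4 * \<eta>) * (p x)\<^sup>2"
   proof -
    have "0 \<le> (2 * \<eta> * S - C3 * s * ap)\<^sup>2" by simp
    also have "(2 * \<eta> * S - C3 * s * ap)\<^sup>2 = 4 * \<eta> * (\<eta> * S\<^sup>2) - 4 * \<eta> * (ap * (C3 * s * S)) + (C3 * s)\<^sup>2 * ap\<^sup>2"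
     by (simp add: power2_eq_square algebra_simps)
    finally have "4 * \<eta> * (ap * (C3 * s * S)) \<le> 4 * \<eta> * (\<eta> * S\<^sup>2) + (C3 * s)\<^sup>2 * (p x)\<^sup>2" unfolding ap(1) by linarith
    then have "4 * \<eta> * (ap * (C3 * s * S)) \<le> 4 * \<eta> * (\<eta> * S\<^sup>2 + (C3 * s)\<^sup>2 / (4 * \<eta>) * (p x)\<^sup>2)"
     using eta by (simp add: distrib_left)
    then show ?thesis by (rule mult_left_le_imp_le) (use eta in simp)
   qed
   finally show "(b - x) * (u (s\<^sup>2) x)\<^sup>2 - ((b - x) * (u (s\<^sup>2) x)\<^sup>2 - p x * (u (s\<^sup>2) x - (b - x) * u' (s\<^sup>2) x)) \<le> \<eta> * S\<^sup>2 + (C3 * s)\<^sup>2 / (4 * \<eta>) * (p x)\<^sup>2"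
    by simp
  qed
  have e: "(b - a) *\<^sub>R (\<eta> * S\<^sup>2) = k1 / 2 * S\<^sup>2" using arg_cong[OF eta(2), of "\<lambda>t. t * S\<^sup>2"] by (simp add: mult_ac)
  have "k1 * S\<^sup>2 \<le> k1 / 2 * S\<^sup>2 + (C3 * s)\<^sup>2 / (4 * \<eta>) * P" using lowJ r unfolding e by linarith
  then have "k1 / 2 * S\<^sup>2 \<le> C3\<^sup>2 * s\<^sup>2 / (4 * \<eta>) * P" unfolding power_mult_distrib by linarith
  then have "k1 / 2 * S\<^sup>2 * (4 * \<eta>) / (C3\<^sup>2 * s\<^sup>2) \<le> P"
  proof -
   assume h: "k1 / 2 * S\<^sup>2 \<le> C3\<^sup>2 * s\<^sup>2 / (4 * \<eta>) * P"
   have "k1 / 2 * S\<^sup>2 * (4 * \<eta>) \<le> C3\<^sup>2 * s\<^sup>2 / (4 * \<eta>) * P * (4 * \<eta>)"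
    using h eta(1) by (intro mult_right_mono) auto
   also have "\<dots> = P * (C3\<^sup>2 * s\<^sup>2)" using eta(1) by simp
   finally show ?thesis using C3 s by (subst pos_divide_le_eq) auto
  qed
  moreover have "k1 / 2 * (4 * \<eta>) / C3\<^sup>2 * S\<^sup>2 / s\<^sup>2 = k1 / 2 * S\<^sup>2 * (4 * \<eta>) / (C3\<^sup>2 * s\<^sup>2)" by (simp add: mult_ac)
  ultimately show "k1 / 2 * (4 * \<eta>) / C3\<^sup>2 * (s powr - (\<nu> + 1/2))\<^sup>2 / s\<^sup>2 \<le> integral {a..b} (\<lambda>x. (integral {a..x} (u (s\<^sup>2)))\<^sup>2)"
   unfolding S_def[symmetric] P_def[symmetric, unfolded p_def] by simp
 qed simp
qed

end

context bessel_bc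
begin

text \<open>For fixed x the coefficients of one indicator function are summed over the eigenvalues;
  integration in x then converts them into square norms of primitives. The primitives start at b/2
  because the lower bounds for u hold only away from 0.\<close>

lemma trace_bound:
 obtains L0 C where "L0 > 0" "\<And>S. finite S \<Longrightarrow> (\<And>l. l \<in> S \<Longrightarrow> eigen l \<and> l \<ge> L0) \<Longrightarrow> (\<Sum>l\<in>S. 1 / l) \<le> C"
proof -
 define a where "a = b / 2"
 have a: "0 < a" "a < b" using b by (auto simp: a_def)
 obtain s1 k where A: "s1 > 0" "k > 0"
  "\<And>s. s \<ge> s1 \<Longrightarrow> k * (s powr - (\<nu> + 1/2))\<^sup>2 / s\<^sup>2 \<le> integral {a..b} (\<lambda>x. (integral {a..x} (u (s\<^sup>2)))\<^sup>2)"
  using primitive_large[OF a] by metis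
 obtain s2 k' K where B: "s2 > 0" "k' > 0" "K > 0" "\<And>s. s \<ge> s2 \<Longrightarrow> k' * (s powr - (\<nu> + 1/2))\<^sup>2 \<le> Nsq (s\<^sup>2)" "\<And>s. s \<ge> s2 \<Longrightarrow> Nsq (s\<^sup>2) \<le> K * (s powr - (\<nu> + 1/2))\<^sup>2"
  using Nsq_large by metis
 define s0 where "s0 = max s1 s2"
 show thesis
 proof (rule that[of "s0\<^sup>2" "b * (b - a) * (K / k)"])
  show "s0\<^sup>2 > 0" using A by (simp add: s0_def)
  fix S assume S: "finite S" "\<And>l. l \<in> S \<Longrightarrow> eigen l \<and> l \<ge> s0\<^sup>2"
  define P where "P l x = integral {a..x} (u l)" for l x
  have Pc: "continuous_on {a..b} (P l)" for l unfolding P_def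
   by (intro indefinite_integral_continuous_1 integrable_continuous_interval u_cont_sub[OF a(1) order_refl])
  have "(\<Sum>l\<in>S. k / K * (1 / l)) \<le> (\<Sum>l\<in>S. integral {a..b} (\<lambda>x. (P l x)\<^sup>2) / Nsq l)"
  proof (rule sum_mono)
   fix l assume l: "l \<in> S"
   define s where "s = sqrt l"
   have l0: "l \<ge> s0\<^sup>2" "s0 > 0" using S(2)[OF l] A by (auto simp: s0_def)
   have lpos: "l > 0" using l0 by (smt (verit) zero_less_power2)
   have s: "s \<ge> s0" "s\<^sup>2 = l" "s > 0" using l0 lpos by (auto simp: s_def intro: real_le_rsqrt)
   define T where "T = (s powr - (\<nu> + 1/2))\<^sup>2"
   have T: "T > 0" using s by (simp add: T_def)
   have 1: "k * T / l \<le> integral {a..b} (\<lambda>x. (P l x)\<^sup>2)" using A(3)[of s] s by (simp add: T_def P_def s0_def)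
   have 2: "Nsq l \<le> K * T" using B(5)[of s] s by (simp add: T_def s0_def)
   have "k / K * (1 / l) = (k * T / l) / (K * T)" using T B by simp
   also have "\<dots> \<le> integral {a..b} (\<lambda>x. (P l x)\<^sup>2) / Nsq l"
   proof (rule frac_le)
    have "0 \<le> k * T / l" using A T lpos by simp
    then show "0 \<le> integral {a..b} (\<lambda>x. (P l x)\<^sup>2)" using 1 by linarith
   qed (use 1 2 Nsq_pos[of l] in auto)
   finally show "k / K * (1 / l) \<le> integral {a..b} (\<lambda>x. (P l x)\<^sup>2) / Nsq l" .
  qed
  also have "\<dots> = integral {a..b} (\<lambda>x. \<Sum>l\<in>S. (P l x)\<^sup>2 / Nsq l)"
   by (subst Henstock_Kurzweil_Integration.integral_sum[OF S(1)])
    (use Nsq_pos in \<open>auto intro!: integrable_continuous_interval continuous_intros Pc simp: less_imp_neq[symmetric]\<close>)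
  also have "\<dots> \<le> integral {a..b} (\<lambda>x. b)"
  proof (rule integral_le)
   show "(\<lambda>x. \<Sum>l\<in>S. (P l x)\<^sup>2 / Nsq l) integrable_on {a..b}"
    by (intro integrable_continuous_interval continuous_intros Pc) (use Nsq_pos in \<open>auto simp: less_imp_neq[symmetric]\<close>)
   fix x assume x: "x \<in> {a..b}"
   have "(\<Sum>l\<in>S. (P l x)\<^sup>2 / Nsq l) = (\<Sum>l\<in>S. (\<integral>y. indicator {a..x} y * u l y \<partial>M)\<^sup>2 / Nsq l)"
    using x a by (simp add: P_def integral_indicator_u)
   also have "\<dots> \<le> (\<integral>y. (indicator {a..x} y)\<^sup>2 \<partial>M)"
    by (rule eigen_Bessel) (use S indicator_sq_int in auto)
   also have "\<dots> = x - a" by (rule indicator_norm) (use x a in auto)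
   also have "\<dots> \<le> b" using x a by simp
   finally show "(\<Sum>l\<in>S. (P l x)\<^sup>2 / Nsq l) \<le> b" .
  qed auto
  also have "\<dots> = b * (b - a)" using a by simp
  finally have "k / K * (\<Sum>l\<in>S. 1 / l) \<le> b * (b - a)" by (simp only: sum_distrib_left)
  then show "(\<Sum>l\<in>S. 1 / l) \<le> b * (b - a) * (K / k)" using A B by (simp add: field_simps)
 qed
qed

end

section \<open>Compactness of the Green operator and extremal sequences\<close>

context sl_green
begin

lemma nrm_sq: "(nrm f)\<^sup>2 = (\<integral>x. (f x)\<^sup>2 \<partial>M)"
 by (simp add: nrm_def Bochner_Integration.integral_nonneg)

lemma nrm_cong: "(\<And>x. x \<in> {0<..<b} \<Longrightarrow> f x = g x) \<Longrightarrow> nrm f = nrm g"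
 unfolding nrm_def by (intro arg_cong[where f=sqrt] Bochner_Integration.integral_cong) (auto simp: space_M)

lemma nrm_cmult: "nrm (\<lambda>x. c * f x) = \<bar>c\<bar> * nrm f"
 by (simp add: nrm_def power_mult_distrib real_sqrt_mult)

lemma nrm_triangle:
 assumes "sq_int M f" "sq_int M g"
 shows "nrm (\<lambda>x. f x + g x) \<le> nrm f + nrm g"
proof -
 have "(nrm (\<lambda>x. f x + g x))\<^sup>2 = (nrm f)\<^sup>2 + 2 * (\<integral>x. f x * g x \<partial>M) + (nrm g)\<^sup>2"
  unfolding nrm_sq using sq_int_diff_expand[OF assms, of "-1"] by simp
 also have "(\<integral>x. f x * g x \<partial>M) \<le> nrm f * nrm g"
 proof -
  have "\<bar>\<integral>x. f x * g x \<partial>M\<bar>\<^sup>2 \<le> (nrm f * nrm g)\<^sup>2"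
   using integral_Cauchy_Schwarz[OF assms] by (simp add: power_mult_distrib nrm_sq)
  then have "\<bar>\<integral>x. f x * g x \<partial>M\<bar> \<le> nrm f * nrm g"
   by (rule power2_le_imp_le) (simp add: nrm_nonneg)
  then show ?thesis by simp
 qed
 finally have "(nrm (\<lambda>x. f x + g x))\<^sup>2 \<le> (nrm f + nrm g)\<^sup>2" by (simp add: power2_sum)
 then show ?thesis by (rule power2_le_imp_le) (simp add: nrm_nonneg add_nonneg_nonneg)
qed

lemma nrm_bound:
 assumes "sq_int M f" "\<And>x. x \<in> {0<..<b} \<Longrightarrow> \<bar>f x\<bar> \<le> e" "e \<ge> 0"
 shows "nrm f \<le> e * sqrt b"
proof -
 have "(\<integral>x. (f x)\<^sup>2 \<partial>M) \<le> (\<integral>x. e\<^sup>2 \<partial>M)"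
 proof (rule integral_mono)
  show "integrable M (\<lambda>x. e\<^sup>2)" by (rule finite_measure.integrable_const[OF finite_measure_lb])
  fix x assume "x \<in> space M"
  then have "\<bar>f x\<bar>\<^sup>2 \<le> e\<^sup>2" using assms by (intro power_mono) (auto simp: space_M)
  then show "(f x)\<^sup>2 \<le> e\<^sup>2" by simp
 qed (use assms in auto)
 also have "\<dots> = e\<^sup>2 * b" using b by (simp add: measure_restrict_space space_M)
 finally have "nrm f \<le> sqrt (e\<^sup>2 * b)" unfolding nrm_def by (rule real_sqrt_le_mono)
 then show ?thesis using assms by (simp add: real_sqrt_mult)
qed

lemma Gr_nrm_bound: "sq_int M \<phi> \<Longrightarrow> nrm (Gr \<phi>) \<le> Ck * b * b * nrm \<phi>"
proof -
 assume phi: "sq_int M \<phi>"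
 have "nrm (Gr \<phi>) \<le> (Ck * b * sqrt b * nrm \<phi>) * sqrt b"
 proof (rule nrm_bound[OF Gr_sq_int[OF phi]])
  fix x assume x: "x \<in> {0<..<b}"
  have "Ck * b * sqrt x * nrm \<phi> \<le> Ck * b * sqrt b * nrm \<phi>"
   using x Ck_pos b nrm_nonneg[of \<phi>] by (intro mult_right_mono mult_left_mono) auto
  then show "\<bar>Gr \<phi> x\<bar> \<le> Ck * b * sqrt b * nrm \<phi>" using Gr_bound(1)[OF _ phi, of x] x by auto
 qed (use Ck_pos b nrm_nonneg in auto)
 also have "\<dots> = Ck * b * b * nrm \<phi>" using b by (simp add: real_sqrt_mult[symmetric])
 finally show ?thesis .
qed

lemma Gr_lipschitz:
 assumes phi: "sq_int M \<phi>" and x: "0 < c" "x \<in> {c..b}" "y \<in> {c..b}"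
 shows "\<bar>Gr \<phi> x - Gr \<phi> y\<bar> \<le> Ck * b / sqrt c * nrm \<phi> * \<bar>x - y\<bar>"
proof -
 have "norm (Gr \<phi> x - Gr \<phi> y) \<le> Ck * b / sqrt c * nrm \<phi> * norm (x - y)"
 proof (rule field_differentiable_bound[of "{c..b}" "Gr \<phi>" "Gr' \<phi>"])
  fix z assume z: "z \<in> {c..b}"
  then have zb: "z \<in> {0<..b}" using x by auto
  show "(Gr \<phi> has_field_derivative Gr' \<phi> z) (at z within {c..b})"
   by (rule DERIV_subset[OF Gr_deriv[OF phi zb]]) (use x in auto)
  have "Ck * b / sqrt z * nrm \<phi> \<le> Ck * b / sqrt c * nrm \<phi>"
   using z x Ck_pos b nrm_nonneg[of \<phi>] by (intro mult_right_mono divide_left_mono) auto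
  then show "norm (Gr' \<phi> z) \<le> Ck * b / sqrt c * nrm \<phi>" using Gr_bound(2)[OF zb phi] by simp
 qed (use x in auto)
 then show ?thesis by simp
qed

lemma Gr_sqrt_bound: "sq_int M \<phi> \<Longrightarrow> nrm \<phi> \<le> 1 \<Longrightarrow> x \<in> {0<..b} \<Longrightarrow> \<bar>Gr \<phi> x\<bar> \<le> Ck * b * sqrt x"
proof -
 assume phi: "sq_int M \<phi>" "nrm \<phi> \<le> 1" and x: "x \<in> {0<..b}"
 have "Ck * b * sqrt x * nrm \<phi> \<le> Ck * b * sqrt x * 1"
  using phi x Ck_pos b by (intro mult_left_mono) auto
 then show ?thesis using Gr_bound(1)[OF x phi(1)] by simp
qed

text \<open>Arzela-Ascoli on the closed interval after extension by 0 at the origin. Equicontinuity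
  at 0 comes from the factor sqrt x, elsewhere from the Lipschitz bound, whose constant depends on
  the distance to 0.\<close>

lemma Gr_compact:
 assumes psi: "\<And>m::nat. sq_int M (\<psi> m)" "\<And>m. nrm (\<psi> m) \<le> 1"
 obtains g k where "continuous_on {0..b} g" "strict_mono (k :: nat \<Rightarrow> nat)"
  "\<forall>e>0. \<exists>N. \<forall>n x. n \<ge> N \<and> x \<in> {0<..b} \<longrightarrow> \<bar>Gr (\<psi> (k n)) x - g x\<bar> < e"
proof -
 define F where "F m x = (if x = 0 then 0 else Gr (\<psi> m) x)" for m x
 define A where "A = Ck * b"
 have A: "A > 0" using Ck_pos b by (simp add: A_def)
 have bd: "\<bar>F m x\<bar> \<le> A * sqrt x" if "x \<in> {0..b}" for m x
  using Gr_sqrt_bound[OF psi, of x m] that by (cases "x = 0") (auto simp: F_def A_def)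
 obtain g k where g: "continuous_on {0..b} g" "strict_mono (k :: nat \<Rightarrow> nat)"
  "\<And>e. 0 < e \<Longrightarrow> \<exists>N. \<forall>n x. n \<ge> N \<and> x \<in> {0..b} \<longrightarrow> norm (F (k n) x - g x) < e"
 proof (rule Arzela_Ascoli[of "{0..b}" F "A * sqrt b"])
  fix m x assume x: "x \<in> {0..b}"
  have "A * sqrt x \<le> A * sqrt b" using x A by (intro mult_left_mono) auto
  then show "norm (F m x) \<le> A * sqrt b" using bd[OF x, of m] by simp
 next
  fix x e :: real assume x: "x \<in> {0..b}" and e: "0 < e"
  show "\<exists>d. 0 < d \<and> (\<forall>n y. y \<in> {0..b} \<and> norm (x - y) < d \<longrightarrow> norm (F n x - F n y) < e)"
  proof (cases "x = 0")
   case True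
   show ?thesis
   proof (intro exI[of _ "(e / A)\<^sup>2"] conjI allI impI)
    show "(e / A)\<^sup>2 > 0" using e A by simp
    fix n y assume y: "y \<in> {0..b} \<and> norm (x - y) < (e / A)\<^sup>2"
    then have "sqrt y < e / A" using True e A by (intro real_less_lsqrt) auto
    then have "A * sqrt y < e" using A by (simp add: field_simps)
    then show "norm (F n x - F n y) < e" using bd[of y n] y True by (simp add: F_def)
   qed
  next
   case False
   then have x0: "x > 0" using x by simp
   define Lc where "Lc = A / sqrt (x / 2)"
   have Lc: "Lc > 0" using A x0 by (simp add: Lc_def)
   show ?thesis
   proof (intro exI[of _ "min (x / 2) (e / Lc)"] conjI allI impI)
    show "min (x / 2) (e / Lc) > 0" using x0 e Lc by simp
    fix n y assume y: "y \<in> {0..b} \<and> norm (x - y) < min (x / 2) (e / Lc)"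
    then have xy: "\<bar>x - y\<bar> < x / 2" "\<bar>x - y\<bar> < e / Lc" by auto
    then have "x / 2 \<le> y" by linarith
    then have yy: "x \<in> {x/2..b}" "y \<in> {x/2..b}" "y \<noteq> 0" "\<bar>x - y\<bar> < e / Lc" using x x0 y xy by auto
    have "\<bar>Gr (\<psi> n) x - Gr (\<psi> n) y\<bar> \<le> Ck * b / sqrt (x/2) * nrm (\<psi> n) * \<bar>x - y\<bar>"
     by (rule Gr_lipschitz[OF psi(1) _ yy(1,2)]) (use x0 in simp)
    also have "\<dots> \<le> Lc * 1 * \<bar>x - y\<bar>"
     unfolding Lc_def A_def[symmetric] using psi(2) A x0 nrm_nonneg by (intro mult_right_mono mult_left_mono) auto
    also have "\<dots> < Lc * (e / Lc)" using mult_strict_left_mono[OF yy(4) Lc] by simp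
    finally show "norm (F n x - F n y) < e" using False yy(3) Lc by (simp add: F_def)
   qed
  qed
 qed auto
 show thesis
 proof (rule that[OF g(1,2)], intro allI impI)
  fix e :: real assume "e > 0"
  from g(3)[OF this] obtain N where N: "\<And>n x. n \<ge> N \<Longrightarrow> x \<in> {0..b} \<Longrightarrow> norm (F (k n) x - g x) < e" by blast
  show "\<exists>N. \<forall>n x. n \<ge> N \<and> x \<in> {0<..b} \<longrightarrow> \<bar>Gr (\<psi> (k n)) x - g x\<bar> < e"
  proof (intro exI allI impI)
   fix n x assume "n \<ge> N \<and> x \<in> {0<..b}"
   then show "\<bar>Gr (\<psi> (k n)) x - g x\<bar> < e" using N[of n x] by (auto simp: F_def)
  qed
 qed
qed

text \<open>An extremal sequence for the norm of \<open>Gr\<close> on an invariant subspace is mapped by \<open>Gr\<close> to a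
 sequence with a uniform limit, an eigenfunction of \<open>Gr\<^sup>2\<close> and hence a source of one for \<open>Gr\<close>.\<close>

lemma Gr_invariant_eigenfunction:
 assumes V: "\<And>\<phi>. \<phi> \<in> V \<Longrightarrow> sq_int M \<phi>" "\<And>\<phi>. \<phi> \<in> V \<Longrightarrow> Gr \<phi> \<in> V"
  "\<And>\<phi> \<psi> s t. \<phi> \<in> V \<Longrightarrow> \<psi> \<in> V \<Longrightarrow> (\<lambda>x. s * \<phi> x + t * \<psi> x) \<in> V"
  and Vlim: "\<And>\<phi> g. (\<And>n. \<phi> n \<in> V) \<Longrightarrow> continuous_on {0..b} g \<Longrightarrow>
    (\<And>e. e > 0 \<Longrightarrow> \<exists>N. \<forall>n x. n \<ge> (N::nat) \<and> x \<in> {0<..b} \<longrightarrow> \<bar>\<phi> n x - g x\<bar> < e) \<Longrightarrow> g \<in> V"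
  and ne: "\<phi>0 \<in> V" "nrm (Gr \<phi>0) \<noteq> 0"
 obtains h \<kappa> where "h \<in> V" "continuous_on {0<..b} h" "\<kappa> \<noteq> 0" "nrm h \<noteq> 0" "nrm (\<lambda>x. Gr h x - \<kappa> * h x) = 0"
proof -
 define A where "A = {nrm (Gr \<psi>) | \<psi>. \<psi> \<in> V \<and> nrm \<psi> \<le> 1}"
 define N where "N = Sup A"
 have bA: "bdd_above A"
 proof (rule bdd_aboveI)
  fix r assume "r \<in> A"
  then obtain \<psi> where p: "\<psi> \<in> V" "nrm \<psi> \<le> 1" "r = nrm (Gr \<psi>)" by (auto simp: A_def)
  have "Ck * b * b * nrm \<psi> \<le> Ck * b * b * 1" using p Ck_pos b by (intro mult_left_mono) auto
  then show "r \<le> Ck * b * b" using Gr_nrm_bound[OF V(1)[OF p(1)]] p by simp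
 qed
 have leN: "nrm (Gr \<psi>) \<le> N * nrm \<psi>" if p: "\<psi> \<in> V" for \<psi>
 proof (cases "nrm \<psi> = 0")
  case True
  then show ?thesis using Gr_nrm_bound[OF V(1)[OF p]] by simp
 next
  case False
  then have r: "nrm \<psi> > 0" using nrm_nonneg[of \<psi>] by simp
  \<comment> \<open>The normalized function, written as a linear combination so that the closure
    assumption on V applies.\<close>
  define \<theta> where "\<theta> = (\<lambda>x. (1 / nrm \<psi>) * \<psi> x + 0 * \<psi> x)"
  have c: "\<theta> \<in> V" unfolding \<theta>_def by (rule V(3)[OF p p])
  have "nrm \<theta> = 1" unfolding \<theta>_def using nrm_cmult[of "1 / nrm \<psi>" \<psi>] r by simp
  then have "nrm (Gr \<theta>) \<in> A" using c by (auto simp: A_def)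
  then have 1: "nrm (Gr \<theta>) \<le> N" unfolding N_def by (rule cSup_upper[OF _ bA])
  have "nrm (Gr \<theta>) = nrm (\<lambda>x. 1 / nrm \<psi> * Gr \<psi> x)"
   unfolding \<theta>_def by (rule nrm_cong) (subst Gr_linear[OF V(1)[OF p] V(1)[OF p]], auto)
  also have "\<dots> = nrm (Gr \<psi>) / nrm \<psi>" using nrm_cmult[of "1 / nrm \<psi>" "Gr \<psi>"] r by simp
  finally have "nrm (Gr \<psi>) = nrm (Gr \<theta>) * nrm \<psi>" using r by (simp add: field_simps)
  then show ?thesis using mult_right_mono[OF 1, of "nrm \<psi>"] r by simp
 qed
 have N: "N > 0"
 proof -
  have "0 < N * nrm \<phi>0" using leN[OF ne(1)] ne(2) nrm_nonneg[of "Gr \<phi>0"] by linarith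
  then show ?thesis using nrm_nonneg[of \<phi>0] by (simp add: zero_less_mult_iff)
 qed
 have Ane: "A \<noteq> {}"
 proof -
  have "(\<lambda>x. 0 * \<phi>0 x + 0 * \<phi>0 x) \<in> V" by (rule V(3)[OF ne(1) ne(1)])
  moreover have "nrm (\<lambda>x. 0 * \<phi>0 x + 0 * \<phi>0 x) \<le> 1" by (simp add: nrm_def)
  ultimately show ?thesis unfolding A_def by blast
 qed
 have "\<exists>\<psi>. \<psi> \<in> V \<and> nrm \<psi> \<le> 1 \<and> N - 1 / (real m + 1) < nrm (Gr \<psi>)" for m :: nat
 proof -
  have "N - 1 / (real m + 1) < Sup A" by (simp add: N_def)
  from less_cSupD[OF Ane this] show ?thesis by (auto simp: A_def)
 qed
 then obtain \<psi> where psi: "\<And>m::nat. \<psi> m \<in> V" "\<And>m. nrm (\<psi> m) \<le> 1" "\<And>m. N - 1 / (real m + 1) < nrm (Gr (\<psi> m))" by metis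
 have psq: "sq_int M (\<psi> m)" for m using psi V by auto
 obtain g k where g: "continuous_on {0..b} g" "strict_mono (k :: nat \<Rightarrow> nat)"
  "\<forall>e>0. \<exists>N. \<forall>n x. n \<ge> N \<and> x \<in> {0<..b} \<longrightarrow> \<bar>Gr (\<psi> (k n)) x - g x\<bar> < e"
  by (rule Gr_compact[where \<psi>=\<psi>, OF psq psi(2)]) blast
 have gV: "g \<in> V" by (rule Vlim[OF V(2)[OF psi(1)] g(1) g(3)[rule_format]])
 have gc: "continuous_on {0<..b} g" by (rule continuous_on_subset[OF g(1)]) auto
 have gsq: "sq_int M g" by (rule V(1)[OF gV])
 define G2 where "G2 \<phi> = Gr (Gr \<phi>)" for \<phi>
 \<comment> \<open>The first part makes g an eigenfunction of the square of \<open>Gr\<close> for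
   the value N^2; the second keeps g from being 0.\<close>
 have small: "\<exists>n. nrm (\<lambda>x. G2 g x - N\<^sup>2 * g x) \<le> e \<and> N - e \<le> nrm g" if e: "e > 0" for e
 proof -
  define e1 where "e1 = e / (4 * (N\<^sup>2 + 1) * (sqrt b + 1))"
  have e1: "e1 > 0" using e b unfolding e1_def by (intro divide_pos_pos mult_pos_pos add_nonneg_pos) auto
  have e1b: "e1 * sqrt b * (N\<^sup>2 + 1) \<le> e / 4"
  proof -
   have "e1 * sqrt b * (N\<^sup>2 + 1) \<le> e1 * (sqrt b + 1) * (N\<^sup>2 + 1)" using e1 by (intro mult_right_mono mult_left_mono) auto
   also have "\<dots> = e / 4" unfolding e1_def using b by (simp add: field_simps add_nonneg_eq_0_iff)
   finally show ?thesis .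
  qed
  obtain n0 where n0: "\<And>n x. n \<ge> n0 \<Longrightarrow> x \<in> {0<..b} \<Longrightarrow> \<bar>Gr (\<psi> (k n)) x - g x\<bar> < e1"
   using g(3)[rule_format, OF e1] by blast
  \<comment> \<open>How far p may fall short of the supremum: the first entry serves the norm of g,
    the second makes N times the norm of r at most e/4.\<close>
  define d where "d = min (e / 4) ((e / 4)\<^sup>2 / (2 * N ^ 4 * N + 1))"
  have d: "d > 0" "d \<le> e / 4" "d \<le> (e / 4)\<^sup>2 / (2 * N ^ 4 * N + 1)"
  proof -
   have "2 * N ^ 4 * N + 1 > 0" using N by (intro add_pos_pos mult_pos_pos) auto
   then show "d > 0" using e by (simp add: d_def)
  qed (simp_all only: d_def min.cobounded1 min.cobounded2)
  obtain n1 :: nat where "1 / d < real n1" using reals_Archimedean2 by blast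
  then have n1: "1 / (real n1 + 1) < d" using d by (simp add: field_simps)
  define n where "n = max n0 n1"
  define p where "p = \<psi> (k n)"
  have pV: "p \<in> V" and p1: "nrm p \<le> 1" and psq: "sq_int M p" using psi V by (auto simp: p_def)
  have pN: "N - d < nrm (Gr p)"
  proof -
   have "n1 \<le> k n" using seq_suble[OF g(2), of n] by (simp add: n_def)
   then have "1 / (real (k n) + 1) \<le> 1 / (real n1 + 1)" by (intro divide_left_mono) auto
   then show ?thesis using psi(3)[of "k n"] n1 by (simp add: p_def)
  qed
  define q where "q = (\<lambda>x. 1 * g x + (- 1) * Gr p x)"
  have qV: "q \<in> V" unfolding q_def by (rule V(3)[OF gV V(2)[OF pV]])
  have qn: "nrm q \<le> e1 * sqrt b"
  proof (rule nrm_bound[OF V(1)[OF qV]])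
   fix x assume "x \<in> {0<..<b}"
   then show "\<bar>q x\<bar> \<le> e1" using n0[of n x] by (simp add: n_def p_def q_def abs_minus_commute)
  qed (use e1 in simp)
  have Gp: "Gr p \<in> V" "G2 p \<in> V" using V(2) pV by (auto simp: G2_def)
  define r where "r = (\<lambda>x. 1 * G2 p x + (- (N\<^sup>2)) * p x)"
  have rV: "r \<in> V" unfolding r_def by (rule V(3)[OF Gp(2) pV])
  \<comment> \<open>Expand the square. By symmetry the mixed term is the square norm of
    \<open>Gr p\<close>, and what remains is N^2 times the gap between N^2 and that square
    norm.\<close>
  have rn: "(nrm r)\<^sup>2 \<le> 2 * N ^ 3 * d"
  proof -
   have "(nrm r)\<^sup>2 = (nrm (G2 p))\<^sup>2 - 2 * N\<^sup>2 * (\<integral>x. G2 p x * p x \<partial>M) + N ^ 4 * (nrm p)\<^sup>2"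
    unfolding nrm_sq r_def using sq_int_diff_expand[OF V(1)[OF Gp(2)] psq, of "N\<^sup>2"] by (simp add: power_mult[symmetric])
   also have "(\<integral>x. G2 p x * p x \<partial>M) = (nrm (Gr p))\<^sup>2"
    unfolding G2_def nrm_sq using Gr_symmetric[OF V(1)[OF Gp(1)] psq] by (simp add: power2_eq_square)
   also have "(nrm (G2 p))\<^sup>2 \<le> (N * nrm (Gr p))\<^sup>2"
    unfolding G2_def using leN[OF Gp(1)] nrm_nonneg by (intro power_mono) auto
   also have "N ^ 4 * (nrm p)\<^sup>2 \<le> N ^ 4 * 1" using p1 nrm_nonneg[of p] N by (intro mult_left_mono power_le_one) auto
   finally have "(nrm r)\<^sup>2 \<le> N\<^sup>2 * (N\<^sup>2 - (nrm (Gr p))\<^sup>2)" by (simp add: power_mult_distrib algebra_simps power4_eq_xxxx power2_eq_square)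
   also have "\<dots> \<le> N\<^sup>2 * (2 * N * d)"
   proof (rule mult_left_mono)
    show "N\<^sup>2 - (nrm (Gr p))\<^sup>2 \<le> 2 * N * d"
    proof -
    have le: "nrm (Gr p) \<le> N" using leN[OF pV] p1 N by (smt (verit) mult_left_le)
    have "N\<^sup>2 - (nrm (Gr p))\<^sup>2 = (N - nrm (Gr p)) * (N + nrm (Gr p))" by (simp add: power2_eq_square algebra_simps)
    also have "\<dots> \<le> d * (2 * N)" using pN le nrm_nonneg[of "Gr p"] N d by (intro mult_mono) auto
    finally show "N\<^sup>2 - (nrm (Gr p))\<^sup>2 \<le> 2 * N * d" by (simp add: mult_ac)
    qed
   qed simp
   finally show ?thesis by (simp add: power2_eq_square power3_eq_cube mult_ac)
  qed
  have Nr: "N * nrm r \<le> e / 4"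
  proof -
   have "(N * nrm r)\<^sup>2 \<le> N\<^sup>2 * (2 * N ^ 3 * d)" using rn by (simp add: power_mult_distrib mult_left_mono)
   also have "\<dots> = (2 * N ^ 4 * N) * d" by (simp add: power2_eq_square power3_eq_cube power4_eq_xxxx mult_ac)
   also have "\<dots> \<le> (2 * N ^ 4 * N + 1) * ((e / 4)\<^sup>2 / (2 * N ^ 4 * N + 1))"
    using d N by (intro mult_mono) auto
   also have "\<dots> = (e / 4)\<^sup>2"
   proof -
    have "2 * N ^ 4 * N + 1 > 0" using N by (intro add_pos_pos mult_pos_pos) auto
    then show ?thesis by simp
   qed
   finally show ?thesis by (rule power2_le_imp_le) (use e in simp)
  qed
  define r1 where "r1 = (\<lambda>x. G2 q x + Gr r x)"
  define r2 where "r2 = (\<lambda>x. (- (N\<^sup>2)) * q x)"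
  have Gq: "Gr q \<in> V" "G2 q \<in> V" using V(2) qV by (auto simp: G2_def)
  have s1: "sq_int M (G2 q)" "sq_int M (Gr r)" using V(1) Gq V(2)[OF rV] by auto
  have s2: "sq_int M r2" unfolding r2_def by (rule sq_int_cmult[OF V(1)[OF qV]])
  have s12: "sq_int M r1" unfolding r1_def by (rule sq_int_add[OF s1])
  \<comment> \<open>With q = g - Gr p and r = G2 p - N^2 p, the residual of g equals G2 q + Gr r -
    N^2 q; every summand is small.\<close>
  have "nrm (\<lambda>x. G2 g x - N\<^sup>2 * g x) = nrm (\<lambda>x. r1 x + r2 x)"
  proof (rule nrm_cong)
   fix x assume "x \<in> {0<..<b}"
   then have x: "x \<in> {0<..b}" by auto
   have GqL: "Gr q y = 1 * Gr g y + (- 1) * Gr (Gr p) y" if "y \<in> {0<..b}" for y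
    unfolding q_def by (rule Gr_linear[OF gsq V(1)[OF Gp(1)] that])
   have "G2 q x = Gr (\<lambda>y. 1 * Gr g y + (- 1) * Gr (Gr p) y) x"
    unfolding G2_def Gr_def[of "Gr q"] Gr_def[of "\<lambda>y. 1 * Gr g y + (- 1) * Gr (Gr p) y"]
    using GqL by (intro arg_cong[where f=uminus] Bochner_Integration.integral_cong) (auto simp: space_M)
   also have "\<dots> = 1 * G2 g x + (- 1) * G2 (Gr p) x"
    unfolding G2_def by (rule Gr_linear[OF V(1)[OF V(2)[OF gV]] V(1)[OF V(2)[OF Gp(1)]] x])
   finally have 1: "G2 q x = G2 g x - G2 (Gr p) x" by simp
   have "Gr r x = 1 * Gr (G2 p) x + (- (N\<^sup>2)) * Gr p x" unfolding r_def
    by (rule Gr_linear[OF V(1)[OF Gp(2)] psq x])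
   then have 2: "Gr r x = G2 (Gr p) x - N\<^sup>2 * Gr p x" by (simp add: G2_def)
   show "G2 g x - N\<^sup>2 * g x = r1 x + r2 x" unfolding r1_def r2_def 1 2 by (simp add: q_def algebra_simps)
  qed
  also have "\<dots> \<le> nrm r1 + nrm r2" by (rule nrm_triangle[OF s12 s2])
  also have "nrm r1 \<le> nrm (G2 q) + nrm (Gr r)" unfolding r1_def by (rule nrm_triangle[OF s1])
  also have "nrm r2 = N\<^sup>2 * nrm q" unfolding r2_def using nrm_cmult[of "- (N\<^sup>2)" q] by simp
  also have "nrm (Gr r) \<le> e / 4" using leN[OF rV] Nr by linarith
  also have "nrm (G2 q) \<le> N\<^sup>2 * nrm q"
  proof -
   have "nrm (G2 q) \<le> N * nrm (Gr q)" unfolding G2_def by (rule leN[OF Gq(1)])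
   also have "\<dots> \<le> N * (N * nrm q)" using leN[OF qV] N by (intro mult_left_mono) auto
   finally show ?thesis by (simp add: power2_eq_square mult_ac)
  qed
  finally have "nrm (\<lambda>x. G2 g x - N\<^sup>2 * g x) \<le> 2 * (N\<^sup>2 * nrm q) + e / 4" by (simp add: mult_ac)
  moreover have qe: "(N\<^sup>2 + 1) * nrm q \<le> e / 4"
  proof -
   have "(N\<^sup>2 + 1) * nrm q \<le> (N\<^sup>2 + 1) * (e1 * sqrt b)" using qn by (intro mult_left_mono) auto
   then show ?thesis using e1b by (simp only: mult_ac)
  qed
  moreover have "N\<^sup>2 * nrm q \<le> (N\<^sup>2 + 1) * nrm q" "nrm q \<le> (N\<^sup>2 + 1) * nrm q"
   using nrm_nonneg[of q] by (auto simp: distrib_right)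
  ultimately have fin1: "nrm (\<lambda>x. G2 g x - N\<^sup>2 * g x) \<le> e" and qe2: "nrm q \<le> e / 4" using e by linarith+
  have "nrm (Gr p) = nrm (\<lambda>x. g x + (- 1) * q x)" by (rule nrm_cong) (simp add: q_def)
  also have "\<dots> \<le> nrm g + nrm q"
   using nrm_triangle[OF gsq sq_int_cmult[OF V(1)[OF qV], of "- 1"]] nrm_cmult[of "- 1" q] by simp
  finally have "N - e \<le> nrm g" using pN qe2 d e by linarith
  then show ?thesis using fin1 by blast
 qed
 have z: "nrm (\<lambda>x. G2 g x - N\<^sup>2 * g x) = 0"
 proof (rule antisym[OF field_le_epsilon nrm_nonneg])
  fix e :: real assume "e > 0"
  then show "nrm (\<lambda>x. G2 g x - N\<^sup>2 * g x) \<le> 0 + e" using small[of e] by auto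
 qed
 have gN: "nrm g \<noteq> 0" using small[of "N / 2"] N by auto
 have Gg: "Gr g \<in> V" "sq_int M (Gr g)" using V gV by auto
 \<comment> \<open>Factorization of \<open>Gr\<close> squared minus N squared: either h is an
   eigenfunction for N, or h = 0 and g is one for -N.\<close>
 define h where "h = (\<lambda>x. 1 * Gr g x + N * g x)"
 have hV: "h \<in> V" unfolding h_def by (rule V(3)[OF Gg(1) gV])
 have hc: "continuous_on {0<..b} h" unfolding h_def by (intro continuous_intros Gr_cont gsq gc)
 have "nrm (\<lambda>x. Gr h x - N * h x) = nrm (\<lambda>x. G2 g x - N\<^sup>2 * g x)"
 proof (rule nrm_cong)
  fix x assume "x \<in> {0<..<b}"
  then have x: "x \<in> {0<..b}" by auto
  have "Gr h x = 1 * Gr (Gr g) x + N * Gr g x" unfolding h_def by (rule Gr_linear[OF Gg(2) gsq x])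
  then show "Gr h x - N * h x = G2 g x - N\<^sup>2 * g x" by (simp add: h_def G2_def power2_eq_square algebra_simps)
 qed
 then have hz: "nrm (\<lambda>x. Gr h x - N * h x) = 0" using z by simp
 show thesis
 proof (cases "nrm h = 0")
  case False
  then show ?thesis using that[OF hV hc _ _ hz] N by simp
 next
  case True
  have "nrm (\<lambda>x. Gr g x - (- N) * g x) = nrm h" by (rule nrm_cong) (simp add: h_def)
  then show ?thesis using that[OF gV gc _ gN, of "- N"] True N by simp
 qed
qed

end

section \<open>Completeness of the eigenfunctions\<close>

context bessel_bc
begin

lemma u_boundary_0: "((\<lambda>x. x powr (\<nu> - 1/2) * ((\<nu> + 1/2) * u l x - x * u' l x)) \<longlongrightarrow> 0) (at_right 0)"
proof -
 obtain \<omega> B where sl: "sl_solution \<nu> b (\<lambda>x. V x - l) (u l) (u' l) \<omega> (lead_const \<nu>) B"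
  using sl_solution_u[of "\<bar>l\<bar> + 1"] by (metis abs_ge_zero add_nonneg_pos less_add_one less_imp_le zero_less_one)
 interpret S: sl_solution \<nu> b "\<lambda>x. V x - l" "u l" "u' l" \<omega> "lead_const \<nu>" B by (rule sl)
 show ?thesis
 proof (rule Lim_null_comparison)
  show "\<forall>\<^sub>F x in at_right 0. norm (x powr (\<nu> - 1/2) * ((\<nu> + 1/2) * u l x - x * u' l x)) \<le> (\<nu> + 3/2) * b powr (2 * \<nu>) * \<omega> x"
   unfolding eventually_at_right_field
  proof (intro exI[of _ b] conjI allI impI)
   fix x assume x: "0 < x" "x < b"
   then have xb: "x \<in> {0<..b}" by auto
   have "x powr (\<nu> - 1/2) * \<bar>(\<nu> + 1/2) * u l x - x * u' l x\<bar> \<le> x powr (\<nu> - 1/2) * ((\<nu> + 3/2) * \<omega> x * x powr (\<nu> + 1/2))"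
    using S.u_boundary_form[OF xb] by (intro mult_left_mono) auto
   also have "\<dots> = (\<nu> + 3/2) * (x powr (\<nu> - 1/2) * x powr (\<nu> + 1/2)) * \<omega> x" by simp
   also have "x powr (\<nu> - 1/2) * x powr (\<nu> + 1/2) = x powr (2 * \<nu>)" by (simp add: powr_add[symmetric])
   also have "(\<nu> + 3/2) * x powr (2 * \<nu>) * \<omega> x \<le> (\<nu> + 3/2) * b powr (2 * \<nu>) * \<omega> x"
    using x nu S.om[OF xb] by (intro mult_right_mono mult_left_mono powr_mono2) auto
   finally show "norm (x powr (\<nu> - 1/2) * ((\<nu> + 1/2) * u l x - x * u' l x)) \<le> (\<nu> + 3/2) * b powr (2 * \<nu>) * \<omega> x"
    by (simp add: abs_mult)
  qed (rule b)
  from tendsto_mult_left[OF S.om_0, of "(\<nu> + 3/2) * b powr (2 * \<nu>)"]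
  show "((\<lambda>x. (\<nu> + 3/2) * b powr (2 * \<nu>) * \<omega> x) \<longlongrightarrow> 0) (at_right 0)" by simp
 qed
qed

lemma sl_green_of_non_eigen:
 assumes "\<not> eigen m"
 obtains \<omega> B where "sl_green \<nu> b (\<lambda>x. V x - m) (u m) (u' m) \<omega> (lead_const \<nu>) B \<alpha> \<beta>"
proof -
 obtain \<omega> B where sl: "sl_solution \<nu> b (\<lambda>x. V x - m) (u m) (u' m) \<omega> (lead_const \<nu>) B"
  using sl_solution_u[of "\<bar>m\<bar> + 1"] by (metis abs_ge_zero add_nonneg_pos less_add_one less_imp_le zero_less_one)
 show thesis
  by (rule that) (use sl assms in \<open>auto simp: sl_green_def sl_green_axioms_def eigen_def\<close>)
qed

text \<open>The conditions at 0 make y a multiple of u, and the condition at b passes to u unless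
  the multiple is 0.\<close>

lemma eigen_of_solution:
 assumes y: "\<And>x. x \<in> {0<..b} \<Longrightarrow> (y has_real_derivative y' x) (at x within {0<..b})"
  "\<And>x. x \<in> {0<..b} \<Longrightarrow> (y' has_real_derivative (V x - l) * y x) (at x within {0<..b})"
  and ysq: "sq_int M y" and bb: "\<alpha> * y b + \<beta> * y' b = 0"
  and b0: "\<nu> < 1 \<Longrightarrow> ((\<lambda>x. x powr (\<nu> - 1/2) * ((\<nu> + 1/2) * y x - x * y' x)) \<longlongrightarrow> 0) (at_right 0)"
 obtains k where "\<And>x. x \<in> {0<..b} \<Longrightarrow> y x = k * u l x" "k = 0 \<or> eigen l"
proof -
 obtain \<omega> B where sl: "sl_solution \<nu> b (\<lambda>x. V x - l) (u l) (u' l) \<omega> (lead_const \<nu>) B"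
  using sl_solution_u[of "\<bar>l\<bar> + 1"] by (metis abs_ge_zero add_nonneg_pos less_add_one less_imp_le zero_less_one)
 interpret S: sl_solution \<nu> b "\<lambda>x. V x - l" "u l" "u' l" \<omega> "lead_const \<nu>" B by (rule sl)
 have sol: "S.solves y y'" unfolding S.solves_def using y by blast
 obtain k where k: "\<And>x. x \<in> {0<..b} \<Longrightarrow> y x = k * u l x" "\<And>x. x \<in> {0<..b} \<Longrightarrow> y' x = k * u' l x"
  using S.solves_unique[OF sol _ b0] ysq by blast
 have "k * (\<alpha> * u l b + \<beta> * u' l b) = \<alpha> * y b + \<beta> * y' b" using k[of b] b by (simp add: algebra_simps)
 then have "k = 0 \<or> eigen l" using bb by (simp add: eigen_def)
 then show thesis using that k by blast
qed

text \<open>The orthogonal complement X of all eigenfunctions is invariant under the symmetric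
  operator \<open>Gr\<close>. If it contained a nonzero element, it would contain an eigenfunction
  of \<open>Gr\<close>, which is a multiple of some \<open>u l\<close> with l an eigenvalue and
  hence orthogonal to itself.\<close>

lemma eigenfunctions_complete:
 assumes phi: "sq_int M \<phi>" and orth: "\<And>l. eigen l \<Longrightarrow> (\<integral>x. \<phi> x * u l x \<partial>M) = 0"
 shows "AE x in M. \<phi> x = 0"
proof -
 obtain m where m: "\<not> eigen m" by (rule exists_non_eigen)
 obtain \<omega> B where sg: "sl_green \<nu> b (\<lambda>x. V x - m) (u m) (u' m) \<omega> (lead_const \<nu>) B \<alpha> \<beta>"
  by (rule sl_green_of_non_eigen[OF m])
 interpret G: sl_green \<nu> b "\<lambda>x. V x - m" "u m" "u' m" \<omega> "lead_const \<nu>" B \<alpha> \<beta> by (rule sg)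
 define X where "X = {\<psi>. sq_int M \<psi> \<and> (\<forall>l. eigen l \<longrightarrow> (\<integral>x. \<psi> x * u l x \<partial>M) = 0)}"
 \<comment> \<open>An eigenfunction for l is mapped to its multiple by 1/(l - m); this is what makes
   X invariant.\<close>
 have Gu: "G.Gr (u l) x = u l x / (l - m)" if l: "eigen l" and x: "x \<in> {0<..b}" for l x
 proof -
  have lm: "l \<noteq> m" using l m by auto
  have "(1 / (l - m)) * u l x = G.Gr (u l) x"
  proof (rule G.Gr_inverse[where y'="\<lambda>x. (1 / (l - m)) * u' l x"])
   show "sq_int M (\<lambda>x. 1 / (l - m) * u l x)" by (rule sq_int_cmult[OF u_sq_int])
   show "sq_int M (u l)" by (rule u_sq_int)
   fix s assume s: "s \<in> {0<..b}"
   show "((\<lambda>x. 1 / (l - m) * u l x - G.Gr (u l) x) has_real_derivative 1 / (l - m) * u' l s - G.Gr' (u l) s) (at s within {0<..b})"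
    by (intro DERIV_diff DERIV_cmult u_deriv s G.Gr_deriv u_sq_int)
   have "((\<lambda>x. 1 / (l - m) * u' l x - G.Gr' (u l) x) has_real_derivative
     1 / (l - m) * ((V s - l) * u l s) - ((V s - m) * G.Gr (u l) s - u l s)) (at s within {0<..b})"
    by (intro DERIV_diff DERIV_cmult u'_deriv s G.Gr'_deriv_classical u_sq_int u_cont)
   also have "1 / (l - m) * ((V s - l) * u l s) - ((V s - m) * G.Gr (u l) s - u l s) = (V s - m) * (1 / (l - m) * u l s - G.Gr (u l) s)"
    using lm by (simp add: field_simps)
   finally show "((\<lambda>x. 1 / (l - m) * u' l x - G.Gr' (u l) x) has_real_derivative (V s - m) * (1 / (l - m) * u l s - G.Gr (u l) s)) (at s within {0<..b})" .
  next
   have "\<alpha> * (1 / (l - m) * u l b) + \<beta> * (1 / (l - m) * u' l b) = 1 / (l - m) * (\<alpha> * u l b + \<beta> * u' l b)"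
    by (simp add: algebra_simps add_divide_distrib)
   then show "\<alpha> * (1 / (l - m) * u l b) + \<beta> * (1 / (l - m) * u' l b) = 0" using l by (simp add: eigen_def)
   have eq: "(\<lambda>x. x powr (\<nu> - 1/2) * ((\<nu> + 1/2) * (c * u l x) - x * (c * u' l x)))
     = (\<lambda>x. c * (x powr (\<nu> - 1/2) * ((\<nu> + 1/2) * u l x - x * u' l x)))" for c by (auto simp: algebra_simps)
   show "((\<lambda>x. x powr (\<nu> - 1/2) * ((\<nu> + 1/2) * (1 / (l - m) * u l x) - x * (1 / (l - m) * u' l x))) \<longlongrightarrow> 0) (at_right 0)"
    using tendsto_mult_left[OF u_boundary_0[of l], of "1 / (l - m)"] unfolding eq mult_zero_right .
  qed (rule x)
  then show ?thesis by simp
 qed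
 show ?thesis
 proof (rule ccontr)
  assume nz: "\<not> (AE x in M. \<phi> x = 0)"
  have phiX: "\<phi> \<in> X" using phi orth by (simp add: X_def)
  have ne: "G.nrm (G.Gr \<phi>) \<noteq> 0"
  proof
   assume z: "G.nrm (G.Gr \<phi>) = 0"
   have "G.Gr \<phi> x = 0" if "x \<in> {0<..<b}" for x
    by (rule integral_zero_cont[OF G.Gr_cont[OF phi] G.Gr_sq_int[OF phi]]) (use z that in \<open>auto simp: G.nrm_def\<close>)
   then show False using G.Gr_injective[OF phi] nz by blast
  qed
  obtain h \<kappa> where h: "h \<in> X" "continuous_on {0<..b} h" "\<kappa> \<noteq> 0" "G.nrm h \<noteq> 0" "G.nrm (\<lambda>x. G.Gr h x - \<kappa> * h x) = 0"
  proof (rule G.Gr_invariant_eigenfunction[OF _ _ _ _ phiX ne])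
   show "sq_int M \<psi>" if "\<psi> \<in> X" for \<psi> using that by (simp add: X_def)
   show "G.Gr \<psi> \<in> X" if p: "\<psi> \<in> X" for \<psi>
   proof -
    have ps: "sq_int M \<psi>" using p by (simp add: X_def)
    have "(\<integral>x. G.Gr \<psi> x * u l x \<partial>M) = 0" if l: "eigen l" for l
    proof -
     have "(\<integral>x. G.Gr \<psi> x * u l x \<partial>M) = (\<integral>x. \<psi> x * G.Gr (u l) x \<partial>M)" by (rule G.Gr_symmetric[OF ps u_sq_int])
     also have "\<dots> = (\<integral>x. \<psi> x * u l x / (l - m) \<partial>M)"
      by (rule Bochner_Integration.integral_cong) (auto simp: Gu[OF l] space_M)
     also have "\<dots> = 0" using p l by (simp add: X_def)
     finally show ?thesis .
    qed
    then show ?thesis using G.Gr_sq_int[OF ps] by (simp add: X_def)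
   qed
   show "(\<lambda>x. s * \<psi> x + t * \<theta> x) \<in> X" if p: "\<psi> \<in> X" "\<theta> \<in> X" for \<psi> \<theta> s t
   proof -
    have ps: "sq_int M \<psi>" "sq_int M \<theta>" using p by (simp_all add: X_def)
    have "(\<integral>x. (s * \<psi> x + t * \<theta> x) * u l x \<partial>M) = 0" if l: "eigen l" for l
    proof -
     have "(\<integral>x. (s * \<psi> x + t * \<theta> x) * u l x \<partial>M) = (\<integral>x. s * (\<psi> x * u l x) + t * (\<theta> x * u l x) \<partial>M)" by (simp add: algebra_simps)
     also have "\<dots> = s * (\<integral>x. \<psi> x * u l x \<partial>M) + t * (\<integral>x. \<theta> x * u l x \<partial>M)"
      using sq_int_mult[OF ps(1) u_sq_int[of l]] sq_int_mult[OF ps(2) u_sq_int[of l]] by simp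
     finally show ?thesis using p l by (simp add: X_def)
    qed
    moreover have "sq_int M (\<lambda>x. s * \<psi> x + t * \<theta> x)" by (intro sq_int_add sq_int_cmult ps)
    ultimately show ?thesis by (simp add: X_def)
   qed
   fix \<psi> :: "nat \<Rightarrow> real \<Rightarrow> real" and g
   \<comment> \<open>Uniform convergence passes through the integrals against the bounded functions
     \<open>u l\<close>, so X contains the limits that the extremal argument produces.\<close>
   assume p: "\<And>n. \<psi> n \<in> X" and g: "continuous_on {0..b} g"
    and lim: "\<And>e. e > 0 \<Longrightarrow> \<exists>N. \<forall>n x. n \<ge> N \<and> x \<in> {0<..b} \<longrightarrow> \<bar>\<psi> n x - g x\<bar> < e"
   have gm: "g \<in> borel_measurable M" by (rule continuous_on_lb_measurable[OF continuous_on_subset[OF g]]) auto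
   obtain Bg where Bg: "\<And>x. x \<in> {0..b} \<Longrightarrow> \<bar>g x\<bar> \<le> Bg"
    using compact_imp_bounded[OF compact_continuous_image[OF g compact_Icc]] unfolding bounded_iff by (metis image_eqI real_norm_def)
   have gs: "sq_int M g" by (rule finite_measure.sq_int_bounded[OF finite_measure_lb gm, of Bg]) (use Bg in \<open>auto simp: space_M\<close>)
   have "(\<integral>x. g x * u l x \<partial>M) = 0" if l: "eigen l" for l
   proof (rule ccontr)
    assume "(\<integral>x. g x * u l x \<partial>M) \<noteq> 0"
    define c where "c = \<bar>\<integral>x. g x * u l x \<partial>M\<bar>"
    have c: "c > 0" using \<open>(\<integral>x. g x * u l x \<partial>M) \<noteq> 0\<close> by (simp add: c_def)
    obtain C where C: "C > 0" "\<And>x. x \<in> {0<..b} \<Longrightarrow> \<bar>u l x\<bar> \<le> C" using u_bounded by metis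
    define e where "e = c / (2 * C * b)"
    have e: "e > 0" using c C b by (simp add: e_def)
    obtain n where n: "\<And>x. x \<in> {0<..b} \<Longrightarrow> \<bar>\<psi> n x - g x\<bar> < e" using lim[OF e] by blast
    have ps: "sq_int M (\<psi> n)" using p by (simp add: X_def)
    have i: "integrable M (\<lambda>x. g x * u l x)" "integrable M (\<lambda>x. \<psi> n x * u l x)" using sq_int_mult gs ps u_sq_int by blast+
    have "(\<integral>x. g x * u l x \<partial>M) = (\<integral>x. g x * u l x - \<psi> n x * u l x \<partial>M)"
     using p l i by (simp add: X_def)
    then have "c \<le> (\<integral>x. \<bar>g x * u l x - \<psi> n x * u l x\<bar> \<partial>M)" unfolding c_def using integral_abs_bound by metis
    also have "\<dots> \<le> (\<integral>x. e * C \<partial>M)"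
    proof (rule integral_mono)
     show "integrable M (\<lambda>x. \<bar>g x * u l x - \<psi> n x * u l x\<bar>)" using i by auto
     show "integrable M (\<lambda>x. e * C)" by (rule finite_measure.integrable_const[OF finite_measure_lb])
     fix x assume "x \<in> space M"
     then have x: "x \<in> {0<..b}" by (auto simp: space_M)
     have "\<bar>\<psi> n x - g x\<bar> * \<bar>u l x\<bar> \<le> e * C" using n[OF x] C(2)[OF x] e by (intro mult_mono) auto
     then show "\<bar>g x * u l x - \<psi> n x * u l x\<bar> \<le> e * C"
      by (simp add: abs_mult[symmetric] left_diff_distrib[symmetric] abs_minus_commute)
    qed
    also have "\<dots> = e * C * b" using b by (simp add: measure_restrict_space space_M)
    also have "\<dots> = c / 2" using C b by (simp add: e_def)
    finally show False using c by simp
   qed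
   then show "g \<in> X" using gs by (simp add: X_def)
  qed auto
  have hs: "sq_int M h" using h(1) by (simp add: X_def)
  have Gh: "G.Gr h x = \<kappa> * h x" if x: "x \<in> {0<..b}" for x
  proof -
   have "G.Gr h x - \<kappa> * h x = 0"
   proof (rule integral_zero_cont[OF _ _ _ x])
    show "continuous_on {0<..b} (\<lambda>x. G.Gr h x - \<kappa> * h x)" by (intro continuous_intros G.Gr_cont hs h(2))
    show "sq_int M (\<lambda>x. G.Gr h x - \<kappa> * h x)" by (intro sq_int_diff sq_int_cmult G.Gr_sq_int hs)
    show "(\<integral>x. (G.Gr h x - \<kappa> * h x)\<^sup>2 \<partial>M) = 0" using h(5) by (simp add: G.nrm_def)
   qed
   then show ?thesis by simp
  qed
  \<comment> \<open>The differential equation turns the value \<kappa> of the inverse of H - m into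
    the spectral value m + 1/\<kappa>.\<close>
  define l where "l = m + 1 / \<kappa>"
  obtain k where k: "\<And>x. x \<in> {0<..b} \<Longrightarrow> G.Gr h x = k * u l x" "k = 0 \<or> eigen l"
  proof (rule eigen_of_solution[where y="G.Gr h" and y'="G.Gr' h" and l=l])
   fix x assume x: "x \<in> {0<..b}"
   show "(G.Gr h has_real_derivative G.Gr' h x) (at x within {0<..b})" by (rule G.Gr_deriv[OF hs x])
   have "(V x - m) * G.Gr h x - h x = (V x - l) * G.Gr h x"
    using Gh[OF x] h(3) by (simp add: l_def field_simps)
   then show "(G.Gr' h has_real_derivative (V x - l) * G.Gr h x) (at x within {0<..b})"
    using G.Gr'_deriv_classical[OF hs h(2) x] by simp
  qed (use G.Gr_sq_int[OF hs] G.Gr_boundary_b[OF hs] G.Gr_boundary_0[OF hs] in auto)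
  have hk: "h x = k / \<kappa> * u l x" if "x \<in> {0<..b}" for x using k(1)[OF that] Gh[OF that] h(3) by (simp add: field_simps)
  have "k \<noteq> 0"
  proof
   assume "k = 0"
   then have "G.nrm h = G.nrm (\<lambda>x. 0)" using hk by (intro G.nrm_cong) auto
   then show False using h(4) by (simp add: G.nrm_def)
  qed
  then have "(\<integral>x. h x * u l x \<partial>M) = 0" using k(2) h(1) by (simp add: X_def)
  moreover have "(\<integral>x. h x * u l x \<partial>M) = (\<integral>x. k / \<kappa> * (u l x)\<^sup>2 \<partial>M)"
   by (rule Bochner_Integration.integral_cong) (auto simp: hk space_M power2_eq_square)
  ultimately have "k / \<kappa> * Nsq l = 0" by (simp add: Nsq_def)
  then show False using \<open>k \<noteq> 0\<close> h(3) Nsq_pos[of l] by simp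
 qed
qed

end

section \<open>The transform and the norm of the de Branges space\<close>

text \<open>The exponent is stated in two spellings of the same extended real, so that rewriting
  applies to either.\<close>

lemma in_L2_iff:
 "in_Lr 2 s \<phi> \<longleftrightarrow> \<phi> \<in> borel_measurable (lb s) \<and> integrable (lb s) (\<lambda>x. (norm (\<phi> x))\<^sup>2)"
 "in_Lr (ereal 2) s \<phi> \<longleftrightarrow> \<phi> \<in> borel_measurable (lb s) \<and> integrable (lb s) (\<lambda>x. (norm (\<phi> x))\<^sup>2)"
proof -
 let ?R = "\<phi> \<in> borel_measurable (lb s) \<and> integrable (lb s) (\<lambda>x. (norm (\<phi> x))\<^sup>2)"
 have "in_Lr 2 s \<phi> \<longleftrightarrow> ?R"
 proof -
 have "(2::ereal) \<noteq> \<infinity>" "real_of_ereal 2 = 2" by simp_all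
 moreover have "norm (\<phi> x) powr 2 = (norm (\<phi> x))\<^sup>2" for x by (cases "norm (\<phi> x) = 0") (auto simp: powr_numeral)
 moreover have "set_borel_measurable lborel {0<..<s} \<phi> \<longleftrightarrow> \<phi> \<in> borel_measurable (lb s)"
  unfolding set_borel_measurable_def by (rule borel_measurable_restrict_space_iff[symmetric]) simp
 ultimately show ?thesis unfolding in_Lr_def integrable_lb_iff by simp
 qed
 then show "in_Lr 2 s \<phi> = ?R" "in_Lr (ereal 2) s \<phi> = ?R" by simp_all
qed

lemma in_L2_complex_iff:
 "\<phi> \<in> L2 s \<longleftrightarrow> sq_int (lb s) (\<lambda>x. Re (\<phi> x)) \<and> sq_int (lb s) (\<lambda>x. Im (\<phi> x))"
 "in_Lr (ereal 2) s \<phi> \<longleftrightarrow> sq_int (lb s) (\<lambda>x. Re (\<phi> x)) \<and> sq_int (lb s) (\<lambda>x. Im (\<phi> x))"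
proof -
 let ?R = "sq_int (lb s) (\<lambda>x. Re (\<phi> x)) \<and> sq_int (lb s) (\<lambda>x. Im (\<phi> x))"
 show "\<phi> \<in> L2 s \<longleftrightarrow> ?R"
 proof
 assume "\<phi> \<in> L2 s"
 then have m [measurable]: "\<phi> \<in> borel_measurable (lb s)" and i: "integrable (lb s) (\<lambda>x. (norm (\<phi> x))\<^sup>2)"
  by (auto simp: in_L2_iff)
 show "sq_int (lb s) (\<lambda>x. Re (\<phi> x)) \<and> sq_int (lb s) (\<lambda>x. Im (\<phi> x))"
  unfolding sq_int_def
  by (intro conjI Bochner_Integration.integrable_bound[OF i]) (auto simp: cmod_power2)
next
 assume a: "sq_int (lb s) (\<lambda>x. Re (\<phi> x)) \<and> sq_int (lb s) (\<lambda>x. Im (\<phi> x))"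
 then have "\<phi> \<in> borel_measurable (lb s)" by (auto simp: borel_measurable_complex_iff)
 moreover have "integrable (lb s) (\<lambda>x. (norm (\<phi> x))\<^sup>2)" using a by (auto simp: cmod_power2)
 ultimately show "\<phi> \<in> L2 s" by (simp add: in_L2_iff)
 qed
 then show "in_Lr (ereal 2) s \<phi> \<longleftrightarrow> ?R" by simp
qed

lemma L2_integrable: "\<phi> \<in> L2 s \<Longrightarrow> integrable (lb s) \<phi>"
proof -
 assume p: "\<phi> \<in> L2 s"
 then have i: "\<phi> \<in> borel_measurable (lb s)" "integrable (lb s) (\<lambda>x. (norm (\<phi> x))\<^sup>2)" by (auto simp: in_L2_iff)
 show ?thesis
 proof (rule Bochner_Integration.integrable_bound[OF Bochner_Integration.integrable_add[OF finite_measure.integrable_const[OF finite_measure_lb, of s 1] i(2)] i(1)], rule AE_I2)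
  fix x
  show "norm (\<phi> x) \<le> norm (1 + (norm (\<phi> x))\<^sup>2)"
  proof -
   have "2 * norm (\<phi> x) \<le> 1 + (norm (\<phi> x))\<^sup>2" using zero_le_power2[of "norm (\<phi> x) - 1"] by (simp add: power2_diff)
   with norm_ge_zero[of "\<phi> x"] have "norm (\<phi> x) \<le> 1 + (norm (\<phi> x))\<^sup>2" by linarith
   then show ?thesis by simp
  qed
 qed
qed

lemma AE_lborel_negligible:
 assumes "AE x in lborel. P (x::real)"
 obtains N where "negligible N" "\<And>x. x \<notin> N \<Longrightarrow> P x"
proof -
 obtain N where "{x \<in> space lborel. \<not> P x} \<subseteq> N" "emeasure lborel N = 0" "N \<in> sets lborel" using assms by (rule AE_E)
 then have N: "N \<in> null_sets lborel" "{x. \<not> P x} \<subseteq> N" by auto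
 show thesis by (rule that[of N]) (use N in \<open>auto simp: negligible_iff_null_sets null_sets_completionI\<close>)
qed

context sl_green
begin

text \<open>Elements of the operator domain satisfy the equation only almost everywhere. In the
  difference with the Green integral the rough term \<phi> cancels, the remaining derivative is
  continuous, and the equation becomes classical.\<close>

lemma Gr_inverse_AE:
 assumes y: "\<And>x. x \<in> {0<..b} \<Longrightarrow> (y has_real_derivative y' x) (at x within {0<..b})"
  and ac: "AC_loc y' b" and ysq: "sq_int M y" and phi: "sq_int M \<phi>"
  and ae: "AE x in lborel. x \<in> {0<..<b} \<longrightarrow> (y' has_real_derivative Q x * y x - \<phi> x) (at x)"
  and bb: "\<alpha> * y b + \<beta> * y' b = 0"
  and b0: "\<nu> < 1 \<Longrightarrow> ((\<lambda>x. x powr (\<nu> - 1/2) * ((\<nu> + 1/2) * y x - x * y' x)) \<longlongrightarrow> 0) (at_right 0)"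
  and x: "x \<in> {0<..b}"
 shows "y x = Gr \<phi> x"
proof (rule Gr_inverse[OF ysq phi _ _ bb b0 x])
 show "((\<lambda>x. y x - Gr \<phi> x) has_real_derivative y' x - Gr' \<phi> x) (at x within {0<..b})" if "x \<in> {0<..b}" for x
  by (intro DERIV_diff y Gr_deriv phi that)
 fix x assume x: "x \<in> {0<..b}"
 have c: "0 < x / 2" "x / 2 < b" "x / 2 < x" "x \<le> b" using x by auto
 have sub: "{x/2..b} \<subseteq> {0<..b}" using x by auto
 have yc: "continuous_on {0<..b} y" unfolding continuous_on_eq_continuous_within using y DERIV_continuous by blast
 obtain N1 where N1: "negligible N1" "\<And>x. x \<notin> N1 \<Longrightarrow> x \<in> {0<..<b} \<longrightarrow> (y' has_real_derivative Q x * y x - \<phi> x) (at x)"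
  using AE_lborel_negligible[OF ae] by metis
 obtain N2 where N2: "negligible N2" "\<And>x. x \<notin> N2 \<Longrightarrow> x \<in> {0<..<b} \<longrightarrow> (Gr' \<phi> has_real_derivative Q x * Gr \<phi> x - \<phi> x) (at x)"
  using AE_lborel_negligible[OF Gr'_deriv_AE[OF phi]] by metis
 have "((\<lambda>x. y' x - Gr' \<phi> x) has_vector_derivative Q x * (y x - Gr \<phi> x)) (at x within {x/2..b})"
 proof (rule AC_on_continuous_derivative[where N="N1 \<union> N2"])
  show "AC_on (\<lambda>x. y' x - Gr' \<phi> x) (x/2) b" using ac Gr'_AC[OF phi] c by (intro AC_on_diff) (auto simp: AC_loc_def)
  show "continuous_on {x/2..b} (\<lambda>x. Q x * (y x - Gr \<phi> x))"
   by (rule continuous_on_subset[OF _ sub]) (intro continuous_intros Q_cont yc Gr_cont[OF phi])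
  show "negligible (N1 \<union> N2)" using N1 N2 by simp
  fix s assume s: "s \<in> {x/2<..<b} - (N1 \<union> N2)"
  then have "s \<in> {0<..<b}" using c by auto
  then have "((\<lambda>x. y' x - Gr' \<phi> x) has_real_derivative (Q s * y s - \<phi> s) - (Q s * Gr \<phi> s - \<phi> s)) (at s)"
   using N1(2)[of s] N2(2)[of s] s by (intro DERIV_diff) auto
  then show "((\<lambda>x. y' x - Gr' \<phi> x) has_vector_derivative Q s * (y s - Gr \<phi> s)) (at s)"
   by (simp add: has_real_derivative_iff_has_vector_derivative algebra_simps)
 qed (use c in auto)
 then show "((\<lambda>x. y' x - Gr' \<phi> x) has_real_derivative Q x * (y x - Gr \<phi> x)) (at x within {0<..b})"
  unfolding at_within_left[OF c(1,3,4)] by (simp add: has_real_derivative_iff_has_vector_derivative)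
qed

lemma Gr_cong_AE:
 assumes "sq_int M \<phi>" "sq_int M \<psi>" "AE x in M. \<phi> x = \<psi> x" "x \<in> {0<..b}"
 shows "Gr \<phi> x = Gr \<psi> x"
 unfolding Gr_def
proof (intro arg_cong[where f=uminus] integral_cong_AE)
 show "(\<lambda>y. kern x y * \<phi> y) \<in> borel_measurable M" using kern_integrable(1)[OF assms(4,1)] by (rule borel_measurable_integrable)
 show "(\<lambda>y. kern x y * \<psi> y) \<in> borel_measurable M" using kern_integrable(1)[OF assms(4,2)] by (rule borel_measurable_integrable)
 show "AE y in M. kern x y * \<phi> y = kern x y * \<psi> y" using assms(3) by eventually_elim simp
qed

end

context bessel_bc
begin

lemma xi_measurable: "\<xi> z \<in> borel_measurable M"
 by (rule continuous_on_lb_measurable[OF xi_cont(1)])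

lemma xi_phi_integrable:
 assumes p: "\<phi> \<in> L2 b"
 shows "integrable M (\<lambda>x. \<xi> z x * \<phi> x)"
proof -
 obtain C where C: "C > 0" "\<And>y x. norm y \<le> norm z + 1 \<Longrightarrow> x \<in> {0<..b} \<Longrightarrow> norm (\<xi> y x) \<le> C"
  using xi_bounded[of "norm z + 1"] by (metis add_nonneg_pos norm_ge_zero zero_less_one)
 show ?thesis
 proof (rule Bochner_Integration.integrable_bound[OF integrable_mult_right[OF L2_integrable[OF p], of "of_real C"]])
  show "(\<lambda>x. \<xi> z x * \<phi> x) \<in> borel_measurable M" using p xi_measurable by (auto simp: in_L2_iff)
  show "AE x in M. norm (\<xi> z x * \<phi> x) \<le> norm (complex_of_real C * \<phi> x)"
  proof (rule AE_I2)
   fix x assume "x \<in> space M"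
   then have "norm (\<xi> z x) \<le> C" using C(2)[of z x] by (auto simp: space_M)
   then show "norm (\<xi> z x * \<phi> x) \<le> norm (complex_of_real C * \<phi> x)" using C(1) by (simp add: norm_mult mult_right_mono)
  qed
 qed
qed

lemma transf_eq: "transf \<xi> b \<phi> z = (\<integral>x. \<xi> z x * \<phi> x \<partial>M)"
 unfolding transf_def integral_lb ..

lemma transf_linear:
 assumes "\<phi> \<in> L2 b" "\<psi> \<in> L2 b"
 shows "transf \<xi> b (\<lambda>x. \<phi> x + c * \<psi> x) z = transf \<xi> b \<phi> z + c * transf \<xi> b \<psi> z"
proof -
 have "transf \<xi> b (\<lambda>x. \<phi> x + c * \<psi> x) z = (\<integral>x. \<xi> z x * \<phi> x + c * (\<xi> z x * \<psi> x) \<partial>M)"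
  unfolding transf_eq by (simp add: algebra_simps)
 also have "\<dots> = transf \<xi> b \<phi> z + c * transf \<xi> b \<psi> z"
  unfolding transf_eq using xi_phi_integrable[OF assms(1), of z] xi_phi_integrable[OF assms(2), of z] by simp
 finally show ?thesis .
qed

lemma L2_linear: "\<phi> \<in> L2 b \<Longrightarrow> \<psi> \<in> L2 b \<Longrightarrow> (\<lambda>x. \<phi> x + of_real c * \<psi> x) \<in> L2 b"
 by (auto simp: in_L2_complex_iff intro!: sq_int_add sq_int_cmult)

lemma transf_at_real:
 assumes "\<phi> \<in> L2 b"
 shows "Re (transf \<xi> b \<phi> (of_real l)) = (\<integral>x. Re (\<phi> x) * u l x \<partial>M)"
  "Im (transf \<xi> b \<phi> (of_real l)) = (\<integral>x. Im (\<phi> x) * u l x \<partial>M)"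
proof -
 note i = xi_phi_integrable[OF assms, of "of_real l"]
 have "Re (transf \<xi> b \<phi> (of_real l)) = (\<integral>x. Re (\<xi> (of_real l) x * \<phi> x) \<partial>M)"
  "Im (transf \<xi> b \<phi> (of_real l)) = (\<integral>x. Im (\<xi> (of_real l) x * \<phi> x) \<partial>M)"
  unfolding transf_eq using integral_Re[OF i] integral_Im[OF i] by simp_all
 moreover have "(\<integral>x. Re (\<xi> (of_real l) x * \<phi> x) \<partial>M) = (\<integral>x. Re (\<phi> x) * u l x \<partial>M)"
  "(\<integral>x. Im (\<xi> (of_real l) x * \<phi> x) \<partial>M) = (\<integral>x. Im (\<phi> x) * u l x \<partial>M)"
  by (rule Bochner_Integration.integral_cong; force simp: xi_real space_M)+
 ultimately show "Re (transf \<xi> b \<phi> (of_real l)) = (\<integral>x. Re (\<phi> x) * u l x \<partial>M)"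
  "Im (transf \<xi> b \<phi> (of_real l)) = (\<integral>x. Im (\<phi> x) * u l x \<partial>M)" by simp_all
qed

text \<open>The eigenfunctions are real, so vanishing transforms at the eigenvalues mean
  orthogonality of the real and the imaginary part separately.\<close>

lemma complex_complete:
 assumes p: "\<phi> \<in> L2 b" and z: "\<And>l. eigen l \<Longrightarrow> transf \<xi> b \<phi> (of_real l) = 0"
 shows "AE x in M. \<phi> x = 0"
proof -
 have "AE x in M. Re (\<phi> x) = 0"
  using p z transf_at_real(1)[OF p, symmetric] by (intro eigenfunctions_complete) (auto simp: in_L2_complex_iff)
 moreover have "AE x in M. Im (\<phi> x) = 0"
  using p z transf_at_real(2)[OF p, symmetric] by (intro eigenfunctions_complete) (auto simp: in_L2_complex_iff)
 ultimately show ?thesis by eventually_elim (simp add: complex_eq_iff)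
qed

lemma transf_injective:
 assumes p: "\<phi> \<in> L2 b" "\<psi> \<in> L2 b" and eq: "transf \<xi> b \<phi> = transf \<xi> b \<psi>"
 shows "AE x in M. \<phi> x = \<psi> x"
proof -
 have L: "(\<lambda>x. \<phi> x + of_real (- 1) * \<psi> x) \<in> L2 b" by (rule L2_linear[OF p])
 have "AE x in M. \<phi> x + of_real (- 1) * \<psi> x = 0"
 proof (rule complex_complete[OF L])
  fix l
  show "transf \<xi> b (\<lambda>x. \<phi> x + of_real (- 1) * \<psi> x) (of_real l) = 0"
   unfolding transf_linear[OF p] eq by simp
 qed
 then show ?thesis by eventually_elim simp
qed

text \<open>The definite description in \<open>dB_norm\<close> is meaningful because the transform
  determines \<phi> almost everywhere.\<close>

lemma dB_norm_eq:
 assumes p: "\<phi> \<in> L2 b"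
 shows "dB_norm \<xi> b (transf \<xi> b \<phi>) = sqrt (\<integral>x. (norm (\<phi> x))\<^sup>2 \<partial>M)"
 unfolding dB_norm_def integral_lb[symmetric]
proof (rule the_equality)
 show "\<exists>\<psi>\<in>L2 b. transf \<xi> b \<phi> = transf \<xi> b \<psi> \<and> sqrt (\<integral>x. (norm (\<phi> x))\<^sup>2 \<partial>M) = sqrt (\<integral>x. (norm (\<psi> x))\<^sup>2 \<partial>M)"
  using p by blast
 fix N assume "\<exists>\<psi>\<in>L2 b. transf \<xi> b \<phi> = transf \<xi> b \<psi> \<and> N = sqrt (\<integral>x. (norm (\<psi> x))\<^sup>2 \<partial>M)"
 then obtain \<psi> where s: "\<psi> \<in> L2 b" "transf \<xi> b \<phi> = transf \<xi> b \<psi>" "N = sqrt (\<integral>x. (norm (\<psi> x))\<^sup>2 \<partial>M)" by blast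
 have "(\<integral>x. (norm (\<psi> x))\<^sup>2 \<partial>M) = (\<integral>x. (norm (\<phi> x))\<^sup>2 \<partial>M)"
 proof (rule integral_cong_AE)
  show "AE x in M. (norm (\<psi> x))\<^sup>2 = (norm (\<phi> x))\<^sup>2" using transf_injective[OF p s(1,2)] by eventually_elim simp
  show "(\<lambda>x. (norm (\<psi> x))\<^sup>2) \<in> borel_measurable M" "(\<lambda>x. (norm (\<phi> x))\<^sup>2) \<in> borel_measurable M"
   using p s(1) by (simp_all add: in_L2_iff borel_measurable_integrable)
 qed
 then show "N = sqrt (\<integral>x. (norm (\<phi> x))\<^sup>2 \<partial>M)" using s by simp
qed

lemma norm_sq_split:
 assumes "\<phi> \<in> L2 b"
 shows "(\<integral>x. (norm (\<phi> x))\<^sup>2 \<partial>M) = (\<integral>x. (Re (\<phi> x))\<^sup>2 \<partial>M) + (\<integral>x. (Im (\<phi> x))\<^sup>2 \<partial>M)"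
 unfolding cmod_power2 using assms by (intro Bochner_Integration.integral_add) (auto simp: in_L2_complex_iff)

end

section \<open>The spectrum as the set of zeros of the boundary form\<close>

locale bessel_spectrum = bessel_bc \<nu> b q \<xi> \<xi>' C0 "cos \<gamma>" "sin \<gamma>" for \<nu> b q \<xi> \<xi>' C0 \<gamma>
begin

text \<open>The graph relation with right-hand side \<psi> - m f is inverted by the Green operator.
  That operator is real, so it acts on the two components of the complex functions
  separately.\<close>

lemma H_graph_solution:
 assumes g: "sl_green \<nu> b (\<lambda>x. V x - m) (u m) (u' m) \<omega> L B (cos \<gamma>) (sin \<gamma>)"
  and H: "(f, \<psi>) \<in> H_graph \<nu> q b \<gamma>"
 defines "\<phi> \<equiv> (\<lambda>x. \<psi> x + of_real (- m) * f x)"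
 shows "x \<in> {0<..b} \<Longrightarrow> Re (f x) = sl_green.Gr b (\<lambda>x. V x - m) (u m) (u' m) (cos \<gamma>) (sin \<gamma>) (\<lambda>x. Re (\<phi> x)) x"
  "x \<in> {0<..b} \<Longrightarrow> Im (f x) = sl_green.Gr b (\<lambda>x. V x - m) (u m) (u' m) (cos \<gamma>) (sin \<gamma>) (\<lambda>x. Im (\<phi> x)) x"
  "\<phi> \<in> L2 b"
proof -
 interpret G: sl_green \<nu> b "\<lambda>x. V x - m" "u m" "u' m" \<omega> L B "cos \<gamma>" "sin \<gamma>" by (rule g)
 obtain f' where f: "f \<in> L2 b" "\<psi> \<in> L2 b" "\<And>x. x \<in> {0<..b} \<Longrightarrow> (f has_vector_derivative f' x) (at x within {0<..b})"
  "AC_loc f' b"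
  "AE x in lborel. x \<in> {0<..<b} \<longrightarrow> (\<exists>d. (f' has_vector_derivative d) (at x) \<and> \<psi> x = - d + of_real ((\<nu>\<^sup>2 - 1/4) / x\<^sup>2 + q x) * f x)"
  "f b * of_real (cos \<gamma>) + f' b * of_real (sin \<gamma>) = 0"
  "\<nu> < 1 \<longrightarrow> ((\<lambda>x. of_real (x powr (\<nu> - 1/2)) * (of_real (\<nu> + 1/2) * f x - of_real x * f' x)) \<longlongrightarrow> 0) (at_right 0)"
  using H unfolding H_graph_def by blast
 show phi: "\<phi> \<in> L2 b" unfolding \<phi>_def by (rule L2_linear[OF f(2,1)])
 \<comment> \<open>Real and imaginary part are handled at once by a real-linear functional T that
   commutes with real factors and is bounded by the modulus.\<close>
 have key: "T (f x) = G.Gr (\<lambda>x. T (\<phi> x)) x"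
  if T: "bounded_linear T" "\<And>r z. T (of_real r * z) = r * T z" "\<And>z. \<bar>T z\<bar> \<le> norm z"
   and sq: "\<And>p. p \<in> L2 b \<Longrightarrow> sq_int M (\<lambda>x. T (p x))" and x: "x \<in> {0<..b}" for T :: "complex \<Rightarrow> real" and x
 proof (rule G.Gr_inverse_AE[where y="\<lambda>x. T (f x)" and y'="\<lambda>x. T (f' x)"])
  interpret T: bounded_linear T by (rule T(1))
  show "((\<lambda>x. T (f x)) has_real_derivative T (f' x)) (at x within {0<..b})" if "x \<in> {0<..b}" for x
   unfolding has_real_derivative_iff_has_vector_derivative by (rule bounded_linear.has_vector_derivative[OF T(1) f(3)[OF that]])
  show "AC_loc (\<lambda>x. T (f' x)) b"
   unfolding AC_loc_def
  proof (intro allI impI)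
   fix c assume "0 < c \<and> c < b"
   then have "AC_on f' c b" using f(4) by (auto simp: AC_loc_def)
   then show "AC_on (\<lambda>x. T (f' x)) c b"
    by (rule AC_on_combine[OF _ AC_on_const[of 0], where B=1]) (use T(3) in \<open>simp flip: T.diff\<close>)
  qed
  show "sq_int M (\<lambda>x. T (f x))" "sq_int M (\<lambda>x. T (\<phi> x))" using sq f(1) phi by auto
  show "AE x in lborel. x \<in> {0<..<b} \<longrightarrow> ((\<lambda>x. T (f' x)) has_real_derivative (V x - m) * T (f x) - T (\<phi> x)) (at x)"
   using f(5)
  proof eventually_elim
   case (elim x)
   show ?case
   proof
    assume "x \<in> {0<..<b}"
    then obtain d where d: "(f' has_vector_derivative d) (at x)" "\<psi> x = - d + of_real (V x) * f x" using elim by (auto simp: V_def)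
    have "T d = (V x - m) * T (f x) - T (\<phi> x)"
     unfolding \<phi>_def d(2) by (simp only: T.add T.neg T(2)) (simp add: algebra_simps)
    then show "((\<lambda>x. T (f' x)) has_real_derivative (V x - m) * T (f x) - T (\<phi> x)) (at x)"
     using bounded_linear.has_vector_derivative[OF T(1) d(1)] by (simp add: has_real_derivative_iff_has_vector_derivative)
   qed
  qed
  have "T (of_real (cos \<gamma>) * f b + of_real (sin \<gamma>) * f' b) = 0" using f(6) by (simp add: mult.commute T.zero)
  then show "cos \<gamma> * T (f b) + sin \<gamma> * T (f' b) = 0" by (simp only: T.add T(2))
  assume "\<nu> < 1"
  with f(7) have "((\<lambda>x. of_real (x powr (\<nu> - 1/2)) * (of_real (\<nu> + 1/2) * f x - of_real x * f' x)) \<longlongrightarrow> 0) (at_right 0)" by blast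
  from T.tendsto[OF this]
  show "((\<lambda>x. x powr (\<nu> - 1/2) * ((\<nu> + 1/2) * T (f x) - x * T (f' x))) \<longlongrightarrow> 0) (at_right 0)"
   by (simp only: T(2) T.diff T.zero)
 qed (rule x)
 show "Re (f x) = G.Gr (\<lambda>x. Re (\<phi> x)) x" if "x \<in> {0<..b}"
  by (rule key[OF bounded_linear_Re _ _ _ that]) (auto simp: abs_Re_le_cmod in_L2_complex_iff)
 show "Im (f x) = G.Gr (\<lambda>x. Im (\<phi> x)) x" if "x \<in> {0<..b}"
  by (rule key[OF bounded_linear_Im _ _ _ that]) (auto simp: abs_Im_le_cmod in_L2_complex_iff)
qed

text \<open>Surjectivity of H - m: applying the Green operator to both components yields an element
  that satisfies every clause of the domain.\<close>

lemma H_graph_resolvent: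
 assumes g: "sl_green \<nu> b (\<lambda>x. V x - m) (u m) (u' m) \<omega> L B (cos \<gamma>) (sin \<gamma>)" and phi: "\<phi> \<in> L2 b"
 shows "\<exists>f. (f, \<lambda>x. \<phi> x + of_real m * f x) \<in> H_graph \<nu> q b \<gamma>"
proof -
 interpret G: sl_green \<nu> b "\<lambda>x. V x - m" "u m" "u' m" \<omega> L B "cos \<gamma>" "sin \<gamma>" by (rule g)
 have r: "sq_int M (\<lambda>x. Re (\<phi> x))" "sq_int M (\<lambda>x. Im (\<phi> x))" using phi by (auto simp: in_L2_complex_iff)
 define fr fi fr' fi' where "fr = G.Gr (\<lambda>x. Re (\<phi> x))" and "fi = G.Gr (\<lambda>x. Im (\<phi> x))"
  and "fr' = G.Gr' (\<lambda>x. Re (\<phi> x))" and "fi' = G.Gr' (\<lambda>x. Im (\<phi> x))"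
 define f f' where "f x = Complex (fr x) (fi x)" and "f' x = Complex (fr' x) (fi' x)" for x
 have cd: "((\<lambda>x. Complex (p x) (s x)) has_vector_derivative Complex p' s') F"
  if "(p has_real_derivative p') F" "(s has_real_derivative s') F" for p s :: "real \<Rightarrow> real" and p' s' F
 proof -
  have "((\<lambda>x. of_real (p x) + \<i> * of_real (s x)) has_vector_derivative of_real p' + \<i> * of_real s') F"
   using that by (intro has_vector_derivative_add has_vector_derivative_mult_right has_vector_derivative_of_real)
  then show ?thesis by (simp only: complex_eq[symmetric] Complex_eq)
 qed
 have fL: "f \<in> L2 b" unfolding f_def in_L2_complex_iff complex.sel fr_def fi_def by (intro conjI G.Gr_sq_int r)
 have "(f, \<lambda>x. \<phi> x + of_real m * f x) \<in> H_graph \<nu> q b \<gamma>"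
  unfolding H_graph_def mem_Collect_eq case_prod_conv
 proof (intro conjI)
  show "in_Lr 2 b f" using fL by simp
  show "in_Lr 2 b (\<lambda>x. \<phi> x + of_real m * f x)" using L2_linear[OF phi fL, of m] by simp
  show "\<exists>f'. (\<forall>x\<in>{0<..b}. (f has_vector_derivative f' x) (at x within {0<..b})) \<and> AC_loc f' b \<and>
    (AE x in lborel. x \<in> {0<..<b} \<longrightarrow> (\<exists>d. (f' has_vector_derivative d) (at x) \<and>
     \<phi> x + of_real m * f x = - d + of_real ((\<nu>\<^sup>2 - 1/4) / x\<^sup>2 + q x) * f x)) \<and>
    f b * of_real (cos \<gamma>) + f' b * of_real (sin \<gamma>) = 0 \<and>
    (\<nu> < 1 \<longrightarrow> ((\<lambda>x. of_real (x powr (\<nu> - 1/2)) * (of_real (\<nu> + 1/2) * f x - of_real x * f' x)) \<longlongrightarrow> 0) (at_right 0))"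
  proof (intro exI[of _ f'] conjI ballI impI)
   show "(f has_vector_derivative f' x) (at x within {0<..b})" if "x \<in> {0<..b}" for x
    unfolding f_def[abs_def] f'_def fr_def fi_def fr'_def fi'_def by (intro cd G.Gr_deriv r that)
   show "AC_loc f' b" unfolding AC_loc_def
   proof (intro allI impI)
    fix c assume c: "0 < c \<and> c < b"
    have "AC_on fr' c b" "AC_on fi' c b" using G.Gr'_AC[OF r(1)] G.Gr'_AC[OF r(2)] c unfolding AC_loc_def fr'_def fi'_def by auto
    then show "AC_on f' c b"
    proof (rule AC_on_combine[where B=1])
     fix s t
     have "norm (f' t - f' s) \<le> \<bar>Re (f' t - f' s)\<bar> + \<bar>Im (f' t - f' s)\<bar>" by (rule cmod_le)
     then show "norm (f' t - f' s) \<le> 1 * (norm (fr' t - fr' s) + norm (fi' t - fi' s))" by (simp add: f'_def)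
    qed
   qed
   show "AE x in lborel. x \<in> {0<..<b} \<longrightarrow> (\<exists>d. (f' has_vector_derivative d) (at x) \<and>
     \<phi> x + of_real m * f x = - d + of_real ((\<nu>\<^sup>2 - 1/4) / x\<^sup>2 + q x) * f x)"
    using G.Gr'_deriv_AE[OF r(1)] G.Gr'_deriv_AE[OF r(2)]
   proof eventually_elim
    case (elim x)
    show ?case
    proof
     assume x: "x \<in> {0<..<b}"
     define d where "d = Complex ((V x - m) * fr x - Re (\<phi> x)) ((V x - m) * fi x - Im (\<phi> x))"
     have "(f' has_vector_derivative d) (at x)"
      unfolding f'_def[abs_def] d_def using elim x unfolding fr_def fi_def fr'_def fi'_def by (intro cd) auto
     moreover have "\<phi> x + of_real m * f x = - d + of_real ((\<nu>\<^sup>2 - 1/4) / x\<^sup>2 + q x) * f x"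
      unfolding V_def[symmetric] d_def f_def by (simp add: complex_eq_iff algebra_simps)
     ultimately show "\<exists>d. (f' has_vector_derivative d) (at x) \<and>
     \<phi> x + of_real m * f x = - d + of_real ((\<nu>\<^sup>2 - 1/4) / x\<^sup>2 + q x) * f x" by blast
    qed
   qed
   show "f b * of_real (cos \<gamma>) + f' b * of_real (sin \<gamma>) = 0"
    using G.Gr_boundary_b[OF r(1)] G.Gr_boundary_b[OF r(2)]
    by (simp add: complex_eq_iff f_def f'_def fr_def fi_def fr'_def fi'_def mult.commute)
   have "((\<lambda>x. Complex (x powr (\<nu> - 1/2) * ((\<nu> + 1/2) * fr x - x * fr' x)) (x powr (\<nu> - 1/2) * ((\<nu> + 1/2) * fi x - x * fi' x))) \<longlongrightarrow> Complex 0 0) (at_right 0)"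
    unfolding fr_def fi_def fr'_def fi'_def by (intro tendsto_Complex G.Gr_boundary_0 r)
   moreover have "Complex (x powr (\<nu> - 1/2) * ((\<nu> + 1/2) * fr x - x * fr' x)) (x powr (\<nu> - 1/2) * ((\<nu> + 1/2) * fi x - x * fi' x))
     = of_real (x powr (\<nu> - 1/2)) * (of_real (\<nu> + 1/2) * f x - of_real x * f' x)" for x
    by (rule complex_eqI) (simp_all add: f_def f'_def)
   ultimately show "((\<lambda>x. of_real (x powr (\<nu> - 1/2)) * (of_real (\<nu> + 1/2) * f x - of_real x * f' x)) \<longlongrightarrow> 0) (at_right 0)"
    by (simp add: zero_complex.code[symmetric])
  qed
 qed
 then show ?thesis by blast
qed

text \<open>Existence comes from the Green operator, uniqueness from the injectivity of the
  transform, and the bound on the inverse from the operator bound of \<open>Gr\<close>, applied to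
  both components.\<close>

lemma non_eigen_resolvent:
 assumes m: "\<not> eigen m"
 shows "of_real m \<in> resolvent_set (dB_space \<xi> b) (dB_norm \<xi> b) (S_graph \<xi> \<nu> q b \<gamma>)"
proof -
 obtain \<omega> B where g: "sl_green \<nu> b (\<lambda>x. V x - m) (u m) (u' m) \<omega> (lead_const \<nu>) B (cos \<gamma>) (sin \<gamma>)"
  by (rule sl_green_of_non_eigen[OF m])
 interpret G: sl_green \<nu> b "\<lambda>x. V x - m" "u m" "u' m" \<omega> "lead_const \<nu>" B "cos \<gamma>" "sin \<gamma>" by (rule g)
 note Hs = H_graph_solution[OF g]
 have L2H: "f \<in> L2 b \<and> \<psi> \<in> L2 b" if "(f, \<psi>) \<in> H_graph \<nu> q b \<gamma>" for f \<psi> using that by (auto simp: H_graph_def)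
 have trm: "transf \<xi> b (\<lambda>x. \<psi> x + of_real (- m) * f x) = (\<lambda>z. transf \<xi> b \<psi> z - of_real m * transf \<xi> b f z)"
  if "(f, \<psi>) \<in> H_graph \<nu> q b \<gamma>" for f \<psi>
  using transf_linear[of \<psi> f "of_real (- m)"] L2H[OF that] by (auto simp: fun_eq_iff)
 show ?thesis unfolding resolvent_set_def mem_Collect_eq
 proof (intro conjI ballI)
  fix Gf assume "Gf \<in> dB_space \<xi> b"
  then obtain \<phi> where phi: "\<phi> \<in> L2 b" "Gf = transf \<xi> b \<phi>" by (auto simp: dB_space_def)
  obtain f where f: "(f, \<lambda>x. \<phi> x + of_real m * f x) \<in> H_graph \<nu> q b \<gamma>" using H_graph_resolvent[OF g phi(1)] by blast
  show "\<exists>!F. (F, \<lambda>z. Gf z + of_real m * F z) \<in> S_graph \<xi> \<nu> q b \<gamma>"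
  proof (rule ex1I[of _ "transf \<xi> b f"])
   have "transf \<xi> b (\<lambda>x. \<phi> x + of_real m * f x) = (\<lambda>z. Gf z + of_real m * transf \<xi> b f z)"
    using transf_linear[OF phi(1) conjunct1[OF L2H[OF f]], of "of_real m"] phi by (auto simp: fun_eq_iff)
   then show "(transf \<xi> b f, \<lambda>z. Gf z + of_real m * transf \<xi> b f z) \<in> S_graph \<xi> \<nu> q b \<gamma>"
    unfolding S_graph_def using f by (metis (no_types, lifting) map_prod_imageI)
   fix F assume "(F, \<lambda>z. Gf z + of_real m * F z) \<in> S_graph \<xi> \<nu> q b \<gamma>"
   then obtain f1 \<psi>1 where f1: "(f1, \<psi>1) \<in> H_graph \<nu> q b \<gamma>" "F = transf \<xi> b f1" "(\<lambda>z. Gf z + of_real m * F z) = transf \<xi> b \<psi>1"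
    unfolding S_graph_def by auto
   \<comment> \<open>Two preimages have right-hand sides with the same transform, hence equal almost
     everywhere; the Green operator then returns the same function at every point.\<close>
   have eq: "transf \<xi> b (\<lambda>x. \<psi>1 x + of_real (- m) * f1 x) = transf \<xi> b (\<lambda>x. (\<phi> x + of_real m * f x) + of_real (- m) * f x)"
    unfolding trm[OF f1(1)] f1(2,3)[symmetric] using phi(2) by (simp add: fun_eq_iff)
   have ae: "AE x in M. \<psi>1 x + of_real (- m) * f1 x = (\<phi> x + of_real m * f x) + of_real (- m) * f x"
    by (rule transf_injective[OF Hs(3)[OF f1(1)] Hs(3)[OF f] eq])
   have "f1 x = f x" if x: "x \<in> {0<..b}" for x
   proof (rule complex_eqI)
    note sq = Hs(3)[OF f1(1), unfolded in_L2_complex_iff] Hs(3)[OF f, unfolded in_L2_complex_iff]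
    have "AE x in M. Re (\<psi>1 x + of_real (- m) * f1 x) = Re ((\<phi> x + of_real m * f x) + of_real (- m) * f x)"
     using ae by eventually_elim (simp only:)
    then show "Re (f1 x) = Re (f x)"
     unfolding Hs(1)[OF f1(1) x] Hs(1)[OF f x] using sq x by (intro G.Gr_cong_AE) blast+
    have "AE x in M. Im (\<psi>1 x + of_real (- m) * f1 x) = Im ((\<phi> x + of_real m * f x) + of_real (- m) * f x)"
     using ae by eventually_elim (simp only:)
    then show "Im (f1 x) = Im (f x)"
     unfolding Hs(2)[OF f1(1) x] Hs(2)[OF f x] using sq x by (intro G.Gr_cong_AE) blast+
   qed
   then show "F = transf \<xi> b f" unfolding f1(2) by (auto simp: fun_eq_iff transf_eq space_M intro!: Bochner_Integration.integral_cong)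
  qed
 next
  define K where "K = G.Ck * b * b"
  have K: "K \<ge> 0" using G.Ck_pos b by (simp add: K_def)
  show "\<exists>C. \<forall>(F, H)\<in>S_graph \<xi> \<nu> q b \<gamma>. dB_norm \<xi> b F \<le> C * dB_norm \<xi> b (\<lambda>z. H z - of_real m * F z)"
  proof (rule exI[of _ K], clarsimp simp: S_graph_def)
   fix f \<psi> assume f: "(f, \<psi>) \<in> H_graph \<nu> q b \<gamma>"
   define \<phi> where "\<phi> x = \<psi> x + of_real (- m) * f x" for x
   have phi: "\<phi> \<in> L2 b" unfolding \<phi>_def[abs_def] by (rule Hs(3)[OF f])
   have r: "sq_int M (\<lambda>x. Re (\<phi> x))" "sq_int M (\<lambda>x. Im (\<phi> x))" using phi by (auto simp: in_L2_complex_iff)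
   have fx: "Re (f x) = G.Gr (\<lambda>x. Re (\<phi> x)) x" "Im (f x) = G.Gr (\<lambda>x. Im (\<phi> x)) x" if "x \<in> {0<..b}" for x
    using Hs(1,2)[OF f that] unfolding \<phi>_def by auto
   have b1: "(\<integral>x. (h x)\<^sup>2 \<partial>M) \<le> K\<^sup>2 * (\<integral>x. (p x)\<^sup>2 \<partial>M)"
    if "\<And>x. x \<in> {0<..b} \<Longrightarrow> h x = G.Gr p x" "sq_int M p" for h p
   proof -
    have "G.nrm h = G.nrm (G.Gr p)" by (rule G.nrm_cong) (use that in auto)
    then have "G.nrm h \<le> K * G.nrm p" using G.Gr_nrm_bound[OF that(2)] by (simp add: K_def)
    then have "(G.nrm h)\<^sup>2 \<le> (K * G.nrm p)\<^sup>2" using G.nrm_nonneg by (intro power_mono) auto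
    then show ?thesis by (simp add: G.nrm_sq power_mult_distrib)
   qed
   have "(\<integral>x. (norm (f x))\<^sup>2 \<partial>M) \<le> K\<^sup>2 * (\<integral>x. (norm (\<phi> x))\<^sup>2 \<partial>M)"
    unfolding norm_sq_split[OF conjunct1[OF L2H[OF f]]] norm_sq_split[OF phi]
    using b1[OF fx(1) r(1)] b1[OF fx(2) r(2)] by (simp add: distrib_left)
   then have "sqrt (\<integral>x. (norm (f x))\<^sup>2 \<partial>M) \<le> sqrt (K\<^sup>2 * (\<integral>x. (norm (\<phi> x))\<^sup>2 \<partial>M))" by (rule real_sqrt_le_mono)
   then have "sqrt (\<integral>x. (norm (f x))\<^sup>2 \<partial>M) \<le> K * sqrt (\<integral>x. (norm (\<phi> x))\<^sup>2 \<partial>M)" using K by (simp add: real_sqrt_mult)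
   then have "dB_norm \<xi> b (transf \<xi> b f) \<le> K * dB_norm \<xi> b (transf \<xi> b \<phi>)"
    unfolding dB_norm_eq[OF phi] dB_norm_eq[OF conjunct1[OF L2H[OF f]]] .
   then show "dB_norm \<xi> b (transf \<xi> b f) \<le> K * dB_norm \<xi> b (\<lambda>z. transf \<xi> b \<psi> z - of_real m * transf \<xi> b f z)"
    unfolding trm[OF f, symmetric] \<phi>_def[abs_def] .
  qed
 qed
qed

lemma xi_L2: "(\<lambda>x. of_real c * \<xi> (of_real l) x) \<in> L2 b"
proof -
 have "sq_int M (\<lambda>x. c * u l x)" by (rule sq_int_cmult[OF u_sq_int])
 then have m: "integrable M (\<lambda>x. (c * u l x)\<^sup>2)" by auto
 show ?thesis unfolding in_L2_iff mem_Collect_eq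
 proof
  show "(\<lambda>x. of_real c * \<xi> (of_real l) x) \<in> borel_measurable M" using xi_measurable by measurable
  show "integrable M (\<lambda>x. (norm (of_real c * \<xi> (of_real l) x))\<^sup>2)"
   by (rule Bochner_Integration.integrable_cong[THEN iffD1, OF refl _ m]) (auto simp: xi_real norm_mult space_M power_mult_distrib)
 qed
qed

text \<open>At an eigenvalue the homogeneous problem has two solutions, 0 and the transform of
  \<xi>(l,.). They differ, since the latter takes the value \<open>Nsq l\<close> > 0 at l, and this
  contradicts unique solvability.\<close>

lemma eigen_spectrum:
 assumes l: "eigen l"
 shows "of_real l \<notin> resolvent_set (dB_space \<xi> b) (dB_norm \<xi> b) (S_graph \<xi> \<nu> q b \<gamma>)"
proof
 assume "of_real l \<in> resolvent_set (dB_space \<xi> b) (dB_norm \<xi> b) (S_graph \<xi> \<nu> q b \<gamma>)"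
 then have ex1: "\<And>G. G \<in> dB_space \<xi> b \<Longrightarrow> \<exists>!F. (F, \<lambda>z. G z + of_real l * F z) \<in> S_graph \<xi> \<nu> q b \<gamma>"
  unfolding resolvent_set_def by blast
 define f where "f = \<xi> (of_real l)"
 have fL: "f \<in> L2 b" using xi_L2[of 1 l] by (simp add: f_def)
 have zL: "(\<lambda>x. 0) \<in> L2 b" by (simp add: in_L2_complex_iff)
 have z0: "transf \<xi> b (\<lambda>x. 0) = (\<lambda>z. 0)" by (simp add: transf_eq fun_eq_iff)
 have lf: "transf \<xi> b (\<lambda>x. of_real l * f x) = (\<lambda>z. of_real l * transf \<xi> b f z)"
  using transf_linear[OF zL fL, of "of_real l"] z0 by (auto simp: fun_eq_iff)
 \<comment> \<open>The factor c gives both graph elements from one verification: c = 1 is the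
   eigenfunction, c = 0 the zero function.\<close>
 have H: "(\<lambda>x. of_real c * f x, \<lambda>x. of_real l * (of_real c * f x)) \<in> H_graph \<nu> q b \<gamma>" for c :: real
  unfolding H_graph_def mem_Collect_eq case_prod_conv
 proof (intro conjI exI[of _ "\<lambda>x. of_real c * \<xi>' (of_real l) x"] ballI impI)
  show "in_Lr 2 b (\<lambda>x. of_real c * f x)" using xi_L2[of c l] by (simp add: f_def)
  show "in_Lr 2 b (\<lambda>x. of_real l * (of_real c * f x))" using xi_L2[of "l * c" l] by (simp add: f_def mult.assoc)
  show "((\<lambda>x. of_real c * f x) has_vector_derivative of_real c * \<xi>' (of_real l) x) (at x within {0<..b})" if "x \<in> {0<..b}" for x
   unfolding f_def by (intro has_vector_derivative_mult_right xi_deriv that)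
  show "AC_loc (\<lambda>x. of_real c * \<xi>' (of_real l) x) b"
   unfolding AC_loc_def
  proof (intro allI impI)
   fix a assume a: "0 < a \<and> a < b"
   have sub: "{a..b} \<subseteq> {0<..b}" using a by auto
   show "AC_on (\<lambda>x. of_real c * \<xi>' (of_real l) x) a b"
   proof (rule AC_on_C1)
    show "((\<lambda>x. of_real c * \<xi>' (of_real l) x) has_vector_derivative of_real c * ((of_real (V x) - of_real l) * \<xi> (of_real l) x)) (at x within {a..b})"
     if "x \<in> {a..b}" for x
     using has_vector_derivative_within_subset[OF xi'_deriv sub, of x "of_real l"] that sub
     unfolding V_def by (intro has_vector_derivative_mult_right) auto
    show "continuous_on {a..b} (\<lambda>x. of_real c * ((of_real (V x) - of_real l) * \<xi> (of_real l) x))"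
     by (rule continuous_on_subset[OF _ sub]) (intro continuous_intros V_cont xi_cont)
   qed
  qed
  show "AE x in lborel. x \<in> {0<..<b} \<longrightarrow> (\<exists>d. ((\<lambda>x. of_real c * \<xi>' (of_real l) x) has_vector_derivative d) (at x) \<and>
    of_real l * (of_real c * f x) = - d + of_real ((\<nu>\<^sup>2 - 1/4) / x\<^sup>2 + q x) * (of_real c * f x))"
  proof (intro AE_I2 impI)
   fix x assume x: "x \<in> {0<..<b}"
   then have xb: "x \<in> {0<..b}" by auto
   have at: "at x within {0<..b} = at x" by (rule at_within_nhd[where S="{0<..<b}"]) (use x in auto)
   show "\<exists>d. ((\<lambda>x. of_real c * \<xi>' (of_real l) x) has_vector_derivative d) (at x) \<and>
    of_real l * (of_real c * f x) = - d + of_real ((\<nu>\<^sup>2 - 1/4) / x\<^sup>2 + q x) * (of_real c * f x)"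
    using has_vector_derivative_mult_right[OF xi'_deriv[OF xb, of "of_real l", unfolded at], of "of_real c"]
    by (intro exI conjI, assumption) (simp add: f_def algebra_simps)
  qed
  have bb: "b \<in> {0<..b}" using b by simp
  have "of_real c * f b * of_real (cos \<gamma>) + of_real c * \<xi>' (of_real l) b * of_real (sin \<gamma>) = of_real (c * (cos \<gamma> * u l b + sin \<gamma> * u' l b))"
   unfolding f_def xi_real[OF bb] by (simp add: algebra_simps)
  then show "of_real c * f b * of_real (cos \<gamma>) + of_real c * \<xi>' (of_real l) b * of_real (sin \<gamma>) = 0"
   by (simp only: l[unfolded eigen_def] mult_zero_right of_real_0)
  have "((\<lambda>x. complex_of_real (c * (x powr (\<nu> - 1/2) * ((\<nu> + 1/2) * u l x - x * u' l x)))) \<longlongrightarrow> of_real (c * 0)) (at_right 0)"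
   by (intro tendsto_of_real tendsto_mult_left u_boundary_0)
  moreover have "\<forall>\<^sub>F x in at_right 0. complex_of_real (c * (x powr (\<nu> - 1/2) * ((\<nu> + 1/2) * u l x - x * u' l x)))
    = of_real (x powr (\<nu> - 1/2)) * (of_real (\<nu> + 1/2) * (of_real c * f x) - of_real x * (of_real c * \<xi>' (of_real l) x))"
   unfolding eventually_at_right_field
  proof (intro exI[of _ b] conjI allI impI)
   fix x assume "0 < x" "x < b"
   then have xb: "x \<in> {0<..b}" by auto
   show "complex_of_real (c * (x powr (\<nu> - 1/2) * ((\<nu> + 1/2) * u l x - x * u' l x)))
    = of_real (x powr (\<nu> - 1/2)) * (of_real (\<nu> + 1/2) * (of_real c * f x) - of_real x * (of_real c * \<xi>' (of_real l) x))"
    unfolding f_def xi_real[OF xb] by (simp add: algebra_simps)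
  qed (rule b)
  ultimately show "((\<lambda>x. of_real (x powr (\<nu> - 1/2)) * (of_real (\<nu> + 1/2) * (of_real c * f x) - of_real x * (of_real c * \<xi>' (of_real l) x))) \<longlongrightarrow> 0) (at_right 0)"
   using Lim_transform_eventually by fastforce
 qed
 have S: "(F, \<lambda>z. 0 + of_real l * F z) \<in> S_graph \<xi> \<nu> q b \<gamma>" if "F = transf \<xi> b f \<or> F = (\<lambda>z. 0)" for F
 proof -
  have "(transf \<xi> b f, transf \<xi> b (\<lambda>x. of_real l * f x)) \<in> S_graph \<xi> \<nu> q b \<gamma>"
   unfolding S_graph_def using H[of 1] by (intro map_prod_imageI) simp
  moreover have "(transf \<xi> b (\<lambda>x. 0), transf \<xi> b (\<lambda>x. 0)) \<in> S_graph \<xi> \<nu> q b \<gamma>"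
   unfolding S_graph_def using H[of 0] by (intro map_prod_imageI) simp
  ultimately show ?thesis using that unfolding lf z0 by auto
 qed
 have "(\<lambda>z. 0) \<in> dB_space \<xi> b" unfolding dB_space_def using z0 zL by (metis image_eqI)
 from ex1[OF this] have "transf \<xi> b f = (\<lambda>z. 0)" using S by blast
 then have "Re (transf \<xi> b f (of_real l)) = 0" by simp
 moreover have "Re (transf \<xi> b f (of_real l)) = Nsq l"
  using transf_at_real(1)[OF fL, of l] by (simp add: Nsq_def f_def u_def power2_eq_square)
 ultimately show False using Nsq_pos[of l] by simp
qed

lemma spectrum_eigen: "of_real l \<in> spectrum_S \<xi> \<nu> q b \<gamma> \<longleftrightarrow> eigen l"
 unfolding spectrum_S_def using eigen_spectrum non_eigen_resolvent by blast

end

section \<open>The sequence of eigenvalues and the eigenfunction expansion\<close>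

text \<open>Here \<open>mu\<close> enumerates the eigenvalues from index 0, whereas the theorem
  counts from 1; \<open>mu n\<close> is to be read as the eigenvalue of number n + 1.\<close>

locale eigen_sequence = bessel_bc \<nu> b q \<xi> \<xi>' C0 \<alpha> \<beta>
 for \<nu> b q \<xi> \<xi>' C0 \<alpha> \<beta> +
 fixes mu :: "nat \<Rightarrow> real"
 assumes mono: "strict_mono mu" and eigen_range: "eigen l \<longleftrightarrow> l \<in> range mu"
begin

lemma eigen_mu: "eigen (mu n)"
 by (simp add: eigen_range)

text \<open>Otherwise infinitely many eigenvalues would lie in a bounded interval.\<close>

lemma mu_ge: "\<exists>n0. \<forall>n\<ge>n0. R \<le> mu n"
proof (rule ccontr)
 assume "\<nexists>n0. \<forall>n\<ge>n0. R \<le> mu n"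
 then have lt: "mu n < R" for n
  using strict_mono_less_eq[OF mono] by (meson not_le order_le_less_trans)
 have "range mu \<subseteq> {l. \<bar>l\<bar> \<le> \<bar>mu 0\<bar> + \<bar>R\<bar> + 1 \<and> eigen l}"
 proof
  fix l assume "l \<in> range mu"
  then obtain n where n: "l = mu n" by auto
  have "mu 0 \<le> mu n" using strict_mono_less_eq[OF mono] by simp
  then show "l \<in> {l. \<bar>l\<bar> \<le> \<bar>mu 0\<bar> + \<bar>R\<bar> + 1 \<and> eigen l}" using n lt[of n] eigen_mu[of n] by auto
 qed
 moreover have "finite {l. \<bar>l\<bar> \<le> \<bar>mu 0\<bar> + \<bar>R\<bar> + 1 \<and> eigen l}" by (rule finite_eigen) linarith
 ultimately have "finite (range mu)" by (rule finite_subset)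
 then show False using range_inj_infinite[OF strict_mono_imp_inj_on[OF mono]] by blast
qed

lemma summable_inverse_mu: "summable (\<lambda>n. 1 / mu n)"
proof -
 obtain L0 C where L0: "L0 > 0" "\<And>S. finite S \<Longrightarrow> (\<And>l. l \<in> S \<Longrightarrow> eigen l \<and> l \<ge> L0) \<Longrightarrow> (\<Sum>l\<in>S. 1 / l) \<le> C"
  using trace_bound by metis
 obtain n0 where n0: "\<And>n. n \<ge> n0 \<Longrightarrow> L0 \<le> mu n" using mu_ge by blast
 \<comment> \<open>Finitely many eigenvalues may be negative or zero; beyond n0 the terms are
   positive and bounded partial sums suffice.\<close>
 have "summable (\<lambda>n. 1 / mu (n + n0))"
 proof (rule summableI_nonneg_bounded[where x=C])
  show "0 \<le> 1 / mu (n + n0)" for n using n0[of "n + n0"] L0(1) by simp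
  fix N
  have "(\<Sum>i<N. 1 / mu (i + n0)) = (\<Sum>l\<in>(\<lambda>i. mu (i + n0)) ` {..<N}. 1 / l)"
   by (subst sum.reindex) (auto simp: inj_on_def strict_mono_eq[OF mono])
  also have "\<dots> \<le> C" by (rule L0(2)) (use eigen_mu n0 in auto)
  finally show "(\<Sum>i<N. 1 / mu (i + n0)) \<le> C" .
 qed
 then show ?thesis by (simp add: summable_iff_shift[of "\<lambda>n. 1 / mu n" n0])
qed

definition en :: "nat \<Rightarrow> real \<Rightarrow> real" where "en n x = u (mu n) x / sqrt (Nsq (mu n))"

lemma en_sq_int: "sq_int M (en n)"
 unfolding en_def[abs_def] using sq_int_cmult[OF u_sq_int[of "mu n"], of "1 / sqrt (Nsq (mu n))"] by simp

lemma en_orthonormal: "(\<integral>x. en n x * en m x \<partial>M) = (if n = m then 1 else 0)"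
proof -
 have "(\<integral>x. en n x * en m x \<partial>M) = (\<integral>x. u (mu n) x * u (mu m) x \<partial>M) / (sqrt (Nsq (mu n)) * sqrt (Nsq (mu m)))"
  unfolding en_def by simp
 moreover have "(\<integral>x. u (mu n) x * u (mu m) x \<partial>M) = 0" if "n \<noteq> m"
  by (rule eigen_orthogonal[OF eigen_mu eigen_mu]) (use that strict_mono_eq[OF mono] in auto)
 moreover have "(\<integral>x. u (mu n) x * u (mu n) x \<partial>M) = Nsq (mu n)" by (simp add: Nsq_def power2_eq_square)
 ultimately show ?thesis using Nsq_pos[of "mu n"] by auto
qed

lemma en_cont: "continuous_on {0<..b} (en n)"
 unfolding en_def[abs_def] using Nsq_pos[of "mu n"] by (intro continuous_intros u_cont) auto

text \<open>Numerator and norm are of the same order in the spectral parameter, so the quotient is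
  bounded for large n; each of the finitely many remaining eigenfunctions is bounded by
  itself.\<close>

lemma en_bounded:
 obtains E where "E > 0" "\<And>n x. x \<in> {0<..b} \<Longrightarrow> \<bar>en n x\<bar> \<le> E"
proof -
 obtain s1 C where A: "s1 > 0" "C > 0" "\<And>s x. s \<ge> s1 \<Longrightarrow> x \<in> {0<..b} \<Longrightarrow> \<bar>u (s\<^sup>2) x\<bar> \<le> C * s powr - (\<nu> + 1/2)"
  using u_large by metis
 obtain s2 k K where B: "s2 > 0" "k > 0" "K > 0" "\<And>s. s \<ge> s2 \<Longrightarrow> k * (s powr - (\<nu> + 1/2))\<^sup>2 \<le> Nsq (s\<^sup>2)" "\<And>s. s \<ge> s2 \<Longrightarrow> Nsq (s\<^sup>2) \<le> K * (s powr - (\<nu> + 1/2))\<^sup>2"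
  using Nsq_large by metis
 obtain n0 where n0: "\<And>n. n \<ge> n0 \<Longrightarrow> (max s1 s2)\<^sup>2 \<le> mu n" using mu_ge by blast
 have "\<exists>D>0. \<forall>x\<in>{0<..b}. \<bar>en n x\<bar> \<le> D" for n
 proof -
  obtain c where c: "c > 0" "\<And>x. x \<in> {0<..b} \<Longrightarrow> \<bar>u (mu n) x\<bar> \<le> c" using u_bounded by metis
  show ?thesis
   by (rule exI[of _ "c / sqrt (Nsq (mu n))"]) (use c Nsq_pos[of "mu n"] in \<open>auto simp: en_def divide_right_mono\<close>)
 qed
 then obtain D where D: "\<And>n. D n > 0" "\<And>n x. x \<in> {0<..b} \<Longrightarrow> \<bar>en n x\<bar> \<le> D n" by metis
 have large: "\<bar>en n x\<bar> \<le> C / sqrt k" if n: "n \<ge> n0" and x: "x \<in> {0<..b}" for n x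
 proof -
  define s where "s = sqrt (mu n)"
  have m0: "mu n > 0" using n0[OF n] A(1) by (smt (verit) zero_less_power2)
  have s: "s \<ge> max s1 s2" unfolding s_def using n0[OF n] by (rule real_le_rsqrt)
  have s2: "s\<^sup>2 = mu n" using m0 by (simp add: s_def)
  define P where "P = s powr - (\<nu> + 1/2)"
  have P: "P > 0" using s A(1) by (simp add: P_def)
  have 1: "\<bar>u (mu n) x\<bar> \<le> C * P" using A(3)[of s x] s x s2 by (simp add: P_def)
  have "k * P\<^sup>2 \<le> Nsq (mu n)" using B(4)[of s] s s2 by (simp add: P_def)
  then have "sqrt (k * P\<^sup>2) \<le> sqrt (Nsq (mu n))" by (rule real_sqrt_le_mono)
  then have 2: "sqrt k * P \<le> sqrt (Nsq (mu n))" using P by (simp add: real_sqrt_mult)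
  have "\<bar>en n x\<bar> = \<bar>u (mu n) x\<bar> / sqrt (Nsq (mu n))" using Nsq_pos[of "mu n"] by (simp add: en_def)
  also have "\<dots> \<le> (C * P) / (sqrt k * P)" using 1 2 P B(2) A(2) by (intro frac_le) auto
  also have "\<dots> = C / sqrt k" using P by simp
  finally show ?thesis .
 qed
 show thesis
 proof (rule that[of "C / sqrt k + (\<Sum>n<n0. D n)"])
  have s0: "(\<Sum>n<n0. D n) \<ge> 0" using D(1) by (intro sum_nonneg) (auto intro: less_imp_le)
  show "C / sqrt k + (\<Sum>n<n0. D n) > 0" using A(2) B(2) s0 by (intro add_pos_nonneg) auto
  fix n x assume x: "x \<in> {0<..b}"
  show "\<bar>en n x\<bar> \<le> C / sqrt k + (\<Sum>n<n0. D n)"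
  proof (cases "n \<ge> n0")
   case True
   then show ?thesis using large[OF True x] s0 by linarith
  next
   case False
   have "D n \<le> (\<Sum>n<n0. D n)" by (rule member_le_sum) (use False D(1) in \<open>auto intro: less_imp_le\<close>)
   moreover have "C / sqrt k > 0" using A(2) B(2) by simp
   ultimately show ?thesis using D(2)[OF x, of n] by linarith
  qed
 qed
qed

lemma en_integrable:
 fixes h :: "real \<Rightarrow> complex"
 assumes h: "integrable M h"
 shows "integrable M (\<lambda>x. of_real (en n x) * h x)"
proof -
 obtain E where E: "E > 0" "\<And>n x. x \<in> {0<..b} \<Longrightarrow> \<bar>en n x\<bar> \<le> E" using en_bounded by metis
 show ?thesis
 proof (rule Bochner_Integration.integrable_bound[OF integrable_mult_right[OF h, of "of_real E"]])
  show "(\<lambda>x. of_real (en n x) * h x) \<in> borel_measurable M"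
   using borel_measurable_integrable[OF h] continuous_on_lb_measurable[OF en_cont[of n]] by measurable
  show "AE x in M. norm (of_real (en n x) * h x) \<le> norm (complex_of_real E * h x)"
  proof (rule AE_I2)
   fix x assume "x \<in> space M"
   then have "\<bar>en n x\<bar> \<le> E" using E(2)[of x n] by (auto simp: space_M)
   then show "norm (of_real (en n x) * h x) \<le> norm (complex_of_real E * h x)" using E(1) by (simp add: norm_mult mult_right_mono)
  qed
 qed
qed

text \<open>Absolutely summable coefficients and uniformly bounded eigenfunctions make the series
  converge uniformly. This allows pairing term by term with a merely integrable h; completeness is
  needed only to identify the sum with g.\<close>

lemma eigen_expansion:
 fixes g h :: "real \<Rightarrow> complex"
 assumes g: "g \<in> L2 b" and d: "\<And>n. d n = (\<integral>x. of_real (en n x) * g x \<partial>M)"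
  and s: "summable (\<lambda>n. norm (d n))" and h: "integrable M h"
 shows "(\<lambda>n. d n * (\<integral>x. of_real (en n x) * h x \<partial>M)) sums (\<integral>x. g x * h x \<partial>M)"
proof -
 obtain E where E: "E > 0" "\<And>n x. x \<in> {0<..b} \<Longrightarrow> \<bar>en n x\<bar> \<le> E" using en_bounded by metis
 define S where "S x = (\<Sum>n. d n * of_real (en n x))" for x
 have enm [measurable]: "en n \<in> borel_measurable M" for n by (rule continuous_on_lb_measurable[OF en_cont])
 have nrm: "norm (d n * of_real (en n x)) \<le> E * norm (d n)" if "x \<in> {0<..b}" for n x
  using mult_left_mono[OF E(2)[OF that, of n], of "norm (d n)"] by (simp add: norm_mult mult.commute)
 have sE: "summable (\<lambda>n. E * norm (d n))" by (rule summable_mult[OF s])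
 have sS: "summable (\<lambda>n. norm (d n * of_real (en n x)))" if "x \<in> {0<..b}" for x
  by (rule summable_comparison_test'[OF sE, of 0]) (use nrm[OF that] in simp)
 have key: "(\<lambda>n. d n * (\<integral>x. of_real (en n x) * f x \<partial>M)) sums (\<integral>x. S x * f x \<partial>M)" if f: "integrable M f" for f
 proof -
  define F where "F n x = d n * (of_real (en n x) * f x)" for n x
  have iF: "integrable M (F n)" for n unfolding F_def by (rule integrable_mult_right[OF en_integrable[OF f]])
  have bF: "norm (F n x) \<le> E * norm (d n) * norm (f x)" if "x \<in> {0<..b}" for n x
   using mult_right_mono[OF nrm[OF that, of n], of "norm (f x)"] by (simp add: F_def norm_mult mult.assoc)
  have "(\<lambda>n. integral\<^sup>L M (F n)) sums (\<integral>x. (\<Sum>n. F n x) \<partial>M)"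
  proof (rule sums_integral[OF iF])
   show "AE x in M. summable (\<lambda>n. norm (F n x))"
   proof (rule AE_I2)
    fix x assume "x \<in> space M"
    then have x: "x \<in> {0<..b}" by (auto simp: space_M)
    show "summable (\<lambda>n. norm (F n x))"
     by (rule summable_comparison_test'[OF summable_mult2[OF sE, of "norm (f x)"], of 0]) (use bF[OF x] in simp)
   qed
   show "summable (\<lambda>n. \<integral>x. norm (F n x) \<partial>M)"
   proof (rule summable_comparison_test'[OF summable_mult2[OF sE, of "\<integral>x. norm (f x) \<partial>M"], of 0])
    fix n
    have "(\<integral>x. norm (F n x) \<partial>M) \<le> (\<integral>x. E * norm (d n) * norm (f x) \<partial>M)"
     using iF[of n] f bF by (intro integral_mono) (auto simp: space_M)
    then show "norm (\<integral>x. norm (F n x) \<partial>M) \<le> E * norm (d n) * (\<integral>x. norm (f x) \<partial>M)"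
     by (simp add: Bochner_Integration.integral_nonneg)
   qed
  qed
  moreover have "(\<integral>x. (\<Sum>n. F n x) \<partial>M) = (\<integral>x. S x * f x \<partial>M)"
  proof (rule Bochner_Integration.integral_cong[OF refl])
   fix x assume "x \<in> space M"
   then have x: "x \<in> {0<..b}" by (auto simp: space_M)
   show "(\<Sum>n. F n x) = S x * f x"
    unfolding S_def F_def suminf_mult2[OF summable_norm_cancel[OF sS[OF x]]] by (simp add: mult.assoc)
  qed
  moreover have "integral\<^sup>L M (F n) = d n * (\<integral>x. of_real (en n x) * f x \<partial>M)" for n
   unfolding F_def by simp
  ultimately show ?thesis by simp
 qed
 have Sm: "S \<in> borel_measurable M" unfolding S_def[abs_def] by measurable
 have SL: "S \<in> L2 b" unfolding in_L2_iff mem_Collect_eq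
 proof (intro conjI Sm)
  show "integrable M (\<lambda>x. (norm (S x))\<^sup>2)"
  proof (rule finite_measure.integrable_const_bound[OF finite_measure_lb, where B="(\<Sum>n. E * norm (d n))\<^sup>2"])
   show "AE x in M. norm ((norm (S x))\<^sup>2) \<le> (\<Sum>n. E * norm (d n))\<^sup>2"
   proof (rule AE_I2)
    fix x assume "x \<in> space M"
    then have x: "x \<in> {0<..b}" by (auto simp: space_M)
    have "norm (S x) \<le> (\<Sum>n. norm (d n * of_real (en n x)))" unfolding S_def by (rule summable_norm[OF sS[OF x]])
    also have "\<dots> \<le> (\<Sum>n. E * norm (d n))" by (rule suminf_le[OF nrm[OF x] sS[OF x] sE])
    finally show "norm ((norm (S x))\<^sup>2) \<le> (\<Sum>n. E * norm (d n))\<^sup>2" by (simp add: power_mono)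
   qed
   show "(\<lambda>x. (norm (S x))\<^sup>2) \<in> borel_measurable M" using Sm by measurable
  qed
 qed
 \<comment> \<open>The sum S has the same coefficients as g, so their difference is orthogonal to
   every eigenfunction.\<close>
 have ae: "AE x in M. g x + of_real (- 1) * S x = 0"
 proof (rule complex_complete[OF L2_linear[OF g SL]])
  fix l assume "eigen l"
  then obtain m where m: "l = mu m" by (auto simp: eigen_range)
  define r where "r = sqrt (Nsq (mu m))"
  have r: "r > 0" using Nsq_pos by (simp add: r_def)
  have T: "transf \<xi> b f (of_real l) = of_real r * (\<integral>x. of_real (en m x) * f x \<partial>M)" for f
  proof -
   have "transf \<xi> b f (of_real l) = (\<integral>x. of_real r * (of_real (en m x) * f x) \<partial>M)"
    unfolding transf_eq m by (rule Bochner_Integration.integral_cong) (use r in \<open>auto simp: space_M xi_real en_def r_def\<close>)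
   then show ?thesis by simp
  qed
  have em: "integrable M (\<lambda>x. complex_of_real (en m x))"
   using en_integrable[of "\<lambda>x. 1" m] finite_measure.integrable_const[OF finite_measure_lb, of b "1::complex"] by simp
  have "(\<integral>x. complex_of_real (en n x) * of_real (en m x) \<partial>M) = (if n = m then 1 else 0)" for n
  proof -
   have "(\<integral>x. complex_of_real (en n x) * of_real (en m x) \<partial>M) = (\<integral>x. complex_of_real (en n x * en m x) \<partial>M)" by simp
   also have "\<dots> = of_real (\<integral>x. en n x * en m x \<partial>M)" by (rule integral_complex_of_real)
   finally show ?thesis by (simp add: en_orthonormal)
  qed
  then have "(\<lambda>n. d n * (if n = m then 1 else 0)) sums (\<integral>x. S x * of_real (en m x) \<partial>M)" using key[OF em] by simp
  moreover have "(\<lambda>n. d n * (if n = m then 1 else 0)) sums d m"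
   using sums_single[of m d] by (rule sums_cong[THEN iffD1, rotated]) simp
  ultimately have "(\<integral>x. S x * of_real (en m x) \<partial>M) = d m" by (rule sums_unique2)
  then have "(\<integral>x. of_real (en m x) * S x \<partial>M) = (\<integral>x. of_real (en m x) * g x \<partial>M)" by (simp add: d mult.commute)
  then show "transf \<xi> b (\<lambda>x. g x + of_real (- 1) * S x) (of_real l) = 0"
   unfolding transf_linear[OF g SL] T by simp
 qed
 have "(\<integral>x. g x * h x \<partial>M) = (\<integral>x. S x * h x \<partial>M)"
 proof (rule integral_cong_AE)
  have gm: "g \<in> borel_measurable M" using g by (simp add: in_L2_iff)
  note [measurable] = gm Sm borel_measurable_integrable[OF h]
  show "(\<lambda>x. g x * h x) \<in> borel_measurable M" "(\<lambda>x. S x * h x) \<in> borel_measurable M" by measurable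
  show "AE x in M. g x * h x = S x * h x" using ae by eventually_elim simp
 qed
 then show ?thesis using key[OF h] by simp
qed

end

section \<open>Growth of the eigenvalues\<close>

context eigen_sequence
begin

lemma norm_integral_en_le:
 obtains E where "E > 0" "\<And>n g. integrable M g \<Longrightarrow> \<bar>\<integral>x. g x * en n x \<partial>M\<bar> \<le> E * (\<integral>x. \<bar>g x\<bar> \<partial>M)"
proof -
 obtain E where E: "E > 0" "\<And>n x. x \<in> {0<..b} \<Longrightarrow> \<bar>en n x\<bar> \<le> E" using en_bounded by metis
 show thesis
 proof (rule that[OF E(1)])
  fix n and g :: "real \<Rightarrow> real" assume g: "integrable M g"
  have bd: "\<bar>g x * en n x\<bar> \<le> E * \<bar>g x\<bar>" if "x \<in> space M" for x
   using mult_left_mono[OF E(2)[of x n], of "\<bar>g x\<bar>"] that by (simp add: space_M abs_mult mult.commute)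
  have i: "integrable M (\<lambda>x. g x * en n x)"
  proof (rule Bochner_Integration.integrable_bound[OF integrable_mult_right[OF g, of E]])
   show "(\<lambda>x. g x * en n x) \<in> borel_measurable M"
    using borel_measurable_integrable[OF g] continuous_on_lb_measurable[OF en_cont[of n]] by measurable
   show "AE x in M. norm (g x * en n x) \<le> norm (E * g x)"
    using bd E(1) by (intro AE_I2) (simp add: abs_mult)
  qed
  have "\<bar>\<integral>x. g x * en n x \<partial>M\<bar> \<le> (\<integral>x. \<bar>g x * en n x\<bar> \<partial>M)" by (rule integral_abs_bound)
  also have "\<dots> \<le> (\<integral>x. E * \<bar>g x\<bar> \<partial>M)" using i g bd by (intro integral_mono) auto
  finally show "\<bar>\<integral>x. g x * en n x \<partial>M\<bar> \<le> E * (\<integral>x. \<bar>g x\<bar> \<partial>M)" by simp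
 qed
qed

lemma en_Bessel:
 assumes "finite S" "sq_int M g"
 shows "(\<Sum>n\<in>S. (\<integral>x. g x * en n x \<partial>M)\<^sup>2) \<le> (\<integral>x. (g x)\<^sup>2 \<partial>M)"
 using Bessel_inequality[OF assms, of en] en_sq_int en_orthonormal by (simp add: power2_eq_square)

lemma Parseval:
 assumes g: "sq_int M g" and s: "summable (\<lambda>n. \<bar>\<integral>x. g x * en n x \<partial>M\<bar>)"
 shows "(\<lambda>n. (\<integral>x. g x * en n x \<partial>M)\<^sup>2) sums (\<integral>x. (g x)\<^sup>2 \<partial>M)"
proof -
 have gL: "(\<lambda>x. complex_of_real (g x)) \<in> L2 b" using g by (simp add: in_L2_complex_iff)
 define d where "d n = (\<integral>x. g x * en n x \<partial>M)" for n
 have c: "(\<integral>x. of_real (en n x) * complex_of_real (g x) \<partial>M) = of_real (d n)" for n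
 proof -
  have "(\<integral>x. of_real (en n x) * complex_of_real (g x) \<partial>M) = (\<integral>x. complex_of_real (g x * en n x) \<partial>M)" by (simp add: mult.commute)
  also have "\<dots> = of_real (d n)" unfolding d_def by (rule integral_complex_of_real)
  finally show ?thesis .
 qed
 have "(\<lambda>n. complex_of_real (d n) * (\<integral>x. of_real (en n x) * complex_of_real (g x) \<partial>M)) sums (\<integral>x. complex_of_real (g x) * of_real (g x) \<partial>M)"
  by (rule eigen_expansion[OF gL _ _ L2_integrable[OF gL]]) (use c s in \<open>auto simp: d_def\<close>)
 moreover have "(\<integral>x. complex_of_real (g x) * of_real (g x) \<partial>M) = of_real (\<integral>x. (g x)\<^sup>2 \<partial>M)"
  using integral_complex_of_real[of M "\<lambda>x. (g x)\<^sup>2"] by (simp add: power2_eq_square)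
 ultimately have "(\<lambda>n. complex_of_real ((d n)\<^sup>2)) sums of_real (\<integral>x. (g x)\<^sup>2 \<partial>M)"
  unfolding c by (simp add: power2_eq_square)
 then show ?thesis unfolding sums_of_real_iff d_def .
qed

text \<open>The bump is t^2 (1-t)^2 on the last piece [b-h,b], with t affine from 0 to 1. It
  vanishes to second order at both ends, so the differential expression passes from u to the bump
  without boundary terms. The constant 26 = 2 + 12 + 12 bounds the second derivative in t.\<close>

lemma bump_function:
 assumes h: "0 < h" "h \<le> b / 2" and Vm: "\<And>x. x \<in> {b/2..b} \<Longrightarrow> \<bar>V x\<bar> \<le> Vm"
 obtains g Hg where "sq_int M g" "sq_int M Hg" "\<And>l. l * (\<integral>x. g x * u l x \<partial>M) = (\<integral>x. Hg x * u l x \<partial>M)"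
  "(\<integral>x. \<bar>g x\<bar> \<partial>M) \<le> h" "(\<integral>x. (g x)\<^sup>2 \<partial>M) \<ge> (9/256)\<^sup>2 / 2 * h" "(\<integral>x. (Hg x)\<^sup>2 \<partial>M) \<le> (26 + Vm * b\<^sup>2)\<^sup>2 / h ^ 3"
proof -
 define c where "c = b - h"
 have c: "b / 2 \<le> c" "0 < c" "c < b" "0 \<le> c" "b - c = h" using h b by (auto simp: c_def)
 have sub: "{c..b} \<subseteq> {0<..b}" using c by auto
 define t where "t x = (x - c) / h" for x
 define p where "p x = (t x)\<^sup>2 * (1 - t x)\<^sup>2" for x
 define \<kappa> where "\<kappa> = 1 / h"
 define p' where "p' x = \<kappa> * (2 * t x * (1 - t x)\<^sup>2 - 2 * (t x)\<^sup>2 * (1 - t x))" for x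
 define p'' where "p'' x = \<kappa>\<^sup>2 * (2 - 12 * t x + 12 * (t x)\<^sup>2)" for x
 have t_d: "(t has_real_derivative \<kappa>) (at x within S)" for x S
  unfolding t_def[abs_def] \<kappa>_def using h by (auto intro!: derivative_eq_intros)
 have p_d: "(p has_real_derivative p' x) (at x within S)" for x S
  unfolding p_def[abs_def]
  by (rule DERIV_cong, (rule t_d derivative_intros)+) (simp add: p'_def power2_eq_square algebra_simps)
 have p'_d: "(p' has_real_derivative p'' x) (at x within S)" for x S
  unfolding p'_def[abs_def]
  by (rule DERIV_cong, (rule t_d derivative_intros)+) (simp add: p''_def power2_eq_square algebra_simps)
 have t01: "0 \<le> t x" "t x \<le> 1" if "x \<in> {c..b}" for x using that h by (auto simp: t_def c_def field_simps)
 have ends: "t c = 0" "t b = 1" using h by (auto simp: t_def c_def)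
 have p01: "0 \<le> p x" "p x \<le> 1" if "x \<in> {c..b}" for x
 proof -
  show "0 \<le> p x" by (simp add: p_def)
  have "(t x)\<^sup>2 \<le> 1" "(1 - t x)\<^sup>2 \<le> 1" using t01[OF that] by (auto simp: abs_square_le_1)
  then show "p x \<le> 1" unfolding p_def by (intro mult_le_one) auto
 qed
 have p''b: "\<bar>p'' x\<bar> \<le> 26 / h\<^sup>2" if "x \<in> {c..b}" for x
 proof -
  have "(t x)\<^sup>2 \<le> 1" using t01[OF that] by (simp add: abs_square_le_1)
  then have "\<bar>2 - 12 * t x + 12 * (t x)\<^sup>2\<bar> \<le> 26" using t01[OF that] zero_le_power2[of "t x"] by linarith
  then have "\<kappa>\<^sup>2 * \<bar>2 - 12 * t x + 12 * (t x)\<^sup>2\<bar> \<le> \<kappa>\<^sup>2 * 26" by (intro mult_left_mono) auto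
  then show ?thesis by (simp add: p''_def abs_mult \<kappa>_def power_divide)
 qed
 define g where "g x = indicator {c..b} x * p x" for x
 \<comment> \<open>The maximum with b/2 changes nothing on [c,b] but keeps the potential away from
   its singularity, so that W is continuous on (0,b].\<close>
 define W where "W x = p x * V (max x (b/2)) - p'' x" for x
 define Hg where "Hg x = indicator {c..b} x * W x" for x
 have pc: "continuous_on S p" "continuous_on S p''" "continuous_on S t" for S
  unfolding p_def[abs_def] p''_def[abs_def] t_def[abs_def] \<kappa>_def using h by (auto intro!: continuous_intros)
 have Wc: "continuous_on {0<..b} W"
 proof -
  have "continuous_on {0<..b} (\<lambda>x. V (max x (b/2)))"
   by (rule continuous_on_compose2[OF V_cont, of _ "\<lambda>x. max x (b/2)"]) (use b in \<open>auto intro!: continuous_intros\<close>)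
  then show ?thesis unfolding W_def[abs_def] by (intro continuous_intros pc)
 qed
 have Wb: "\<bar>W x\<bar> \<le> (26 + Vm * b\<^sup>2) / h\<^sup>2" if x: "x \<in> {c..b}" for x
 proof -
  have V0: "Vm \<ge> 0" using Vm[of b] b by (smt (verit) abs_ge_zero atLeastAtMost_iff field_sum_of_halves)
  have "max x (b/2) = x" using x c by auto
  then have "\<bar>p x * V (max x (b/2))\<bar> \<le> 1 * Vm"
   unfolding abs_mult using p01[OF x] Vm[of x] x c by (intro mult_mono) auto
  also have "\<dots> \<le> Vm * b\<^sup>2 / h\<^sup>2"
  proof -
   have "h\<^sup>2 \<le> b\<^sup>2" using h b by (intro power_mono) auto
   then show ?thesis using h V0 by (simp add: field_simps mult_left_mono)
  qed
  finally show ?thesis using p''b[OF x] unfolding W_def by (simp add: add_divide_distrib)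
 qed
 have gm: "g \<in> borel_measurable M" "Hg \<in> borel_measurable M"
 proof -
  have i: "(\<lambda>x. indicator {c..b} x :: real) \<in> borel_measurable M" by (rule measurable_restrict_space1) simp
  show "g \<in> borel_measurable M" "Hg \<in> borel_measurable M"
   unfolding g_def[abs_def] Hg_def[abs_def]
   using i continuous_on_lb_measurable[OF pc(1)] continuous_on_lb_measurable[OF Wc] by measurable
 qed
 have gs: "sq_int M g"
  by (rule finite_measure.sq_int_bounded[OF finite_measure_lb gm(1), of 1]) (use p01 in \<open>auto simp: g_def indicator_def\<close>)
 have Hb0: "(26 + Vm * b\<^sup>2) / h\<^sup>2 \<ge> 0" using Wb[of b] c by (smt (verit) abs_ge_zero atLeastAtMost_iff)
 have Hs: "sq_int M Hg"
  by (rule finite_measure.sq_int_bounded[OF finite_measure_lb gm(2), of "(26 + Vm * b\<^sup>2) / h\<^sup>2"]) (use Wb Hb0 in \<open>auto simp: Hg_def indicator_def\<close>)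
 have ci: "(\<integral>x. indicator {c..b} x * f x \<partial>M) = integral {c..b} f" if f: "continuous_on {0<..b} f" "\<And>x. x \<in> {0<..b} \<Longrightarrow> \<bar>f x\<bar> \<le> F" for f :: "real \<Rightarrow> real" and F :: real
 proof -
  have "integrable M f"
   by (rule finite_measure.integrable_const_bound[OF finite_measure_lb, where B=F])
    (use f(2) in \<open>auto simp: space_M intro!: AE_I2 continuous_on_lb_measurable f(1)\<close>)
  from integral_lb_indicator(2)[OF this c(4) order_refl] show ?thesis by simp
 qed
 have eq: "l * (\<integral>x. g x * u l x \<partial>M) = (\<integral>x. Hg x * u l x \<partial>M)" for l
 proof -
  note uc = continuous_on_subset[OF u_cont(1) sub] continuous_on_subset[OF u_cont(2) sub]
  have gi: "integrable M (\<lambda>x. indicator {c..b} x *\<^sub>R (g x * u l x))" "(\<integral>x. indicator {c..b} x *\<^sub>R (g x * u l x) \<partial>M) = integral {c..b} (\<lambda>x. g x * u l x)"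
   using integral_lb_indicator[OF sq_int_mult[OF gs u_sq_int] c(4) order_refl] by auto
  have Hi: "integrable M (\<lambda>x. indicator {c..b} x *\<^sub>R (Hg x * u l x))" "(\<integral>x. indicator {c..b} x *\<^sub>R (Hg x * u l x) \<partial>M) = integral {c..b} (\<lambda>x. Hg x * u l x)"
   using integral_lb_indicator[OF sq_int_mult[OF Hs u_sq_int] c(4) order_refl] by auto
  have id: "indicator {c..b} x *\<^sub>R (g x * u l x) = g x * u l x" "indicator {c..b} x *\<^sub>R (Hg x * u l x) = Hg x * u l x" for x
   by (auto simp: g_def Hg_def indicator_def)
  have G: "(\<integral>x. g x * u l x \<partial>M) = integral {c..b} (\<lambda>x. p x * u l x)"
   using gi(2) unfolding id by (auto simp: g_def intro!: Henstock_Kurzweil_Integration.integral_cong)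
  have H: "(\<integral>x. Hg x * u l x \<partial>M) = integral {c..b} (\<lambda>x. W x * u l x)"
   using Hi(2) unfolding id by (auto simp: Hg_def intro!: Henstock_Kurzweil_Integration.integral_cong)
  have "((\<lambda>x. l * (p x * u l x) - W x * u l x) has_integral (p' b * u l b - p b * u' l b) - (p' c * u l c - p c * u' l c)) {c..b}"
  proof (rule fundamental_theorem_of_calculus)
   fix x assume x: "x \<in> {c..b}"
   have "((\<lambda>x. p' x * u l x - p x * u' l x) has_real_derivative (p'' x * u l x + u' l x * p' x) - (p' x * u' l x + (V x - l) * u l x * p x)) (at x within {c..b})"
    by (intro DERIV_diff DERIV_mult p_d p'_d u_deriv_sub[OF c(2) order_refl x])
   moreover have "(p'' x * u l x + u' l x * p' x) - (p' x * u' l x + (V x - l) * u l x * p x) = l * (p x * u l x) - W x * u l x"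
   proof -
    have "max x (b/2) = x" using x c by auto
    then show ?thesis by (simp add: W_def algebra_simps)
   qed
   ultimately show "((\<lambda>x. p' x * u l x - p x * u' l x) has_vector_derivative l * (p x * u l x) - W x * u l x) (at x within {c..b})"
    by (simp add: has_real_derivative_iff_has_vector_derivative)
  qed (use c in simp)
  then have "((\<lambda>x. l * (p x * u l x) - W x * u l x) has_integral 0) {c..b}"
   by (simp add: p_def p'_def ends)
  then have "integral {c..b} (\<lambda>x. l * (p x * u l x) - W x * u l x) = 0" by (rule integral_unique)
  moreover have "integral {c..b} (\<lambda>x. l * (p x * u l x) - W x * u l x)
    = integral {c..b} (\<lambda>x. l * (p x * u l x)) - integral {c..b} (\<lambda>x. W x * u l x)"
   by (intro Henstock_Kurzweil_Integration.integral_diff integrable_continuous_interval continuous_intros pc uc continuous_on_subset[OF Wc sub])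
  ultimately show ?thesis unfolding G H by simp
 qed
 have ind: "(\<integral>x. indicator {c..b} x * r \<partial>M) = r * h" for r :: real
  using ci[of "\<lambda>x. r" "\<bar>r\<bar>"] c by simp
 have indi: "integrable M (\<lambda>x. indicator {d..e} x * r)" for d e r :: real
 proof (rule finite_measure.integrable_const_bound[OF finite_measure_lb, where B="\<bar>r\<bar>"])
  show "(\<lambda>x. indicator {d..e} x * r) \<in> borel_measurable M" by (rule measurable_restrict_space1) simp
 qed (auto simp: indicator_def)
 have g1: "(\<integral>x. \<bar>g x\<bar> \<partial>M) \<le> h"
 proof -
  have "integrable M (\<lambda>x. \<bar>g x\<bar>)"
  proof -
   have one: "sq_int M (\<lambda>x. 1)" by (rule finite_measure.sq_int_bounded[OF finite_measure_lb, of _ _ 1]) auto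
   show ?thesis using sq_int_mult[OF gs one] by simp
  qed
  then have "(\<integral>x. \<bar>g x\<bar> \<partial>M) \<le> (\<integral>x. indicator {c..b} x * 1 \<partial>M)"
   by (intro integral_mono indi) (use p01 in \<open>auto simp: g_def indicator_def\<close>)
  then show ?thesis unfolding ind by simp
 qed
 have g2: "(\<integral>x. (g x)\<^sup>2 \<partial>M) \<ge> (9/256)\<^sup>2 / 2 * h"
 proof -
  \<comment> \<open>On the middle half t (1 - t) is at least 3/16, so the bump is at least 9/256
    there.\<close>
  define I where "I = {c + h/4..c + 3*h/4}"
  have "(\<integral>x. indicator I x * (9/256 :: real)\<^sup>2 \<partial>M) = (9/256)\<^sup>2 / 2 * h"
  proof -
   have "(\<integral>x. indicator I x *\<^sub>R (9/256)\<^sup>2 \<partial>M) = integral I (\<lambda>x. (9/256)\<^sup>2 :: real)"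
    unfolding I_def by (rule integral_lb_indicator(2)[OF finite_measure.integrable_const[OF finite_measure_lb]]) (use c h in \<open>auto simp: c_def\<close>)
   then show ?thesis using h by (simp add: I_def)
  qed
  moreover have "(\<integral>x. indicator I x * (9/256 :: real)\<^sup>2 \<partial>M) \<le> (\<integral>x. (g x)\<^sup>2 \<partial>M)"
  proof (rule integral_mono)
   show "integrable M (\<lambda>x. indicator I x * (9/256 :: real)\<^sup>2)" unfolding I_def by (rule indi)
   show "integrable M (\<lambda>x. (g x)\<^sup>2)" using gs by auto
   fix x
   show "indicator I x * (9/256 :: real)\<^sup>2 \<le> (g x)\<^sup>2"
   proof (cases "x \<in> I")
    case True
    then have tx: "1/4 \<le> t x" "t x \<le> 3/4" and xc: "x \<in> {c..b}" using h by (auto simp: t_def I_def field_simps c_def)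
    have "3/16 \<le> t x * (1 - t x)"
    proof -
     have "0 \<le> (t x - 1/4) * (3/4 - t x)" using tx by simp
     then show ?thesis by (simp add: algebra_simps)
    qed
    then have "(3/16)\<^sup>2 \<le> (t x * (1 - t x))\<^sup>2" by (rule power_mono) simp
    then have "9/256 \<le> p x" by (simp add: p_def power_mult_distrib power_divide)
    then have "(9/256)\<^sup>2 \<le> (p x)\<^sup>2" by (rule power_mono) simp
    then show ?thesis using True xc by (simp add: g_def)
   qed simp
  qed
  ultimately show ?thesis by linarith
 qed
 have H2: "(\<integral>x. (Hg x)\<^sup>2 \<partial>M) \<le> (26 + Vm * b\<^sup>2)\<^sup>2 / h ^ 3"
 proof -
  have "(\<integral>x. (Hg x)\<^sup>2 \<partial>M) \<le> (\<integral>x. indicator {c..b} x * ((26 + Vm * b\<^sup>2) / h\<^sup>2)\<^sup>2 \<partial>M)"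
  proof (rule integral_mono[OF _ indi])
   show "integrable M (\<lambda>x. (Hg x)\<^sup>2)" using Hs by auto
   fix x
   show "(Hg x)\<^sup>2 \<le> indicator {c..b} x * ((26 + Vm * b\<^sup>2) / h\<^sup>2)\<^sup>2"
   proof (cases "x \<in> {c..b}")
    case True
    show ?thesis using power_mono[OF Wb[OF True] abs_ge_zero, of 2] True by (simp add: Hg_def)
   qed (simp add: Hg_def)
  qed
  also have "\<dots> = (26 + Vm * b\<^sup>2)\<^sup>2 / h ^ 3" unfolding ind using h by (simp add: field_simps power2_eq_square power3_eq_cube)
  finally show ?thesis .
 qed
 show thesis by (rule that[OF gs Hs eq g1 g2 H2])
qed

text \<open>A bump of width h has square norm of order h, while each coefficient is O(h). If h is a
  small multiple of 1/(N+1), the first N coefficients carry at most half of it. The tail, at most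
  the square norm of \<open>Hg\<close> over \<open>mu N\<close> squared, must carry the rest, so
  \<open>mu N\<close> is O(1/h^2).\<close>

lemma mu_growth:
 obtains C where "C > 0" "\<And>n. mu n \<le> C * (real n + 1)\<^sup>2"
proof -
 obtain E where E: "E > 0" "\<And>n g. integrable M g \<Longrightarrow> \<bar>\<integral>x. g x * en n x \<partial>M\<bar> \<le> E * (\<integral>x. \<bar>g x\<bar> \<partial>M)" using norm_integral_en_le by metis
 have "continuous_on {b/2..b} V" using u_cont_sub(3)[of "b/2" b] b by simp
 then have "bounded (V ` {b/2..b})" by (intro compact_imp_bounded compact_continuous_image compact_Icc)
 then obtain Vm where Vm: "\<And>x. x \<in> {b/2..b} \<Longrightarrow> \<bar>V x\<bar> \<le> Vm" unfolding bounded_pos by fastforce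
 define k0 :: real where "k0 = (9/256)\<^sup>2 / 2"
 have k0: "k0 > 0" by (simp add: k0_def)
 define D where "D = 26 + Vm * b\<^sup>2"
 have "Vm \<ge> 0" using Vm[of b] b by (smt (verit) abs_ge_zero atLeastAtMost_iff field_sum_of_halves)
 then have D: "D > 0" by (simp add: D_def add_pos_nonneg)
 \<comment> \<open>The second entry makes the first N squared coefficients sum to at most half of
   the lower bound k0 h.\<close>
 define \<delta> where "\<delta> = min (b / 2) (k0 / (2 * E\<^sup>2))"
 have \<delta>: "\<delta> > 0" "\<delta> \<le> b / 2" using b k0 E by (auto simp: \<delta>_def)
 have \<delta>E: "\<delta> * E\<^sup>2 \<le> k0 / 2"
 proof -
  have "\<delta> * E\<^sup>2 \<le> k0 / (2 * E\<^sup>2) * E\<^sup>2" by (intro mult_right_mono) (auto simp: \<delta>_def)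
  then show ?thesis using E by simp
 qed
 define C where "C = sqrt (2 / k0) * D / \<delta>\<^sup>2"
 have C: "C > 0" using k0 D \<delta> by (simp add: C_def)
 show thesis
 proof (rule that[OF C])
  fix N
  show "mu N \<le> C * (real N + 1)\<^sup>2"
  proof (cases "mu N > 0")
   case False
   then show ?thesis using C by (smt (verit) mult_nonneg_nonneg zero_le_power2)
  next
   case True
   define h where "h = \<delta> / (real N + 1)"
   have h0: "h > 0" using \<delta> by (simp add: h_def)
   have "h \<le> \<delta> / 1" unfolding h_def using \<delta> by (intro divide_left_mono) auto
   then have h: "0 < h" "h \<le> b / 2" using h0 \<delta> by auto
   obtain g Hg where g: "sq_int M g" "sq_int M Hg" "\<And>l. l * (\<integral>x. g x * u l x \<partial>M) = (\<integral>x. Hg x * u l x \<partial>M)"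
    "(\<integral>x. \<bar>g x\<bar> \<partial>M) \<le> h" "(\<integral>x. (g x)\<^sup>2 \<partial>M) \<ge> (9/256)\<^sup>2 / 2 * h" "(\<integral>x. (Hg x)\<^sup>2 \<partial>M) \<le> (26 + Vm * b\<^sup>2)\<^sup>2 / h ^ 3"
    by (rule bump_function[OF h Vm]) blast+
   define cf kf where "cf n = (\<integral>x. g x * en n x \<partial>M)" and "kf n = (\<integral>x. Hg x * en n x \<partial>M)" for n
   have ck: "mu n * cf n = kf n" for n
   proof -
    have "cf n = (\<integral>x. g x * u (mu n) x \<partial>M) / sqrt (Nsq (mu n))" "kf n = (\<integral>x. Hg x * u (mu n) x \<partial>M) / sqrt (Nsq (mu n))"
     unfolding cf_def kf_def en_def by simp_all
    then show ?thesis using g(3)[of "mu n"] by simp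
   qed
   have one: "sq_int M (\<lambda>x. 1)" by (rule finite_measure.sq_int_bounded[OF finite_measure_lb, of _ _ 1]) auto
   have gi: "integrable M g" "integrable M Hg" using sq_int_mult[OF g(1) one] sq_int_mult[OF g(2) one] by auto
   have pos: "mu n > 0" if "n \<ge> N" for n using that True strict_mono_less_eq[OF mono, of N n] by linarith
   define HE where "HE = E * (\<integral>x. \<bar>Hg x\<bar> \<partial>M)"
   \<comment> \<open>Parseval is available only for absolutely summable coefficients. Moving the
     operator onto the bump gains a factor 1 / \<open>mu n\<close>, and these factors are
     summable.\<close>
   have "summable (\<lambda>n. \<bar>cf n\<bar>)"
   proof (rule summable_comparison_test'[OF summable_mult[OF summable_inverse_mu, of HE], of N])
    fix n assume n: "n \<ge> N"
    have "\<bar>kf n\<bar> \<le> HE" unfolding kf_def HE_def by (rule E(2)[OF gi(2)])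
    moreover have "\<bar>kf n\<bar> = mu n * \<bar>cf n\<bar>" using ck[of n] pos[OF n] by (metis abs_mult abs_of_pos)
    ultimately show "norm \<bar>cf n\<bar> \<le> HE * (1 / mu n)" using pos[OF n] by (simp add: field_simps)
   qed
   then have P: "(\<lambda>n. (cf n)\<^sup>2) sums (\<integral>x. (g x)\<^sup>2 \<partial>M)" using Parseval[OF g(1)] by (simp add: cf_def)
   \<comment> \<open>Bound for the tail of the Parseval sum: for n at least N the coefficient
     \<open>cf n\<close> is at most \<open>kf n\<close> over \<open>mu N\<close>, and Bessel's
     inequality applies to \<open>Hg\<close>.\<close>
   define B where "B = D\<^sup>2 / h ^ 3 / (mu N)\<^sup>2"
   have "(\<integral>x. (g x)\<^sup>2 \<partial>M) \<le> real N * (E * h)\<^sup>2 + B"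
   proof (rule LIMSEQ_le_const2[OF P[unfolded sums_def]], intro exI[of _ 0] allI impI)
    fix m
    have s1: "(\<Sum>n<N. (cf n)\<^sup>2) \<le> (\<Sum>n<N. (E * h)\<^sup>2)"
    proof (rule sum_mono)
     fix n
     have "\<bar>cf n\<bar> \<le> E * (\<integral>x. \<bar>g x\<bar> \<partial>M)" unfolding cf_def by (rule E(2)[OF gi(1)])
     also have "\<dots> \<le> E * h" using g(4) E(1) by (intro mult_left_mono) auto
     finally show "(cf n)\<^sup>2 \<le> (E * h)\<^sup>2" using abs_le_square_iff[of "cf n" "E * h"] by linarith
    qed
    have s2: "(\<Sum>n\<in>{N..<m}. (cf n)\<^sup>2) \<le> B"
    proof -
     have "(\<Sum>n\<in>{N..<m}. (cf n)\<^sup>2) \<le> (\<Sum>n\<in>{N..<m}. (kf n)\<^sup>2 / (mu N)\<^sup>2)"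
     proof (rule sum_mono)
      fix n assume "n \<in> {N..<m}"
      then have n: "n \<ge> N" by simp
      have "mu N \<le> mu n" using n strict_mono_less_eq[OF mono] by simp
      then have "mu N * \<bar>cf n\<bar> \<le> \<bar>mu n * cf n\<bar>" using pos[OF n] True by (simp add: abs_mult mult_right_mono)
      then have "(mu N * \<bar>cf n\<bar>)\<^sup>2 \<le> \<bar>kf n\<bar>\<^sup>2" unfolding ck by (rule power_mono) (use True in simp)
      then show "(cf n)\<^sup>2 \<le> (kf n)\<^sup>2 / (mu N)\<^sup>2" using True by (simp add: power_mult_distrib field_simps)
     qed
     also have "\<dots> = (\<Sum>n\<in>{N..<m}. (kf n)\<^sup>2) / (mu N)\<^sup>2" by (simp add: sum_divide_distrib)
     also have "\<dots> \<le> (D\<^sup>2 / h ^ 3) / (mu N)\<^sup>2"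
      using en_Bessel[OF _ g(2), of "{N..<m}"] g(6) unfolding kf_def D_def by (intro divide_right_mono) auto
     finally show ?thesis by (simp add: B_def)
    qed
    have "(\<Sum>n<m. (cf n)\<^sup>2) \<le> (\<Sum>n\<in>{..<N} \<union> {N..<m}. (cf n)\<^sup>2)" by (rule sum_mono2) auto
    also have "\<dots> = (\<Sum>n<N. (cf n)\<^sup>2) + (\<Sum>n\<in>{N..<m}. (cf n)\<^sup>2)" by (rule sum.union_disjoint) auto
    finally show "(\<Sum>n<m. (cf n)\<^sup>2) \<le> real N * (E * h)\<^sup>2 + B" using s1 s2 by simp
   qed
   then have "k0 * h \<le> real N * (E * h)\<^sup>2 + B" using g(5) by (simp add: k0_def)
   also have "real N * (E * h)\<^sup>2 \<le> k0 / 2 * h"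
   proof -
    have "real N * h \<le> \<delta>" unfolding h_def using \<delta> by (simp add: field_simps)
    then have "(real N * h) * (E\<^sup>2 * h) \<le> \<delta> * (E\<^sup>2 * h)" using h by (intro mult_right_mono) auto
    also have "\<dots> \<le> k0 / 2 * h" using mult_right_mono[OF \<delta>E, of h] h by (simp add: mult_ac)
    finally show ?thesis by (simp add: power2_eq_square mult_ac)
   qed
   finally have "k0 / 2 * h \<le> B" by simp
   then have "(mu N)\<^sup>2 \<le> D\<^sup>2 / h ^ 3 / (k0 / 2 * h)" unfolding B_def using True h k0 by (simp add: field_simps)
   also have "\<dots> = (sqrt (2 / k0) * D / h\<^sup>2)\<^sup>2"
    using k0 h by (simp add: power_mult_distrib power_divide field_simps power2_eq_square power3_eq_cube)
   finally have "mu N \<le> sqrt (2 / k0) * D / h\<^sup>2" by (rule power2_le_imp_le) (use k0 D in simp)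
   also have "\<dots> = C * (real N + 1)\<^sup>2" unfolding C_def h_def using \<delta> by (simp add: field_simps power_divide)
   finally show ?thesis .
  qed
 qed
qed

end

section \<open>The coefficients of the modified kernel\<close>

lemma R_mod_bounds: "a < b \<Longrightarrow> x \<le> b \<Longrightarrow> 0 \<le> R_mod a b x" "a < b \<Longrightarrow> R_mod a b x \<le> 1"
 by (auto simp: R_mod_def)

lemma R_mod_cont:
 assumes "a < b"
 shows "continuous_on S (R_mod a b)"
proof -
 have "R_mod a b = (\<lambda>x. min 1 ((b - x) / (b - a)))" using assms by (auto simp: R_mod_def min_def fun_eq_iff field_simps)
 moreover have "continuous_on S (\<lambda>x. min 1 ((b - x) / (b - a)))" using assms by (intro continuous_intros) auto
 ultimately show ?thesis by simp
qed

lemma R_mod_deriv: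
 assumes "a < b" "x \<noteq> a"
 shows "(R_mod a b has_real_derivative (if a \<le> x then - (1 / (b - a)) else 0)) (at x)"
proof (cases "a \<le> x")
 case True
 have "((\<lambda>x. (b - x) / (b - a)) has_real_derivative (0 - 1) / (b - a)) (at x)"
  by (intro DERIV_cdivide DERIV_diff DERIV_const DERIV_ident)
 then have "((\<lambda>x. (b - x) / (b - a)) has_real_derivative - (1 / (b - a))) (at x)" by simp
 then have "(R_mod a b has_real_derivative - (1 / (b - a))) (at x)"
  by (rule has_field_derivative_transform_within_open[where S="{a<..}"]) (use True assms in \<open>auto simp: R_mod_def\<close>)
 then show ?thesis using True by simp
next
 case False
 have "((\<lambda>x. 1) has_real_derivative 0) (at x)" by simp
 then have "(R_mod a b has_real_derivative 0) (at x)"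
  by (rule has_field_derivative_transform_within_open[where S="{..<a}"]) (use False in \<open>auto simp: R_mod_def\<close>)
 then show ?thesis using False by simp
qed

context eigen_sequence
begin

definition R_xi :: "real \<Rightarrow> complex \<Rightarrow> real \<Rightarrow> complex" where
 "R_xi a z x = of_real (R_mod a b x) * \<xi> z x"

definition J_coeff :: "real \<Rightarrow> complex \<Rightarrow> nat \<Rightarrow> complex" where
 "J_coeff a z n = (\<integral>x. of_real (en n x) * R_xi a z x \<partial>M)"

lemma R_xi_bound:
 assumes "a < b" "x \<in> {0<..b}"
 shows "norm (R_xi a z x) \<le> norm (\<xi> z x)"
 using R_mod_bounds[OF assms(1), of x] assms(2) mult_right_mono[of "\<bar>R_mod a b x\<bar>" 1 "norm (\<xi> z x)"]
 by (auto simp: R_xi_def norm_mult)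

lemma R_xi_L2:
 assumes "a < b"
 shows "R_xi a z \<in> L2 b"
 unfolding mem_Collect_eq in_L2_iff(1)
proof
 show m: "R_xi a z \<in> borel_measurable M"
  unfolding R_xi_def[abs_def]
  by (intro continuous_on_lb_measurable continuous_intros R_mod_cont[OF assms] xi_cont)
 obtain C where C: "C > 0" "\<And>y x. norm y \<le> norm z + 1 \<Longrightarrow> x \<in> {0<..b} \<Longrightarrow> norm (\<xi> y x) \<le> C"
  using xi_bounded[of "norm z + 1"] by (metis add_nonneg_pos norm_ge_zero zero_less_one)
 show "integrable M (\<lambda>x. (norm (R_xi a z x))\<^sup>2)"
 proof (rule finite_measure.integrable_const_bound[OF finite_measure_lb, where B="C\<^sup>2"])
  show "AE x in M. norm ((norm (R_xi a z x))\<^sup>2) \<le> C\<^sup>2"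
  proof (rule AE_I2)
   fix x assume "x \<in> space M"
   then have x: "x \<in> {0<..b}" by (auto simp: space_M)
   have "norm (R_xi a z x) \<le> C" using R_xi_bound[OF assms x, of z] C(2)[of z x] x by simp
   then show "norm ((norm (R_xi a z x))\<^sup>2) \<le> C\<^sup>2" by (simp add: power_mono)
  qed
  show "(\<lambda>x. (norm (R_xi a z x))\<^sup>2) \<in> borel_measurable M" using m by measurable
 qed
qed

text \<open>R vanishes at b and has slope -1/(b-a) on [a,b] only. The term with R' still contains
  u'; writing \<xi> u' - \<xi>' u as the derivative of \<xi> u minus 2 \<xi>' u leaves only
  quantities of the size of u.\<close>

lemma R_xi_lagrange:
 fixes a l :: real and z :: complex
 assumes a: "0 < a" "a < b"
 defines "W \<equiv> \<lambda>x. \<xi> z x * of_real (u l x)"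
 shows "(z - of_real l) * (\<integral>x. of_real (u l x) * R_xi a z x \<partial>M)
   = of_real (1 / (b - a)) * (W b - W a - 2 * integral {a..b} (\<lambda>x. \<xi>' z x * of_real (u l x)))"
proof -
 define \<kappa> where "\<kappa> = 1 / (b - a)"
 define R' where "R' x = (if a \<le> x then - \<kappa> else 0)" for x
 define I where "I = integral {a..b} (\<lambda>x. \<xi>' z x * of_real (u l x))"
 define D where "D x = \<xi> z x * of_real (u' l x) - \<xi>' z x * of_real (u l x)" for x
 have sub: "{a..b} \<subseteq> {0<..b}" using a by auto
 have "((\<lambda>x. of_real (R_mod a b x) * ((z - of_real l) * \<xi> z x * of_real (u l x)) + of_real (R' x) * D x)
   has_integral of_real (R_mod a b b) * D b) {0..b}"
  unfolding D_def
 proof (rule lagrange_identity[where S="{a}", OF R_mod_cont[OF a(2)]])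
  show "(R_mod a b has_real_derivative R' x) (at x)" if "x \<in> {0<..<b} - {a}" for x
   unfolding R'_def \<kappa>_def by (rule R_mod_deriv[OF a(2)]) (use that in simp)
 qed simp
 then have 1: "((\<lambda>x. of_real (R_mod a b x) * ((z - of_real l) * \<xi> z x * of_real (u l x)) + of_real (R' x) * D x) has_integral 0) {0..b}"
  using a by (simp add: R_mod_def)
 \<comment> \<open>The integration by parts that trades u' for boundary values of W and an integral
   of \<xi>' u.\<close>
 have "((\<lambda>x. \<xi> z x * of_real (u' l x) + \<xi>' z x * of_real (u l x)) has_integral W b - W a) {a..b}"
 proof (rule fundamental_theorem_of_calculus)
  fix x assume x: "x \<in> {a..b}"
  then have xb: "x \<in> {0<..b}" using sub by auto
  have "(u l has_real_derivative u' l x) (at x within {a..b})" by (rule u_deriv_sub(1)[OF a(1) order_refl x])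
  then show "(W has_vector_derivative \<xi> z x * of_real (u' l x) + \<xi>' z x * of_real (u l x)) (at x within {a..b})"
   unfolding W_def
   by (intro has_vector_derivative_mult has_vector_derivative_of_real has_vector_derivative_within_subset[OF xi_deriv[OF xb] sub])
 qed (use a in simp)
 moreover have "((\<lambda>x. \<xi>' z x * of_real (u l x)) has_integral I) {a..b}"
  unfolding I_def
  by (intro integrable_integral integrable_continuous_interval continuous_intros continuous_on_subset[OF xi_cont(2) sub] continuous_on_subset[OF u_cont(1) sub])
 ultimately have "((\<lambda>x. (\<xi> z x * of_real (u' l x) + \<xi>' z x * of_real (u l x)) - 2 * (\<xi>' z x * of_real (u l x))) has_integral (W b - W a) - 2 * I) {a..b}"
  by (intro has_integral_diff has_integral_mult_right)
 then have "(D has_integral W b - W a - 2 * I) {a..b}"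
  by (rule has_integral_eq[rotated]) (simp add: D_def)
 then have "((\<lambda>x. of_real (- \<kappa>) * D x) has_integral of_real (- \<kappa>) * (W b - W a - 2 * I)) {a..b}"
  by (rule has_integral_mult_right)
 then have "((\<lambda>x. if x \<in> {a..b} then of_real (- \<kappa>) * D x else 0) has_integral of_real (- \<kappa>) * (W b - W a - 2 * I)) {0..b}"
  by (subst has_integral_restrict) (use a in auto)
 then have 2: "((\<lambda>x. of_real (R' x) * D x) has_integral of_real (- \<kappa>) * (W b - W a - 2 * I)) {0..b}"
  by (rule has_integral_eq[rotated]) (auto simp: R'_def)
 from has_integral_diff[OF 1 2]
 have 3: "((\<lambda>x. (z - of_real l) * (of_real (u l x) * R_xi a z x)) has_integral of_real \<kappa> * (W b - W a - 2 * I)) {0..b}"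
  by (rule has_integral_eq[rotated, THEN has_integral_eq_rhs]) (simp_all add: R_xi_def algebra_simps)
 have i: "integrable M (\<lambda>x. of_real (u l x) * R_xi a z x)"
 proof -
  have "integrable M (\<lambda>x. \<xi> (of_real l) x * R_xi a z x)" by (rule xi_phi_integrable[OF R_xi_L2[OF a(2)]])
  then show ?thesis by (rule Bochner_Integration.integrable_cong[THEN iffD1, rotated 2]) (auto simp: space_M xi_real)
 qed
 have "(z - of_real l) * (\<integral>x. of_real (u l x) * R_xi a z x \<partial>M) = integral {0..b} (\<lambda>x. (z - of_real l) * (of_real (u l x) * R_xi a z x))"
  unfolding integral_lb_hk[OF i] by simp
 also have "\<dots> = of_real \<kappa> * (W b - W a - 2 * I)" by (rule integral_unique[OF 3])
 finally show ?thesis by (simp add: \<kappa>_def I_def)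
qed

lemma J_coeff_eq: "of_real (sqrt (Nsq (mu n))) * J_coeff a z n = (\<integral>x. of_real (u (mu n) x) * R_xi a z x \<partial>M)"
proof -
 have "of_real (sqrt (Nsq (mu n))) * J_coeff a z n = (\<integral>x. of_real (sqrt (Nsq (mu n))) * (of_real (en n x) * R_xi a z x) \<partial>M)"
  unfolding J_coeff_def by simp
 also have "\<dots> = (\<integral>x. of_real (u (mu n) x) * R_xi a z x \<partial>M)"
  using Nsq_pos[of "mu n"] by (intro Bochner_Integration.integral_cong) (auto simp: en_def)
 finally show ?thesis .
qed

text \<open>The majorant w depends only on the bound R for z, so one summable sequence serves the
  whole compact set.\<close>

lemma J_coeff_summable:
 assumes a: "0 < a" "a < b" and R: "R > 0"
 obtains w where "summable w" "\<And>z n. norm z \<le> R \<Longrightarrow> norm (J_coeff a z n) \<le> w n"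
proof -
 obtain E where E: "E > 0" "\<And>n x. x \<in> {0<..b} \<Longrightarrow> \<bar>en n x\<bar> \<le> E" using en_bounded by metis
 obtain B where B: "B > 0" "\<And>z x. norm z \<le> R \<Longrightarrow> x \<in> {0<..b} \<Longrightarrow> norm (\<xi> z x) \<le> B * x powr (\<nu> + 1/2)"
  "\<And>z x. norm z \<le> R \<Longrightarrow> x \<in> {0<..b} \<Longrightarrow> norm (\<xi>' z x) \<le> B * x powr (\<nu> - 1/2)"
  using xi_bounds[OF R] by metis
 define X where "X = B * b powr (\<nu> + 1/2)"
 have X0: "X > 0" using B b by (simp add: X_def)
 have X: "norm (\<xi> z x) \<le> X" if "norm z \<le> R" "x \<in> {0<..b}" for z x
 proof -
  have "B * x powr (\<nu> + 1/2) \<le> X" unfolding X_def using that nu B(1) by (intro mult_left_mono powr_mono2) auto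
  then show ?thesis using B(2)[OF that] by linarith
 qed
 have X': "norm (\<xi>' z x) \<le> X / a" if z: "norm z \<le> R" and x: "x \<in> {a..b}" for z x
 proof -
  have xb: "x \<in> {0<..b}" using x a by auto
  have "x powr (\<nu> - 1/2) = x powr (\<nu> + 1/2) / x" using xb powr_diff[of x "\<nu> + 1/2" 1] by simp
  also have "\<dots> \<le> b powr (\<nu> + 1/2) / a" using x a nu by (intro frac_le powr_mono2) auto
  finally have "B * x powr (\<nu> - 1/2) \<le> X / a" using B(1) by (simp add: X_def mult_left_mono flip: times_divide_eq_right)
  then show ?thesis using B(3)[OF z xb] by linarith
 qed
 \<comment> \<open>Bound for the right-hand side of the Lagrange identity after division by the norm
   of u, which by \<open>en_bounded\<close> enters every term linearly.\<close>
 define Q where "Q = 1 / (b - a) * (X * E + X * E + 2 * (X / a * E * (b - a)))"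
 have Q: "Q \<ge> 0" unfolding Q_def using a X0 E(1) by (intro mult_nonneg_nonneg add_nonneg_nonneg divide_nonneg_nonneg) auto
 have large: "norm (z - of_real (mu n)) * norm (J_coeff a z n) \<le> Q" if z: "norm z \<le> R" for z n
 proof -
  define r where "r = sqrt (Nsq (mu n))"
  have r: "r > 0" using Nsq_pos by (simp add: r_def)
  have ub: "\<bar>u (mu n) x\<bar> \<le> E * r" if "x \<in> {0<..b}" for x
   using E(2)[OF that, of n] r by (simp add: en_def r_def[symmetric] abs_div_pos[symmetric] field_simps)
  define W where "W x = \<xi> z x * of_real (u (mu n) x)" for x
  define I where "I = integral {a..b} (\<lambda>x. \<xi>' z x * of_real (u (mu n) x))"
  have Wb: "norm (W x) \<le> X * (E * r)" if "x \<in> {0<..b}" for x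
   unfolding W_def norm_mult norm_of_real using X[OF z that] ub[OF that] X0 by (intro mult_mono) auto
  have sub: "{a..b} \<subseteq> {0<..b}" using a by auto
  have "((\<lambda>x. \<xi>' z x * of_real (u (mu n) x)) has_integral I) {a..b}"
   unfolding I_def
   by (intro integrable_integral integrable_continuous_interval continuous_intros continuous_on_subset[OF xi_cont(2) sub] continuous_on_subset[OF u_cont(1) sub])
  note hI = this
  have Ib: "norm I \<le> X / a * (E * r) * measure lborel {a..b}"
  proof (rule has_integral_bound_real[OF _ finite.emptyI hI])
   show "0 \<le> X / a * (E * r)" using X0 a E(1) r by simp
   fix x assume "x \<in> {a..b} - {}"
   then have x: "x \<in> {a..b}" by simp
   show "norm (\<xi>' z x * of_real (u (mu n) x)) \<le> X / a * (E * r)"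
    unfolding norm_mult norm_of_real using X'[OF z x] ub[of x] x sub X0 a by (intro mult_mono) auto
  qed
  have "norm (W b - W a - 2 * I) \<le> norm (W b) + norm (W a) + norm (2 * I)"
   using norm_triangle_ineq4[of "W b - W a" "2 * I"] norm_triangle_ineq4[of "W b" "W a"] by linarith
  also have "\<dots> \<le> X * (E * r) + X * (E * r) + 2 * (X / a * (E * r) * (b - a))"
   using Wb[of b] Wb[of a] Ib a by (intro add_mono) (auto simp: norm_mult)
  finally have Wn: "norm (W b - W a - 2 * I) \<le> X * (E * r) + X * (E * r) + 2 * (X / a * (E * r) * (b - a))" .
  have "r * (norm (z - of_real (mu n)) * norm (J_coeff a z n)) = norm ((z - of_real (mu n)) * (of_real r * J_coeff a z n))"
   using r by (simp add: norm_mult)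
  also have "(z - of_real (mu n)) * (of_real r * J_coeff a z n) = of_real (1 / (b - a)) * (W b - W a - 2 * I)"
   unfolding r_def J_coeff_eq W_def I_def by (rule R_xi_lagrange[OF a])
  also have "norm \<dots> = 1 / (b - a) * norm (W b - W a - 2 * I)" unfolding norm_mult norm_of_real using a by simp
  also have "\<dots> \<le> 1 / (b - a) * (X * (E * r) + X * (E * r) + 2 * (X / a * (E * r) * (b - a)))"
   using Wn a by (intro mult_left_mono) auto
  also have "\<dots> = r * Q" unfolding Q_def by (simp add: algebra_simps)
  finally show ?thesis using r by simp
 qed
 have small: "norm (J_coeff a z n) \<le> E * X * b" if z: "norm z \<le> R" for z n
 proof -
  have i: "integrable M (\<lambda>x. of_real (en n x) * R_xi a z x)" by (rule en_integrable[OF L2_integrable[OF R_xi_L2[OF a(2)]]])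
  have "norm (J_coeff a z n) \<le> (\<integral>x. norm (of_real (en n x) * R_xi a z x) \<partial>M)"
   unfolding J_coeff_def by (rule integral_norm_bound)
  also have "\<dots> \<le> (\<integral>x. E * X \<partial>M)"
  proof (rule integral_mono)
   show "integrable M (\<lambda>x. norm (of_real (en n x) * R_xi a z x))" using i by auto
   show "integrable M (\<lambda>x. E * X)" by (rule finite_measure.integrable_const[OF finite_measure_lb])
   fix x assume "x \<in> space M"
   then have x: "x \<in> {0<..b}" by (auto simp: space_M)
   show "norm (of_real (en n x) * R_xi a z x) \<le> E * X"
    unfolding norm_mult norm_of_real using E(2)[OF x, of n] order_trans[OF R_xi_bound[OF a(2) x] X[OF z x]] E(1) by (intro mult_mono) auto
  qed
  also have "\<dots> = E * X * b" using b by (simp add: measure_restrict_space space_M)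
  finally show ?thesis .
 qed
 obtain n0 where n0: "\<And>n. n \<ge> n0 \<Longrightarrow> 2 * R \<le> mu n" using mu_ge by blast
 \<comment> \<open>Beyond n0 the eigenvalue is at least 2 R, so its distance to z is at least half
   of it. The earlier terms, where z may coincide with an eigenvalue, get the trivial bound.\<close>
 define w where "w n = (if n < n0 then E * X * b else 2 * Q * (1 / mu n))" for n
 show thesis
 proof (rule that[of w])
  have "summable (\<lambda>n. 2 * Q * (1 / mu (n + n0)))"
   using summable_mult[OF summable_inverse_mu, of "2 * Q"] summable_iff_shift[of "\<lambda>n. 2 * Q * (1 / mu n)" n0] by blast
  then have "summable (\<lambda>n. w (n + n0))" by (simp add: w_def)
  then show "summable w" by (simp only: summable_iff_shift)
  fix z n assume z: "norm (z::complex) \<le> R"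
  show "norm (J_coeff a z n) \<le> w n"
  proof (cases "n < n0")
   case True
   then show ?thesis using small[OF z] by (simp add: w_def)
  next
   case False
   then have m: "2 * R \<le> mu n" "mu n > 0" using n0[of n] R by auto
   have "norm (complex_of_real (mu n)) \<le> norm (z - of_real (mu n)) + norm z"
    by (metis norm_minus_commute norm_triangle_sub add.commute)
   then have "mu n / 2 \<le> norm (z - of_real (mu n))" using m z by simp
   then have "mu n / 2 * norm (J_coeff a z n) \<le> norm (z - of_real (mu n)) * norm (J_coeff a z n)" by (rule mult_right_mono) simp
   then have "mu n / 2 * norm (J_coeff a z n) \<le> Q" using large[OF z, of n] by linarith
   then show ?thesis using False m by (simp add: w_def field_simps)
  qed
 qed
qed

section \<open>The sampling formula and its stability\<close>

text \<open>Extending \<phi> by zero to (a,b) pairs it with R \<xi>(z,.) without change, since R = 1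
  on its support; the extension need only be integrable for the expansion to apply.\<close>

lemma J_expansion:
 assumes a: "0 < a" "a < b" and phi: "\<phi> \<in> L2 a"
 shows "(\<lambda>n. J_coeff a z n * (transf \<xi> a \<phi> (of_real (mu n)) / of_real (sqrt (Nsq (mu n))))) sums transf \<xi> a \<phi> z"
proof -
 define \<phi>0 where "\<phi>0 x = indicator {0<..<a} x *\<^sub>R \<phi> x" for x
 have id: "indicator {0<..<b} x *\<^sub>R (G * (indicator {0<..<a} x *\<^sub>R y)) = indicator {0<..<a} x *\<^sub>R (G * y)" for x and G y :: complex
  using a by (auto simp: indicator_def)
 have "set_integrable lborel {0<..<a} \<phi>" using L2_integrable[OF phi] by (simp add: integrable_lb_iff)
 then have i0: "integrable M \<phi>0"
 proof -
  have "(\<lambda>x. indicator {0<..<b} x *\<^sub>R \<phi>0 x) = (\<lambda>x. indicator {0<..<a} x *\<^sub>R \<phi> x)"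
   using a by (auto simp: \<phi>0_def indicator_def fun_eq_iff)
  then show ?thesis using \<open>set_integrable lborel {0<..<a} \<phi>\<close> by (simp only: integrable_lb_iff set_integrable_def)
 qed
 have int: "(\<integral>x. G x * \<phi>0 x \<partial>M) = (LINT x:{0<..<a}|lborel. G x * \<phi> x)" for G
  unfolding integral_lb set_lebesgue_integral_def \<phi>0_def id ..
 obtain w where w: "summable w" "\<And>y n. norm y \<le> norm z + 1 \<Longrightarrow> norm (J_coeff a y n) \<le> w n"
  using J_coeff_summable[OF a, of "norm z + 1"] by (metis add_nonneg_pos norm_ge_zero zero_less_one)
 have "summable (\<lambda>n. norm (J_coeff a z n))"
  by (rule summable_comparison_test'[OF w(1), of 0]) (use w(2)[of z] in simp)
 from eigen_expansion[OF R_xi_L2[OF a(2), of z] J_coeff_def this i0]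
 have "(\<lambda>n. J_coeff a z n * (\<integral>x. of_real (en n x) * \<phi>0 x \<partial>M)) sums (\<integral>x. R_xi a z x * \<phi>0 x \<partial>M)" .
 moreover have "(\<integral>x. R_xi a z x * \<phi>0 x \<partial>M) = transf \<xi> a \<phi> z"
  unfolding int transf_def by (rule set_lebesgue_integral_cong) (auto simp: R_xi_def R_mod_def)
 moreover have "(\<integral>x. of_real (en n x) * \<phi>0 x \<partial>M) = transf \<xi> a \<phi> (of_real (mu n)) / of_real (sqrt (Nsq (mu n)))" for n
 proof -
  have "(\<integral>x. of_real (en n x) * \<phi>0 x \<partial>M) = (LINT x:{0<..<a}|lborel. \<xi> (of_real (mu n)) x * \<phi> x / of_real (sqrt (Nsq (mu n))))"
   unfolding int by (rule set_lebesgue_integral_cong) (use a in \<open>auto simp: en_def xi_real\<close>)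
  then show ?thesis unfolding transf_def by simp
 qed
 ultimately show ?thesis by simp
qed

lemma kernels_eq:
 "kernel_J \<xi> a b z (of_real (mu n)) = of_real (sqrt (Nsq (mu n))) * J_coeff a z n"
 "kernel_K \<xi> b (of_real (mu n)) (of_real (mu n)) = (of_real (sqrt (Nsq (mu n))))\<^sup>2"
proof -
 show "kernel_J \<xi> a b z (of_real (mu n)) = of_real (sqrt (Nsq (mu n))) * J_coeff a z n"
  unfolding kernel_J_def J_coeff_eq integral_lb
  by (rule set_lebesgue_integral_cong) (auto simp: R_xi_def xi_real)
 have "kernel_K \<xi> b (of_real (mu n)) (of_real (mu n)) = (\<integral>x. complex_of_real ((u (mu n) x)\<^sup>2) \<partial>M)"
  unfolding kernel_K_def integral_lb
  by (rule set_lebesgue_integral_cong) (auto simp: xi_real power2_eq_square)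
 also have "\<dots> = of_real (Nsq (mu n))" unfolding Nsq_def by (rule integral_complex_of_real)
 also have "\<dots> = (of_real (sqrt (Nsq (mu n))))\<^sup>2"
  using Nsq_pos[of "mu n"] by (simp flip: of_real_power)
 finally show "kernel_K \<xi> b (of_real (mu n)) (of_real (mu n)) = (of_real (sqrt (Nsq (mu n))))\<^sup>2" .
qed

text \<open>The norm of u at s^2 is at least a multiple of s^(-(\<nu>+1/2)), a decreasing function
  of s, so the upper bound on s of order n + 1 is the direction required. The finitely many small
  indices are absorbed by a sum.\<close>

lemma weight_bound:
 obtains Q where "Q > 0" "\<And>n. real (Suc n) powr - (\<nu> + 1/2) \<le> Q * sqrt (Nsq (mu n))"
proof -
 obtain C where C: "C > 0" "\<And>n. mu n \<le> C * (real n + 1)\<^sup>2" using mu_growth by metis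
 obtain s0 k K where B: "s0 > 0" "k > 0" "K > 0" "\<And>s. s \<ge> s0 \<Longrightarrow> k * (s powr - (\<nu> + 1/2))\<^sup>2 \<le> Nsq (s\<^sup>2)" "\<And>s. s \<ge> s0 \<Longrightarrow> Nsq (s\<^sup>2) \<le> K * (s powr - (\<nu> + 1/2))\<^sup>2"
  using Nsq_large by metis
 obtain n0 where n0: "\<And>n. n \<ge> n0 \<Longrightarrow> s0\<^sup>2 \<le> mu n" using mu_ge by blast
 define D where "D = sqrt k * sqrt C powr - (\<nu> + 1/2)"
 have D: "D > 0" using B C by (simp add: D_def)
 define P where "P n = real (Suc n) powr - (\<nu> + 1/2) / sqrt (Nsq (mu n))" for n
 have P: "P n \<ge> 0" for n using Nsq_pos[of "mu n"] by (simp add: P_def)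
 have large: "P n \<le> 1 / D" if n: "n \<ge> n0" for n
 proof -
  define s where "s = sqrt (mu n)"
  have m0: "mu n > 0" using n0[OF n] B(1) by (smt (verit) zero_less_power2)
  have s: "s \<ge> s0" unfolding s_def using n0[OF n] by (rule real_le_rsqrt)
  have s2: "s\<^sup>2 = mu n" using m0 by (simp add: s_def)
  have "s \<le> sqrt (C * (real n + 1)\<^sup>2)" unfolding s_def using C(2) by (rule real_sqrt_le_mono)
  then have sn: "s \<le> sqrt C * real (Suc n)" by (simp add: real_sqrt_mult add.commute)
  have "sqrt C powr - (\<nu> + 1/2) * real (Suc n) powr - (\<nu> + 1/2) = (sqrt C * real (Suc n)) powr - (\<nu> + 1/2)"
   using C by (simp add: powr_mult)
  also have "\<dots> \<le> s powr - (\<nu> + 1/2)" using sn s B(1) nu by (intro powr_mono2') auto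
  finally have "D * real (Suc n) powr - (\<nu> + 1/2) \<le> sqrt k * s powr - (\<nu> + 1/2)"
   unfolding D_def using B(2) by (simp add: mult.assoc)
  also have "\<dots> = sqrt (k * (s powr - (\<nu> + 1/2))\<^sup>2)" by (simp add: real_sqrt_mult)
  also have "\<dots> \<le> sqrt (Nsq (mu n))" using B(4)[OF s] s2 by (intro real_sqrt_le_mono) simp
  finally show ?thesis using D Nsq_pos[of "mu n"] unfolding P_def by (simp add: field_simps)
 qed
 show thesis
 proof (rule that[of "1 / D + (\<Sum>n<n0. P n)"])
  have s0: "(\<Sum>n<n0. P n) \<ge> 0" using P by (intro sum_nonneg) auto
  show "1 / D + (\<Sum>n<n0. P n) > 0" using D s0 by (intro add_pos_nonneg) auto
  fix n
  have "P n \<le> 1 / D + (\<Sum>n<n0. P n)"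
  proof (cases "n \<ge> n0")
   case True
   then show ?thesis using large[OF True] s0 by linarith
  next
   case False
   have "P n \<le> (\<Sum>n<n0. P n)" by (rule member_le_sum) (use False P in auto)
   moreover have "1 / D > 0" using D by simp
   ultimately show ?thesis by linarith
  qed
  then show "real (Suc n) powr - (\<nu> + 1/2) \<le> (1 / D + (\<Sum>n<n0. P n)) * sqrt (Nsq (mu n))"
   using Nsq_pos[of "mu n"] unfolding P_def by (simp add: pos_divide_le_eq)
 qed
qed

text \<open>The unperturbed part of each term sums to F z exactly, so the error is the sum of the
  terms with \<epsilon>. Its bound uses only w and Q, which do not involve F, \<epsilon> or the
  point z. Summability is shown alongside so that \<open>F_eps\<close> is a genuine sum.\<close>

lemma sampling_stable:
 assumes a: "0 < a" "a < b" and lam: "mu = (\<lambda>n. lam (Suc n))" and K: "compact K"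
 shows "\<exists>C>0. \<forall>F\<in>dB_space \<xi> a. \<forall>\<epsilon>\<in>ell_inf \<nu>. \<forall>z\<in>K.
      summable (\<lambda>n. sampling_term \<xi> a b lam F \<epsilon> z (Suc n)) \<and>
      norm (F z - F_eps \<xi> a b lam F \<epsilon> z) \<le> C * ell_inf_norm \<nu> \<epsilon>"
proof -
 obtain R where R: "R > 0" "\<And>z. z \<in> K \<Longrightarrow> norm z \<le> R"
  using compact_imp_bounded[OF K] unfolding bounded_pos by blast
 obtain w where w: "summable w" "\<And>z n. norm z \<le> R \<Longrightarrow> norm (J_coeff a z n) \<le> w n"
  using J_coeff_summable[OF a R(1)] by metis
 obtain Q where Q: "Q > 0" "\<And>n. real (Suc n) powr - (\<nu> + 1/2) \<le> Q * sqrt (Nsq (mu n))" using weight_bound by metis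
 have w0: "w n \<ge> 0" for n using w(2)[of 0 n] R(1) order_trans[OF norm_ge_zero] by auto
 have sw: "suminf w \<ge> 0" by (rule suminf_nonneg[OF w(1) w0])
 show ?thesis
 \<comment> \<open>The summand 1 makes the constant positive.\<close>
 proof (intro exI[of _ "Q * suminf w + 1"] conjI ballI)
  show "Q * suminf w + 1 > 0" using Q(1) sw by (intro add_nonneg_pos) auto
  fix F \<epsilon> z assume F: "F \<in> dB_space \<xi> a" and \<epsilon>: "\<epsilon> \<in> ell_inf \<nu>" and z: "z \<in> K"
  define N where "N = ell_inf_norm \<nu> \<epsilon>"
  define r where "r n = sqrt (Nsq (mu n))" for n
  have r: "r n > 0" for n using Nsq_pos by (simp add: r_def)
  define d where "d n = J_coeff a z n * (\<epsilon> (Suc n) / of_real (r n))" for n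
  have eN: "norm (\<epsilon> (Suc n)) * real (Suc n) powr (\<nu> + 1/2) \<le> N" for n
   unfolding N_def ell_inf_norm_def by (rule cSUP_upper) (use \<epsilon> in \<open>auto simp: ell_inf_def\<close>)
  have N0: "N \<ge> 0" by (rule order_trans[OF _ eN[of 0]]) simp
  have eQ: "norm (\<epsilon> (Suc n)) / r n \<le> Q * N" for n
  proof -
   have pm: "real (Suc n) powr (\<nu> + 1/2) * real (Suc n) powr - (\<nu> + 1/2) = 1" by (simp flip: powr_add)
   have "norm (\<epsilon> (Suc n)) = norm (\<epsilon> (Suc n)) * (real (Suc n) powr (\<nu> + 1/2) * real (Suc n) powr - (\<nu> + 1/2))"
    unfolding pm by simp
   also have "\<dots> = (norm (\<epsilon> (Suc n)) * real (Suc n) powr (\<nu> + 1/2)) * real (Suc n) powr - (\<nu> + 1/2)" by (simp only: mult.assoc)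
   also have "\<dots> \<le> N * (Q * r n)" using eN[of n] Q(2)[of n] N0 unfolding r_def by (intro mult_mono) auto
   finally show ?thesis using r[of n] by (simp add: pos_divide_le_eq mult_ac)
  qed
  have db: "norm (d n) \<le> w n * (Q * N)" for n
  proof -
   have "norm (d n) = norm (J_coeff a z n) * (norm (\<epsilon> (Suc n)) / r n)"
    unfolding d_def using r[of n] by (simp add: norm_mult norm_divide)
   also have "\<dots> \<le> w n * (Q * N)" using w(2)[OF R(2)[OF z], of n] eQ[of n] w0 r[of n] by (intro mult_mono) auto
   finally show ?thesis .
  qed
  have swQ: "summable (\<lambda>n. w n * (Q * N))" by (rule summable_mult2[OF w(1)])
  have sd: "summable (\<lambda>n. norm (d n))" by (rule summable_comparison_test'[OF swQ, of 0]) (use db in simp)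
  \<comment> \<open>K_b is the square of the norm r; one factor r cancels against J_ab, the other
    normalizes the sample and the perturbation.\<close>
  have st: "sampling_term \<xi> a b lam F \<epsilon> z (Suc n) = J_coeff a z n * (F (of_real (mu n)) / of_real (r n)) + d n" for n
  proof -
   have "sampling_term \<xi> a b lam F \<epsilon> z (Suc n) = (of_real (r n) * J_coeff a z n) / (of_real (r n))\<^sup>2 * (F (of_real (mu n)) + \<epsilon> (Suc n))"
    unfolding sampling_term_def r_def kernels_eq[symmetric] by (simp add: lam)
   then show ?thesis using r[of n] by (simp add: d_def power2_eq_square field_simps)
  qed
  obtain \<phi> where phi: "\<phi> \<in> L2 a" "F = transf \<xi> a \<phi>" using F unfolding dB_space_def by blast
  have "(\<lambda>n. J_coeff a z n * (F (of_real (mu n)) / of_real (r n))) sums F z"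
   using J_expansion[OF a phi(1), of z] unfolding phi(2) r_def .
  from sums_add[OF this summable_sums[OF summable_norm_cancel[OF sd]]]
  have S: "(\<lambda>n. sampling_term \<xi> a b lam F \<epsilon> z (Suc n)) sums (F z + suminf d)" unfolding st .
  show "summable (\<lambda>n. sampling_term \<xi> a b lam F \<epsilon> z (Suc n))" by (rule sums_summable[OF S])
  have "norm (F z - F_eps \<xi> a b lam F \<epsilon> z) = norm (suminf d)"
   unfolding F_eps_def sums_unique[OF S, symmetric] by simp
  also have "\<dots> \<le> (\<Sum>n. norm (d n))" by (rule summable_norm[OF sd])
  also have "\<dots> \<le> (\<Sum>n. w n * (Q * N))" by (rule suminf_le[OF db sd swQ])
  also have "\<dots> = suminf w * (Q * N)" by (rule suminf_mult2[OF w(1), symmetric])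
  also have "\<dots> \<le> (Q * suminf w + 1) * N" using N0 by (simp add: algebra_simps)
  finally show "norm (F z - F_eps \<xi> a b lam F \<epsilon> z) \<le> (Q * suminf w + 1) * ell_inf_norm \<nu> \<epsilon>" by (simp add: N_def)
 qed
qed

end

section \<open>From the hypotheses on the potential and the solution to the locales\<close>

text \<open>The definition of absolute continuity is applied to the single interval between x and y,
  within [x/2,b] to stay away from 0.\<close>

lemma AC_loc_continuous:
 assumes "AC_loc f b"
 shows "continuous_on {0<..b} f"
 unfolding continuous_on_iff
proof (intro ballI allI impI)
 fix x e :: real assume x: "x \<in> {0<..b}" and e: "e > 0"
 have AC: "AC_on f (x / 2) b" using assms x by (auto simp: AC_loc_def)
 obtain d where d: "d > 0" "\<forall>D :: (real \<times> real) set. finite D \<and> (\<forall>(u, v)\<in>D. x / 2 \<le> u \<and> u \<le> v \<and> v \<le> b) \<and>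
    disjoint_family_on (\<lambda>(u, v). {u<..<v}) D \<and> (\<Sum>(u, v)\<in>D. v - u) < d \<longrightarrow> (\<Sum>(u, v)\<in>D. norm (f v - f u)) < e"
  using AC[unfolded AC_on_def, THEN spec, THEN mp, OF e] by blast
 show "\<exists>d>0. \<forall>y\<in>{0<..b}. dist y x < d \<longrightarrow> dist (f y) (f x) < e"
 proof (intro exI[of _ "min d (x / 2)"] conjI ballI impI)
  show "min d (x / 2) > 0" using d x by simp
  fix y assume y: "y \<in> {0<..b}" "dist y x < min d (x / 2)"
  then have yx: "\<bar>y - x\<bar> < d" and "\<bar>y - x\<bar> < x / 2" by (auto simp: dist_real_def)
  then have xy: "x / 2 \<le> y" by linarith
  have "norm (f (max x y) - f (min x y)) < e"
   using spec[OF d(2), of "{(min x y, max x y)}"] yx xy x y by (auto simp: disjoint_family_on_def max_def min_def)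
  then show "dist (f y) (f x) < e" by (auto simp: dist_norm max_def min_def norm_minus_commute split: if_splits)
 qed
qed

text \<open>On a space of finite measure |f| is at most 1 + |f|^p; for the exponent infinity the
  constant bound suffices.\<close>

lemma in_Lr_integrable:
 fixes f :: "real \<Rightarrow> real"
 assumes r: "1 \<le> r" and f: "in_Lr r b f"
 shows "set_integrable lborel {0<..<b} f"
proof -
 have m: "f \<in> borel_measurable (lb b)"
  using f unfolding in_Lr_def set_borel_measurable_def by (subst borel_measurable_restrict_space_iff) auto
 have "integrable (lb b) f"
 proof (cases "r = \<infinity>")
  case True
  then obtain K where "AE x in lborel. x \<in> {0<..<b} \<longrightarrow> norm (f x) \<le> K" using f by (auto simp: in_Lr_def)
  then have "AE x in lb b. norm (f x) \<le> K" by (subst AE_restrict_space_iff) auto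
  then show ?thesis by (rule finite_measure.integrable_const_bound[OF finite_measure_lb _ m])
 next
  case False
  define p where "p = real_of_ereal r"
  have p: "p \<ge> 1" using r False by (cases r) (auto simp: p_def)
  have i: "integrable (lb b) (\<lambda>x. norm (f x) powr p)" using f False by (auto simp: in_Lr_def integrable_lb_iff p_def)
  show ?thesis
  proof (rule Bochner_Integration.integrable_bound[OF Bochner_Integration.integrable_add[OF finite_measure.integrable_const[OF finite_measure_lb, of b 1] i] m], rule AE_I2)
   fix x
   show "norm (f x) \<le> norm (1 + norm (f x) powr p)"
   proof (cases "norm (f x) \<le> 1")
    case True
    have "0 \<le> norm (f x) powr p" by simp
    then have "norm (f x) \<le> 1 + norm (f x) powr p" using True by linarith
    then show ?thesis by simp
   next
    case False
    then have "norm (f x) powr 1 \<le> norm (f x) powr p" using p by (intro powr_mono) auto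
    then show ?thesis using False by simp
   qed
  qed
 qed
 then show ?thesis by (simp add: integrable_lb_iff)
qed

lemma regular_solution_bessel:
 assumes nu: "0 < \<nu>" "0 < b" and q: "AC_loc q b" and Lr: "\<exists>r::ereal. 2 < r \<and> in_Lr r b (\<lambda>x. x * q x)"
  and reg: "regular_solution \<nu> q b \<xi>"
 obtains \<xi>' C0 where "regular_bessel \<nu> b q \<xi> \<xi>' C0"
proof -
 obtain \<xi>' C where
  d: "\<And>z x. x \<in> {0<..b} \<Longrightarrow> (\<xi> z has_vector_derivative \<xi>' z x) (at x within {0<..b}) \<and>
     (\<exists>d. (\<xi>' z has_vector_derivative d) (at x within {0<..b}) \<and>
        - d + of_real ((\<nu>\<^sup>2 - 1/4) / x\<^sup>2 + q x) * \<xi> z x = z * \<xi> z x)"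
  and e: "\<And>z x. x \<in> {0<..b} \<Longrightarrow> norm (\<xi> z x - xi_free \<nu> z x) \<le>
      C * (x / (1 + norm (csqrt z) * x)) powr (\<nu> + 1/2) * exp (\<bar>Im (csqrt z)\<bar> * x) *
      (LINT u:{0<..<x}|lborel. u * \<bar>q u\<bar> / (1 + norm (csqrt z) * u))"
  and e': "\<And>z x. x \<in> {0<..b} \<Longrightarrow> norm (\<xi>' z x - vector_derivative (xi_free \<nu> z) (at x)) \<le>
      C * (x / (1 + norm (csqrt z) * x)) powr (\<nu> - 1/2) * exp (\<bar>Im (csqrt z)\<bar> * x) *
      (LINT u:{0<..<x}|lborel. u * \<bar>q u\<bar> / (1 + norm (csqrt z) * u))"
  using reg unfolding regular_solution_def by blast
 \<comment> \<open>The constant in \<open>regular_solution\<close> carries no sign; |C| + 1 is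
   positive and gives weaker estimates because the remaining factors are nonnegative.\<close>
 have enlarge: "C * A * B * (LINT u:{0<..<x}|lborel. u * \<bar>q u\<bar> / (1 + norm (csqrt z) * u)) \<le>
   (\<bar>C\<bar> + 1) * A * B * (LINT u:{0<..<x}|lborel. u * \<bar>q u\<bar> / (1 + norm (csqrt z) * u))"
  if "A \<ge> 0" "B \<ge> 0" for A B x z
 proof -
  have "0 \<le> (LINT u:{0<..<x}|lborel. u * \<bar>q u\<bar> / (1 + norm (csqrt z) * u))"
   unfolding set_lebesgue_integral_def
   by (rule Bochner_Integration.integral_nonneg) (auto simp: indicator_def intro!: divide_nonneg_nonneg add_nonneg_nonneg)
  then show ?thesis using that by (intro mult_right_mono) auto
 qed
 show thesis
 proof (rule that[of \<xi>' "\<bar>C\<bar> + 1"], unfold_locales)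
  show "continuous_on {0<..b} q" by (rule AC_loc_continuous[OF q])
  obtain r :: ereal where r: "2 < r" "in_Lr r b (\<lambda>x. x * q x)" using Lr by blast
  have "set_integrable lborel {0<..<b} (\<lambda>x. x * q x)"
   by (rule in_Lr_integrable[OF _ r(2)]) (use r(1) order_trans[of 1 "2::ereal" r] in simp)
  from set_integrable_abs[OF this] show "set_integrable lborel {0<..<b} (\<lambda>u. u * \<bar>q u\<bar>)"
   by (rule set_integrable_cong[THEN iffD1, rotated 3]) (auto simp: abs_mult)
  fix z x assume x: "x \<in> {0<..b}"
  show "(\<xi> z has_vector_derivative \<xi>' z x) (at x within {0<..b})" using d[OF x] by blast
  obtain y where y: "(\<xi>' z has_vector_derivative y) (at x within {0<..b})" "- y + of_real ((\<nu>\<^sup>2 - 1/4) / x\<^sup>2 + q x) * \<xi> z x = z * \<xi> z x"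
   using d[OF x] by blast
  have "y = (of_real ((\<nu>\<^sup>2 - 1/4) / x\<^sup>2 + q x) - z) * \<xi> z x"
   unfolding left_diff_distrib y(2)[symmetric] by simp
  then show "(\<xi>' z has_vector_derivative (of_real ((\<nu>\<^sup>2 - 1/4) / x\<^sup>2 + q x) - z) * \<xi> z x) (at x within {0<..b})" using y(1) by simp
  show "norm (\<xi> z x - xi_free \<nu> z x) \<le>
      (\<bar>C\<bar> + 1) * (x / (1 + norm (csqrt z) * x)) powr (\<nu> + 1/2) * exp (\<bar>Im (csqrt z)\<bar> * x) *
      (LINT u:{0<..<x}|lborel. u * \<bar>q u\<bar> / (1 + norm (csqrt z) * u))"
   by (rule order_trans[OF e[OF x] enlarge]) auto
  have v: "vector_derivative (xi_free \<nu> z) (at x) = xi_free' \<nu> z x"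
   by (rule vector_derivative_at[OF xi_free_deriv]) (use x nu in auto)
  show "norm (\<xi>' z x - xi_free' \<nu> z x) \<le>
      (\<bar>C\<bar> + 1) * (x / (1 + norm (csqrt z) * x)) powr (\<nu> - 1/2) * exp (\<bar>Im (csqrt z)\<bar> * x) *
      (LINT u:{0<..<x}|lborel. u * \<bar>q u\<bar> / (1 + norm (csqrt z) * u))"
   by (rule order_trans[OF e'[OF x, of z, unfolded v] enlarge]) auto
 qed (use nu in auto)
qed

theorem theorem3p3:
 fixes \<nu> a b \<gamma> :: real
  and q :: "real \<Rightarrow> real"
  and \<xi> :: "complex \<Rightarrow> real \<Rightarrow> complex"
  and lam :: "nat \<Rightarrow> real"
  and K :: "complex set"
 assumes "0 < \<nu>" and "0 < b" and "0 < a" and "a < b" and "0 \<le> \<gamma>" and "\<gamma> < pi"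
  and "AC_loc q b"
  and "\<exists>r::ereal. 2 < r \<and> in_Lr r b (\<lambda>x. x * q x)"
  and "regular_solution \<nu> q b \<xi>"
  and "strict_mono_on {1..} lam"
  and "(\<lambda>n. complex_of_real (lam n)) ` {1..} = spectrum_S \<xi> \<nu> q b \<gamma>"
  and "compact K"
 shows "\<exists>C>0. \<forall>F\<in>dB_space \<xi> a. \<forall>\<epsilon>\<in>ell_inf \<nu>. \<forall>z\<in>K.
      summable (\<lambda>n. sampling_term \<xi> a b lam F \<epsilon> z (Suc n)) \<and>
      norm (F z - F_eps \<xi> a b lam F \<epsilon> z) \<le> C * ell_inf_norm \<nu> \<epsilon>"
proof -
 obtain \<xi>' C0 where "regular_bessel \<nu> b q \<xi> \<xi>' C0"
  using regular_solution_bessel[OF assms(1,2,7,8,9)] .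
 then interpret regular_bessel \<nu> b q \<xi> \<xi>' C0 .
 \<comment> \<open>Cosine and sine of \<gamma> cannot both vanish, as their squares add up to
   1.\<close>
 interpret bessel_spectrum \<nu> b q \<xi> \<xi>' C0 \<gamma>
  by unfold_locales (use sin_cos_squared_add[of \<gamma>] in \<open>auto simp: power2_eq_square\<close>)
 \<comment> \<open>The shift by \<open>Suc\<close> moves the enumeration from index 1 to index
   0.\<close>
 interpret eigen_sequence \<nu> b q \<xi> \<xi>' C0 "cos \<gamma>" "sin \<gamma>" "\<lambda>n. lam (Suc n)"
 proof unfold_locales
  show "strict_mono (\<lambda>n. lam (Suc n))"
   by (rule strict_monoI) (use strict_mono_onD[OF assms(10)] in simp)
  show "eigen l \<longleftrightarrow> l \<in> range (\<lambda>n. lam (Suc n))" for l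
  proof -
   have "eigen l \<longleftrightarrow> of_real l \<in> (\<lambda>n. complex_of_real (lam n)) ` {1..}"
    unfolding assms(11) by (rule spectrum_eigen[symmetric])
   also have "\<dots> \<longleftrightarrow> (\<exists>n\<ge>1. l = lam n)" by auto
   also have "\<dots> \<longleftrightarrow> (\<exists>n. l = lam (Suc n))"
   proof
    assume "\<exists>n\<ge>1. l = lam n"
    then obtain n where "n \<ge> 1" "l = lam n" by blast
    then have "l = lam (Suc (n - 1))" by simp
    then show "\<exists>n. l = lam (Suc n)" ..
   qed (metis le_add1 plus_1_eq_Suc)
   finally show ?thesis by blast
  qed
 qed
 show ?thesis by (rule sampling_stable[OF assms(3,4) refl assms(12)])
qed

end
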